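(* Let $K$ be a field, let $a\ge1$, $n\ge1$, $b\ge 3$ be integers, and let $G_{a,b,n}=\overline{K}_a\nabla(nB_b)$. For every $i\ge 1$, $$\beta_{i,i+2}(G_{a,b,n})=\sum_{j=0}^{i}\binom{a}{j}\left(n\mu_{i-j}+\binom{n}{2}\sum_{\substack{p+q=i-j\\ p,q\ge1}}\lambda_p\lambda_q\right),$$ where the inner sum is over ordered pairs $(p,q)$ of positive integers.
   Context: All graphs are finite, simple and undirected. For $b\ge 2$, $B_b$ is the graph with vertices $x_1,\dots,x_b,y_1,\dots,y_b$ and edges $\{x_i,x_j\}$ and $\{y_i,y_j\}$ for $1\le i<j\le b$, and $\{x_i,y_i\}$ for $1\le i\le b$. $nB_b$ is the disjoint union of $n$ copies of $B_b$. The join $G\nabla H$ of graphs on disjoint vertex sets is obtained from the disjoint union by adding every edge between $V(G)$ and $V(H)$. $\overline{K}_a$ is the edgeless graph on $a$ vertices. For a graph $G$, $R_G$ is the standard graded polynomial ring over $K$ whose variables are the vertices of $G$, $I(G)=(xy:\{x,y\}\in E(G))\subseteq R_G$ is the edge ideal, and $\beta_{i,d}(G)$ denotes the graded Betti number of $R_G/I(G)$ over $R_G$ in homological degree $i$ and internal degree $d$. For fixed $b\ge3$ the integers $\lambda_i,\mu_i$ are defined as follows, with the convention $\binom{u}{v}=0$ if $v<0$ or $v>u$. For $1\le i\le 2b-2$: $\lambda_1=2\binom{b}{2}+b$; $\lambda_3=6\binom{b}{4}+2b\binom{b-1}{2}+\binom{b}{2}$; and $\lambda_i=2i\binom{b}{i+1}+2b\binom{b-1}{i-1}$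 for $i\ne1,3$. Also $\lambda_i=0$ outside $1\le i\le 2b-2$. For $1\le i\le 2b-2$, $$\mu_i=\lambda_{i+1}+\binom{2b-2}{i+2}-(2b-2)\binom{2b-2}{i+1}+(b^2-3b+1)\binom{2b-2}{i},$$ and $\mu_i=0$ outside this range. *)

theory Defs
  imports "HOL-Library.Poly_Mapping"
begin

section \<open>Graphs\<close>

text \<open>A graph is a pair of a vertex set and a set of edges, each edge being a two-element set of
  vertices. All graphs built below are finite and simple.\<close>

type_synonym 'v graph = "'v set \<times> 'v set set"

abbreviation verts :: "'v graph \<Rightarrow> 'v set" where "verts G \<equiv> fst G"
abbreviation edges :: "'v graph \<Rightarrow> 'v set set" where "edges G \<equiv> snd G"

definition edgeless :: "nat \<Rightarrow> nat graph" where
  "edgeless a = ({1..a}, {})"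

text \<open>The vertex \<open>x\<^sub>i\<close> is \<open>Inl i\<close> and \<open>y\<^sub>i\<close> is \<open>Inr i\<close>.\<close>

definition B_graph :: "nat \<Rightarrow> (nat + nat) graph" where
  "B_graph b =
    (Inl ` {1..b} \<union> Inr ` {1..b},
     {{Inl i, Inl j} | i j. 1 \<le> i \<and> i < j \<and> j \<le> b} \<union>
     {{Inr i, Inr j} | i j. 1 \<le> i \<and> i < j \<and> j \<le> b} \<union>
     {{Inl i, Inr i} | i. 1 \<le> i \<and> i \<le> b})"

definition graph_copies :: "nat \<Rightarrow> 'v graph \<Rightarrow> (nat \<times> 'v) graph" where
  "graph_copies n G =
    ({1..n} \<times> verts G, {Pair k ` e | k e. k \<in> {1..n} \<and> e \<in> edges G})"

definition graph_join :: "'v graph \<Rightarrow> 'w graph \<Rightarrow> ('v + 'w) graph" where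
  "graph_join G H =
    (Inl ` verts G \<union> Inr ` verts H,
     (`) Inl ` edges G \<union> (`) Inr ` edges H \<union>
     {{Inl x, Inr y} | x y. x \<in> verts G \<and> y \<in> verts H})"

definition G_graph :: "nat \<Rightarrow> nat \<Rightarrow> nat \<Rightarrow> (nat + nat \<times> (nat + nat)) graph" where
  "G_graph a b n = graph_join (edgeless a) (graph_copies n (B_graph b))"

section \<open>Standard graded polynomial rings and edge ideals\<close>

text \<open>Polynomials are finitely supported functions from monomials (exponent vectors) to
  coefficients; ring operations are those of the type. The polynomial ring in the variables \<open>V\<close>
  is a subring of this type.\<close>

type_synonym ('v, 'k) mpoly = "('v \<Rightarrow>\<^sub>0 nat) \<Rightarrow>\<^sub>0 'k"

definition mdeg :: "('v \<Rightarrow>\<^sub>0 nat) \<Rightarrow> nat" where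
  "mdeg m = (\<Sum>v\<in>Poly_Mapping.keys m. Poly_Mapping.lookup m v)"

definition var :: "'v \<Rightarrow> ('v, 'k::field) mpoly" where
  "var v = Poly_Mapping.single (Poly_Mapping.single v 1) 1"

definition poly_ring :: "'v set \<Rightarrow> ('v, 'k::field) mpoly set" where
  "poly_ring V = {p. \<forall>m\<in>Poly_Mapping.keys p. Poly_Mapping.keys m \<subseteq> V}"

definition homogeneous :: "nat \<Rightarrow> ('v, 'k::field) mpoly \<Rightarrow> bool" where
  "homogeneous d p \<longleftrightarrow> (\<forall>m\<in>Poly_Mapping.keys p. mdeg m = d)"

definition irrelevant_ideal :: "'v set \<Rightarrow> ('v, 'k::field) mpoly set" where
  "irrelevant_ideal V = {p \<in> poly_ring V. Poly_Mapping.lookup p 0 = 0}"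

definition ideal_gen :: "'v set \<Rightarrow> ('v, 'k::field) mpoly set \<Rightarrow> ('v, 'k) mpoly set" where
  "ideal_gen V S =
    {\<Sum>s\<in>T. c s * s | T c. finite T \<and> T \<subseteq> S \<and> (\<forall>s\<in>T. c s \<in> poly_ring V)}"

definition edge_ideal :: "'v graph \<Rightarrow> ('v, 'k::field) mpoly set" where
  "edge_ideal G = ideal_gen (verts G) {var x * var y | x y. {x, y} \<in> edges G}"

section \<open>Graded free modules, minimal graded free resolutions and Betti numbers\<close>

text \<open>A graded free module has a basis \<open>B\<close>, whose element \<open>e\<close> has degree \<open>\<delta> e\<close>: it is the direct
  sum of the \<open>R(-\<delta> e)\<close>. Its elements are finitely supported families of coefficients. The bases
  occurring here are countable, so they are indexed by natural numbers.\<close>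

type_synonym ('v, 'k) mvec = "nat \<Rightarrow>\<^sub>0 ('v, 'k) mpoly"

definition free_module :: "'v set \<Rightarrow> nat set \<Rightarrow> ('v, 'k::field) mvec set" where
  "free_module V B = {u. Poly_Mapping.keys u \<subseteq> B \<and> (\<forall>e. Poly_Mapping.lookup u e \<in> poly_ring V)}"

definition mvec_scale :: "('v, 'k::field) mpoly \<Rightarrow> ('v, 'k) mvec \<Rightarrow> ('v, 'k) mvec" where
  "mvec_scale p u = Poly_Mapping.map ((*) p) u"

definition mvec_homogeneous :: "(nat \<Rightarrow> nat) \<Rightarrow> nat \<Rightarrow> ('v, 'k::field) mvec \<Rightarrow> bool" where
  "mvec_homogeneous \<delta> d u \<longleftrightarrow> 
    (\<forall>e\<in>Poly_Mapping.keys u. \<forall>m\<in>Poly_Mapping.keys (Poly_Mapping.lookup u e). mdeg m + \<delta> e = d)"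

definition linear_over ::
  "'r set \<Rightarrow> ('r \<Rightarrow> 'a \<Rightarrow> 'a) \<Rightarrow> ('r \<Rightarrow> 'b \<Rightarrow> 'b) \<Rightarrow> 'a::plus set \<Rightarrow> 'b::plus set \<Rightarrow> ('a \<Rightarrow> 'b) \<Rightarrow> bool"
where
  "linear_over R s t M N f \<longleftrightarrow>
    (\<forall>u\<in>M. f u \<in> N) \<and>
    (\<forall>u\<in>M. \<forall>v\<in>M. f (u + v) = f u + f v) \<and>
    (\<forall>p\<in>R. \<forall>u\<in>M. f (s p u) = t p (f u))"

text \<open>A minimal graded free resolution
  \<open>\<cdots> \<rightarrow> F\<^sub>2 \<rightarrow> F\<^sub>1 \<rightarrow> F\<^sub>0 \<rightarrow> R/I \<rightarrow> 0\<close>, where \<open>F\<^sub>i\<close> has basis \<open>B i\<close> with degrees \<open>\<delta> i\<close> and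
  \<open>\<phi> i\<close> is the differential from \<open>F\<^sub>i\<^sub>+\<^sub>1\<close> to \<open>F\<^sub>i\<close>. The augmentation \<open>F\<^sub>0 \<rightarrow> R/I\<close> is given by a
  lift \<open>\<epsilon> : F\<^sub>0 \<rightarrow> R\<close>, which always exists as \<open>F\<^sub>0\<close> is free: it is surjective iff \<open>\<epsilon>(F\<^sub>0) + I = R\<close>, and
  its kernel is the preimage of \<open>I\<close> under \<open>\<epsilon>\<close>. Finiteness of the ranks is not demanded,
  since it follows from the minimality of the resolution.\<close>

definition minimal_graded_free_resolution ::
  "'v set \<Rightarrow> ('v, 'k::field) mpoly set \<Rightarrow> (nat \<Rightarrow> nat set) \<Rightarrow> (nat \<Rightarrow> nat \<Rightarrow> nat) \<Rightarrow>
   (nat \<Rightarrow> ('v, 'k) mvec \<Rightarrow> ('v, 'k) mvec) \<Rightarrow> (('v, 'k) mvec \<Rightarrow> ('v, 'k) mpoly) \<Rightarrow> bool"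
where
  "minimal_graded_free_resolution V I B \<delta> \<phi> \<epsilon> \<longleftrightarrow>
    (let R = poly_ring V; F = (\<lambda>i. free_module V (B i)) in
      linear_over R mvec_scale (*) (F 0) R \<epsilon> \<and>
      (\<forall>i. linear_over R mvec_scale mvec_scale (F (Suc i)) (F i) (\<phi> i)) \<and>
      (\<forall>d. \<forall>u\<in>F 0. mvec_homogeneous (\<delta> 0) d u \<longrightarrow> homogeneous d (\<epsilon> u)) \<and>
      (\<forall>i d. \<forall>u\<in>F (Suc i). mvec_homogeneous (\<delta> (Suc i)) d u \<longrightarrow>
         mvec_homogeneous (\<delta> i) d (\<phi> i u)) \<and>
      {\<epsilon> u + g | u g. u \<in> F 0 \<and> g \<in> I} = R \<and>
      \<phi> 0 ` F 1 = {u \<in> F 0. \<epsilon> u \<in> I} \<and>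
      (\<forall>i. \<phi> (Suc i) ` F (Suc (Suc i)) = {u \<in> F (Suc i). \<phi> i u = 0}) \<and>
      (\<forall>i. \<forall>u\<in>F (Suc i). \<forall>e. Poly_Mapping.lookup (\<phi> i u) e \<in> irrelevant_ideal V))"

text \<open>The graded Betti number of \<open>R/I\<close> is the number of copies of \<open>R(-d)\<close> in the \<open>i\<close>-th module of
  a minimal graded free resolution, which is unique up to isomorphism.\<close>

definition graded_betti :: "'v set \<Rightarrow> ('v, 'k::field) mpoly set \<Rightarrow> nat \<Rightarrow> nat \<Rightarrow> nat" where
  "graded_betti V I i d =
    (THE r. \<exists>B \<delta> \<phi> \<epsilon>. minimal_graded_free_resolution V I B \<delta> \<phi> \<epsilon> \<and>
       r = card {e \<in> B i. \<delta> i e = d})"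

text \<open>The type argument fixes the coefficient field.\<close>

definition graph_betti :: "'k::field itself \<Rightarrow> 'v graph \<Rightarrow> nat \<Rightarrow> nat \<Rightarrow> nat" where
  "graph_betti K G i d = graded_betti (verts G) (edge_ideal G :: ('v, 'k) mpoly set) i d"

section \<open>The numerical coefficients\<close>

definition lam :: "nat \<Rightarrow> nat \<Rightarrow> int" where
  "lam b i =
    (if i < 1 \<or> 2 * b - 2 < i then 0
     else if i = 1 then int (2 * (b choose 2) + b)
     else if i = 3 then int (6 * (b choose 4) + 2 * b * ((b - 1) choose 2) + (b choose 2))
     else int (2 * i * (b choose (i + 1)) + 2 * b * ((b - 1) choose (i - 1))))"

definition mu :: "nat \<Rightarrow> nat \<Rightarrow> int" where
  "mu b i =
    (if i < 1 \<or> 2 * b - 2 < i then 0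
     else lam b (i + 1) + int ((2 * b - 2) choose (i + 2))
       - (2 * int b - 2) * int ((2 * b - 2) choose (i + 1))
       + (int b ^ 2 - 3 * int b + 1) * int ((2 * b - 2) choose i))"

end

theory Submission
  imports Defs "HOL.Vector_Spaces" "HOL-Library.Function_Algebras" "HOL-Library.Nat_Bijection"
begin

text \<open>Shifting dimensions along a minimal graded free resolution identifies the graded Betti number
  in degree \<open>(i, d)\<close> with the dimension of the degree \<open>d\<close> part of the \<open>i\<close>-th Koszul homology of
  \<open>R/I\<close>; a minimal resolution itself is found by choosing minimal generators degree by degree. For
  an edge ideal and \<open>d = i + 2\<close>, the multidegrees that are not squarefree are contracted by a
  homotopy, and the squarefree ones contribute the first cohomology of the independence complexes of
  the induced subgraphs on \<open>i + 2\<close> vertices (Hochster). The independence complex of a join is a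
  disjoint union, in which a simplex does not affect the first cohomology, and that of \<open>n B\<^sub>b\<close> is
  the join of \<open>n\<close> crown graphs. If a vertex set meets one copy, the cohomology has dimension
  \<open>e - v + c\<close> for a triangle-free graph with \<open>c\<close> components; if it meets two copies, the dimension is
  \<open>(c - 1) (c' - 1)\<close>; if it meets more, the cohomology vanishes. Counting vertex sets, \<open>\<lambda>\<^sub>i\<close> is the
  sum of \<open>c - 1\<close> over the sets of size \<open>i + 1\<close> in the crown graph, and \<open>\<mu>\<^sub>i\<close> is the sum of
  \<open>e - v + c\<close> over those of size \<open>i + 2\<close>.\<close>

section \<open>Bases of quotient spaces\<close>

text \<open>The Betti number is a definite description, so two things are owed: every minimal
  resolution yields the same rank, and one exists. Only cardinalities of bases are compared, so a
  quotient is handled as a pair of sets U, W, with representatives chosen in U. Internal degree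
  \<open>i + 2\<close> in homological degree \<open>i\<close> means quadratic coefficients on sets
  of size \<open>i\<close>. In a squarefree multidegree W such a coefficient is a pair of vertices
  of W, and the Koszul differential moves a third vertex into the monomial; hence 1-cochains, and
  cohomology of the independence complex. The exceptional values of \<lambda> come from the crown
  graph: the pair of x_i and y_i fits the generic count from either side, which lowers \<lambda>_1
  by b, and the set of x_i, x_j, y_i, y_j carries two disjoint edges, which raises \<lambda>_3 by
  the number of pairs. In \<mu> the three binomial terms are what remains of the sum of e - (v - 1)
  once the sum of c - 1 has been split off as \<lambda>_(i+1).\<close>

definition quot_basis ::
  "('k::field \<Rightarrow> 'a::ab_group_add \<Rightarrow> 'a) \<Rightarrow> 'a set \<Rightarrow> 'a set \<Rightarrow> 'j set \<Rightarrow> ('j \<Rightarrow> 'a) \<Rightarrow> bool" where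
  "quot_basis s U W J b \<longleftrightarrow> b ` J \<subseteq> U \<and>
    (\<forall>u\<in>U. \<exists>F c. finite F \<and> F \<subseteq> J \<and> u - (\<Sum>j\<in>F. s (c j) (b j)) \<in> W) \<and>
    (\<forall>F c. finite F \<and> F \<subseteq> J \<and> (\<Sum>j\<in>F. s (c j) (b j)) \<in> W \<longrightarrow> (\<forall>j\<in>F. c j = 0))"

definition quot_dim ::
  "('k::field \<Rightarrow> 'a::ab_group_add \<Rightarrow> 'a) \<Rightarrow> 'a set \<Rightarrow> 'a set \<Rightarrow> nat \<Rightarrow> bool" where
  "quot_dim s U W r \<longleftrightarrow> (\<exists>b :: nat \<Rightarrow> 'a. quot_basis s U W {..<r} b)"

lemma quot_basis_in: "quot_basis s U W J b \<Longrightarrow> j \<in> J \<Longrightarrow> b j \<in> U"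
  by (auto simp: quot_basis_def)

lemma quot_basis_spans:
  assumes "quot_basis s U W J b" "u \<in> U"
  obtains F c where "finite F" "F \<subseteq> J" "u - (\<Sum>j\<in>F. s (c j) (b j)) \<in> W"
proof -
  have "\<forall>u\<in>U. \<exists>F c. finite F \<and> F \<subseteq> J \<and> u - (\<Sum>j\<in>F. s (c j) (b j)) \<in> W"
    using assms(1) unfolding quot_basis_def by (elim conjE)
  from bspec[OF this assms(2)] show thesis using that by (elim exE conjE)
qed

lemma quot_basis_indep:
  assumes "quot_basis s U W J b" "finite F" "F \<subseteq> J" "(\<Sum>j\<in>F. s (c j) (b j)) \<in> W" "j \<in> F"
  shows "c j = 0"
proof -
  have "\<forall>F c. finite F \<and> F \<subseteq> J \<and> (\<Sum>j\<in>F. s (c j) (b j)) \<in> W \<longrightarrow> (\<forall>j\<in>F. c j = 0)"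
    using assms(1) unfolding quot_basis_def by (elim conjE)
  then show ?thesis using assms(2-) by simp
qed

lemma quot_basisI:
  assumes "\<And>j. j \<in> J \<Longrightarrow> b j \<in> U"
    and "\<And>u. u \<in> U \<Longrightarrow> \<exists>F c. finite F \<and> F \<subseteq> J \<and> u - (\<Sum>j\<in>F. s (c j) (b j)) \<in> W"
    and "\<And>F c j. finite F \<Longrightarrow> F \<subseteq> J \<Longrightarrow> (\<Sum>j\<in>F. s (c j) (b j)) \<in> W \<Longrightarrow> j \<in> F \<Longrightarrow> c j = 0"
  shows "quot_basis s U W J b"
  unfolding quot_basis_def
proof (intro conjI allI ballI impI)
  show "b ` J \<subseteq> U" using assms(1) by blast
  show "\<exists>F c. finite F \<and> F \<subseteq> J \<and> u - (\<Sum>j\<in>F. s (c j) (b j)) \<in> W" if "u \<in> U" for u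
    by (rule assms(2)[OF that])
  show "c j = 0" if "finite F \<and> F \<subseteq> J \<and> (\<Sum>j\<in>F. s (c j) (b j)) \<in> W" "j \<in> F" for F c j
    using assms(3)[of F c j] that by simp
qed

lemma quot_basis_spans_finite:
  assumes vs: "vector_space s" and qb: "quot_basis s U W J b" and J: "finite J" and u: "u \<in> U"
  obtains c where "u - (\<Sum>j\<in>J. s (c j) (b j)) \<in> W" "\<And>j. j \<notin> J \<Longrightarrow> c j = 0"
proof -
  interpret vector_space s by (rule vs)
  obtain F c where F: "finite F" "F \<subseteq> J" "u - (\<Sum>j\<in>F. s (c j) (b j)) \<in> W"
    using quot_basis_spans[OF qb u] by blast
  define c' where "c' = (\<lambda>j. if j \<in> F then c j else 0)"
  have eq: "(\<Sum>j\<in>J. s (c' j) (b j)) = (\<Sum>j\<in>F. s (c j) (b j))"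
    by (rule sum.mono_neutral_cong_right) (use J F in \<open>auto simp: c'_def\<close>)
  show thesis
  proof (rule that)
    show "u - (\<Sum>j\<in>J. s (c' j) (b j)) \<in> W" unfolding eq by (rule F(3))
    show "c' j = 0" if "j \<notin> J" for j using that F by (auto simp: c'_def)
  qed
qed

lemma quot_basis_reindex:
  assumes qb: "quot_basis s U W J b" and h: "bij_betw h J' J"
  shows "quot_basis s U W J' (b \<circ> h)"
proof (rule quot_basisI)
  have inj: "inj_on h J'" and im: "h ` J' = J" using h by (auto simp: bij_betw_def)
  fix j assume "j \<in> J'"
  then show "(b \<circ> h) j \<in> U" using quot_basis_in[OF qb] im by auto
next
  have inj: "inj_on h J'" and im: "h ` J' = J" using h by (auto simp: bij_betw_def)
  fix u assume "u \<in> U"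
  then obtain F c where F: "finite F" "F \<subseteq> J" "u - (\<Sum>j\<in>F. s (c j) (b j)) \<in> W"
    using quot_basis_spans[OF qb] by blast
  define G where "G = J' \<inter> h -` F"
  have hG: "h ` G = F" using F im by (auto simp: G_def)
  have injG: "inj_on h G" using inj by (rule inj_on_subset) (auto simp: G_def)
  have "finite G" using hG injG F(1) finite_imageD by blast
  moreover have "(\<Sum>j\<in>G. s ((c \<circ> h) j) ((b \<circ> h) j)) = (\<Sum>j\<in>F. s (c j) (b j))"
    unfolding hG[symmetric] by (simp add: sum.reindex[OF injG])
  ultimately show "\<exists>F c. finite F \<and> F \<subseteq> J' \<and> u - (\<Sum>j\<in>F. s (c j) ((b \<circ> h) j)) \<in> W"
    using F(3) by (intro exI[of _ G] exI[of _ "c \<circ> h"]) (auto simp: G_def)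
next
  have inj: "inj_on h J'" and im: "h ` J' = J" using h by (auto simp: bij_betw_def)
  fix F c j assume F: "finite F" "F \<subseteq> J'" "(\<Sum>j\<in>F. s (c j) ((b \<circ> h) j)) \<in> W" "j \<in> F"
  have injF: "inj_on h F" using inj F(2) by (rule inj_on_subset)
  have "(\<Sum>j\<in>h ` F. s (c (inv_into F h j)) (b j)) = (\<Sum>j\<in>F. s (c j) ((b \<circ> h) j))"
    by (simp add: sum.reindex[OF injF] injF)
  with F have "c (inv_into F h (h j)) = 0"
    using im by (intro quot_basis_indep[OF qb, where F = "h ` F" and c = "\<lambda>j. c (inv_into F h j)"]) auto
  then show "c j = 0" using injF F(4) by simp
qed

lemma quot_basis_imp_quot_dim:
  assumes "quot_basis s U W J b" "finite J"
  shows "quot_dim s U W (card J)"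
proof -
  obtain h where "bij_betw h {..<card J} J"
    using ex_bij_betw_nat_finite[OF assms(2)] by (auto simp: atLeast0LessThan)
  then show ?thesis using quot_basis_reindex[OF assms(1)] unfolding quot_dim_def by blast
qed

text \<open>A relation \<open>\<rho>\<close> takes the place of a linear map because a connecting
  homomorphism is defined only up to the choice of lifts. The hypotheses say that it induces an
  isomorphism of quotients: total on U, onto modulo W', and matching W with W'. Any choice of
  related elements then carries a basis to a basis.\<close>

lemma quot_basis_transfer:
  assumes s: "vector_space s" and s': "vector_space s'"
    and qb: "quot_basis s U W J b"
    and sub: "\<rho> \<subseteq> U \<times> U'"
    and add: "\<And>u u' v v'. (u,u') \<in> \<rho> \<Longrightarrow> (v,v') \<in> \<rho> \<Longrightarrow> (u+v,u'+v') \<in> \<rho>"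
    and scale: "\<And>c u u'. (u,u') \<in> \<rho> \<Longrightarrow> (s c u, s' c u') \<in> \<rho>"
    and total: "\<And>u. u \<in> U \<Longrightarrow> \<exists>u'. (u,u') \<in> \<rho>"
    and onto: "\<And>u'. u' \<in> U' \<Longrightarrow> \<exists>u w. (u,w) \<in> \<rho> \<and> u' - w \<in> W'"
    and iff: "\<And>u u'. (u,u') \<in> \<rho> \<Longrightarrow> u \<in> W \<longleftrightarrow> u' \<in> W'"
    and zero: "(0,0) \<in> \<rho>"
    and W'add: "\<And>x y. x \<in> W' \<Longrightarrow> y \<in> W' \<Longrightarrow> x + y \<in> W'"
  shows "\<exists>b'. quot_basis s' U' W' J b'"
proof -
  interpret v: vector_space s by (rule s)
  interpret v': vector_space s' by (rule s')
  have "\<forall>j\<in>J. \<exists>u'. (b j, u') \<in> \<rho>" using total quot_basis_in[OF qb] by blast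
  then obtain b' where b': "\<And>j. j \<in> J \<Longrightarrow> (b j, b' j) \<in> \<rho>" by metis
  have sums: "((\<Sum>j\<in>F. s (c j) (b j)), (\<Sum>j\<in>F. s' (c j) (b' j))) \<in> \<rho>" if "finite F" "F \<subseteq> J" for F c
    using that by (induction F rule: finite_induct) (auto intro!: add scale b' zero)
  have minus: "(u - v, u' - v') \<in> \<rho>" if "(u,u') \<in> \<rho>" "(v,v') \<in> \<rho>" for u u' v v'
    using add[OF that(1) scale[OF that(2), of "-1"]] by simp
  have "quot_basis s' U' W' J b'"
  proof (rule quot_basisI)
    show "b' j \<in> U'" if "j \<in> J" for j using b'[OF that] sub by auto
  next
    fix u' assume "u' \<in> U'"
    then obtain u w where w: "(u,w) \<in> \<rho>" "u' - w \<in> W'" using onto by blast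
    then have "u \<in> U" using sub by auto
    then obtain F c where F: "finite F" "F \<subseteq> J" "u - (\<Sum>j\<in>F. s (c j) (b j)) \<in> W"
      using quot_basis_spans[OF qb] by blast
    have "w - (\<Sum>j\<in>F. s' (c j) (b' j)) \<in> W'"
      using iff[OF minus[OF w(1) sums[OF F(1,2)]]] F(3) by blast
    from W'add[OF w(2) this] show "\<exists>F c. finite F \<and> F \<subseteq> J \<and> u' - (\<Sum>j\<in>F. s' (c j) (b' j)) \<in> W'"
      using F by (intro exI[of _ F] exI[of _ c]) auto
  next
    fix F c j assume F: "finite F" "F \<subseteq> J" "(\<Sum>j\<in>F. s' (c j) (b' j)) \<in> W'" "j \<in> F"
    then have "(\<Sum>j\<in>F. s (c j) (b j)) \<in> W" using iff[OF sums[OF F(1,2)]] by blast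
    then show "c j = 0" using quot_basis_indep[OF qb F(1,2)] F(4) by blast
  qed
  then show ?thesis by blast
qed

lemma quot_basis_transfer_fun:
  assumes s: "vector_space s" and s': "vector_space s'"
    and qb: "quot_basis s U W J b"
    and U: "module.subspace s U" and W': "module.subspace s' W'"
    and maps: "\<And>u. u \<in> U \<Longrightarrow> f u \<in> U'"
    and add: "\<And>u v. u \<in> U \<Longrightarrow> v \<in> U \<Longrightarrow> f (u + v) = f u + f v"
    and scale: "\<And>c u. u \<in> U \<Longrightarrow> f (s c u) = s' c (f u)"
    and onto: "\<And>u'. u' \<in> U' \<Longrightarrow> \<exists>u\<in>U. u' - f u \<in> W'"
    and iff: "\<And>u. u \<in> U \<Longrightarrow> u \<in> W \<longleftrightarrow> f u \<in> W'"
  shows "\<exists>b'. quot_basis s' U' W' J b'"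
proof -
  interpret v: vector_space s by (rule s)
  interpret v': vector_space s' by (rule s')
  have f0: "f 0 = 0" using scale[of 0 0] v.subspace_0[OF U] by simp
  show ?thesis
  proof (rule quot_basis_transfer[OF s s' qb, where \<rho> = "(\<lambda>u. (u, f u)) ` U" and U' = U' and W' = W'])
    show "(\<lambda>u. (u, f u)) ` U \<subseteq> U \<times> U'" using maps by blast
    show "(u + v, u' + v') \<in> (\<lambda>u. (u, f u)) ` U"
      if "(u, u') \<in> (\<lambda>u. (u, f u)) ` U" "(v, v') \<in> (\<lambda>u. (u, f u)) ` U" for u u' v v'
      using that v.subspace_add[OF U, of u v] add[of u v] by auto
    show "(s c u, s' c u') \<in> (\<lambda>u. (u, f u)) ` U"
      if "(u, u') \<in> (\<lambda>u. (u, f u)) ` U" for c u u'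
      using that v.subspace_scale[OF U, of u c] scale[of u c] by auto
    show "\<exists>u'. (u, u') \<in> (\<lambda>u. (u, f u)) ` U" if "u \<in> U" for u using that by blast
    show "\<exists>u w. (u, w) \<in> (\<lambda>u. (u, f u)) ` U \<and> u' - w \<in> W'" if "u' \<in> U'" for u'
      using onto[OF that] by blast
    show "u \<in> W \<longleftrightarrow> u' \<in> W'" if "(u, u') \<in> (\<lambda>u. (u, f u)) ` U" for u u'
      using that iff[of u] by auto
    show "(0, 0) \<in> (\<lambda>u. (u, f u)) ` U" using v.subspace_0[OF U] f0 by force
    show "x + y \<in> W'" if "x \<in> W'" "y \<in> W'" for x y using v'.subspace_add[OF W' that] .
  qed
qed

section \<open>Uniqueness, existence and additivity of dimensions\<close>

lemma sum_fun_apply: "(\<Sum>i\<in>A. f i) x = (\<Sum>i\<in>A. f i x)"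
  by (induction A rule: infinite_finite_induct) auto

lemma vector_space_fun:
  assumes "vector_space s"
  shows "vector_space (\<lambda>c f x. s c (f x))"
proof -
  interpret vector_space s by (rule assms)
  show ?thesis
  proof
    show "(\<lambda>x. s a ((f + g) x)) = (\<lambda>x. s a (f x)) + (\<lambda>x. s a (g x))" for a f g
      by (rule ext) (simp only: plus_fun_def scale_right_distrib)
    show "(\<lambda>x. s (a + b) (f x)) = (\<lambda>x. s a (f x)) + (\<lambda>x. s b (f x))" for a b f
      by (rule ext) (simp only: plus_fun_def scale_left_distrib)
  qed simp_all
qed

lemma vector_space_times: "vector_space ((*) :: 'k::field \<Rightarrow> 'k \<Rightarrow> 'k)"
  by unfold_locales (simp_all add: distrib_left distrib_right)

lemma vector_space_fun_times: "vector_space (\<lambda>c (f :: 'x \<Rightarrow> 'k::field) x. c * f x)"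
  by (rule vector_space_fun[OF vector_space_times])

text \<open>Each \<open>b j\<close> is congruent modulo W to a combination of the \<open>b'\<close>.
  A relation between the coefficient vectors puts the same combination of the \<open>b j\<close>
  into W, so these vectors are independent in a function space spanned by \<open>card J'\<close>
  unit vectors.\<close>

lemma quot_basis_card_le:
  fixes s :: "'k::field \<Rightarrow> 'a::ab_group_add \<Rightarrow> 'a" and J :: "'i set" and J' :: "'j set"
  assumes vs: "vector_space s" and W: "module.subspace s W"
    and qb: "quot_basis s U W J b" and qb': "quot_basis s U W J' b'" and J': "finite J'"
  shows "finite J \<and> card J \<le> card J'"
proof -
  interpret vector_space s by (rule vs)
  define fs where "fs = (\<lambda>(c::'k) (f :: 'j \<Rightarrow> 'k) x. c * f x)"
  interpret F: vector_space fs unfolding fs_def by (rule vector_space_fun_times)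
  have "\<forall>j\<in>J. \<exists>c. b j - (\<Sum>j'\<in>J'. s (c j') (b' j')) \<in> W \<and> (\<forall>j'. j' \<notin> J' \<longrightarrow> c j' = 0)"
    using quot_basis_spans_finite[OF vs qb' J'] quot_basis_in[OF qb] by metis
  then obtain g where g: "\<And>j. j \<in> J \<Longrightarrow> b j - (\<Sum>j'\<in>J'. s (g j j') (b' j')) \<in> W"
    and g0: "\<And>j j'. j \<in> J \<Longrightarrow> j' \<notin> J' \<Longrightarrow> g j j' = 0" by metis
  have key: "\<forall>j\<in>F. a j = 0" if F: "finite F" "F \<subseteq> J" and z: "(\<Sum>j\<in>F. fs (a j) (g j)) = 0" for F a
  proof -
    have "(\<Sum>j\<in>F. s (a j) (b j - (\<Sum>j'\<in>J'. s (g j j') (b' j')))) \<in> W"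
      using F g by (intro subspace_sum[OF W] subspace_scale[OF W]) auto
    moreover have "(\<Sum>j\<in>F. s (a j) (b j - (\<Sum>j'\<in>J'. s (g j j') (b' j')))) =
       (\<Sum>j\<in>F. s (a j) (b j)) - (\<Sum>j'\<in>J'. s (\<Sum>j\<in>F. a j * g j j') (b' j'))"
      by (simp add: scale_right_diff_distrib sum_subtractf scale_sum_right scale_sum_left)
        (rule sum.swap)
    moreover have "(\<Sum>j\<in>F. a j * g j j') = 0" for j'
      using fun_cong[OF z, of j'] by (simp add: fs_def sum_fun_apply)
    ultimately have "(\<Sum>j\<in>F. s (a j) (b j)) \<in> W" by simp
    then show ?thesis using quot_basis_indep[OF qb F] by blast
  qed
  \<comment> \<open>Independence of the set of coefficient vectors does not exclude repetitions in
    the family, so injectivity is extracted from the relation with coefficients 1 and -1.\<close>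
  have inj: "inj_on g J"
  proof (rule inj_onI, rule ccontr)
    fix x y assume xy: "x \<in> J" "y \<in> J" "g x = g y" "x \<noteq> y"
    have "(\<Sum>j\<in>{x,y}. fs (if j = x then 1 else -1) (g j)) = fs 1 (g x) + fs (-1) (g y)"
      using xy(4) by simp
    also have "\<dots> = 0" unfolding xy(3) by simp
    finally have "\<forall>j\<in>{x,y}. (if j = x then 1 else -1) = (0::'k)"
      using xy(1,2) by (intro key) auto
    then show False by simp
  qed
  have "F.independent (g ` J)"
    unfolding F.independent_explicit_finite_subsets
  proof (intro allI impI)
    fix S u assume S: "S \<subseteq> g ` J" "finite S" "(\<Sum>v\<in>S. fs (u v) v) = 0"
    then obtain F where F: "F \<subseteq> J" "S = g ` F" "inj_on g F"
      by (auto simp: subset_image_inj)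
    then have fF: "finite F" using S finite_imageD by blast
    have "(\<Sum>j\<in>F. fs (u (g j)) (g j)) = 0" using S(3) F by (simp add: sum.reindex)
    from key[OF fF F(1) this] show "\<forall>v\<in>S. u v = 0" using F by auto
  qed
  moreover have "g ` J \<subseteq> F.span ((\<lambda>i x. if x = i then 1 else 0) ` J')"
  proof
    fix f assume "f \<in> g ` J"
    then have f0: "f x = 0" if "x \<notin> J'" for x using g0 that by auto
    have "f = (\<Sum>i\<in>J'. fs (f i) (\<lambda>x. if x = i then 1 else 0))"
    proof
      fix x
      have "(\<Sum>i\<in>J'. fs (f i) (\<lambda>x. if x = i then 1 else 0)) x = (\<Sum>i\<in>J'. if i = x then f x else 0)"
        unfolding sum_fun_apply by (intro sum.cong) (auto simp: fs_def)
      then show "f x = (\<Sum>i\<in>J'. fs (f i) (\<lambda>x. if x = i then 1 else 0)) x" using J' f0 by simp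
    qed
    also have "\<dots> \<in> F.span ((\<lambda>i x. if x = i then 1 else 0) ` J')"
      by (intro F.span_sum F.span_scale F.span_base) auto
    finally show "f \<in> F.span ((\<lambda>i x. if x = i then 1 else 0) ` J')" .
  qed
  ultimately have "finite (g ` J) \<and> card (g ` J) \<le> card ((\<lambda>i x. if x = i then (1::'k) else 0) ` J')"
    using J' by (intro F.independent_span_bound) auto
  then have "finite J" "card J \<le> card ((\<lambda>i x. if x = i then (1::'k) else 0) ` J')"
    using inj by (simp_all only: card_image finite_image_iff)
  then show ?thesis
    using card_image_le[OF J', of "\<lambda>i x. if x = i then (1::'k) else 0"] by linarith
qed

text \<open>Finiteness of \<open>J\<close> is a conclusion. This matters because a resolution is
  given without finite ranks, and its basis elements of one degree are compared here with a homology
  space of known dimension.\<close>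

lemma quot_basis_card_eq:
  assumes "vector_space s" "module.subspace s W"
    and "quot_basis s U W J b" "quot_dim s U W r"
  shows "finite J \<and> card J = r"
proof -
  obtain b' :: "nat \<Rightarrow> 'b" where b': "quot_basis s U W {..<r} b'"
    using assms(4) unfolding quot_dim_def by blast
  have "finite J \<and> card J \<le> r"
    using quot_basis_card_le[OF assms(1-3) b'] by simp
  moreover from this have "r \<le> card J" using quot_basis_card_le[OF assms(1,2) b' assms(3)] by simp
  ultimately show ?thesis by simp
qed

lemma quot_dim_unique:
  assumes "vector_space s" "module.subspace s W" "quot_dim s U W r" "quot_dim s U W r'"
  shows "r = r'"
proof -
  obtain b' :: "nat \<Rightarrow> 'b" where b': "quot_basis s U W {..<r} b'"
    using assms(3) unfolding quot_dim_def by blast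
  show ?thesis using quot_basis_card_eq[OF assms(1,2) b' assms(4)] by simp
qed

text \<open>A maximal independent subset C of W extends to a maximal independent subset D of U, and
  the elements of D outside C represent a basis modulo W. The finite set T bounds the size of
  D.\<close>

lemma quot_basis_exists:
  fixes s :: "'k::field \<Rightarrow> 'a::ab_group_add \<Rightarrow> 'a"
  assumes vs: "vector_space s" and U: "module.subspace s U" and W: "module.subspace s W" and WU: "W \<subseteq> U"
    and T: "finite T" "U \<subseteq> module.span s T"
  shows "\<exists>D. finite D \<and> quot_basis s U W D id"
proof -
  interpret vector_space s by (rule vs)
  obtain C where C: "C \<subseteq> W" "independent C" "W \<subseteq> span C"
    using maximal_independent_subset[of W] by blast
  obtain D where D: "C \<subseteq> D" "D \<subseteq> U" "independent D" "U \<subseteq> span D"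
    using maximal_independent_subset_extend[OF subset_trans[OF C(1) WU] C(2)] by blast
  have finD: "finite D" using independent_span_bound[OF T(1) D(3)] D(2) T(2) by auto
  have finC: "finite C" using finD D(1) finite_subset by blast
  have DC: "D = (D - C) \<union> C" using D(1) by auto
  have spanC: "W = span C" using C span_minimal[OF C(1) W] by auto
  have "quot_basis s U W (D - C) id"
  proof (rule quot_basisI)
    show "id j \<in> U" if "j \<in> D - C" for j using that D by auto
  next
    fix u assume "u \<in> U"
    then have "u \<in> range (\<lambda>c. \<Sum>v\<in>D. s (c v) v)" using D(4) span_finite[OF finD] by auto
    then obtain c where "u = (\<Sum>v\<in>(D - C) \<union> C. s (c v) v)" using DC by auto
    also have "\<dots> = (\<Sum>v\<in>D - C. s (c v) v) + (\<Sum>v\<in>C. s (c v) v)"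
      by (rule sum.union_disjoint) (use finD finC in auto)
    finally have "u - (\<Sum>v\<in>D - C. s (c v) (id v)) = (\<Sum>v\<in>C. s (c v) v)" by simp
    also have "\<dots> \<in> W" unfolding spanC by (intro span_sum span_scale span_base)
    finally show "\<exists>F c. finite F \<and> F \<subseteq> D - C \<and> u - (\<Sum>j\<in>F. s (c j) (id j)) \<in> W"
      using finD by (intro exI[of _ "D - C"] exI[of _ c]) auto
  next
    fix F c j assume F: "finite F" "F \<subseteq> D - C" "(\<Sum>j\<in>F. s (c j) (id j)) \<in> W" "j \<in> F"
    then obtain c' where c': "(\<Sum>j\<in>F. s (c j) j) = (\<Sum>v\<in>C. s (c' v) v)"
      unfolding spanC span_finite[OF finC] by auto
    \<comment> \<open>A combination of elements outside C that lies in W is also a combination of C;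
      the difference is a relation on the independent set D.\<close>
    define e where "e = (\<lambda>v. if v \<in> F then c v else - c' v)"
    have "(\<Sum>v\<in>F \<union> C. s (e v) v) = (\<Sum>v\<in>F. s (e v) v) + (\<Sum>v\<in>C. s (e v) v)"
      using F finC by (intro sum.union_disjoint) auto
    also have "(\<Sum>v\<in>F. s (e v) v) = (\<Sum>v\<in>F. s (c v) v)" by (simp add: e_def)
    also have "(\<Sum>v\<in>C. s (e v) v) = (\<Sum>v\<in>C. - s (c' v) v)"
      using F by (intro sum.cong) (auto simp: e_def)
    also have "(\<Sum>v\<in>F. s (c v) v) + (\<Sum>v\<in>C. - s (c' v) v) = 0"
      by (simp add: c' sum_negf)
    finally have z: "(\<Sum>v\<in>F \<union> C. s (e v) v) = 0" .
    have "F \<union> C \<subseteq> D" "finite (F \<union> C)" using F D(1) finC by auto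
    with z have "\<forall>v\<in>F \<union> C. e v = 0"
      using D(3)[unfolded independent_explicit_finite_subsets, rule_format] by metis
    then have "e j = 0" using F(4) by blast
    then show "c j = 0" using F(4) by (simp add: e_def)
  qed
  then show ?thesis using finD by auto
qed

lemma quot_dim_exists:
  assumes "vector_space s" "module.subspace s U" "module.subspace s W" "W \<subseteq> U"
    and "finite T" "U \<subseteq> module.span s T"
  shows "\<exists>r. quot_dim s U W r"
proof -
  obtain D where "finite D" "quot_basis s U W D id"
    using quot_basis_exists[OF assms] by (elim exE conjE)
  then show ?thesis by (metis quot_basis_imp_quot_dim)
qed

lemma quot_dim_transfer_fun:
  assumes "vector_space s" "vector_space s'" "quot_dim s U W r"
    and "module.subspace s U" "module.subspace s' W'"
    and "\<And>u. u \<in> U \<Longrightarrow> f u \<in> U'"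
    and "\<And>u v. u \<in> U \<Longrightarrow> v \<in> U \<Longrightarrow> f (u + v) = f u + f v"
    and "\<And>c u. u \<in> U \<Longrightarrow> f (s c u) = s' c (f u)"
    and "\<And>u'. u' \<in> U' \<Longrightarrow> \<exists>u\<in>U. u' - f u \<in> W'"
    and "\<And>u. u \<in> U \<Longrightarrow> u \<in> W \<longleftrightarrow> f u \<in> W'"
  shows "quot_dim s' U' W' r"
proof -
  obtain b :: "nat \<Rightarrow> 'b" where "quot_basis s U W {..<r} b"
    using assms(3) unfolding quot_dim_def by blast
  from quot_basis_transfer_fun[OF assms(1,2) this assms(4-)]
  show ?thesis unfolding quot_dim_def by blast
qed

text \<open>For X inside W inside U, representatives of U modulo W followed by representatives of W
  modulo X form a basis of U modulo X. Independence is read off modulo W for the first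
  \<open>r\<close> coefficients and then modulo X for the rest.\<close>

lemma quot_dim_add:
  assumes vs: "vector_space s" and WU: "W \<subseteq> U" and X: "module.subspace s X"
    and XW: "X \<subseteq> W" and W: "module.subspace s W"
    and d1: "quot_dim s U W r" and d2: "quot_dim s W X r'"
  shows "quot_dim s U X (r + r')"
proof -
  interpret vector_space s by (rule vs)
  obtain b :: "nat \<Rightarrow> 'b" where b: "quot_basis s U W {..<r} b" using d1 unfolding quot_dim_def by blast
  obtain b' :: "nat \<Rightarrow> 'b" where b': "quot_basis s W X {..<r'} b'" using d2 unfolding quot_dim_def by blast
  define e where "e = (\<lambda>i. if i < r then b i else b' (i - r))"
  have split: "(\<Sum>i<r + r'. s (c i) (e i)) = (\<Sum>i<r. s (c i) (b i)) + (\<Sum>i<r'. s (c (r + i)) (b' i))" for c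
  proof -
    have "(\<Sum>i<r + r'. s (c i) (e i)) = (\<Sum>i<r. s (c i) (e i)) + (\<Sum>i\<in>{r..<r + r'}. s (c i) (e i))"
      by (subst sum.union_disjoint[symmetric]) (auto intro!: sum.cong)
    also have "(\<Sum>i\<in>{r..<r + r'}. s (c i) (e i)) = (\<Sum>i<r'. s (c (r + i)) (e (r + i)))"
      by (rule sum.reindex_bij_witness[of _ "\<lambda>i. r + i" "\<lambda>i. i - r"]) auto
    finally show ?thesis by (simp add: e_def)
  qed
  have "quot_basis s U X {..<r + r'} e"
  proof (rule quot_basisI)
    show "e j \<in> U" if "j \<in> {..<r + r'}" for j
      using that quot_basis_in[OF b, of j] quot_basis_in[OF b', of "j - r"] WU by (auto simp: e_def)
  next
    fix u assume "u \<in> U"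
    then obtain c where c: "u - (\<Sum>j<r. s (c j) (b j)) \<in> W"
      using quot_basis_spans_finite[OF vs b finite_lessThan] by metis
    then obtain c' where c': "u - (\<Sum>j<r. s (c j) (b j)) - (\<Sum>j<r'. s (c' j) (b' j)) \<in> X"
      using quot_basis_spans_finite[OF vs b' finite_lessThan] by metis
    have "(\<Sum>i<r + r'. s (if i < r then c i else c' (i - r)) (e i)) =
       (\<Sum>i<r. s (c i) (b i)) + (\<Sum>i<r'. s (c' i) (b' i))" by (simp add: split)
    then show "\<exists>F c. finite F \<and> F \<subseteq> {..<r + r'} \<and> u - (\<Sum>j\<in>F. s (c j) (e j)) \<in> X"
      using c' by (intro exI[of _ "{..<r + r'}"] exI[of _ "\<lambda>i. if i < r then c i else c' (i - r)"])
        (auto simp: diff_diff_add)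
  next
    fix F c j assume F: "finite F" "F \<subseteq> {..<r + r'}" "(\<Sum>j\<in>F. s (c j) (e j)) \<in> X" "j \<in> F"
    define c' where "c' = (\<lambda>j. if j \<in> F then c j else 0)"
    have "(\<Sum>j\<in>F. s (c j) (e j)) = (\<Sum>j<r + r'. s (c' j) (e j))"
      by (rule sum.mono_neutral_cong_left) (use F in \<open>auto simp: c'_def\<close>)
    with F(3) have eq: "(\<Sum>i<r. s (c' i) (b i)) + (\<Sum>i<r'. s (c' (r + i)) (b' i)) \<in> X"
      by (simp add: split)
    have in_W: "(\<Sum>i<r'. s (c' (r + i)) (b' i)) \<in> W"
      using quot_basis_in[OF b'] by (intro subspace_sum[OF W] subspace_scale[OF W]) auto
    have "(\<Sum>i<r. s (c' i) (b i)) \<in> W"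
      using subspace_diff[OF W _ in_W] eq XW by (metis add_diff_cancel_right' subsetD)
    then have z: "\<forall>i<r. c' i = 0"
      using quot_basis_indep[OF b, of "{..<r}" c'] by auto
    with eq have "(\<Sum>i<r'. s (c' (r + i)) (b' i)) \<in> X" by simp
    then have z': "\<forall>i<r'. c' (r + i) = 0"
      using quot_basis_indep[OF b', of "{..<r'}" "\<lambda>i. c' (r + i)"] by auto
    have "c' j = 0"
    proof (cases "j < r")
      case False
      then have "j - r < r'" "r + (j - r) = j" using F by auto
      then show ?thesis using z' by metis
    qed (use z in auto)
    then show "c j = 0" using F(4) by (simp add: c'_def)
  qed
  then show ?thesis unfolding quot_dim_def by blast
qed

text \<open>Elements of the product are extended by zero outside \<open>\<Omega>\<close>, so that
  they are determined by their factors and the product lives in a plain function space.\<close>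

definition fun_prod :: "'w set \<Rightarrow> ('w \<Rightarrow> 'a::zero set) \<Rightarrow> ('w \<Rightarrow> 'a) set" where
  "fun_prod \<Omega> U = {f. (\<forall>w\<in>\<Omega>. f w \<in> U w) \<and> (\<forall>w. w \<notin> \<Omega> \<longrightarrow> f w = 0)}"

text \<open>Serves to add up the contributions of the squarefree multidegrees. A basis consists of
  the representatives of each factor, extended by zero to the other factors.\<close>

lemma quot_dim_fun_prod:
  assumes vs: "vector_space s" and \<Omega>: "finite \<Omega>"
    and U: "\<And>w. w \<in> \<Omega> \<Longrightarrow> 0 \<in> U w"
    and d: "\<And>w. w \<in> \<Omega> \<Longrightarrow> quot_dim s (U w) (W w) (r w)"
  shows "quot_dim (\<lambda>c f w. s c (f w)) (fun_prod \<Omega> U) (fun_prod \<Omega> W) (\<Sum>w\<in>\<Omega>. r w)"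
proof -
  interpret vector_space s by (rule vs)
  have "\<forall>w\<in>\<Omega>. \<exists>b :: nat \<Rightarrow> _. quot_basis s (U w) (W w) {..<r w} b"
    using d unfolding quot_dim_def by blast
  then obtain b :: "'c \<Rightarrow> nat \<Rightarrow> 'b" where b: "\<And>w. w \<in> \<Omega> \<Longrightarrow> quot_basis s (U w) (W w) {..<r w} (b w)"
    by metis
  define J where "J = Sigma \<Omega> (\<lambda>w. {..<r w})"
  have finJ: "finite J" using \<Omega> by (auto simp: J_def)
  define e where "e = (\<lambda>(w,j) w'. if w' = w then b w j else 0)"
  have ev: "(\<Sum>p\<in>J. (\<lambda>c f w. s c (f w)) (c p) (e p)) w = (\<Sum>j<r w. s (c (w, j)) (b w j))"
    if "w \<in> \<Omega>" for c w
  proof -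
    have "(\<Sum>p\<in>J. (\<lambda>c f w. s c (f w)) (c p) (e p)) w = (\<Sum>p\<in>J. s (c p) (e p w))"
      by (rule sum_fun_apply)
    also have "\<dots> = (\<Sum>w'\<in>\<Omega>. \<Sum>j<r w'. s (c (w', j)) (e (w', j) w))"
      unfolding J_def using \<Omega> by (subst sum.Sigma) (auto intro!: sum.cong)
    also have "\<dots> = (\<Sum>w'\<in>\<Omega>. if w' = w then (\<Sum>j<r w. s (c (w, j)) (b w j)) else 0)"
      by (intro sum.cong) (auto simp: e_def)
    also have "\<dots> = (\<Sum>j<r w. s (c (w, j)) (b w j))" using \<Omega> that by simp
    finally show ?thesis .
  qed
  have ev0: "(\<Sum>p\<in>F. (\<lambda>c f w. s c (f w)) (c p) (e p)) w = 0"
    if "finite F" "F \<subseteq> J" "w \<notin> \<Omega>" for c w F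
  proof -
    have "e p w = 0" if "p \<in> J" for p using that \<open>w \<notin> \<Omega>\<close> by (auto simp: e_def J_def)
    then have "e p w = 0" if "p \<in> F" for p using that \<open>F \<subseteq> J\<close> by blast
    then show ?thesis unfolding sum_fun_apply by (intro sum.neutral) simp
  qed
  have "quot_basis (\<lambda>c f w. s c (f w)) (fun_prod \<Omega> U) (fun_prod \<Omega> W) J e"
  proof (rule quot_basisI)
    show "e p \<in> fun_prod \<Omega> U" if pJ: "p \<in> J" for p
    proof -
      obtain w j where p: "p = (w, j)" "w \<in> \<Omega>" "j < r w" using pJ by (auto simp: J_def)
      then have "b w j \<in> U w" using quot_basis_in[OF b[OF p(2)]] by simp
      then show ?thesis using p U by (auto simp: e_def fun_prod_def)
    qed
  next
    fix f assume f: "f \<in> fun_prod \<Omega> U"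
    then have "\<forall>w\<in>\<Omega>. \<exists>c. f w - (\<Sum>j<r w. s (c j) (b w j)) \<in> W w"
      using b by (auto simp: fun_prod_def) (metis finite_lessThan quot_basis_spans_finite vs)
    then obtain c where c: "\<And>w. w \<in> \<Omega> \<Longrightarrow> f w - (\<Sum>j<r w. s (c w j) (b w j)) \<in> W w" by metis
    have "f - (\<Sum>p\<in>J. (\<lambda>c f w. s c (f w)) (case_prod c p) (e p)) \<in> fun_prod \<Omega> W"
      using c ev[of _ "case_prod c"] f ev0[OF finJ, of _ "case_prod c"]
      by (auto simp: fun_prod_def fun_diff_def)
    then show "\<exists>F c. finite F \<and> F \<subseteq> J \<and> f - (\<Sum>p\<in>F. (\<lambda>c f w. s c (f w)) (c p) (e p)) \<in> fun_prod \<Omega> W"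
      using finJ by blast
  next
    fix F c p assume F: "finite F" "F \<subseteq> J" "(\<Sum>p\<in>F. (\<lambda>c f w. s c (f w)) (c p) (e p)) \<in> fun_prod \<Omega> W" "p \<in> F"
    define c' where "c' = (\<lambda>j. if j \<in> F then c j else 0)"
    have "(\<Sum>p\<in>F. (\<lambda>c f w. s c (f w)) (c p) (e p)) = (\<Sum>p\<in>J. (\<lambda>c f w. s c (f w)) (c' p) (e p))"
      by (rule sum.mono_neutral_cong_left) (use F finJ in \<open>auto simp: c'_def fun_eq_iff\<close>)
    then have *: "(\<Sum>p\<in>J. (\<lambda>c f w. s c (f w)) (c' p) (e p)) \<in> fun_prod \<Omega> W" using F by simp
    obtain w j where p: "p = (w,j)" "w \<in> \<Omega>" "j < r w" using F by (auto simp: J_def)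
    have "(\<Sum>j<r w. s (c' (w, j)) (b w j)) \<in> W w"
      using * ev[OF p(2), of c'] p by (auto simp: fun_prod_def)
    from quot_basis_indep[OF b[OF p(2)] _ _ this, of j] p have "c' p = 0" by simp
    then show "c p = 0" using F(4) by (simp add: c'_def)
  qed
  from quot_basis_imp_quot_dim[OF this finJ] show ?thesis using \<Omega> by (simp add: J_def)
qed

section \<open>The Koszul complex\<close>

text \<open>The sign of bringing \<open>v\<close> to its place in the exterior product over T, where
  the vertices are ordered by \<open>ix\<close>.\<close>

definition ksgn :: "('v \<Rightarrow> nat) \<Rightarrow> 'v \<Rightarrow> 'v set \<Rightarrow> 'k::comm_ring_1" where
  "ksgn ix v T = (-1) ^ card {u \<in> T. ix u < ix v}"

text \<open>A chain stores at T the coefficient of the exterior product e_T. The coefficient of e_T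
  in the differential collects the contributions of all e_S with S one element larger than T;
  \<open>X v\<close> is the action of the variable \<open>v\<close>.\<close>

definition kdiff ::
  "('k::field \<Rightarrow> 'a::ab_group_add \<Rightarrow> 'a) \<Rightarrow> ('v \<Rightarrow> 'a \<Rightarrow> 'a) \<Rightarrow> 'v set \<Rightarrow> ('v \<Rightarrow> nat) \<Rightarrow>
   ('v set \<Rightarrow> 'a) \<Rightarrow> 'v set \<Rightarrow> 'a" where
  "kdiff s X V ix f T =
    (if T \<subseteq> V then \<Sum>v\<in>V - T. s (ksgn ix v T) (X v (f (insert v T))) else 0)"

definition kchain :: "'v set \<Rightarrow> nat \<Rightarrow> 'a::zero set \<Rightarrow> ('v set \<Rightarrow> 'a) set" where
  "kchain V q A = {f. \<forall>S. if S \<subseteq> V \<and> card S = q then f S \<in> A else f S = 0}"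

text \<open>Cycles and boundaries of the Koszul complex of a graded quotient module \<open>A/B\<close> in
  homological degree \<open>q\<close> and internal degree \<open>q + k + 1\<close>, as chains with values in \<open>A\<close>.\<close>

definition kcyc ::
  "('k::field \<Rightarrow> 'a::ab_group_add \<Rightarrow> 'a) \<Rightarrow> ('v \<Rightarrow> 'a \<Rightarrow> 'a) \<Rightarrow> 'v set \<Rightarrow> ('v \<Rightarrow> nat) \<Rightarrow>
   (nat \<Rightarrow> 'a set) \<Rightarrow> (nat \<Rightarrow> 'a set) \<Rightarrow> nat \<Rightarrow> nat \<Rightarrow> ('v set \<Rightarrow> 'a) set" where
  "kcyc s X V ix A B q k =
    {f \<in> kchain V q (A (Suc k)). \<forall>T. kdiff s X V ix f T \<in> B (Suc (Suc k))}"

definition kbnd ::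
  "('k::field \<Rightarrow> 'a::ab_group_add \<Rightarrow> 'a) \<Rightarrow> ('v \<Rightarrow> 'a \<Rightarrow> 'a) \<Rightarrow> 'v set \<Rightarrow> ('v \<Rightarrow> nat) \<Rightarrow>
   (nat \<Rightarrow> 'a set) \<Rightarrow> (nat \<Rightarrow> 'a set) \<Rightarrow> nat \<Rightarrow> nat \<Rightarrow> ('v set \<Rightarrow> 'a) set" where
  "kbnd s X V ix A B q k =
    {f + kdiff s X V ix g | f g. f \<in> kchain V q (B (Suc k)) \<and> g \<in> kchain V (Suc q) (A k)}"

section \<open>Signs, chains and the square of the differential\<close>

lemma ksgn_insert:
  assumes "finite T" "u \<notin> T"
  shows "ksgn ix v (insert u T) = (if ix u < ix v then - ksgn ix v T else ksgn ix v T)"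
proof (cases "ix u < ix v")
  case True
  then have "{w \<in> insert u T. ix w < ix v} = insert u {w \<in> T. ix w < ix v}" by auto
  then show ?thesis using assms True by (simp add: ksgn_def)
next
  case False
  then have "{w \<in> insert u T. ix w < ix v} = {w \<in> T. ix w < ix v}" by auto
  then show ?thesis using False by (simp add: ksgn_def)
qed

text \<open>Inserting a vertex changes the sign of the larger ones only, so of the two vertices
  exactly one sees its sign flipped by the other.\<close>

lemma ksgn_swap:
  assumes "finite T" "u \<notin> T" "v \<notin> T" "ix u \<noteq> ix v"
  shows "ksgn ix v T * ksgn ix u (insert v T) = - (ksgn ix u T * ksgn ix v (insert u T))"
  using assms by (auto simp: ksgn_insert mult.commute)

lemma ksgn_square [simp]: "ksgn ix v T * ksgn ix v T = 1"
  by (simp add: ksgn_def flip: power_add mult_2)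

lemma ksgn_square_left [simp]: "ksgn ix v T * (ksgn ix v T * x) = x"
  by (simp flip: mult.assoc)

lemma kchain_outside: "f \<in> kchain V q A \<Longrightarrow> \<not> (S \<subseteq> V \<and> card S = q) \<Longrightarrow> f S = 0"
  by (auto simp: kchain_def)

lemma kchain_in: "f \<in> kchain V q A \<Longrightarrow> S \<subseteq> V \<Longrightarrow> card S = q \<Longrightarrow> f S \<in> A"
  by (auto simp: kchain_def)

lemma kchain_all: "f \<in> kchain V q A \<Longrightarrow> 0 \<in> A \<Longrightarrow> f S \<in> A"
  by (cases "S \<subseteq> V \<and> card S = q") (auto simp: kchain_def)

lemma kchainI:
  assumes "\<And>S. S \<subseteq> V \<Longrightarrow> card S = q \<Longrightarrow> f S \<in> A"
    and "\<And>S. \<not> (S \<subseteq> V \<and> card S = q) \<Longrightarrow> f S = 0"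
  shows "f \<in> kchain V q A"
  using assms by (simp add: kchain_def)

lemma kchain_mono: "f \<in> kchain V q A \<Longrightarrow> A \<subseteq> B \<Longrightarrow> f \<in> kchain V q B"
  by (rule kchainI) (auto dest: kchain_in kchain_outside)

text \<open>A module over the polynomial ring is recorded by its scalar action \<open>s\<close> and
  the commuting linear operators \<open>X v\<close> of the variables. The numbering
  \<open>ix\<close> of the finite vertex set fixes all signs.\<close>

locale koszul = vector_space s
  for s :: "'k::field \<Rightarrow> 'a::ab_group_add \<Rightarrow> 'a" +
  fixes X :: "'v \<Rightarrow> 'a \<Rightarrow> 'a" and V :: "'v set" and ix :: "'v \<Rightarrow> nat"
  assumes finV: "finite V" and ix: "inj_on ix V"
    and X_add: "X v (x + y) = X v x + X v y"
    and X_scale: "X v (s c x) = s c (X v x)"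
    and X_commute: "X u (X v x) = X v (X u x)"
begin

abbreviation d where "d \<equiv> kdiff s X V ix"

definition graded :: "(nat \<Rightarrow> 'a set) \<Rightarrow> bool" where
  "graded A \<longleftrightarrow> (\<forall>k. subspace (A k)) \<and> (\<forall>k. \<forall>v\<in>V. \<forall>x\<in>A k. X v x \<in> A (Suc k))"

lemma graded_subspace: "graded A \<Longrightarrow> subspace (A k)"
  by (simp add: graded_def)

lemma X_0 [simp]: "X v 0 = 0"
  using X_scale[of v 0 0] by simp

lemma X_minus: "X v (x - y) = X v x - X v y"
  using X_add[of v "x - y" y] by (simp add: algebra_simps)

lemma X_sum: "X v (\<Sum>i\<in>I. f i) = (\<Sum>i\<in>I. X v (f i))"
  by (induction I rule: infinite_finite_induct) (auto simp: X_add)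

lemma d_add: "d (f + g) = d f + d g"
  by (rule ext) (simp add: kdiff_def X_add scale_right_distrib sum.distrib)

lemma d_minus: "d (f - g) = d f - d g"
  by (rule ext) (simp add: kdiff_def X_minus scale_right_diff_distrib sum_subtractf)

lemma d_scale: "d (\<lambda>S. s c (f S)) = (\<lambda>S. s c (d f S))"
  by (rule ext) (simp add: kdiff_def X_scale scale_sum_right mult.commute)

lemma d_zero: "d 0 = 0"
  by (rule ext) (simp add: kdiff_def)

lemma d_chain:
  assumes "graded A" "f \<in> kchain V (Suc q) (A k)"
  shows "d f \<in> kchain V q (A (Suc k))"
proof -
  have sub: "subspace (A k)" for k using assms(1) by (rule graded_subspace)
  have "d f S \<in> A (Suc k)" for S
    unfolding kdiff_def using assms sub[of k]
    by (auto intro!: subspace_sum[OF sub] subspace_scale[OF sub] subspace_0[OF sub]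
        kchain_all[OF assms(2)] simp: graded_def)
  moreover have "d f S = 0" if "S \<subseteq> V" "card S \<noteq> q" for S
  proof -
    have "f (insert v S) = 0" if "v \<in> V - S" for v
      using that \<open>S \<subseteq> V\<close> \<open>card S \<noteq> q\<close> finite_subset[OF _ finV]
      by (intro kchain_outside[OF assms(2)]) auto
    then show ?thesis by (simp add: kdiff_def)
  qed
  moreover have "d f S = 0" if "\<not> S \<subseteq> V" for S using that by (simp add: kdiff_def)
  ultimately show ?thesis by (auto simp: kchain_def)
qed

text \<open>The double sum runs over ordered pairs of distinct vertices outside T. Pairs in
  increasing and in decreasing order cancel: the operators commute and \<open>ksgn_swap\<close>
  reverses the sign.\<close>

lemma d_d: "d (d f) = 0"
proof
  fix T
  show "d (d f) T = 0 T"
  proof (cases "T \<subseteq> V")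
    case False
    then show ?thesis by (simp add: kdiff_def)
  next
    case True
    have finT: "finite T" using True finV finite_subset by blast
    define h where "h = (\<lambda>v u. s (ksgn ix v T * ksgn ix u (insert v T)) (X v (X u (f (insert u (insert v T))))))"
    define L where "L = {(v, u). v \<in> V - T \<and> u \<in> V - T \<and> ix v < ix u}"
    define G where "G = {(v, u). v \<in> V - T \<and> u \<in> V - T \<and> ix u < ix v}"
    have fin: "finite L" "finite G"
      using finite_subset[of L "V \<times> V"] finite_subset[of G "V \<times> V"] finV by (auto simp: L_def G_def)
    have LG: "(SIGMA v : V - T. V - insert v T) = L \<union> G" "L \<inter> G = {}"
      using inj_onD[OF ix] by (auto simp: L_def G_def) (metis nat_neq_iff)
    have "d (d f) T = (\<Sum>v\<in>V - T. \<Sum>u\<in>V - insert v T. h v u)"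
      using True by (simp add: kdiff_def h_def X_sum X_scale scale_sum_right)
    also have "\<dots> = (\<Sum>(v,u)\<in>L \<union> G. h v u)"
      using finV by (simp add: sum.Sigma LG)
    also have "\<dots> = (\<Sum>(v,u)\<in>L. h v u) + (\<Sum>(v,u)\<in>G. h v u)"
      using fin LG by (intro sum.union_disjoint) auto
    also have "(\<Sum>(v,u)\<in>G. h v u) = (\<Sum>(v,u)\<in>L. h u v)"
      by (rule sum.reindex_bij_witness[of _ prod.swap prod.swap]) (auto simp: L_def G_def)
    also have "\<dots> = (\<Sum>(v,u)\<in>L. - h v u)"
    proof (rule sum.cong, simp, clarify)
      fix v u assume vu: "(v, u) \<in> L"
      have "ksgn ix u T * ksgn ix v (insert u T) = - (ksgn ix v T * ksgn ix u (insert v T) :: 'k)"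
        using vu by (intro ksgn_swap[OF finT]) (auto simp: L_def)
      then have "h u v = s (- (ksgn ix v T * ksgn ix u (insert v T))) (X v (X u (f (insert u (insert v T)))))"
        by (simp add: h_def insert_commute X_commute[of u v])
      then show "h u v = - h v u" by (simp add: h_def)
    qed
    also have "(\<Sum>(v,u)\<in>L. h v u) + (\<Sum>(v,u)\<in>L. - h v u) = 0"
      by (simp add: case_prod_unfold sum_negf)
    finally show ?thesis by simp
  qed
qed

lemma kchain_add: "subspace A \<Longrightarrow> f \<in> kchain V q A \<Longrightarrow> g \<in> kchain V q A \<Longrightarrow> f + g \<in> kchain V q A"
  by (auto simp: kchain_def subspace_add)

lemma kchain_minus: "subspace A \<Longrightarrow> f \<in> kchain V q A \<Longrightarrow> g \<in> kchain V q A \<Longrightarrow> f - g \<in> kchain V q A"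
  by (auto simp: kchain_def subspace_diff)

lemma kchain_scale: "subspace A \<Longrightarrow> f \<in> kchain V q A \<Longrightarrow> (\<lambda>S. s c (f S)) \<in> kchain V q A"
  by (auto simp: kchain_def subspace_scale)

lemma kchain_zero: "subspace A \<Longrightarrow> 0 \<in> kchain V q A"
  by (auto simp: kchain_def subspace_0)

lemma kcyc_add:
  "graded A \<Longrightarrow> graded B \<Longrightarrow> f \<in> kcyc s X V ix A B q k \<Longrightarrow> g \<in> kcyc s X V ix A B q k \<Longrightarrow>
    f + g \<in> kcyc s X V ix A B q k"
  using graded_subspace[of A] graded_subspace[of B]
  by (auto simp: kcyc_def d_add kchain_add subspace_add)

lemma kcyc_scale:
  "graded A \<Longrightarrow> graded B \<Longrightarrow> f \<in> kcyc s X V ix A B q k \<Longrightarrow> (\<lambda>S. s c (f S)) \<in> kcyc s X V ix A B q k"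
  using graded_subspace[of A] graded_subspace[of B]
  by (auto simp: kcyc_def d_scale kchain_scale subspace_scale)

lemma kcyc_zero: "graded A \<Longrightarrow> graded B \<Longrightarrow> 0 \<in> kcyc s X V ix A B q k"
  using graded_subspace[of A] graded_subspace[of B]
  by (auto simp: kcyc_def d_zero kchain_zero subspace_0)

lemma kbnd_add:
  assumes "graded A" "graded B" "f \<in> kbnd s X V ix A B q k" "g \<in> kbnd s X V ix A B q k"
  shows "f + g \<in> kbnd s X V ix A B q k"
proof -
  obtain f1 f2 where f: "f = f1 + d f2" "f1 \<in> kchain V q (B (Suc k))" "f2 \<in> kchain V (Suc q) (A k)"
    using assms(3) by (auto simp: kbnd_def)
  obtain g1 g2 where g: "g = g1 + d g2" "g1 \<in> kchain V q (B (Suc k))" "g2 \<in> kchain V (Suc q) (A k)"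
    using assms(4) by (auto simp: kbnd_def)
  have "f + g = (f1 + g1) + d (f2 + g2)" by (simp add: f g d_add algebra_simps)
  moreover have "f1 + g1 \<in> kchain V q (B (Suc k))" "f2 + g2 \<in> kchain V (Suc q) (A k)"
    using f g graded_subspace assms(1,2) by (auto intro: kchain_add)
  ultimately show ?thesis unfolding kbnd_def by blast
qed

lemma kbnd_scale:
  assumes "graded A" "graded B" "f \<in> kbnd s X V ix A B q k"
  shows "(\<lambda>S. s c (f S)) \<in> kbnd s X V ix A B q k"
proof -
  obtain f1 f2 where f: "f = f1 + d f2" "f1 \<in> kchain V q (B (Suc k))" "f2 \<in> kchain V (Suc q) (A k)"
    using assms(3) by (auto simp: kbnd_def)
  have "(\<lambda>S. s c (f S)) = (\<lambda>S. s c (f1 S)) + d (\<lambda>S. s c (f2 S))"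
    by (rule ext) (simp add: f d_scale scale_right_distrib)
  moreover have "(\<lambda>S. s c (f1 S)) \<in> kchain V q (B (Suc k))" "(\<lambda>S. s c (f2 S)) \<in> kchain V (Suc q) (A k)"
    using f graded_subspace assms(1,2) by (auto intro: kchain_scale)
  ultimately show ?thesis unfolding kbnd_def by blast
qed

lemma kbnd_zero:
  assumes "graded A" "graded B"
  shows "0 \<in> kbnd s X V ix A B q k"
proof -
  have "(0 :: 'v set \<Rightarrow> 'a) = 0 + d 0" by (simp add: d_zero)
  then show ?thesis
    using kchain_zero[OF graded_subspace] assms unfolding kbnd_def by blast
qed

lemma kbnd_subspace:
  assumes "graded A" "graded B"
  shows "module.subspace (\<lambda>c f S. s c (f S)) (kbnd s X V ix A B q k)"
proof -
  interpret F: vector_space "\<lambda>c f S. s c (f S) :: 'a" by (rule vector_space_fun) unfold_locales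
  show ?thesis
    unfolding F.subspace_def using kbnd_zero kbnd_add kbnd_scale assms by blast
qed

end

text \<open>The connecting isomorphism for \<open>0 \<rightarrow> M \<rightarrow> F \<rightarrow> A/B \<rightarrow> 0\<close>, with \<open>F\<close> acyclic in the relevant
  degree: a cycle of \<open>A/B\<close> corresponds to the differential of a lift to \<open>F\<close>.\<close>

lemma koszul_dimension_shift:
  fixes s1 :: "'k::field \<Rightarrow> 'f::ab_group_add \<Rightarrow> 'f" and s2 :: "'k \<Rightarrow> 'a::ab_group_add \<Rightarrow> 'a"
    and F M :: "nat \<Rightarrow> 'f set" and A B :: "nat \<Rightarrow> 'a set" and \<psi> :: "'f \<Rightarrow> 'a"
  assumes k1: "koszul s1 X1 V ix" and k2: "koszul s2 X2 V ix"
    and F: "koszul.graded s1 X1 V F" and M: "koszul.graded s1 X1 V M"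
    and A: "koszul.graded s2 X2 V A" and B: "koszul.graded s2 X2 V B"
    and BA: "\<And>k. B k \<subseteq> A k"
    and \<psi>: "\<And>k x. x \<in> F k \<Longrightarrow> \<psi> x \<in> A k"
    and \<psi>_add: "\<And>k x y. x \<in> F k \<Longrightarrow> y \<in> F k \<Longrightarrow> \<psi> (x + y) = \<psi> x + \<psi> y"
    and \<psi>_scale: "\<And>k c x. x \<in> F k \<Longrightarrow> \<psi> (s1 c x) = s2 c (\<psi> x)"
    and \<psi>_X: "\<And>k v x. v \<in> V \<Longrightarrow> x \<in> F k \<Longrightarrow> \<psi> (X1 v x) = X2 v (\<psi> x)"
    and onto: "\<And>k a. a \<in> A k \<Longrightarrow> \<exists>x\<in>F k. \<psi> x - a \<in> B k"
    and M_def: "\<And>k. M k = {x \<in> F k. \<psi> x \<in> B k}"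
    and lift: "\<And>y. y \<in> kchain V q (M (Suc (Suc k))) \<Longrightarrow> kdiff s1 X1 V ix y = 0 \<Longrightarrow>
      \<exists>f\<in>kchain V (Suc q) (F (Suc k)). kdiff s1 X1 V ix f = y"
    and acyclic: "\<And>f. f \<in> kchain V (Suc q) (F (Suc k)) \<Longrightarrow> kdiff s1 X1 V ix f = 0 \<Longrightarrow>
      \<exists>g\<in>kchain V (Suc (Suc q)) (F k). kdiff s1 X1 V ix g = f"
    and qb: "quot_basis (\<lambda>c f S. s1 c (f S)) (kcyc s1 X1 V ix M (\<lambda>_. {0}) q (Suc k))
      (kbnd s1 X1 V ix M (\<lambda>_. {0}) q (Suc k)) J b"
  shows "\<exists>b'. quot_basis (\<lambda>c f S. s2 c (f S)) (kcyc s2 X2 V ix A B (Suc q) k)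
      (kbnd s2 X2 V ix A B (Suc q) k) J b'"
proof -
  interpret k1: koszul s1 X1 V ix by (rule k1)
  interpret k2: koszul s2 X2 V ix by (rule k2)
  have sF: "k1.subspace (F k)" and sM: "k1.subspace (M k)" for k
    using F M by (auto simp: k1.graded_def)
  have sA: "k2.subspace (A k)" and sB: "k2.subspace (B k)" for k
    using A B by (auto simp: k2.graded_def)
  have Z: "k1.graded (\<lambda>_. {0})" by (auto simp: k1.graded_def k1.subspace_def)
  have \<psi>0 [simp]: "\<psi> 0 = 0" using \<psi>_scale[of 0 0 0] k1.subspace_0[OF sF] by simp
  have \<psi>_minus: "\<psi> (x - y) = \<psi> x - \<psi> y" if "x \<in> F k" "y \<in> F k" for k x y
    using \<psi>_add[of "x - y" k y] that k1.subspace_diff[OF sF that] by (simp add: algebra_simps)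
  have \<psi>_sum: "\<psi> (\<Sum>i\<in>I. f i) = (\<Sum>i\<in>I. \<psi> (f i))" if "\<And>i. i \<in> I \<Longrightarrow> f i \<in> F k" for I k and f :: "'v \<Rightarrow> 'f"
    using that by (induction I rule: infinite_finite_induct) (auto simp: \<psi>_add[of _ k] k1.subspace_sum[OF sF])
  have \<psi>_d: "\<psi> (k1.d f T) = k2.d (\<lambda>S. \<psi> (f S)) T" if f: "f \<in> kchain V p (F j)" for f p j T
  proof -
    have fS: "f S \<in> F j" for S using kchain_all[OF f k1.subspace_0[OF sF]] .
    have Xf: "X1 v (f S) \<in> F (Suc j)" if "v \<in> V" for v S using F fS that by (auto simp: k1.graded_def)
    show ?thesis
    proof (cases "T \<subseteq> V")
      case True
      have "\<psi> (\<Sum>v\<in>V - T. s1 (ksgn ix v T) (X1 v (f (insert v T)))) =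
          (\<Sum>v\<in>V - T. \<psi> (s1 (ksgn ix v T) (X1 v (f (insert v T)))))"
        by (rule \<psi>_sum, rule k1.subspace_scale[OF sF], rule Xf) simp
      also have "\<dots> = (\<Sum>v\<in>V - T. s2 (ksgn ix v T) (X2 v (\<psi> (f (insert v T)))))"
        by (rule sum.cong) (auto simp: \<psi>_scale[OF Xf] \<psi>_X[OF _ fS])
      finally show ?thesis using True by (simp add: kdiff_def)
    qed (simp add: kdiff_def)
  qed
  have \<psi>_chain: "(\<lambda>S. \<psi> (f S)) \<in> kchain V p (A j)" if f: "f \<in> kchain V p (F j)" for f p j
    using kchain_in[OF f] kchain_outside[OF f] \<psi> by (intro kchainI) auto
  \<comment> \<open>Surjectivity onto A/B is used coefficient by coefficient; the value 0 off the
    admissible sets keeps the lift a chain.\<close>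
  have lift_chain: "\<exists>h\<in>kchain V p (F j). (\<lambda>S. \<psi> (h S) - a S) \<in> kchain V p (B j)" if a: "a \<in> kchain V p (A j)" for a p j
  proof -
    define h where "h = (\<lambda>S. if S \<subseteq> V \<and> card S = p then SOME x. x \<in> F j \<and> \<psi> x - a S \<in> B j else 0)"
    have "h S \<in> F j \<and> \<psi> (h S) - a S \<in> B j" if "S \<subseteq> V" "card S = p" for S
    proof -
      have "\<exists>x. x \<in> F j \<and> \<psi> x - a S \<in> B j" using onto kchain_in[OF a that] by blast
      from someI_ex[OF this] show ?thesis using that by (simp add: h_def)
    qed
    moreover have "h S = 0" "a S = 0" if "\<not> (S \<subseteq> V \<and> card S = p)" for S
      using that kchain_outside[OF a] by (auto simp: h_def)
    ultimately show ?thesis by (intro bexI[of _ h]) (auto simp: kchain_def)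
  qed
  have MF: "f \<in> kchain V p (F j)" if "f \<in> kchain V p (M j)" for f p j
    using that by (rule kchain_mono) (auto simp: M_def)
  have BA_chain: "f \<in> kchain V p (A j)" if "f \<in> kchain V p (B j)" for f p j
    using that BA by (rule kchain_mono)
  define cycM where "cycM = kcyc s1 X1 V ix M (\<lambda>_. {0}) q (Suc k)"
  define cycA where "cycA = kcyc s2 X2 V ix A B (Suc q) k"
  \<comment> \<open>The connecting map as a relation: \<open>z\<close> is a cycle of A/B,
    \<open>f\<close> a chain over F lifting it modulo B, and the partner of \<open>z\<close> is the
    differential of \<open>f\<close>.\<close>
  define \<rho> where "\<rho> = {(k1.d f, z) | f z. f \<in> kchain V (Suc q) (F (Suc k)) \<and> k1.d f \<in> cycM \<and>
     z \<in> cycA \<and> (\<lambda>S. \<psi> (f S) - z S) \<in> kchain V (Suc q) (B (Suc k))}"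
  have \<rho>I: "(k1.d f, z) \<in> \<rho>" if "f \<in> kchain V (Suc q) (F (Suc k))" "k1.d f \<in> cycM" "z \<in> cycA"
    "(\<lambda>S. \<psi> (f S) - z S) \<in> kchain V (Suc q) (B (Suc k))" for f z
    using that unfolding \<rho>_def by blast
  have v1: "vector_space (\<lambda>c f S. s1 c (f S) :: 'f)" by (rule vector_space_fun) unfold_locales
  have v2: "vector_space (\<lambda>c f S. s2 c (f S) :: 'a)" by (rule vector_space_fun) unfold_locales
  \<comment> \<open>Up to the error \<open>\<psi> f - z\<close>, whose differential lies in B, the
    image of \<open>d f\<close> is the differential of the cycle \<open>z\<close>. Hence it lies in
    B, and \<open>d f\<close> takes values in M.\<close>
  have cyc_d: "k1.d f \<in> cycM"
    if f: "f \<in> kchain V (Suc q) (F (Suc k))" and z: "z \<in> cycA"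
      and fz: "(\<lambda>S. \<psi> (f S) - z S) \<in> kchain V (Suc q) (B (Suc k))" for f z
  proof -
    have "\<psi> (k1.d f T) \<in> B (Suc (Suc k))" for T
    proof -
      have "k2.d (\<lambda>S. \<psi> (f S)) = k2.d (\<lambda>S. \<psi> (f S) - z S) + k2.d z"
        by (subst k2.d_add[symmetric]) (rule arg_cong[where f = k2.d], auto)
      moreover have "k2.d (\<lambda>S. \<psi> (f S) - z S) T \<in> B (Suc (Suc k))"
        using k2.d_chain[OF B fz] kchain_all k2.subspace_0[OF sB] by blast
      moreover have "k2.d z T \<in> B (Suc (Suc k))" using z by (auto simp: cycA_def kcyc_def)
      ultimately show ?thesis by (simp add: \<psi>_d[OF f] k2.subspace_add[OF sB])
    qed
    then have "k1.d f \<in> kchain V q (M (Suc (Suc k)))"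
      using kchain_in[OF k1.d_chain[OF F f]] kchain_outside[OF k1.d_chain[OF F f]]
      by (intro kchainI) (auto simp: M_def)
    then show ?thesis by (simp add: cycM_def kcyc_def k1.d_d)
  qed
  have d_lift: "\<exists>f\<in>kchain V (Suc q) (F (Suc k)). k1.d f = y" if "y \<in> cycM" for y
    using that lift[of y] by (auto simp: cycM_def kcyc_def fun_eq_iff)
  have A_cyc: "(\<lambda>S. \<psi> (f S)) \<in> cycA" if f: "f \<in> kchain V (Suc q) (F (Suc k))" "k1.d f \<in> cycM" for f
  proof -
    have "k1.d f \<in> kchain V q (M (Suc (Suc k)))" using f(2) by (simp add: cycM_def kcyc_def)
    then have "k1.d f T \<in> M (Suc (Suc k))" for T by (rule kchain_all) (rule k1.subspace_0[OF sM])
    then show ?thesis using \<psi>_chain[OF f(1)] \<psi>_d[OF f(1)] by (auto simp: cycA_def kcyc_def M_def)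
  qed
  have B0: "(\<lambda>S. 0) \<in> kchain V p (B j)" for p j using k2.subspace_0[OF sB] by (auto simp: kchain_def)
  show ?thesis
  proof (rule quot_basis_transfer[OF v1 v2 qb, where \<rho> = \<rho>], unfold cycM_def[symmetric] cycA_def[symmetric])
    show "\<rho> \<subseteq> cycM \<times> cycA" unfolding \<rho>_def by blast
  next
    fix u u' v v' assume uv: "(u, u') \<in> \<rho>" "(v, v') \<in> \<rho>"
    obtain f where f: "u = k1.d f" "f \<in> kchain V (Suc q) (F (Suc k))" "k1.d f \<in> cycM" "u' \<in> cycA"
      "(\<lambda>S. \<psi> (f S) - u' S) \<in> kchain V (Suc q) (B (Suc k))" using uv(1) by (auto simp: \<rho>_def)
    obtain g where g: "v = k1.d g" "g \<in> kchain V (Suc q) (F (Suc k))" "k1.d g \<in> cycM" "v' \<in> cycA"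
      "(\<lambda>S. \<psi> (g S) - v' S) \<in> kchain V (Suc q) (B (Suc k))" using uv(2) by (auto simp: \<rho>_def)
    have fg: "f + g \<in> kchain V (Suc q) (F (Suc k))" by (rule k1.kchain_add[OF sF f(2) g(2)])
    have c: "u' + v' \<in> cycA" using f g k2.kcyc_add[OF A B] by (auto simp: cycA_def)
    have "f S \<in> F (Suc k)" "g S \<in> F (Suc k)" for S
      using f g kchain_all k1.subspace_0[OF sF] by blast+
    then have "(\<lambda>S. \<psi> ((f + g) S) - (u' + v') S) = (\<lambda>S. \<psi> (f S) - u' S) + (\<lambda>S. \<psi> (g S) - v' S)"
      by (auto simp: \<psi>_add[of _ "Suc k"])
    then have "(\<lambda>S. \<psi> ((f + g) S) - (u' + v') S) \<in> kchain V (Suc q) (B (Suc k))"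
      using k2.kchain_add[OF sB f(5) g(5)] by simp
    from \<rho>I[OF fg cyc_d[OF fg c this] c this] show "(u + v, u' + v') \<in> \<rho>"
      by (simp only: f(1) g(1) k1.d_add)
  next
    fix c u u' assume uv: "(u, u') \<in> \<rho>"
    obtain f where f: "u = k1.d f" "f \<in> kchain V (Suc q) (F (Suc k))" "k1.d f \<in> cycM" "u' \<in> cycA"
      "(\<lambda>S. \<psi> (f S) - u' S) \<in> kchain V (Suc q) (B (Suc k))" using uv(1) by (auto simp: \<rho>_def)
    have fg: "(\<lambda>S. s1 c (f S)) \<in> kchain V (Suc q) (F (Suc k))" by (rule k1.kchain_scale[OF sF f(2)])
    have c: "(\<lambda>S. s2 c (u' S)) \<in> cycA" using f k2.kcyc_scale[OF A B] by (auto simp: cycA_def)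
    have "f S \<in> F (Suc k)" for S
      using f kchain_all k1.subspace_0[OF sF] by blast+
    then have "(\<lambda>S. \<psi> (s1 c (f S)) - s2 c (u' S)) = (\<lambda>S. s2 c (\<psi> (f S) - u' S))"
      by (auto simp: \<psi>_scale[of _ "Suc k"] k2.scale_right_diff_distrib)
    then have "(\<lambda>S. \<psi> (s1 c (f S)) - s2 c (u' S)) \<in> kchain V (Suc q) (B (Suc k))"
      using k2.kchain_scale[OF sB f(5), of c] by simp
    from \<rho>I[OF fg cyc_d[OF fg c this] c this] show "(\<lambda>S. s1 c (u S), \<lambda>S. s2 c (u' S)) \<in> \<rho>"
      by (simp only: f(1) k1.d_scale)
  next
    fix u assume u: "u \<in> cycM"
    obtain f where f: "f \<in> kchain V (Suc q) (F (Suc k))" "k1.d f = u" using d_lift[OF u] by blast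
    show "\<exists>u'. (u, u') \<in> \<rho>"
      using \<rho>I[OF f(1) _ A_cyc[OF f(1)]] u f(2) B0 by auto
  next
    fix z assume z: "z \<in> cycA"
    then have "z \<in> kchain V (Suc q) (A (Suc k))" by (auto simp: cycA_def kcyc_def)
    from lift_chain[OF this] obtain f where f: "f \<in> kchain V (Suc q) (F (Suc k))"
      "(\<lambda>S. \<psi> (f S) - z S) \<in> kchain V (Suc q) (B (Suc k))" by blast
    have "(k1.d f, z) \<in> \<rho>" by (rule \<rho>I[OF f(1) cyc_d[OF f(1) z f(2)] z f(2)])
    moreover have "z - z \<in> kbnd s2 X2 V ix A B (Suc q) k" using k2.kbnd_zero[OF A B] by simp
    ultimately show "\<exists>u w. (u, w) \<in> \<rho> \<and> z - w \<in> kbnd s2 X2 V ix A B (Suc q) k" by blast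
  next
    fix u z assume "(u, z) \<in> \<rho>"
    then obtain f where f: "u = k1.d f" "f \<in> kchain V (Suc q) (F (Suc k))" "k1.d f \<in> cycM" "z \<in> cycA"
      "(\<lambda>S. \<psi> (f S) - z S) \<in> kchain V (Suc q) (B (Suc k))" by (auto simp: \<rho>_def)
    show "u \<in> kbnd s1 X1 V ix M (\<lambda>_. {0}) q (Suc k) \<longleftrightarrow> z \<in> kbnd s2 X2 V ix A B (Suc q) k"
    proof
      \<comment> \<open>If \<open>u\<close> bounds a chain \<open>g\<close> over M, then
        \<open>f - g\<close> is a cycle over F, hence equal to \<open>d h\<close>. Applying
        \<open>\<psi>\<close> writes \<open>z\<close> as a B-valued chain plus the differential of
        \<open>\<psi> h\<close>.\<close>
      assume "u \<in> kbnd s1 X1 V ix M (\<lambda>_. {0}) q (Suc k)"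
      then obtain f0 g where g: "u = f0 + k1.d g" "f0 \<in> kchain V q {0}" "g \<in> kchain V (Suc q) (M (Suc k))"
        unfolding kbnd_def by blast
      have "f0 S = 0" for S using kchain_all[OF g(2), of S] by simp
      then have "f0 = 0" by (simp add: fun_eq_iff)
      then have "k1.d (f - g) = 0" using f(1) g(1) by (simp add: k1.d_minus)
      moreover have "f - g \<in> kchain V (Suc q) (F (Suc k))"
        by (rule k1.kchain_minus[OF sF f(2) MF[OF g(3)]])
      ultimately obtain h where h: "h \<in> kchain V (Suc (Suc q)) (F k)" "k1.d h = f - g"
        using acyclic by blast
      have "f S = g S + k1.d h S" for S using h(2) by simp
      moreover have "g S \<in> F (Suc k)" "k1.d h S \<in> F (Suc k)" for S
        using MF[OF g(3)] k1.d_chain[OF F h(1)] kchain_all k1.subspace_0[OF sF] by blast+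
      ultimately have "\<psi> (f S) = \<psi> (g S) + k2.d (\<lambda>S. \<psi> (h S)) S" for S
        by (simp add: \<psi>_add[of _ "Suc k"] \<psi>_d[OF h(1)])
      then have "z = ((\<lambda>S. \<psi> (g S)) - (\<lambda>S. \<psi> (f S) - z S)) + k2.d (\<lambda>S. \<psi> (h S))"
        by (auto simp: fun_eq_iff)
      moreover have "(\<lambda>S. \<psi> (g S)) \<in> kchain V (Suc q) (B (Suc k))"
        using kchain_in[OF g(3)] kchain_outside[OF g(3)] by (intro kchainI) (auto simp: M_def)
      from k2.kchain_minus[OF sB this f(5)]
      have "(\<lambda>S. \<psi> (g S)) - (\<lambda>S. \<psi> (f S) - z S) \<in> kchain V (Suc q) (B (Suc k))" .
      ultimately show "z \<in> kbnd s2 X2 V ix A B (Suc q) k"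
        using \<psi>_chain[OF h(1)] unfolding kbnd_def by blast
    next
      assume "z \<in> kbnd s2 X2 V ix A B (Suc q) k"
      then obtain e a where a: "z = e + k2.d a" "e \<in> kchain V (Suc q) (B (Suc k))" "a \<in> kchain V (Suc (Suc q)) (A k)"
        unfolding kbnd_def by blast
      \<comment> \<open>Conversely, a chain bounded by \<open>z\<close> is lifted to
        \<open>h\<close>. Subtracting \<open>d h\<close> from \<open>f\<close> leaves the
        differential \<open>u\<close> unchanged and moves the chain into M.\<close>
      obtain h where h: "h \<in> kchain V (Suc (Suc q)) (F k)" "(\<lambda>S. \<psi> (h S) - a S) \<in> kchain V (Suc (Suc q)) (B k)"
        using lift_chain[OF a(3)] by blast
      have dh: "k1.d h \<in> kchain V (Suc q) (F (Suc k))" by (rule k1.d_chain[OF F h(1)])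
      have fS: "f S \<in> F (Suc k)" "k1.d h S \<in> F (Suc k)" for S
        using f(2) dh kchain_all k1.subspace_0[OF sF] by blast+
      have "(\<lambda>S. \<psi> ((f - k1.d h) S)) = (\<lambda>S. \<psi> (f S) - z S) + (e - k2.d (\<lambda>S. \<psi> (h S) - a S))"
      proof -
        have "k2.d (\<lambda>S. \<psi> (h S) - a S) = k2.d (\<lambda>S. \<psi> (h S)) - k2.d a"
          by (subst k2.d_minus[symmetric]) (rule arg_cong[where f = k2.d], auto)
        then show ?thesis by (auto simp: a(1) \<psi>_minus[OF fS] \<psi>_d[OF h(1)])
      qed
      also have "\<dots> \<in> kchain V (Suc q) (B (Suc k))"
        by (intro k2.kchain_add[OF sB] k2.kchain_minus[OF sB] f(5) a(2) k2.d_chain[OF B h(2)])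
      finally have "f - k1.d h \<in> kchain V (Suc q) (M (Suc k))"
        using k1.kchain_minus[OF sF f(2) dh]
        by (intro kchainI) (auto simp: M_def dest: kchain_in kchain_outside)
      moreover have "u = 0 + k1.d (f - k1.d h)" by (simp add: f(1) k1.d_minus k1.d_d)
      moreover have "0 \<in> kchain V q {0 :: 'f}" by (auto simp: kchain_def)
      ultimately show "u \<in> kbnd s1 X1 V ix M (\<lambda>_. {0}) q (Suc k)" unfolding kbnd_def by blast
    qed
  next
    have "(k1.d 0, 0) \<in> \<rho>"
    proof (rule \<rho>I)
      show "0 \<in> kchain V (Suc q) (F (Suc k))" by (rule k1.kchain_zero[OF sF])
      show "k1.d 0 \<in> cycM" unfolding cycM_def k1.d_zero by (rule k1.kcyc_zero[OF M Z])
      show "0 \<in> cycA" unfolding cycA_def by (rule k2.kcyc_zero[OF A B])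
      show "(\<lambda>S. \<psi> (0 S) - 0 S) \<in> kchain V (Suc q) (B (Suc k))" using B0 by simp
    qed
    then show "(0, 0) \<in> \<rho>" by (simp add: k1.d_zero)
  next
    show "x + y \<in> kbnd s2 X2 V ix A B (Suc q) k"
      if "x \<in> kbnd s2 X2 V ix A B (Suc q) k" "y \<in> kbnd s2 X2 V ix A B (Suc q) k" for x y
      by (rule k2.kbnd_add[OF A B that])
  qed
qed

section \<open>Polynomials and free modules\<close>

abbreviation coeff :: "('v, 'k::field) mpoly \<Rightarrow> ('v \<Rightarrow>\<^sub>0 nat) \<Rightarrow> 'k" where
  "coeff \<equiv> Poly_Mapping.lookup"

abbreviation mono1 :: "'v \<Rightarrow> 'v \<Rightarrow>\<^sub>0 nat" where
  "mono1 v \<equiv> Poly_Mapping.single v (Suc 0)"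

lemma coeff_single_times:
  fixes a k :: "'v \<Rightarrow>\<^sub>0 nat" and p :: "('v, 'k::field) mpoly"
  shows "coeff (Poly_Mapping.single a c * p) k = (if \<exists>m. k = a + m then c * coeff p (k - a) else 0)"
proof -
  have "coeff (Poly_Mapping.single a c * p) k = c * (\<Sum>q. coeff p q when k = a + q)"
    by (simp add: lookup_mult lookup_single when_mult)
  also have "\<dots> = (if \<exists>m. k = a + m then c * coeff p (k - a) else 0)"
  proof (cases "\<exists>m. k = a + m")
    case True
    then obtain m where m: "k = a + m" by blast
    have "(\<Sum>q. coeff p q when k = a + q) = (\<Sum>q. coeff p q when q = m)"
      by (rule Sum_any.cong) (auto simp: m when_def)
    then show ?thesis using m by simp
  next
    case False
    then show ?thesis by simp
  qed
  finally show ?thesis .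
qed

lemma coeff_const_times [simp]: "coeff (Poly_Mapping.single 0 c * p) m = c * coeff p m"
  by (simp add: coeff_single_times)

lemma mono1_split:
  assumes "Poly_Mapping.lookup m v \<noteq> 0"
  shows "m = mono1 v + (m - mono1 v)"
  by (rule poly_mapping_eqI) (use assms in \<open>auto simp: lookup_add lookup_minus lookup_single when_def\<close>)

lemma coeff_var_times:
  "coeff (var v * p) m = (if Poly_Mapping.lookup m v \<noteq> 0 then coeff p (m - mono1 v) else 0)"
proof -
  have "(\<exists>m'. m = mono1 v + m') \<longleftrightarrow> Poly_Mapping.lookup m v \<noteq> 0"
    using mono1_split[of m v] by (auto simp: lookup_add)
  then show ?thesis by (simp add: var_def coeff_single_times)
qed

lemma mdeg_superset:
  assumes "finite A" "Poly_Mapping.keys m \<subseteq> A"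
  shows "mdeg m = (\<Sum>v\<in>A. Poly_Mapping.lookup m v)"
  unfolding mdeg_def by (rule sum.mono_neutral_left) (use assms in \<open>auto simp: in_keys_iff\<close>)

lemma mdeg_add: "mdeg (m + n) = mdeg m + mdeg n"
proof -
  let ?A = "Poly_Mapping.keys m \<union> Poly_Mapping.keys n"
  have "Poly_Mapping.keys (m + n) \<subseteq> ?A" by (rule Poly_Mapping.keys_add)
  then show ?thesis
    using mdeg_superset[of ?A "m + n"] mdeg_superset[of ?A m] mdeg_superset[of ?A n]
    by (simp add: lookup_add sum.distrib)
qed

lemma mdeg_zero [simp]: "mdeg 0 = 0"
  by (simp add: mdeg_def)

lemma mdeg_mono1 [simp]: "mdeg (mono1 v) = 1"
  by (simp add: mdeg_def)

lemma mdeg_eq_0: "mdeg m = 0 \<longleftrightarrow> m = 0"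
  by (auto simp: mdeg_def in_keys_iff intro!: poly_mapping_eqI)

lemma poly_ringI: "(\<And>m. coeff p m \<noteq> 0 \<Longrightarrow> Poly_Mapping.keys m \<subseteq> V) \<Longrightarrow> p \<in> poly_ring V"
  by (auto simp: poly_ring_def in_keys_iff)

lemma poly_ringD: "p \<in> poly_ring V \<Longrightarrow> coeff p m \<noteq> 0 \<Longrightarrow> Poly_Mapping.keys m \<subseteq> V"
  by (auto simp: poly_ring_def in_keys_iff)

lemma homogeneousI: "(\<And>m. coeff p m \<noteq> 0 \<Longrightarrow> mdeg m = d) \<Longrightarrow> homogeneous d p"
  by (auto simp: homogeneous_def in_keys_iff)

lemma homogeneousD: "homogeneous d p \<Longrightarrow> coeff p m \<noteq> 0 \<Longrightarrow> mdeg m = d"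
  by (auto simp: homogeneous_def in_keys_iff)

lemma poly_ring_zero [simp]: "0 \<in> poly_ring V"
  by (rule poly_ringI) auto

lemma poly_ring_add: "p \<in> poly_ring V \<Longrightarrow> q \<in> poly_ring V \<Longrightarrow> p + q \<in> poly_ring V"
  by (rule poly_ringI) (metis add.right_neutral lookup_add poly_ringD)

lemma poly_ring_mult:
  assumes "p \<in> poly_ring V" "q \<in> poly_ring V"
  shows "p * q \<in> poly_ring V"
  unfolding poly_ring_def
proof (intro CollectI ballI)
  fix m assume "m \<in> Poly_Mapping.keys (p * q)"
  then obtain a b where "m = a + b" "a \<in> Poly_Mapping.keys p" "b \<in> Poly_Mapping.keys q"
    using keys_mult[of p q] by blast
  then show "Poly_Mapping.keys m \<subseteq> V"
    using assms Poly_Mapping.keys_add[of a b] unfolding poly_ring_def by blast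
qed

lemma poly_ring_const [simp]: "Poly_Mapping.single 0 c \<in> poly_ring V"
  by (rule poly_ringI) (auto simp: lookup_single when_def split: if_splits)

lemma poly_ring_var: "v \<in> V \<Longrightarrow> var v \<in> poly_ring V"
  by (rule poly_ringI) (auto simp: var_def lookup_single when_def split: if_splits)

definition pscale :: "'k::field \<Rightarrow> ('v, 'k) mpoly \<Rightarrow> ('v, 'k) mpoly" where
  "pscale c p = Poly_Mapping.single 0 c * p"

definition vscale :: "'k::field \<Rightarrow> ('v, 'k) mvec \<Rightarrow> ('v, 'k) mvec" where
  "vscale c u = mvec_scale (Poly_Mapping.single 0 c) u"

definition poly_piece :: "'v set \<Rightarrow> nat \<Rightarrow> ('v, 'k::field) mpoly set" where
  "poly_piece V k = {p \<in> poly_ring V. homogeneous k p}"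

definition free_piece :: "'v set \<Rightarrow> nat set \<Rightarrow> (nat \<Rightarrow> nat) \<Rightarrow> nat \<Rightarrow> ('v, 'k::field) mvec set" where
  "free_piece V B \<delta> k = {u \<in> free_module V B. mvec_homogeneous \<delta> k u}"

lemma coeff_pscale [simp]: "coeff (pscale c p) m = c * coeff p m"
  by (simp add: pscale_def)

lemma lookup_mvec_scale [simp]: "Poly_Mapping.lookup (mvec_scale p u) e = p * Poly_Mapping.lookup u e"
  by (simp add: mvec_scale_def Poly_Mapping.map.rep_eq when_def)

lemma lookup_vscale: "Poly_Mapping.lookup (vscale c u) e = pscale c (Poly_Mapping.lookup u e)"
  by (simp add: vscale_def pscale_def)

lemma poly_mapping_eqI2:
  "(\<And>e m. coeff (Poly_Mapping.lookup u e) m = coeff (Poly_Mapping.lookup v e) m) \<Longrightarrow> u = v"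
  by (intro poly_mapping_eqI) auto

lemma vector_space_pscale: "vector_space (pscale :: 'k::field \<Rightarrow> ('v, 'k) mpoly \<Rightarrow> _)"
  by unfold_locales (auto intro!: poly_mapping_eqI simp: lookup_add distrib_left distrib_right)

lemma vector_space_vscale: "vector_space (vscale :: 'k::field \<Rightarrow> ('v, 'k) mvec \<Rightarrow> _)"
  by unfold_locales
    (auto intro!: poly_mapping_eqI2 simp: lookup_add lookup_vscale distrib_left distrib_right)

lemma mvec_scale_add: "mvec_scale p (u + v) = mvec_scale p u + mvec_scale p v"
  by (rule poly_mapping_eqI) (simp add: lookup_add distrib_left)

lemma mvec_scale_add_left: "mvec_scale (p + q) u = mvec_scale p u + mvec_scale q u"
  by (rule poly_mapping_eqI) (simp add: lookup_add distrib_right)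

lemma mvec_scale_assoc: "mvec_scale p (mvec_scale q u) = mvec_scale (p * q) u"
  by (rule poly_mapping_eqI) (simp add: mult.assoc)

lemma mvec_scale_zero_left [simp]: "mvec_scale 0 u = 0"
  by (rule poly_mapping_eqI) simp

lemma mvec_scale_zero_right [simp]: "mvec_scale p 0 = 0"
  by (rule poly_mapping_eqI) simp

lemma koszul_pscale:
  fixes V :: "'v set" and ix :: "'v \<Rightarrow> nat"
  assumes "finite V" "inj_on ix V"
  shows "koszul (pscale :: 'k::field \<Rightarrow> ('v, 'k) mpoly \<Rightarrow> _) (\<lambda>v p. var v * p) V ix"
proof -
  interpret vector_space "pscale :: 'k \<Rightarrow> ('v, 'k) mpoly \<Rightarrow> _" by (rule vector_space_pscale)
  show ?thesis
    by unfold_locales (use assms in \<open>auto simp: pscale_def distrib_left mult_ac\<close>)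
qed

lemma koszul_vscale:
  fixes V :: "'v set" and ix :: "'v \<Rightarrow> nat"
  assumes "finite V" "inj_on ix V"
  shows "koszul (vscale :: 'k::field \<Rightarrow> ('v, 'k) mvec \<Rightarrow> _) (\<lambda>v. mvec_scale (var v)) V ix"
proof -
  interpret vector_space "vscale :: 'k \<Rightarrow> ('v, 'k) mvec \<Rightarrow> _" by (rule vector_space_vscale)
  show ?thesis
    by unfold_locales
      (use assms in \<open>auto simp: vscale_def mvec_scale_add mvec_scale_assoc mult.commute\<close>)
qed

section \<open>Membership and degrees, coefficient by coefficient\<close>

lemma free_moduleI:
  assumes "\<And>e m. coeff (Poly_Mapping.lookup u e) m \<noteq> 0 \<Longrightarrow> e \<in> B \<and> Poly_Mapping.keys m \<subseteq> V"
  shows "u \<in> free_module V B"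
proof -
  have "e \<in> B" if "e \<in> Poly_Mapping.keys u" for e
  proof -
    have "Poly_Mapping.lookup u e \<noteq> 0" using that by (simp add: in_keys_iff)
    then obtain m where "coeff (Poly_Mapping.lookup u e) m \<noteq> 0"
      by (metis lookup_zero poly_mapping_eqI)
    then show ?thesis using assms by blast
  qed
  then show ?thesis using assms by (auto simp: free_module_def intro!: poly_ringI)
qed

lemma free_moduleD:
  assumes "u \<in> free_module V B" "coeff (Poly_Mapping.lookup u e) m \<noteq> 0"
  shows "e \<in> B" "Poly_Mapping.keys m \<subseteq> V"
proof -
  have "Poly_Mapping.lookup u e \<noteq> 0" using assms(2) by auto
  then show "e \<in> B" using assms(1) by (auto simp: free_module_def in_keys_iff)
  have "Poly_Mapping.lookup u e \<in> poly_ring V" using assms(1) by (simp add: free_module_def)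
  then show "Poly_Mapping.keys m \<subseteq> V" using assms(2) by (rule poly_ringD)
qed

lemma mvec_homogeneousI:
  "(\<And>e m. coeff (Poly_Mapping.lookup u e) m \<noteq> 0 \<Longrightarrow> mdeg m + \<delta> e = d) \<Longrightarrow> mvec_homogeneous \<delta> d u"
  by (auto simp: mvec_homogeneous_def in_keys_iff)

lemma mvec_homogeneousD:
  "mvec_homogeneous \<delta> d u \<Longrightarrow> coeff (Poly_Mapping.lookup u e) m \<noteq> 0 \<Longrightarrow> mdeg m + \<delta> e = d"
  unfolding mvec_homogeneous_def by (metis in_keys_iff lookup_zero)

lemma free_pieceI:
  assumes "\<And>e m. coeff (Poly_Mapping.lookup u e) m \<noteq> 0 \<Longrightarrow>
    e \<in> B \<and> Poly_Mapping.keys m \<subseteq> V \<and> mdeg m + \<delta> e = k"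
  shows "u \<in> free_piece V B \<delta> k"
  using assms by (simp add: free_piece_def free_moduleI mvec_homogeneousI)

lemma free_pieceD:
  assumes "u \<in> free_piece V B \<delta> k" "coeff (Poly_Mapping.lookup u e) m \<noteq> 0"
  shows "e \<in> B" "Poly_Mapping.keys m \<subseteq> V" "mdeg m + \<delta> e = k"
  using assms free_moduleD[of u V B e m] mvec_homogeneousD[of \<delta> k u e m] by (auto simp: free_piece_def)

lemma poly_pieceI:
  assumes "\<And>m. coeff p m \<noteq> 0 \<Longrightarrow> Poly_Mapping.keys m \<subseteq> V \<and> mdeg m = k"
  shows "p \<in> poly_piece V k"
  using assms by (auto simp: poly_piece_def intro!: poly_ringI homogeneousI)

lemma poly_pieceD:
  assumes "p \<in> poly_piece V k" "coeff p m \<noteq> 0"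
  shows "Poly_Mapping.keys m \<subseteq> V" "mdeg m = k"
  using assms by (auto simp: poly_piece_def dest: poly_ringD homogeneousD)

lemma mono_minus_props:
  assumes "Poly_Mapping.lookup m v \<noteq> 0"
  shows "mdeg m = Suc (mdeg (m - mono1 v))"
    "v \<in> V \<Longrightarrow> Poly_Mapping.keys (m - mono1 v) \<subseteq> V \<Longrightarrow> Poly_Mapping.keys m \<subseteq> V"
proof -
  show "mdeg m = Suc (mdeg (m - mono1 v))"
    by (subst mono1_split[OF assms]) (simp add: mdeg_add)
  show "Poly_Mapping.keys m \<subseteq> V" if "v \<in> V" "Poly_Mapping.keys (m - mono1 v) \<subseteq> V"
    using Poly_Mapping.keys_add[of "mono1 v" "m - mono1 v"] mono1_split[OF assms] that by auto
qed

lemma graded_poly_piece: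
  fixes V :: "'v set" and ix :: "'v \<Rightarrow> nat"
  assumes "finite V" "inj_on ix V"
  shows "koszul.graded (pscale :: 'k::field \<Rightarrow> ('v, 'k) mpoly \<Rightarrow> _) (\<lambda>v p. var v * p) V (poly_piece V)"
proof -
  interpret koszul "pscale :: 'k \<Rightarrow> ('v, 'k) mpoly \<Rightarrow> _" "\<lambda>v p. var v * p" V ix
    by (rule koszul_pscale[OF assms])
  have "p + q \<in> poly_piece V k" if "p \<in> poly_piece V k" "q \<in> poly_piece V k" for p q :: "('v, 'k) mpoly" and k
    using poly_pieceD[OF that(1)] poly_pieceD[OF that(2)]
    by (intro poly_pieceI) (metis add.right_neutral lookup_add)
  moreover have "var v * p \<in> poly_piece V (Suc k)" if "p \<in> poly_piece V k" "v \<in> V"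
    for p :: "('v, 'k) mpoly" and k v
  proof (rule poly_pieceI)
    fix m assume "coeff (var v * p) m \<noteq> 0"
    then have m: "Poly_Mapping.lookup m v \<noteq> 0" "coeff p (m - mono1 v) \<noteq> 0"
      by (auto simp: coeff_var_times split: if_splits)
    from poly_pieceD[OF that(1) m(2)] mono_minus_props[OF m(1)] \<open>v \<in> V\<close>
    show "Poly_Mapping.keys m \<subseteq> V \<and> mdeg m = Suc k" by simp
  qed
  ultimately show ?thesis
    by (auto simp: graded_def subspace_def intro!: poly_pieceI dest: poly_pieceD)
qed

lemma graded_free_piece:
  fixes V :: "'v set" and ix :: "'v \<Rightarrow> nat"
  assumes "finite V" "inj_on ix V"
  shows "koszul.graded (vscale :: 'k::field \<Rightarrow> ('v, 'k) mvec \<Rightarrow> _) (\<lambda>v. mvec_scale (var v)) V (free_piece V B \<delta>)"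
proof -
  interpret koszul "vscale :: 'k \<Rightarrow> ('v, 'k) mvec \<Rightarrow> _" "\<lambda>v. mvec_scale (var v)" V ix
    by (rule koszul_vscale[OF assms])
  have "p + q \<in> free_piece V B \<delta> k" if "p \<in> free_piece V B \<delta> k" "q \<in> free_piece V B \<delta> k"
    for p q :: "('v, 'k) mvec" and k
    using free_pieceD[OF that(1)] free_pieceD[OF that(2)]
    by (intro free_pieceI) (metis add.right_neutral lookup_add)
  moreover have "mvec_scale (var v) p \<in> free_piece V B \<delta> (Suc k)" if "p \<in> free_piece V B \<delta> k" "v \<in> V"
    for p :: "('v, 'k) mvec" and k v
  proof (rule free_pieceI)
    fix e m assume "coeff (Poly_Mapping.lookup (mvec_scale (var v) p) e) m \<noteq> 0"
    then have m: "Poly_Mapping.lookup m v \<noteq> 0" "coeff (Poly_Mapping.lookup p e) (m - mono1 v) \<noteq> 0"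
      by (auto simp: coeff_var_times split: if_splits)
    from free_pieceD[OF \<open>p \<in> free_piece V B \<delta> k\<close> m(2)] mono_minus_props[OF m(1)] \<open>v \<in> V\<close>
    show "e \<in> B \<and> Poly_Mapping.keys m \<subseteq> V \<and> mdeg m + \<delta> e = Suc k" by auto
  qed
  ultimately show ?thesis
    by (auto simp: graded_def subspace_def lookup_vscale intro!: free_pieceI dest: free_pieceD)
qed

section \<open>Contracting homotopies\<close>

text \<open>The squarefree exponent vector of T. The Koszul basis element with coefficient monomial
  \<open>m\<close> on T has multidegree \<open>m + chi T\<close>, which the differential
  preserves.\<close>

definition chi :: "'v set \<Rightarrow> 'v \<Rightarrow>\<^sub>0 nat" where
  "chi T = (\<Sum>v\<in>T. mono1 v)"

lemma lookup_chi: "finite T \<Longrightarrow> Poly_Mapping.lookup (chi T) v = (if v \<in> T then 1 else 0)"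
  by (simp add: chi_def lookup_sum lookup_single when_def)

lemma chi_insert: "finite T \<Longrightarrow> v \<notin> T \<Longrightarrow> chi (insert v T) = mono1 v + chi T"
  by (simp add: chi_def)

text \<open>In each multidegree \<open>\<alpha>\<close> the homotopy divides by the variable \<open>sel \<alpha>\<close>.\<close>

definition khom ::
  "'v set \<Rightarrow> ('v \<Rightarrow> nat) \<Rightarrow> (('v \<Rightarrow>\<^sub>0 nat) \<Rightarrow> 'v) \<Rightarrow> ('v set \<Rightarrow> ('v, 'k::field) mpoly) \<Rightarrow> 'v set \<Rightarrow> ('v, 'k) mpoly"
where
  "khom V ix sel f T = Abs_poly_mapping (\<lambda>m. let w = sel (m + chi T) in
     if T \<subseteq> V \<and> w \<in> T then ksgn ix w (T - {w}) * coeff (f (T - {w})) (m + mono1 w) else 0)"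

text \<open>The point is finite support, without which \<open>Abs_poly_mapping\<close> says nothing:
  a nonzero coefficient at \<open>m\<close> comes from the monomial \<open>m + mono1 w\<close> in
  one of the finitely many values of \<open>f\<close>.\<close>

lemma coeff_khom:
  assumes V: "finite V"
  shows "coeff (khom V ix sel f T) m = (let w = sel (m + chi T) in
     if T \<subseteq> V \<and> w \<in> T then ksgn ix w (T - {w}) * coeff (f (T - {w})) (m + mono1 w) else 0)"
proof -
  define g where "g = (\<lambda>m. let w = sel (m + chi T) in
     if T \<subseteq> V \<and> w \<in> T then ksgn ix w (T - {w}) * coeff (f (T - {w})) (m + mono1 w) else 0)"
  have "{m. g m \<noteq> 0} \<subseteq> (\<Union>w\<in>T \<inter> V. (\<lambda>m. m - mono1 w) ` Poly_Mapping.keys (f (T - {w})))"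
  proof
    fix m assume "m \<in> {m. g m \<noteq> 0}"
    then obtain w where w: "w \<in> T \<inter> V" "coeff (f (T - {w})) (m + mono1 w) \<noteq> 0"
      by (auto simp: g_def Let_def split: if_splits)
    then have "m = (m + mono1 w) - mono1 w" "m + mono1 w \<in> Poly_Mapping.keys (f (T - {w}))"
      by (auto simp: in_keys_iff)
    then show "m \<in> (\<Union>w\<in>T \<inter> V. (\<lambda>m. m - mono1 w) ` Poly_Mapping.keys (f (T - {w})))"
      using w(1) by blast
  qed
  then have "finite {m. g m \<noteq> 0}" by (rule finite_subset) (use V in auto)
  then have "coeff (Abs_poly_mapping g) = g" by simp
  then show ?thesis by (simp add: khom_def g_def)
qed

lemma coeff_kdiff:
  "coeff (kdiff pscale (\<lambda>v p. var v * p) V ix f T) m =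
    (if T \<subseteq> V then \<Sum>v\<in>V - T. ksgn ix v T * (if Poly_Mapping.lookup m v \<noteq> 0 then coeff (f (insert v T)) (m - mono1 v) else 0) else 0)"
  by (simp add: kdiff_def lookup_sum coeff_var_times)

text \<open>The homotopy identity dh + hd = 1 in one multidegree, evaluated where hd contributes
  nothing. All terms share the multidegree and hence the variable \<open>w\<close>. If
  \<open>w\<close> is not in S, only the summand for \<open>w\<close> survives; if it is, the cycle
  condition on S without \<open>w\<close> expresses the remaining sum through the wanted
  coefficient.\<close>

lemma khom_homotopy:
  fixes f :: "'v set \<Rightarrow> ('v, 'k::field) mpoly" and ix :: "'v \<Rightarrow> nat"
  assumes V: "finite V" and ix: "inj_on ix V" and S: "S \<subseteq> V"
    and w: "sel (m + chi S) = w" "w \<in> V" "Poly_Mapping.lookup (m + chi S) w \<noteq> 0"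
    and cyc: "w \<in> S \<Longrightarrow> coeff (kdiff pscale (\<lambda>v p. var v * p) V ix f (S - {w})) (m + mono1 w) = 0"
  shows "coeff (kdiff pscale (\<lambda>v p. var v * p) V ix (khom V ix sel f) S) m = coeff (f S) m"
proof -
  have finS: "finite S" using S V finite_subset by blast
  have "coeff (kdiff pscale (\<lambda>v p. var v * p) V ix (khom V ix sel f) S) m =
     (\<Sum>u\<in>V - S. ksgn ix u S * (if Poly_Mapping.lookup m u \<noteq> 0 then
        (if w \<in> insert u S then ksgn ix w (insert u S - {w}) * coeff (f (insert u S - {w})) (m - mono1 u + mono1 w) else 0) else 0))"
  proof -
    have "(if Poly_Mapping.lookup m u \<noteq> 0 then coeff (khom V ix sel f (insert u S)) (m - mono1 u) else 0) =
      (if Poly_Mapping.lookup m u \<noteq> 0 then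
        (if w \<in> insert u S then ksgn ix w (insert u S - {w}) * coeff (f (insert u S - {w})) (m - mono1 u + mono1 w) else 0) else 0)"
      if u: "u \<in> V - S" for u
    proof -
      \<comment> \<open>The multidegree is unchanged when \<open>u\<close> moves from the monomial
        into the set, so \<open>sel\<close> returns the same \<open>w\<close> in every
        summand.\<close>
      have "Poly_Mapping.lookup m u \<noteq> 0 \<Longrightarrow> m - mono1 u + chi (insert u S) = m + chi S"
        using u finS mono1_split[of m u] by (simp add: chi_insert add.assoc[symmetric] add.commute[of _ "mono1 u"])
      then show ?thesis
        using u S w(1) by (simp add: coeff_khom[OF V])
    qed
    then show ?thesis unfolding coeff_kdiff if_P[OF S]
      by (intro sum.cong refl arg_cong2[where f = "(*)"])
  qed
  also have "\<dots> = coeff (f S) m"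
  proof (cases "w \<in> S")
    case False
    then have m: "Poly_Mapping.lookup m w \<noteq> 0" using w(3) by (simp add: lookup_add lookup_chi[OF finS])
    then have eq: "m - mono1 w + mono1 w = m" using mono1_split[OF m] by (simp add: ac_simps)
    have "(\<Sum>u\<in>V - S. ksgn ix u S * (if Poly_Mapping.lookup m u \<noteq> 0 then
        (if w \<in> insert u S then ksgn ix w (insert u S - {w}) * coeff (f (insert u S - {w})) (m - mono1 u + mono1 w) else 0) else 0))
      = (\<Sum>u\<in>V - S. if u = w then coeff (f S) m else 0)"
      using False m eq by (intro sum.cong) (auto simp: insert_Diff_if)
    then show ?thesis using V w(2) False by simp
  next
    case True
    define T where "T = S - {w}"
    have T: "S = insert w T" "w \<notin> T" "finite T" "T \<subseteq> V" using True finS S by (auto simp: T_def)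
    define h where "h = (\<lambda>u. if Poly_Mapping.lookup m u \<noteq> 0 then coeff (f (insert u T)) (m - mono1 u + mono1 w) else 0)"
    have VT: "V - T = insert w (V - S)" using T w(2) by auto
    \<comment> \<open>The vanishing coefficient of the differential on T is split into the summand
      for \<open>w\<close>, which holds the coefficient at S, and the summands over the vertices
      outside S.\<close>
    have "0 = (\<Sum>u\<in>V - T. ksgn ix u T * (if Poly_Mapping.lookup (m + mono1 w) u \<noteq> 0 then coeff (f (insert u T)) (m + mono1 w - mono1 u) else 0))"
      using cyc[OF True] T(4) unfolding coeff_kdiff T_def[symmetric] by simp
    also have "\<dots> = ksgn ix w T * coeff (f S) m + (\<Sum>u\<in>V - S. ksgn ix u T * h u)"
    proof -
      have "m + mono1 w - mono1 u = m - mono1 u + mono1 w" if "Poly_Mapping.lookup m u \<noteq> 0" for u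
        by (subst (1) mono1_split[OF that]) (simp add: ac_simps)
      then have "(\<Sum>u\<in>V - S. ksgn ix u T * (if Poly_Mapping.lookup (m + mono1 w) u \<noteq> 0 then coeff (f (insert u T)) (m + mono1 w - mono1 u) else 0))
        = (\<Sum>u\<in>V - S. ksgn ix u T * h u)"
        using True by (intro sum.cong) (auto simp: h_def lookup_add lookup_single when_def)
      then show ?thesis unfolding VT using V True T(1) by (simp add: lookup_add)
    qed
    finally have "ksgn ix w T * coeff (f S) m = - (\<Sum>u\<in>V - S. ksgn ix u T * h u)"
      by (simp add: eq_neg_iff_add_eq_0)
    then have "ksgn ix w T * (ksgn ix w T * coeff (f S) m) = ksgn ix w T * (- (\<Sum>u\<in>V - S. ksgn ix u T * h u))"
      by simp
    then have "coeff (f S) m = (\<Sum>u\<in>V - S. - (ksgn ix w T * ksgn ix u T) * h u)"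
      by (simp add: sum_distrib_left sum_negf mult.assoc)
    also have "\<dots> = (\<Sum>u\<in>V - S. ksgn ix u S * (if Poly_Mapping.lookup m u \<noteq> 0 then
        (if w \<in> insert u S then ksgn ix w (insert u S - {w}) * coeff (f (insert u S - {w})) (m - mono1 u + mono1 w) else 0) else 0))"
    proof (rule sum.cong[OF refl])
      fix u assume u: "u \<in> V - S"
      have nix: "ix w \<noteq> ix u" using u True S inj_onD[OF ix] by auto
      have uT: "u \<notin> T" using u T by auto
      \<comment> \<open>Adding \<open>w\<close> below or above \<open>u\<close> flips exactly one of
        the two signs; this converts the signs of the cycle condition on T into those of the
        differential on S.\<close>
      have "ksgn ix u (insert w T) * ksgn ix w (insert u T) = (- (ksgn ix w T * ksgn ix u T) :: 'k)"
        using nix T uT by (auto simp: ksgn_insert mult.commute)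
      moreover have "insert u S - {w} = insert u T" using u T by auto
      ultimately show "- (ksgn ix w T * ksgn ix u T) * h u = ksgn ix u S * (if Poly_Mapping.lookup m u \<noteq> 0 then
        (if w \<in> insert u S then ksgn ix w (insert u S - {w}) * coeff (f (insert u S - {w})) (m - mono1 u + mono1 w) else 0) else 0)"
        using T True by (simp add: h_def flip: mult.assoc)
    qed
    finally show ?thesis by simp
  qed
  finally show ?thesis .
qed

lemma lookup_kdiff_mvec:
  "Poly_Mapping.lookup (kdiff vscale (\<lambda>v. mvec_scale (var v)) V ix f T) e =
    kdiff pscale (\<lambda>v p. var v * p) V ix (\<lambda>S. Poly_Mapping.lookup (f S) e) T"
  by (simp add: kdiff_def lookup_sum lookup_vscale)

text \<open>The Koszul complex of the polynomial ring is exact in every nonzero multidegree, where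
  the homotopy may divide by any variable that occurs. Multidegree zero is met only by constants at
  the empty set, and \<open>const\<close> excludes them.\<close>

lemma free_module_koszul_exact:
  fixes f :: "'v set \<Rightarrow> ('v, 'k::field) mvec" and ix :: "'v \<Rightarrow> nat"
  assumes V: "finite V" and ix: "inj_on ix V"
    and f: "f \<in> kchain V q (free_piece V B \<delta> (Suc k))"
    and cyc: "kdiff vscale (\<lambda>v. mvec_scale (var v)) V ix f = 0"
    and const: "\<And>e. coeff (Poly_Mapping.lookup (f {}) e) 0 = 0"
  shows "\<exists>g\<in>kchain V (Suc q) (free_piece V B \<delta> k). kdiff vscale (\<lambda>v. mvec_scale (var v)) V ix g = f"
proof -
  define sel where "sel = (\<lambda>\<alpha> :: 'v \<Rightarrow>\<^sub>0 nat. SOME v. v \<in> V \<and> Poly_Mapping.lookup \<alpha> v \<noteq> 0)"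
  have sel: "sel \<alpha> \<in> V \<and> Poly_Mapping.lookup \<alpha> (sel \<alpha>) \<noteq> 0"
    if ex: "\<exists>v\<in>V. Poly_Mapping.lookup \<alpha> v \<noteq> 0" for \<alpha>
  proof -
    obtain v where "v \<in> V \<and> Poly_Mapping.lookup \<alpha> v \<noteq> 0" using ex by blast
    then show ?thesis unfolding sel_def by (rule someI)
  qed
  define fe where "fe = (\<lambda>e S. Poly_Mapping.lookup (f S) e)"
  define E where "E = (\<Union>S\<in>Pow V. Poly_Mapping.keys (f S))"
  have finE: "finite E" using V by (auto simp: E_def)
  have fnon: "f S = 0" if "\<not> (S \<subseteq> V \<and> card S = q)" for S using kchain_outside[OF f that] .
  \<comment> \<open>The homotopy acts on each component separately. Only the finitely many
    components in E are met, so the result is again a finitely supported vector.\<close>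
  define g where "g = (\<lambda>T. \<Sum>e\<in>E. Poly_Mapping.single e (khom V ix sel (fe e) T))"
  have khom0: "khom V ix sel (fe e) T = 0" if "e \<notin> E" for e T
  proof (rule poly_mapping_eqI)
    fix m
    have "fe e S = 0" if "S \<subseteq> V" for S using \<open>e \<notin> E\<close> that by (auto simp: fe_def E_def in_keys_iff)
    then show "coeff (khom V ix sel (fe e) T) m = coeff 0 m"
      by (auto simp: coeff_khom[OF V] Let_def) (metis Diff_subset lookup_zero order_trans)
  qed
  have lg: "Poly_Mapping.lookup (g T) e = khom V ix sel (fe e) T" for T e
    using finE khom0 by (simp add: g_def lookup_sum lookup_single when_def)
  have gC: "g \<in> kchain V (Suc q) (free_piece V B \<delta> k)"
  proof (rule kchainI)
    fix T assume T: "T \<subseteq> V" "card T = Suc q"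
    show "g T \<in> free_piece V B \<delta> k"
    proof (rule free_pieceI)
      fix e m assume nz: "coeff (Poly_Mapping.lookup (g T) e) m \<noteq> 0"
      define w where "w = sel (m + chi T)"
      have w: "w \<in> T" "coeff (Poly_Mapping.lookup (f (T - {w})) e) (m + mono1 w) \<noteq> 0"
        using nz unfolding lg coeff_khom[OF V] Let_def w_def[symmetric] by (auto simp: fe_def split: if_splits)
      have "f (T - {w}) \<noteq> 0" using w(2) by auto
      then have "f (T - {w}) \<in> free_piece V B \<delta> (Suc k)" using fnon kchain_in[OF f] by blast
      note D = free_pieceD[OF this w(2)]
      have "Poly_Mapping.keys m \<subseteq> Poly_Mapping.keys (m + mono1 w)" by (auto simp: in_keys_iff lookup_add)
      then show "e \<in> B \<and> Poly_Mapping.keys m \<subseteq> V \<and> mdeg m + \<delta> e = k"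
        using D by (auto simp: mdeg_add)
    qed
  next
    fix T assume T: "\<not> (T \<subseteq> V \<and> card T = Suc q)"
    have "f (T - {w}) = 0" if "T \<subseteq> V" "w \<in> T" for w
    proof -
      have "Suc (card (T - {w})) = card T" using that finite_subset[OF _ V, of T] by (intro card_Suc_Diff1)
      then show ?thesis using T that by (intro fnon) auto
    qed
    then show "g T = 0"
      by (intro poly_mapping_eqI2) (auto simp: lg coeff_khom[OF V] Let_def fe_def)
  qed
  have "kdiff vscale (\<lambda>v. mvec_scale (var v)) V ix g S = f S" for S
  proof (cases "S \<subseteq> V")
    case False
    then show ?thesis using fnon by (simp add: kdiff_def)
  next
    case True
    have finS: "finite S" using True V finite_subset by blast
    show ?thesis
    proof (rule poly_mapping_eqI2)
      fix e m
      have *: "coeff (Poly_Mapping.lookup (kdiff vscale (\<lambda>v. mvec_scale (var v)) V ix g S) e) m =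
        coeff (kdiff pscale (\<lambda>v p. var v * p) V ix (khom V ix sel (fe e)) S) m"
        by (simp add: lookup_kdiff_mvec lg)
      show "coeff (Poly_Mapping.lookup (kdiff vscale (\<lambda>v. mvec_scale (var v)) V ix g S) e) m =
        coeff (Poly_Mapping.lookup (f S) e) m"
      proof (cases "\<exists>v\<in>V. Poly_Mapping.lookup (m + chi S) v \<noteq> 0")
        case ex: True
        have "coeff (kdiff pscale (\<lambda>v p. var v * p) V ix (fe e) T) m' = 0" for T m'
          using cyc by (simp add: fe_def flip: lookup_kdiff_mvec)
        then show ?thesis unfolding *
          using khom_homotopy[OF V ix True refl, of sel m "fe e"] sel[OF ex] by (simp add: fe_def)
      next
        \<comment> \<open>Multidegree zero: S is empty and the monomial is 1 as soon as its
          coefficient is nonzero, so both sides vanish by \<open>const\<close>.\<close>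
        case False
        then have z: "v \<notin> S" "Poly_Mapping.lookup m v = 0" if "v \<in> V" for v
          using that by (auto simp: lookup_add lookup_chi[OF finS] split: if_splits)
        then have "S = {}" using True by auto
        have "coeff (Poly_Mapping.lookup (f S) e) m = 0"
        proof (rule ccontr)
          assume nz: "coeff (Poly_Mapping.lookup (f S) e) m \<noteq> 0"
          then have "f S \<noteq> 0" by auto
          then have "f S \<in> free_piece V B \<delta> (Suc k)" using fnon kchain_in[OF f] by blast
          from free_pieceD(2)[OF this nz] have "m = 0"
            using z by (intro poly_mapping_eqI) (metis in_keys_iff lookup_zero subsetD)
          then show False using const nz \<open>S = {}\<close> by simp
        qed
        moreover have "coeff (kdiff pscale (\<lambda>v p. var v * p) V ix (khom V ix sel (fe e)) S) m = 0"
          unfolding coeff_kdiff using z by (auto intro!: sum.neutral)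
        ultimately show ?thesis unfolding * by simp
      qed
    qed
  qed
  then show ?thesis using gC by blast
qed

text \<open>Exactness in homological degree 0: an element without constant terms lies in the
  irrelevant ideal times the module, with cofactors homogeneous of degree one less.\<close>

lemma free_piece_irrelevant:
  fixes u :: "('v, 'k::field) mvec" and ix :: "'v \<Rightarrow> nat"
  assumes V: "finite V" and ix: "inj_on ix V"
    and u: "u \<in> free_piece V B \<delta> (Suc k)"
    and const: "\<And>e. coeff (Poly_Mapping.lookup u e) 0 = 0"
  shows "\<exists>h. (\<forall>v\<in>V. h v \<in> free_piece V B \<delta> k) \<and> u = (\<Sum>v\<in>V. mvec_scale (var v) (h v))"
proof -
  \<comment> \<open>The element is a 0-chain sitting at the empty set, hence a cycle; a chain
    bounding it on the singletons supplies the cofactors.\<close>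
  define f where "f = (\<lambda>S :: 'v set. if S = {} then u else 0)"
  have "f \<in> kchain V 0 (free_piece V B \<delta> (Suc k))"
  proof (rule kchainI)
    fix S assume "S \<subseteq> V" "card S = 0"
    moreover from this have "finite S" using V finite_subset by blast
    ultimately have "S = {}" by simp
    then show "f S \<in> free_piece V B \<delta> (Suc k)" using u by (simp add: f_def)
  qed (auto simp: f_def)
  moreover have "kdiff vscale (\<lambda>v. mvec_scale (var v)) V ix f = 0"
    by (rule ext) (simp add: kdiff_def f_def vscale_def)
  moreover have "\<And>e. coeff (Poly_Mapping.lookup (f {}) e) 0 = 0" using const by (simp add: f_def)
  ultimately obtain g where g: "g \<in> kchain V (Suc 0) (free_piece V B \<delta> k)"
    "kdiff vscale (\<lambda>v. mvec_scale (var v)) V ix g = f"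
    using free_module_koszul_exact[OF V ix, of f 0 B \<delta> k] by blast
  interpret koszul "vscale :: 'k \<Rightarrow> ('v, 'k) mvec \<Rightarrow> _" "\<lambda>v. mvec_scale (var v)" V ix
    by (rule koszul_vscale[OF V ix])
  have "u = kdiff vscale (\<lambda>v. mvec_scale (var v)) V ix g {}" using g(2) by (simp add: f_def)
  also have "\<dots> = (\<Sum>v\<in>V. mvec_scale (var v) (g {v}))"
    by (simp add: kdiff_def ksgn_def)
  finally show ?thesis using kchain_in[OF g(1)] by (intro exI[of _ "\<lambda>v. g {v}"]) auto
qed

section \<open>Homogeneous components\<close>

definition pfilter :: "(('v \<Rightarrow>\<^sub>0 nat) \<Rightarrow> bool) \<Rightarrow> ('v, 'k::field) mpoly \<Rightarrow> ('v, 'k) mpoly" where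
  "pfilter P p = Poly_Mapping.mapp (\<lambda>m c. if P m then c else 0) p"

definition pcomp :: "nat \<Rightarrow> ('v, 'k::field) mpoly \<Rightarrow> ('v, 'k) mpoly" where
  "pcomp k p = pfilter (\<lambda>m. mdeg m = k) p"

definition vcomp :: "(nat \<Rightarrow> nat) \<Rightarrow> nat \<Rightarrow> ('v, 'k::field) mvec \<Rightarrow> ('v, 'k) mvec" where
  "vcomp \<delta> k u = Poly_Mapping.mapp (\<lambda>e p. pfilter (\<lambda>m. mdeg m + \<delta> e = k) p) u"

lemma coeff_pfilter [simp]: "coeff (pfilter P p) m = (if P m then coeff p m else 0)"
  by (auto simp: pfilter_def lookup_mapp when_def in_keys_iff)

lemma coeff_pcomp [simp]: "coeff (pcomp k p) m = (if mdeg m = k then coeff p m else 0)"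
  by (simp add: pcomp_def)

lemma coeff_vcomp [simp]: "coeff (Poly_Mapping.lookup (vcomp \<delta> k u) e) m =
    (if mdeg m + \<delta> e = k then coeff (Poly_Mapping.lookup u e) m else 0)"
proof (cases "Poly_Mapping.lookup u e = 0")
  case True
  then have "Poly_Mapping.lookup (vcomp \<delta> k u) e = 0"
    by (simp add: vcomp_def lookup_mapp when_def in_keys_iff)
  with True show ?thesis by simp
next
  case False
  then have "Poly_Mapping.lookup (vcomp \<delta> k u) e = pfilter (\<lambda>m. mdeg m + \<delta> e = k) (Poly_Mapping.lookup u e)"
    by (simp add: vcomp_def lookup_mapp when_def in_keys_iff)
  then show ?thesis by simp
qed

lemma vcomp_piece: "u \<in> free_module V B \<Longrightarrow> vcomp \<delta> k u \<in> free_piece V B \<delta> k"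
  by (rule free_pieceI) (auto split: if_splits dest: free_moduleD)

lemma vcomp_homogeneous:
  assumes "mvec_homogeneous \<delta> j u"
  shows "vcomp \<delta> k u = (if j = k then u else 0)"
  using mvec_homogeneousD[OF assms] by (intro poly_mapping_eqI2) auto

lemma vcomp_sum: "vcomp \<delta> k (\<Sum>i\<in>A. f i) = (\<Sum>i\<in>A. vcomp \<delta> k (f i))"
  by (intro poly_mapping_eqI2) (simp add: lookup_sum)

lemma vcomp_decompose:
  obtains D where "finite D" "\<And>D'. finite D' \<Longrightarrow> D \<subseteq> D' \<Longrightarrow> (\<Sum>k\<in>D'. vcomp \<delta> k u) = u"
proof
  let ?D = "\<Union>e\<in>Poly_Mapping.keys u. (\<lambda>m. mdeg m + \<delta> e) ` Poly_Mapping.keys (Poly_Mapping.lookup u e)"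
  show "finite ?D" by simp
  show "(\<Sum>k\<in>D'. vcomp \<delta> k u) = u" if "finite D'" "?D \<subseteq> D'" for D'
  proof (rule poly_mapping_eqI2)
    fix e m
    have "coeff (Poly_Mapping.lookup (\<Sum>k\<in>D'. vcomp \<delta> k u) e) m =
      (if mdeg m + \<delta> e \<in> D' then coeff (Poly_Mapping.lookup u e) m else 0)"
      using that(1) by (simp add: lookup_sum)
    moreover have "mdeg m + \<delta> e \<in> D'" if "coeff (Poly_Mapping.lookup u e) m \<noteq> 0"
    proof -
      have "e \<in> Poly_Mapping.keys u" using that by (auto simp: in_keys_iff)
      moreover have "m \<in> Poly_Mapping.keys (Poly_Mapping.lookup u e)" using that by (simp add: in_keys_iff)
      ultimately show ?thesis using \<open>?D \<subseteq> D'\<close> by blast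
    qed
    ultimately show "coeff (Poly_Mapping.lookup (\<Sum>k\<in>D'. vcomp \<delta> k u) e) m = coeff (Poly_Mapping.lookup u e) m"
      by auto
  qed
qed

lemma free_module_zero [simp]: "0 \<in> free_module V B"
  by (rule free_moduleI) simp

lemma free_module_add: "u \<in> free_module V B \<Longrightarrow> w \<in> free_module V B \<Longrightarrow> u + w \<in> free_module V B"
proof (rule free_moduleI)
  fix e m assume u: "u \<in> free_module V B" and w: "w \<in> free_module V B"
    and "coeff (Poly_Mapping.lookup (u + w) e) m \<noteq> 0"
  then have "coeff (Poly_Mapping.lookup u e) m \<noteq> 0 \<or> coeff (Poly_Mapping.lookup w e) m \<noteq> 0"
    by (auto simp: lookup_add)
  then show "e \<in> B \<and> Poly_Mapping.keys m \<subseteq> V"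
    using free_moduleD[OF u] free_moduleD[OF w] by blast
qed

lemma free_module_sum: "(\<And>i. i \<in> A \<Longrightarrow> f i \<in> free_module V B) \<Longrightarrow> (\<Sum>i\<in>A. f i) \<in> free_module V B"
  by (induction A rule: infinite_finite_induct) (auto simp: free_module_add)

lemma free_module_scale:
  assumes "p \<in> poly_ring V" "u \<in> free_module V B"
  shows "mvec_scale p u \<in> free_module V B"
proof -
  have "e \<in> B" if "e \<in> Poly_Mapping.keys (mvec_scale p u)" for e
  proof -
    have "Poly_Mapping.lookup u e \<noteq> 0" using that by (auto simp: in_keys_iff)
    then have "e \<in> Poly_Mapping.keys u" by (simp add: in_keys_iff)
    then show ?thesis using assms(2) unfolding free_module_def by blast
  qed
  moreover have "p * Poly_Mapping.lookup u e \<in> poly_ring V" for e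
    using assms(2) by (intro poly_ring_mult[OF assms(1)]) (simp add: free_module_def)
  ultimately show ?thesis by (auto simp: free_module_def)
qed

lemma free_piece_module: "u \<in> free_piece V B \<delta> k \<Longrightarrow> u \<in> free_module V B"
  by (simp add: free_piece_def)

lemma linear_over_zero:
  fixes f :: "'b::monoid_add \<Rightarrow> 'a::ab_group_add"
  assumes "linear_over R s t M N f" "0 \<in> M"
  shows "f 0 = 0"
proof -
  have "f (0 + 0) = f 0 + f 0" using assms unfolding linear_over_def by blast
  then show ?thesis by simp
qed

lemma linear_over_maps: "linear_over R s t M N f \<Longrightarrow> u \<in> M \<Longrightarrow> f u \<in> N"
  unfolding linear_over_def by blast

lemma linear_over_add: "linear_over R s t M N f \<Longrightarrow> u \<in> M \<Longrightarrow> v \<in> M \<Longrightarrow> f (u + v) = f u + f v"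
  unfolding linear_over_def by blast

lemma linear_over_scale: "linear_over R s t M N f \<Longrightarrow> p \<in> R \<Longrightarrow> u \<in> M \<Longrightarrow> f (s p u) = t p (f u)"
  unfolding linear_over_def by blast

lemma linear_over_sum:
  fixes f :: "('v, 'k::field) mvec \<Rightarrow> 'a::ab_group_add"
  assumes lin: "linear_over R s t (free_module V B) N f"
    and "\<And>i. i \<in> A \<Longrightarrow> g i \<in> free_module V B"
  shows "f (\<Sum>i\<in>A. g i) = (\<Sum>i\<in>A. f (g i))"
  using assms(2)
  by (induction A rule: infinite_finite_induct)
    (auto simp: linear_over_zero[OF lin] linear_over_add[OF lin] free_module_sum)

text \<open>Decompose \<open>u\<close> into its finitely many components. The image of each is
  homogeneous of the same degree, so only the component of degree \<open>k\<close> survives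
  projection to degree \<open>k\<close>.\<close>

lemma vcomp_linear:
  assumes lin: "linear_over R mvec_scale mvec_scale (free_module V B) N \<phi>"
    and gr: "\<And>d u. u \<in> free_module V B \<Longrightarrow> mvec_homogeneous \<delta> d u \<Longrightarrow> mvec_homogeneous \<delta>' d (\<phi> u)"
    and u: "u \<in> free_module V B"
  shows "\<phi> (vcomp \<delta> k u) = vcomp \<delta>' k (\<phi> u)"
proof -
  obtain D where D: "finite D" "\<And>D'. finite D' \<Longrightarrow> D \<subseteq> D' \<Longrightarrow> (\<Sum>k\<in>D'. vcomp \<delta> k u) = u"
    using vcomp_decompose by blast
  have F: "vcomp \<delta> j u \<in> free_module V B" for j using vcomp_piece[OF u] by (simp add: free_piece_def)
  have "mvec_homogeneous \<delta>' j (\<phi> (vcomp \<delta> j u))" for j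
    using gr[OF F] vcomp_piece[OF u, of \<delta> j] by (simp add: free_piece_def)
  note vc = vcomp_homogeneous[OF this]
  \<comment> \<open>The degree \<open>k\<close> is added to the index set so that the summand in
    question is present even when it is zero.\<close>
  have "vcomp \<delta>' k (\<phi> u) = vcomp \<delta>' k (\<phi> (\<Sum>j\<in>insert k D. vcomp \<delta> j u))"
    using D(2)[of "insert k D"] D(1) by (simp only: finite_insert subset_insertI)
  also have "\<dots> = (\<Sum>j\<in>insert k D. vcomp \<delta>' k (\<phi> (vcomp \<delta> j u)))"
    by (simp only: linear_over_sum[OF lin F] vcomp_sum)
  also have "\<dots> = \<phi> (vcomp \<delta> k u)" using D(1) by (simp add: vc)
  finally show ?thesis by simp
qed

lemma pcomp_linear:
  assumes lin: "linear_over R mvec_scale (*) (free_module V B) N \<epsilon>"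
    and gr: "\<And>d u. u \<in> free_module V B \<Longrightarrow> mvec_homogeneous \<delta> d u \<Longrightarrow> homogeneous d (\<epsilon> u)"
    and u: "u \<in> free_module V B"
  shows "\<epsilon> (vcomp \<delta> k u) = pcomp k (\<epsilon> u)"
proof -
  \<comment> \<open>The ring is viewed as the free module on one generator of degree 0, which
    reduces the claim to \<open>vcomp_linear\<close>.\<close>
  define \<phi> where "\<phi> = (\<lambda>u. Poly_Mapping.single (0::nat) (\<epsilon> u))"
  have "linear_over R mvec_scale mvec_scale (free_module V B) UNIV \<phi>"
    using lin by (auto simp: linear_over_def \<phi>_def single_add intro!: poly_mapping_eqI simp: lookup_single when_def)
  moreover have "mvec_homogeneous (\<lambda>_. 0) d (\<phi> u)" if "u \<in> free_module V B" "mvec_homogeneous \<delta> d u" for d u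
  proof (rule mvec_homogeneousI)
    fix e m assume "coeff (Poly_Mapping.lookup (\<phi> u) e) m \<noteq> 0"
    then have "coeff (\<epsilon> u) m \<noteq> 0" by (auto simp: \<phi>_def lookup_single when_def split: if_splits)
    then show "mdeg m + 0 = d" using homogeneousD[OF gr[OF that]] by simp
  qed
  ultimately have "\<phi> (vcomp \<delta> k u) = vcomp (\<lambda>_. 0) k (\<phi> u)" using u by (rule vcomp_linear)
  then have "coeff (Poly_Mapping.lookup (\<phi> (vcomp \<delta> k u)) 0) m = coeff (Poly_Mapping.lookup (vcomp (\<lambda>_. 0) k (\<phi> u)) 0) m" for m
    by simp
  then show ?thesis by (intro poly_mapping_eqI) (simp add: \<phi>_def)
qed

definition homogeneous_ideal :: "'v set \<Rightarrow> ('v, 'k::field) mpoly set \<Rightarrow> bool" where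
  "homogeneous_ideal V I \<longleftrightarrow> I \<subseteq> poly_ring V \<and> 0 \<in> I \<and> (\<forall>p\<in>I. \<forall>q\<in>I. p + q \<in> I) \<and>
    (\<forall>r\<in>poly_ring V. \<forall>p\<in>I. r * p \<in> I) \<and> (\<forall>p\<in>I. \<forall>k. pcomp k p \<in> I)"

section \<open>Betti numbers as dimensions of Koszul homology\<close>

text \<open>The degree \<open>d\<close> part of the free module tensored with the residue field:
  modulo vectors without constant terms only constants remain, and a nonzero constant at
  \<open>e\<close> has degree \<open>\<delta> e\<close>.\<close>

lemma free_piece_basis:
  fixes V :: "'v set"
  assumes V: "finite V"
  shows "quot_basis (vscale :: 'k::field \<Rightarrow> ('v, 'k) mvec \<Rightarrow> _) (free_piece V B \<delta> d)
    {u \<in> free_piece V B \<delta> d. \<forall>e. coeff (Poly_Mapping.lookup u e) 0 = 0} {e \<in> B. \<delta> e = d}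
    (\<lambda>e. Poly_Mapping.single e 1)"
proof -
  obtain ix :: "'v \<Rightarrow> nat" where ix: "inj_on ix V" using finite_imp_inj_to_nat_seg[OF V] by blast
  interpret koszul "vscale :: 'k \<Rightarrow> ('v, 'k) mvec \<Rightarrow> _" "\<lambda>v. mvec_scale (var v)" V ix
    by (rule koszul_vscale[OF V ix])
  have sub: "subspace (free_piece V B \<delta> d)" using graded_free_piece[OF V ix] by (rule graded_subspace)
  have one: "Poly_Mapping.single e 1 \<in> (free_piece V B \<delta> d :: ('v,'k) mvec set)" if "e \<in> B" "\<delta> e = d" for e
    using that by (intro free_pieceI) (auto simp: lookup_single lookup_one when_def split: if_splits)
  have const: "coeff (Poly_Mapping.lookup (\<Sum>j\<in>F. vscale (c j) (Poly_Mapping.single j 1)) e) 0 =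
      (if e \<in> F then c e else (0::'k))" if "finite F" for F c and e :: nat
  proof -
    have "coeff (Poly_Mapping.lookup (\<Sum>j\<in>F. vscale (c j) (Poly_Mapping.single j 1)) e) 0 =
      (\<Sum>j\<in>F. if j = e then c e else 0)"
      by (auto simp: lookup_sum lookup_vscale lookup_single when_def intro!: sum.cong)
    then show ?thesis using that by simp
  qed
  show ?thesis
  proof (rule quot_basisI)
    show "Poly_Mapping.single e 1 \<in> (free_piece V B \<delta> d :: ('v,'k) mvec set)" if "e \<in> {e \<in> B. \<delta> e = d}" for e
      using one that by simp
  next
    fix u :: "('v,'k) mvec" assume u: "u \<in> free_piece V B \<delta> d"
    define F where "F = Poly_Mapping.keys u \<inter> {e \<in> B. \<delta> e = d}"
    define c where "c = (\<lambda>e. coeff (Poly_Mapping.lookup u e) 0)"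
    have F: "finite F" "F \<subseteq> {e \<in> B. \<delta> e = d}" by (auto simp: F_def)
    have "u - (\<Sum>j\<in>F. vscale (c j) (Poly_Mapping.single j 1)) \<in> free_piece V B \<delta> d"
      using F(2) u one by (intro subspace_diff[OF sub] subspace_sum[OF sub] subspace_scale[OF sub]) auto
    moreover have "coeff (Poly_Mapping.lookup (u - (\<Sum>j\<in>F. vscale (c j) (Poly_Mapping.single j 1))) e) 0 = 0" for e
    proof -
      have "c e = 0" if "e \<notin> F"
      proof (rule ccontr)
        assume nz: "c e \<noteq> 0"
        then have "coeff (Poly_Mapping.lookup u e) 0 \<noteq> 0" by (simp add: c_def)
        from free_pieceD[OF u this] have "e \<in> B" "\<delta> e = d" by simp_all
        moreover have "e \<in> Poly_Mapping.keys u" using nz by (auto simp: c_def in_keys_iff)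
        ultimately show False using that by (simp add: F_def)
      qed
      then show ?thesis unfolding lookup_minus const[OF F(1)] by (auto simp: c_def)
    qed
    ultimately show "\<exists>F c. finite F \<and> F \<subseteq> {e \<in> B. \<delta> e = d} \<and> u - (\<Sum>j\<in>F. vscale (c j) (Poly_Mapping.single j 1))
        \<in> {u \<in> free_piece V B \<delta> d. \<forall>e. coeff (Poly_Mapping.lookup u e) 0 = 0}"
      using F by (intro exI[of _ F] exI[of _ c]) simp
  next
    fix F and c :: "nat \<Rightarrow> 'k" and j
    assume F: "finite F" "F \<subseteq> {e \<in> B. \<delta> e = d}" and j: "j \<in> F"
      and "(\<Sum>j\<in>F. vscale (c j) (Poly_Mapping.single j 1) :: ('v, 'k) mvec)
        \<in> {u \<in> free_piece V B \<delta> d. \<forall>e. coeff (Poly_Mapping.lookup u e) 0 = 0}"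
    then have "coeff (Poly_Mapping.lookup (\<Sum>j\<in>F. vscale (c j) (Poly_Mapping.single j 1) :: ('v, 'k) mvec) j) 0 = 0" by blast
    then show "c j = 0" unfolding const[OF F(1)] using j by simp
  qed
qed

section \<open>Syzygies of a minimal resolution and their Koszul homology\<close>

locale minimal_resolution =
  fixes V :: "'v set" and I :: "('v, 'k::field) mpoly set" and B \<delta> \<phi> \<epsilon> and ix :: "'v \<Rightarrow> nat"
  assumes V: "finite V" and ix: "inj_on ix V" and I: "homogeneous_ideal V I"
    and res: "minimal_graded_free_resolution V I B \<delta> \<phi> \<epsilon>"
begin

abbreviation F :: "nat \<Rightarrow> nat \<Rightarrow> ('v, 'k) mvec set" where "F i \<equiv> free_piece V (B i) (\<delta> i)"

sublocale v: koszul "vscale :: 'k \<Rightarrow> ('v, 'k) mvec \<Rightarrow> _" "\<lambda>v. mvec_scale (var v)" V ix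
  by (rule koszul_vscale[OF V ix])

sublocale p: koszul "pscale :: 'k \<Rightarrow> ('v, 'k) mpoly \<Rightarrow> _" "\<lambda>v p. var v * p" V ix
  by (rule koszul_pscale[OF V ix])

lemmas res_props = res[unfolded minimal_graded_free_resolution_def Let_def]

lemmas \<epsilon>_lin = res_props[THEN conjunct1, rule_format]
lemmas \<phi>_lin = res_props[THEN conjunct2, THEN conjunct1, rule_format]
lemmas \<epsilon>_gr = res_props[THEN conjunct2, THEN conjunct2, THEN conjunct1, rule_format]
lemmas \<phi>_gr = res_props[THEN conjunct2, THEN conjunct2, THEN conjunct2, THEN conjunct1, rule_format]
lemmas onto = res_props[THEN conjunct2, THEN conjunct2, THEN conjunct2, THEN conjunct2, THEN conjunct1, rule_format]
lemmas ker0 = res_props[THEN conjunct2, THEN conjunct2, THEN conjunct2, THEN conjunct2, THEN conjunct2, THEN conjunct1, rule_format]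
lemmas ker = res_props[THEN conjunct2, THEN conjunct2, THEN conjunct2, THEN conjunct2, THEN conjunct2, THEN conjunct2, THEN conjunct1, rule_format]
lemmas minimal = res_props[THEN conjunct2, THEN conjunct2, THEN conjunct2, THEN conjunct2, THEN conjunct2, THEN conjunct2, THEN conjunct2, rule_format]

text \<open>The graded pieces of the syzygy modules: \<open>N i\<close> is the image of
  \<open>\<phi> i\<close> in \<open>F i\<close>, hence by exactness the kernel of the preceding map,
  or of the augmentation modulo I when \<open>i = 0\<close>.\<close>

definition N :: "nat \<Rightarrow> nat \<Rightarrow> ('v, 'k) mvec set" where
  "N i k = {u \<in> F i k. u \<in> \<phi> i ` free_module V (B (Suc i))}"

lemma N_0: "N 0 k = {u \<in> F 0 k. \<epsilon> u \<in> I}"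
  using ker0 by (auto simp: N_def free_piece_def)

lemma N_Suc: "N (Suc i) k = {u \<in> F (Suc i) k. \<phi> i u = 0}"
  unfolding N_def ker by (auto simp: free_piece_def)

lemma \<phi>_piece: "u \<in> F (Suc i) k \<Longrightarrow> \<phi> i u \<in> N i k"
  using linear_over_maps[OF \<phi>_lin] \<phi>_gr by (auto simp: N_def free_piece_def)

text \<open>A homogeneous element of the image has a homogeneous preimage, namely the component in
  its degree of an arbitrary one.\<close>

lemma N_image:
  assumes "y \<in> N i k"
  obtains u where "u \<in> F (Suc i) k" "\<phi> i u = y"
proof -
  obtain u where u: "u \<in> free_module V (B (Suc i))" "y = \<phi> i u" using assms by (auto simp: N_def)
  have "\<phi> i (vcomp (\<delta> (Suc i)) k u) = vcomp (\<delta> i) k y"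
    unfolding u(2) by (rule vcomp_linear[OF \<phi>_lin \<phi>_gr u(1)])
  also have "\<dots> = y" using assms vcomp_homogeneous[of "\<delta> i" k y k] by (auto simp: N_def free_piece_def)
  finally show thesis using that vcomp_piece[OF u(1)] by blast
qed

text \<open>Minimality enters through this fact: a syzygy has no constant entries.\<close>

lemma N_const: "y \<in> N i k \<Longrightarrow> coeff (Poly_Mapping.lookup y e) 0 = 0"
  using minimal by (auto simp: N_def irrelevant_ideal_def)

lemma F_module: "u \<in> F i k \<Longrightarrow> u \<in> free_module V (B i)"
  by (rule free_piece_module)

lemma \<phi>_add: "u \<in> F (Suc i) k \<Longrightarrow> w \<in> F (Suc i) k \<Longrightarrow> \<phi> i (u + w) = \<phi> i u + \<phi> i w"
  using linear_over_add[OF \<phi>_lin] F_module by blast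

lemma \<phi>_scale: "u \<in> F (Suc i) k \<Longrightarrow> \<phi> i (vscale c u) = vscale c (\<phi> i u)"
  unfolding vscale_def using linear_over_scale[OF \<phi>_lin poly_ring_const] F_module by blast

lemma \<phi>_var: "v \<in> V \<Longrightarrow> u \<in> F (Suc i) k \<Longrightarrow> \<phi> i (mvec_scale (var v) u) = mvec_scale (var v) (\<phi> i u)"
  using linear_over_scale[OF \<phi>_lin poly_ring_var] F_module by blast

lemma graded_F: "v.graded (F i)"
  by (rule graded_free_piece[OF V ix])

lemma subspace_F: "v.subspace (F i k)"
  using graded_F by (rule v.graded_subspace)

lemma graded_N: "v.graded (N i)"
proof -
  have "x + y \<in> N i k" if x: "x \<in> N i k" and y: "y \<in> N i k" for x y k
  proof -
    obtain u where "u \<in> F (Suc i) k" "\<phi> i u = x" by (rule N_image[OF x])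
    moreover obtain w where "w \<in> F (Suc i) k" "\<phi> i w = y" by (rule N_image[OF y])
    ultimately show ?thesis using \<phi>_piece[of "u + w" i k] \<phi>_add[of u i k w] v.subspace_add[OF subspace_F] by metis
  qed
  moreover have "vscale c x \<in> N i k" if x: "x \<in> N i k" for c x k
  proof -
    obtain u where "u \<in> F (Suc i) k" "\<phi> i u = x" by (rule N_image[OF x])
    then show ?thesis using \<phi>_piece[of "vscale c u" i k] \<phi>_scale[of u i k c] v.subspace_scale[OF subspace_F] by metis
  qed
  moreover have "mvec_scale (var v) x \<in> N i (Suc k)" if x: "x \<in> N i k" and "v \<in> V" for v x k
  proof -
    obtain u where u: "u \<in> F (Suc i) k" "\<phi> i u = x" by (rule N_image[OF x])
    have "mvec_scale (var v) u \<in> F (Suc i) (Suc k)" using graded_F u \<open>v \<in> V\<close> by (auto simp: v.graded_def)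
    then show ?thesis using \<phi>_piece \<phi>_var[OF \<open>v \<in> V\<close> u(1)] u(2) by metis
  qed
  moreover have "0 \<in> N i k" for k
    using \<phi>_piece[of 0 i k] v.subspace_0[OF subspace_F] linear_over_zero[OF \<phi>_lin] by auto
  ultimately show ?thesis unfolding v.graded_def v.subspace_def by blast
qed

lemma graded_zero: "v.graded (\<lambda>_. {0})"
  by (auto simp: v.graded_def v.subspace_def)

lemma exact_F:
  assumes "f \<in> kchain V q (F i (Suc k))" "v.d f = 0" "\<And>e. coeff (Poly_Mapping.lookup (f {}) e) 0 = 0"
  shows "\<exists>g\<in>kchain V (Suc q) (F i k). v.d g = f"
  by (rule free_module_koszul_exact[OF V ix assms])

lemma acyclic_F:
  assumes "f \<in> kchain V (Suc q) (F i (Suc k))" "v.d f = 0"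
  shows "\<exists>g\<in>kchain V (Suc (Suc q)) (F i k). v.d g = f"
proof -
  have "f {} = 0" by (rule kchain_outside[OF assms(1)]) simp
  then show ?thesis by (intro exact_F[OF assms]) simp
qed

text \<open>Includes homological degree 0, where exactness over the free module fails for constants;
  the values are syzygies and have none.\<close>

lemma lift_N:
  assumes "y \<in> kchain V q (N i (Suc (Suc k)))" "v.d y = 0"
  shows "\<exists>f\<in>kchain V (Suc q) (F i (Suc k)). v.d f = y"
proof -
  have "y {} \<in> N i (Suc (Suc k))"
    using assms(1) by (rule kchain_all) (rule v.subspace_0[OF v.graded_subspace[OF graded_N]])
  then show ?thesis
    using assms by (intro exact_F N_const) (auto elim!: kchain_mono simp: N_def)
qed

text \<open>The dimension shift for the short exact sequence of \<open>N (Suc j)\<close>,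
  \<open>F (Suc j)\<close> and \<open>N j\<close>, with zero submodule on the right.\<close>

lemma syzygy_shift:
  assumes "quot_basis (\<lambda>c f S. vscale c (f S))
      (kcyc vscale (\<lambda>v. mvec_scale (var v)) V ix (N (Suc j)) (\<lambda>_. {0}) q (Suc k))
      (kbnd vscale (\<lambda>v. mvec_scale (var v)) V ix (N (Suc j)) (\<lambda>_. {0}) q (Suc k)) J b"
  shows "\<exists>b'. quot_basis (\<lambda>c f S. vscale c (f S))
      (kcyc vscale (\<lambda>v. mvec_scale (var v)) V ix (N j) (\<lambda>_. {0}) (Suc q) k)
      (kbnd vscale (\<lambda>v. mvec_scale (var v)) V ix (N j) (\<lambda>_. {0}) (Suc q) k) J b'"
proof (rule koszul_dimension_shift[where \<psi> = "\<phi> j" and F = "F (Suc j)" and M = "N (Suc j)"])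
  show "koszul (vscale :: 'k \<Rightarrow> ('v, 'k) mvec \<Rightarrow> _) (\<lambda>v. mvec_scale (var v)) V ix" by unfold_locales
  show "koszul (vscale :: 'k \<Rightarrow> ('v, 'k) mvec \<Rightarrow> _) (\<lambda>v. mvec_scale (var v)) V ix" by unfold_locales
  show "v.graded (F (Suc j))" by (rule graded_F)
  show "v.graded (N (Suc j))" "v.graded (N j)" by (rule graded_N)+
  show "v.graded (\<lambda>_. {0})" by (rule graded_zero)
  show "{0} \<subseteq> N j k" for k using v.subspace_0[OF v.graded_subspace[OF graded_N]] by simp
  show "\<phi> j x \<in> N j k" if "x \<in> F (Suc j) k" for k x using that by (rule \<phi>_piece)
  show "\<phi> j (x + y) = \<phi> j x + \<phi> j y" if "x \<in> F (Suc j) k" "y \<in> F (Suc j) k" for k x y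
    using that by (rule \<phi>_add)
  show "\<phi> j (vscale c x) = vscale c (\<phi> j x)" if "x \<in> F (Suc j) k" for k c x
    using that by (rule \<phi>_scale)
  show "\<phi> j (mvec_scale (var v) x) = mvec_scale (var v) (\<phi> j x)" if "v \<in> V" "x \<in> F (Suc j) k" for k v x
    using that by (rule \<phi>_var)
  show "\<exists>x\<in>F (Suc j) k. \<phi> j x - a \<in> {0}" if "a \<in> N j k" for k a
    using N_image[OF that] by (metis diff_self singletonI)
  show "N (Suc j) k = {x \<in> F (Suc j) k. \<phi> j x \<in> {0}}" for k by (simp add: N_Suc)
  show "\<exists>f\<in>kchain V (Suc q) (F (Suc j) (Suc k)). v.d f = y"
    if "y \<in> kchain V q (N (Suc j) (Suc (Suc k)))" "v.d y = 0" for y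
    using that by (rule lift_N)
  show "\<exists>g\<in>kchain V (Suc (Suc q)) (F (Suc j) k). v.d g = f"
    if "f \<in> kchain V (Suc q) (F (Suc j) (Suc k))" "v.d f = 0" for f
    using that by (rule acyclic_F)
qed (rule assms)

lemma graded_I: "p.graded (\<lambda>k. poly_piece V k \<inter> I)"
proof -
  have "pscale c x \<in> I" if "x \<in> I" for c x
    using I that poly_ring_const unfolding pscale_def homogeneous_ideal_def by blast
  moreover have "var v * x \<in> I" if "v \<in> V" "x \<in> I" for v x
    using I that poly_ring_var[of v V] unfolding homogeneous_ideal_def by blast
  ultimately show ?thesis
    using graded_poly_piece[OF V ix, where 'k = 'k] I
    unfolding p.graded_def p.subspace_def homogeneous_ideal_def by blast
qed

text \<open>The last shift, for \<open>N 0\<close>, \<open>F 0\<close> and R/I. The lift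
  \<open>\<epsilon>\<close> is onto only modulo I, which is why a quotient module is represented by
  a pair of families of sets.\<close>

lemma ideal_shift:
  assumes "quot_basis (\<lambda>c f S. vscale c (f S))
      (kcyc vscale (\<lambda>v. mvec_scale (var v)) V ix (N 0) (\<lambda>_. {0}) q (Suc k))
      (kbnd vscale (\<lambda>v. mvec_scale (var v)) V ix (N 0) (\<lambda>_. {0}) q (Suc k)) J b"
  shows "\<exists>b'. quot_basis (\<lambda>c f S. pscale c (f S))
      (kcyc pscale (\<lambda>v p. var v * p) V ix (poly_piece V) (\<lambda>k. poly_piece V k \<inter> I) (Suc q) k)
      (kbnd pscale (\<lambda>v p. var v * p) V ix (poly_piece V) (\<lambda>k. poly_piece V k \<inter> I) (Suc q) k) J b'"
proof (rule koszul_dimension_shift[where \<psi> = \<epsilon> and F = "F 0" and M = "N 0"])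
  show "koszul (vscale :: 'k \<Rightarrow> ('v, 'k) mvec \<Rightarrow> _) (\<lambda>v. mvec_scale (var v)) V ix" by unfold_locales
  show "koszul (pscale :: 'k \<Rightarrow> ('v, 'k) mpoly \<Rightarrow> _) (\<lambda>v p. var v * p) V ix" by unfold_locales
  show "v.graded (F 0)" by (rule graded_F)
  show "v.graded (N 0)" by (rule graded_N)
  show "p.graded (poly_piece V)" by (rule graded_poly_piece[OF V ix])
  show "p.graded (\<lambda>k. poly_piece V k \<inter> I)" by (rule graded_I)
  show "poly_piece V k \<inter> I \<subseteq> poly_piece V k" for k by simp
  show maps: "\<epsilon> x \<in> poly_piece V k" if "x \<in> F 0 k" for k x
    using that linear_over_maps[OF \<epsilon>_lin] \<epsilon>_gr by (auto simp: poly_piece_def free_piece_def)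
  show "\<epsilon> (x + y) = \<epsilon> x + \<epsilon> y" if "x \<in> F 0 k" "y \<in> F 0 k" for k x y
    using that linear_over_add[OF \<epsilon>_lin] F_module by blast
  show "\<epsilon> (vscale c x) = pscale c (\<epsilon> x)" if "x \<in> F 0 k" for k c x
    unfolding vscale_def pscale_def using that linear_over_scale[OF \<epsilon>_lin poly_ring_const] F_module by blast
  show "\<epsilon> (mvec_scale (var v) x) = var v * \<epsilon> x" if "v \<in> V" "x \<in> F 0 k" for k v x
    using that linear_over_scale[OF \<epsilon>_lin poly_ring_var] F_module by blast
  show "\<exists>x\<in>F 0 k. \<epsilon> x - a \<in> poly_piece V k \<inter> I" if a: "a \<in> poly_piece V k" for k a
  proof -
    have "a \<in> poly_ring V" using a by (simp add: poly_piece_def)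
    then obtain u g where ug: "a = \<epsilon> u + g" "u \<in> free_module V (B 0)" "g \<in> I"
      using onto by blast
    define x where "x = vcomp (\<delta> 0) k u"
    have x: "x \<in> F 0 k" unfolding x_def by (rule vcomp_piece[OF ug(2)])
    have ex: "\<epsilon> x = pcomp k (\<epsilon> u)" unfolding x_def by (rule pcomp_linear[OF \<epsilon>_lin \<epsilon>_gr ug(2)])
    \<comment> \<open>Taking degree \<open>k\<close> components of
      \<open>a = \<epsilon> u + g\<close> leaves the component of \<open>g\<close> with the opposite
      sign, and I is closed under components.\<close>
    have "\<epsilon> x - a = Poly_Mapping.single 0 (-1) * pcomp k g"
    proof (rule poly_mapping_eqI)
      fix m
      show "coeff (\<epsilon> x - a) m = coeff (Poly_Mapping.single 0 (-1) * pcomp k g) m"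
      proof (cases "mdeg m = k")
        case True
        then show ?thesis unfolding ex by (simp add: ug(1) lookup_minus lookup_add)
      next
        case False
        then have "coeff a m = 0" using poly_pieceD(2)[OF a] by blast
        with False show ?thesis unfolding ex by (simp add: lookup_minus)
      qed
    qed
    also have "\<dots> \<in> I"
      using I ug(3) poly_ring_const unfolding homogeneous_ideal_def by blast
    finally have "\<epsilon> x - a \<in> I" .
    moreover have "\<epsilon> x - a \<in> poly_piece V k"
      using p.subspace_diff[OF p.graded_subspace[OF graded_poly_piece[OF V ix]] maps[OF x] a] .
    ultimately show ?thesis using x by blast
  qed
  show "N 0 k = {x \<in> F 0 k. \<epsilon> x \<in> poly_piece V k \<inter> I}" for k using maps by (auto simp: N_0)
  show "\<exists>f\<in>kchain V (Suc q) (F 0 (Suc k)). v.d f = y"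
    if "y \<in> kchain V q (N 0 (Suc (Suc k)))" "v.d y = 0" for y
    using that by (rule lift_N)
  show "\<exists>g\<in>kchain V (Suc (Suc q)) (F 0 k). v.d g = f"
    if "f \<in> kchain V (Suc q) (F 0 (Suc k))" "v.d f = 0" for f
    using that by (rule acyclic_F)
qed (rule assms)

lemma \<phi>_sum: "(\<And>v. v \<in> A \<Longrightarrow> u v \<in> F (Suc i) k) \<Longrightarrow> \<phi> i (\<Sum>v\<in>A. u v) = (\<Sum>v\<in>A. \<phi> i (u v))"
  by (rule linear_over_sum[OF \<phi>_lin]) (rule F_module)

text \<open>Homological degree 0 of the Koszul complex of a syzygy module N is N modulo the
  irrelevant ideal times N. Sending \<open>u\<close> to its image under \<open>\<phi> i\<close>
  identifies this with the next free module modulo the irrelevant ideal, because the kernel of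
  \<open>\<phi> i\<close> has no constant entries.\<close>

lemma syzygy_generators:
  "\<exists>b. quot_basis (\<lambda>c f S. vscale c (f S))
      (kcyc vscale (\<lambda>v. mvec_scale (var v)) V ix (N i) (\<lambda>_. {0}) 0 k)
      (kbnd vscale (\<lambda>v. mvec_scale (var v)) V ix (N i) (\<lambda>_. {0}) 0 k) {e \<in> B (Suc i). \<delta> (Suc i) e = Suc k} b"
proof -
  define f where "f = (\<lambda>u S. if S = ({}::'v set) then \<phi> i u else 0)"
  have empty: "S = {}" if "S \<subseteq> V" "card S = 0" for S
    using that V finite_subset[of S V] by simp
  have f_chain: "f u \<in> kchain V 0 (N i k)" if "u \<in> F (Suc i) k" for u k
  proof (rule kchainI)
    fix S assume "S \<subseteq> V" "card S = 0"
    then have "S = {}" by (rule empty)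
    then show "f u S \<in> N i k" using \<phi>_piece[OF that] by (simp add: f_def)
  qed (auto simp: f_def)
  have d_f: "v.d (f u) = 0" for u
    by (rule ext) (simp add: kdiff_def f_def)
  have d1: "v.d g = (\<lambda>S. if S = {} then \<Sum>v\<in>V. mvec_scale (var v) (g {v}) else 0)" if "g \<in> kchain V (Suc 0) A" for g A
  proof
    fix S
    have "g (insert v S) = 0" if "S \<subseteq> V" "S \<noteq> {}" "v \<in> V - S" for v
      using that finite_subset[OF \<open>S \<subseteq> V\<close> V] by (intro kchain_outside[OF \<open>g \<in> kchain V (Suc 0) A\<close>]) auto
    then show "v.d g S = (if S = {} then \<Sum>v\<in>V. mvec_scale (var v) (g {v}) else 0)"
      by (auto simp: kdiff_def ksgn_def)
  qed
  show ?thesis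
  proof (rule quot_basis_transfer_fun[OF v.vector_space_axioms vector_space_fun[OF v.vector_space_axioms]
      free_piece_basis[OF V] subspace_F v.kbnd_subspace[OF graded_N graded_zero], where f = f])
    show "f u \<in> kcyc vscale (\<lambda>v. mvec_scale (var v)) V ix (N i) (\<lambda>_. {0}) 0 k" if "u \<in> F (Suc i) (Suc k)" for u
      using f_chain[OF that] d_f by (simp add: kcyc_def)
    show "f (u + w) = f u + f w" if "u \<in> F (Suc i) (Suc k)" "w \<in> F (Suc i) (Suc k)" for u w
      using \<phi>_add[OF that] by (auto simp: f_def)
    show "f (vscale c u) = (\<lambda>S. vscale c (f u S))" if "u \<in> F (Suc i) (Suc k)" for c u
      using \<phi>_scale[OF that] by (auto simp: f_def)
  next
    fix z assume "z \<in> kcyc vscale (\<lambda>v. mvec_scale (var v)) V ix (N i) (\<lambda>_. {0}) 0 k"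
    then have z: "z \<in> kchain V 0 (N i (Suc k))" by (simp add: kcyc_def)
    have "z {} \<in> N i (Suc k)" using kchain_in[OF z, of "{}"] by simp
    then obtain u where u: "u \<in> F (Suc i) (Suc k)" "\<phi> i u = z {}" by (rule N_image)
    have "z S = f u S" for S
    proof (cases "S = {}")
      case False
      then have "z S = 0" using empty by (intro kchain_outside[OF z]) blast
      with False show ?thesis by (simp add: f_def)
    qed (simp add: f_def u(2))
    then have "z = f u" by (rule ext)
    then show "\<exists>u\<in>F (Suc i) (Suc k). z - f u \<in> kbnd vscale (\<lambda>v. mvec_scale (var v)) V ix (N i) (\<lambda>_. {0}) 0 k"
      using v.kbnd_zero[OF graded_N graded_zero] by (intro bexI[OF _ u(1)]) simp
  next
    fix u assume u: "u \<in> F (Suc i) (Suc k)"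
    show "u \<in> {u \<in> F (Suc i) (Suc k). \<forall>e. coeff (Poly_Mapping.lookup u e) 0 = 0} \<longleftrightarrow>
      f u \<in> kbnd vscale (\<lambda>v. mvec_scale (var v)) V ix (N i) (\<lambda>_. {0}) 0 k"
    proof
      assume "u \<in> {u \<in> F (Suc i) (Suc k). \<forall>e. coeff (Poly_Mapping.lookup u e) 0 = 0}"
      then obtain h where h: "\<And>v. v \<in> V \<Longrightarrow> h v \<in> F (Suc i) k" "u = (\<Sum>v\<in>V. mvec_scale (var v) (h v))"
        using free_piece_irrelevant[OF V ix u] by blast
      \<comment> \<open>The images of the cofactors of \<open>u\<close>, placed on the singletons,
        form a 1-chain of syzygies bounding the image of \<open>u\<close>.\<close>
      define g where "g = (\<lambda>S. if S \<subseteq> V \<and> card S = Suc 0 then \<phi> i (h (the_elem S)) else 0)"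
      have g: "g \<in> kchain V (Suc 0) (N i k)"
        using h(1) \<phi>_piece by (intro kchainI) (auto simp: g_def card_Suc_eq)
      have Xh: "mvec_scale (var v) (h v) \<in> F (Suc i) (Suc k)" if "v \<in> V" for v
        using graded_F h(1)[OF that] that by (auto simp: v.graded_def)
      have eq: "\<phi> i u = (\<Sum>v\<in>V. mvec_scale (var v) (g {v}))"
        unfolding h(2) by (subst \<phi>_sum[OF Xh]) (auto simp: g_def \<phi>_var[OF _ h(1)])
      have "f u = 0 + v.d g" unfolding f_def d1[OF g] eq by simp
      moreover have "0 \<in> kchain V 0 {0 :: ('v, 'k) mvec}" by (simp add: kchain_def)
      ultimately show "f u \<in> kbnd vscale (\<lambda>v. mvec_scale (var v)) V ix (N i) (\<lambda>_. {0}) 0 k"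
        using g unfolding kbnd_def by blast
    next
      assume "f u \<in> kbnd vscale (\<lambda>v. mvec_scale (var v)) V ix (N i) (\<lambda>_. {0}) 0 k"
      then obtain f0 g where g: "f u = f0 + v.d g" "f0 \<in> kchain V 0 {0}" "g \<in> kchain V (Suc 0) (N i k)"
        unfolding kbnd_def by blast
      have "f0 {} = 0" using kchain_all[OF g(2)] by simp
      then have eq: "\<phi> i u = (\<Sum>v\<in>V. mvec_scale (var v) (g {v}))"
        using fun_cong[OF g(1), of "{}"] by (simp add: d1[OF g(3)] f_def)
      have "\<forall>v\<in>V. \<exists>h. h \<in> F (Suc i) k \<and> \<phi> i h = g {v}"
        using kchain_in[OF g(3)] N_image by (metis card.empty card.insert empty_iff empty_subsetI finite.emptyI insert_subset)
      then obtain h where h: "\<And>v. v \<in> V \<Longrightarrow> h v \<in> F (Suc i) k" "\<And>v. v \<in> V \<Longrightarrow> \<phi> i (h v) = g {v}" by metis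
      have Xh: "mvec_scale (var v) (h v) \<in> F (Suc i) (Suc k)" if "v \<in> V" for v
        using graded_F h(1)[OF that] that by (auto simp: v.graded_def)
      \<comment> \<open>Lifting the bounding chain gives a vector \<open>w\<close> with the same
        image as \<open>u\<close> and without constants. The difference \<open>u - w\<close> is a
        syzygy, so \<open>u\<close> has no constants either.\<close>
      define w where "w = (\<Sum>v\<in>V. mvec_scale (var v) (h v))"
      have w: "w \<in> F (Suc i) (Suc k)" unfolding w_def by (rule v.subspace_sum[OF subspace_F Xh])
      have "\<phi> i w = \<phi> i u"
        unfolding w_def eq by (subst \<phi>_sum[OF Xh]) (auto simp: h(2) \<phi>_var[OF _ h(1)])
      moreover have uw: "u - w \<in> F (Suc i) (Suc k)" by (rule v.subspace_diff[OF subspace_F u w])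
      ultimately have "\<phi> i (u - w) = 0" using \<phi>_add[OF uw w] by simp
      then have "u - w \<in> N (Suc i) (Suc k)" using uw by (simp add: N_Suc)
      then have "coeff (Poly_Mapping.lookup (u - w) e) 0 = 0" for e by (rule N_const)
      moreover have "coeff (Poly_Mapping.lookup w e) 0 = 0" for e
        by (simp add: w_def lookup_sum coeff_var_times)
      ultimately show "u \<in> {u \<in> F (Suc i) (Suc k). \<forall>e. coeff (Poly_Mapping.lookup u e) 0 = 0}"
        using u by (simp add: lookup_minus)
    qed
  qed
qed

text \<open>Each shift trades one syzygy step for one homological degree, while the internal degree
  stays \<open>q + k + 2\<close>. It starts with the generators of \<open>N q\<close> in homological
  degree 0 and arrives at R/I in homological degree \<open>Suc q\<close>.\<close>

lemma resolution_basis_koszul_homology: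
  "\<exists>b. quot_basis (\<lambda>c f S. pscale c (f S))
      (kcyc pscale (\<lambda>v p. var v * p) V ix (poly_piece V) (\<lambda>k. poly_piece V k \<inter> I) (Suc q) k)
      (kbnd pscale (\<lambda>v p. var v * p) V ix (poly_piece V) (\<lambda>k. poly_piece V k \<inter> I) (Suc q) k)
      {e \<in> B (Suc q). \<delta> (Suc q) e = Suc q + k + 1} b"
proof -
  have "\<exists>b. quot_basis (\<lambda>c f S. vscale c (f S))
      (kcyc vscale (\<lambda>v. mvec_scale (var v)) V ix (N (q - r)) (\<lambda>_. {0}) r (Suc k + (q - r)))
      (kbnd vscale (\<lambda>v. mvec_scale (var v)) V ix (N (q - r)) (\<lambda>_. {0}) r (Suc k + (q - r)))
      {e \<in> B (Suc q). \<delta> (Suc q) e = Suc q + k + 1} b" if "r \<le> q" for r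
    using that
  proof (induction r)
    case 0
    then show ?case using syzygy_generators[of q "Suc k + q"] by (simp add: ac_simps)
  next
    case (Suc r)
    then have eq: "q - r = Suc (q - Suc r)" by simp
    obtain b where "quot_basis (\<lambda>c f S. vscale c (f S))
      (kcyc vscale (\<lambda>v. mvec_scale (var v)) V ix (N (Suc (q - Suc r))) (\<lambda>_. {0}) r (Suc (Suc k + (q - Suc r))))
      (kbnd vscale (\<lambda>v. mvec_scale (var v)) V ix (N (Suc (q - Suc r))) (\<lambda>_. {0}) r (Suc (Suc k + (q - Suc r))))
      {e \<in> B (Suc q). \<delta> (Suc q) e = Suc q + k + 1} b"
      using Suc.IH[OF Suc_leD[OF Suc.prems], unfolded eq add_Suc_right] by (elim exE)
    from syzygy_shift[OF this] show ?case .
  qed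
  from this[of q] obtain b where "quot_basis (\<lambda>c f S. vscale c (f S))
      (kcyc vscale (\<lambda>v. mvec_scale (var v)) V ix (N 0) (\<lambda>_. {0}) q (Suc k))
      (kbnd vscale (\<lambda>v. mvec_scale (var v)) V ix (N 0) (\<lambda>_. {0}) q (Suc k))
      {e \<in> B (Suc q). \<delta> (Suc q) e = Suc q + k + 1} b" by auto
  from ideal_shift[OF this] show ?thesis .
qed

end

section \<open>Existence of minimal graded free resolutions\<close>

lemma finite_monomials:
  assumes "finite V"
  shows "finite {m :: 'v \<Rightarrow>\<^sub>0 nat. Poly_Mapping.keys m \<subseteq> V \<and> mdeg m \<le> k}"
proof -
  let ?M = "{m :: 'v \<Rightarrow>\<^sub>0 nat. Poly_Mapping.keys m \<subseteq> V \<and> mdeg m \<le> k}"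
  have "Poly_Mapping.lookup ` ?M \<subseteq> {f. \<forall>x. (x \<in> V \<longrightarrow> f x \<in> {..k}) \<and> (x \<notin> V \<longrightarrow> f x = 0)}"
  proof (clarsimp, intro conjI impI)
    fix m :: "'v \<Rightarrow>\<^sub>0 nat" and x assume m: "Poly_Mapping.keys m \<subseteq> V" "mdeg m \<le> k"
    show "Poly_Mapping.lookup m x \<le> k" if "x \<in> V"
    proof -
      have "Poly_Mapping.lookup m x \<le> (\<Sum>v\<in>V. Poly_Mapping.lookup m v)"
        using assms that by (intro member_le_sum) auto
      then show ?thesis using mdeg_superset[OF assms m(1)] m(2) by simp
    qed
    show "Poly_Mapping.lookup m x = 0" if "x \<notin> V"
      using m(1) that by (auto simp: in_keys_iff)
  qed
  moreover have "finite {f :: 'v \<Rightarrow> nat. \<forall>x. (x \<in> V \<longrightarrow> f x \<in> {..k}) \<and> (x \<notin> V \<longrightarrow> f x = 0)}"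
    by (rule finite_set_of_finite_funs[OF assms]) simp
  ultimately have "finite (Poly_Mapping.lookup ` ?M)" by (rule finite_subset)
  then show ?thesis by (rule finite_imageD) (auto intro!: inj_onI poly_mapping_eqI)
qed

text \<open>Finitely many generators in each degree already make every graded piece
  finite-dimensional, since only degrees up to \<open>k\<close> contribute to piece
  \<open>k\<close>.\<close>

lemma free_piece_finite_span:
  assumes V: "finite V" and fin: "\<And>j. finite {e \<in> B. \<delta> e = j}"
  shows "\<exists>T. finite T \<and> (free_piece V B \<delta> k :: ('v, 'k::field) mvec set) \<subseteq> module.span vscale T"
proof -
  interpret vector_space "vscale :: 'k \<Rightarrow> ('v, 'k) mvec \<Rightarrow> _" by (rule vector_space_vscale)
  define E where "E = {e \<in> B. \<delta> e \<le> k}"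
  define L where "L = {m :: 'v \<Rightarrow>\<^sub>0 nat. Poly_Mapping.keys m \<subseteq> V \<and> mdeg m \<le> k}"
  define T where "T = (\<lambda>(e, m). Poly_Mapping.single e (Poly_Mapping.single m (1 :: 'k))) ` (E \<times> L)"
  have "E = (\<Union>j\<le>k. {e \<in> B. \<delta> e = j})" by (auto simp: E_def)
  then have finE: "finite E" using fin by simp
  have finL: "finite L" unfolding L_def by (rule finite_monomials[OF V])
  have "u \<in> span T" if u: "u \<in> free_piece V B \<delta> k" for u :: "('v, 'k) mvec"
  proof -
    have "u = (\<Sum>e\<in>E. \<Sum>m\<in>L. vscale (coeff (Poly_Mapping.lookup u e) m) (Poly_Mapping.single e (Poly_Mapping.single m 1)))"
      (is "u = ?r")
    proof (rule poly_mapping_eqI2)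
      fix e m
      have "coeff (Poly_Mapping.lookup ?r e) m =
          (\<Sum>e'\<in>E. \<Sum>m'\<in>L. if e' = e then if m' = m then coeff (Poly_Mapping.lookup u e) m else 0 else 0)"
        by (auto simp: lookup_sum lookup_vscale lookup_single when_def intro!: sum.cong)
      also have "\<dots> = (\<Sum>e'\<in>E. if e' = e then if m \<in> L then coeff (Poly_Mapping.lookup u e) m else 0 else 0)"
        using finL by (intro sum.cong) auto
      also have "\<dots> = (if e \<in> E \<and> m \<in> L then coeff (Poly_Mapping.lookup u e) m else 0)"
        using finE by simp
      also have "\<dots> = coeff (Poly_Mapping.lookup u e) m"
      proof (cases "coeff (Poly_Mapping.lookup u e) m = 0")
        case False
        from free_pieceD[OF u this] show ?thesis by (simp add: E_def L_def)
      qed simp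
      finally show "coeff (Poly_Mapping.lookup u e) m = coeff (Poly_Mapping.lookup ?r e) m" by simp
    qed
    also have "\<dots> \<in> span T"
      by (intro span_sum span_scale span_base) (auto simp: T_def)
    finally show ?thesis .
  qed
  then show ?thesis using finE finL by (intro exI[of _ T]) (auto simp: T_def)
qed

section \<open>Minimal generators of graded submodules\<close>

definition graded_submodule ::
  "'v set \<Rightarrow> nat set \<Rightarrow> (nat \<Rightarrow> nat) \<Rightarrow> ('v, 'k::field) mvec set \<Rightarrow> bool" where
  "graded_submodule V B \<delta> M \<longleftrightarrow> M \<subseteq> free_module V B \<and> 0 \<in> M \<and> (\<forall>u\<in>M. \<forall>w\<in>M. u + w \<in> M) \<and>
    (\<forall>p\<in>poly_ring V. \<forall>u\<in>M. mvec_scale p u \<in> M) \<and> (\<forall>u\<in>M. \<forall>k. vcomp \<delta> k u \<in> M)"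

lemma mvec_scale_homogeneous:
  assumes "homogeneous a p" "mvec_homogeneous \<delta> b u"
  shows "mvec_homogeneous \<delta> (a + b) (mvec_scale p u)"
proof (rule mvec_homogeneousI)
  fix e m assume "coeff (Poly_Mapping.lookup (mvec_scale p u) e) m \<noteq> 0"
  then have "m \<in> Poly_Mapping.keys (p * Poly_Mapping.lookup u e)" by (simp add: in_keys_iff)
  then obtain x y where "m = x + y" "x \<in> Poly_Mapping.keys p" "y \<in> Poly_Mapping.keys (Poly_Mapping.lookup u e)"
    using keys_mult[of p "Poly_Mapping.lookup u e"] by blast
  then show "mdeg m + \<delta> e = a + b"
    using homogeneousD[OF assms(1)] mvec_homogeneousD[OF assms(2)] by (simp add: in_keys_iff mdeg_add)
qed

lemma mvec_homogeneous_sum: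
  assumes "\<And>i. i \<in> A \<Longrightarrow> mvec_homogeneous \<delta> d (f i)"
  shows "mvec_homogeneous \<delta> d (\<Sum>i\<in>A. f i)"
proof (rule mvec_homogeneousI)
  fix e m assume "coeff (Poly_Mapping.lookup (\<Sum>i\<in>A. f i) e) m \<noteq> 0"
  then obtain i where "i \<in> A" "coeff (Poly_Mapping.lookup (f i) e) m \<noteq> 0"
    unfolding lookup_sum using sum.not_neutral_contains_not_neutral by blast
  then show "mdeg m + \<delta> e = d" using mvec_homogeneousD[OF assms] by blast
qed

definition gen_map :: "(nat \<Rightarrow> ('v, 'k::field) mvec) \<Rightarrow> ('v, 'k) mvec \<Rightarrow> ('v, 'k) mvec" where
  "gen_map gen u = (\<Sum>e\<in>Poly_Mapping.keys u. mvec_scale (Poly_Mapping.lookup u e) (gen e))"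

lemma gen_map_superset:
  assumes "finite A" "Poly_Mapping.keys u \<subseteq> A"
  shows "gen_map gen u = (\<Sum>e\<in>A. mvec_scale (Poly_Mapping.lookup u e) (gen e))"
  unfolding gen_map_def
  by (rule sum.mono_neutral_left) (use assms in \<open>auto simp: in_keys_iff\<close>)

lemma gen_map_add: "gen_map gen (u + w) = gen_map gen u + gen_map gen w"
proof -
  let ?A = "Poly_Mapping.keys u \<union> Poly_Mapping.keys w"
  have "Poly_Mapping.keys (u + w) \<subseteq> ?A" by (rule Poly_Mapping.keys_add)
  then show ?thesis
    using gen_map_superset[of ?A u gen] gen_map_superset[of ?A w gen] gen_map_superset[of ?A "u + w" gen]
    by (simp add: lookup_add mvec_scale_add_left sum.distrib)
qed

lemma mvec_scale_sum: "mvec_scale p (\<Sum>i\<in>A. f i) = (\<Sum>i\<in>A. mvec_scale p (f i))"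
  by (induction A rule: infinite_finite_induct) (auto simp: mvec_scale_add)

lemma gen_map_scale: "gen_map gen (mvec_scale p u) = mvec_scale p (gen_map gen u)"
proof -
  have "Poly_Mapping.keys (mvec_scale p u) \<subseteq> Poly_Mapping.keys u" by (auto simp: in_keys_iff)
  then show ?thesis
    using gen_map_superset[of "Poly_Mapping.keys u" "mvec_scale p u" gen]
    by (simp add: gen_map_def[of gen u] mvec_scale_sum mvec_scale_assoc)
qed

lemma gen_map_single [simp]: "gen_map gen (Poly_Mapping.single e p) = mvec_scale p (gen e)"
  using gen_map_superset[of "{e}" "Poly_Mapping.single e p" gen] by (simp add: keys_single)

lemma gen_map_sum: "gen_map gen (\<Sum>i\<in>A. f i) = (\<Sum>i\<in>A. gen_map gen (f i))"
  by (induction A rule: infinite_finite_induct) (auto simp: gen_map_add, simp_all add: gen_map_def)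

lemma mvec_scale_one [simp]: "mvec_scale 1 u = u"
  by (rule poly_mapping_eqI) simp

text \<open>Graded Nakayama: in every degree choose representatives of a basis of M modulo the
  irrelevant ideal times M. They generate by induction on the degree, and a relation with a nonzero
  constant entry would contradict independence in the degree of that entry. Finiteness in each
  degree is passed on to the new free module, so the step can be iterated.\<close>

lemma minimal_generators_exist:
  fixes V :: "'v set" and M :: "('v, 'k::field) mvec set" and ix :: "'v \<Rightarrow> nat"
  assumes V: "finite V" and ix: "inj_on ix V" and fin: "\<And>j. finite {e \<in> B. \<delta> e = j}"
    and M: "graded_submodule V B \<delta> M"
  shows "\<exists>B' \<delta>' \<phi>. (\<forall>j. finite {e \<in> B'. \<delta>' e = j}) \<and>
    linear_over (poly_ring V) mvec_scale mvec_scale (free_module V B') (free_module V B) \<phi> \<and>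
    (\<forall>d. \<forall>u\<in>free_module V B'. mvec_homogeneous \<delta>' d u \<longrightarrow> mvec_homogeneous \<delta> d (\<phi> u)) \<and>
    \<phi> ` free_module V B' = M \<and>
    (\<forall>u\<in>free_module V B'. \<phi> u = 0 \<longrightarrow> (\<forall>e. coeff (Poly_Mapping.lookup u e) 0 = 0))"
proof -
  interpret koszul "vscale :: 'k \<Rightarrow> ('v, 'k) mvec \<Rightarrow> _" "\<lambda>v. mvec_scale (var v)" V ix
    by (rule koszul_vscale[OF V ix])
  have M_F: "M \<subseteq> free_module V B" and M_0: "0 \<in> M" and M_add: "\<And>u w. u \<in> M \<Longrightarrow> w \<in> M \<Longrightarrow> u + w \<in> M"
    and M_scale: "\<And>p u. p \<in> poly_ring V \<Longrightarrow> u \<in> M \<Longrightarrow> mvec_scale p u \<in> M"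
    and M_comp: "\<And>u k. u \<in> M \<Longrightarrow> vcomp \<delta> k u \<in> M"
    using M unfolding graded_submodule_def by blast+
  have M_sum: "(\<Sum>i\<in>A. f i) \<in> M" if "\<And>i. i \<in> A \<Longrightarrow> f i \<in> M" for A and f :: "'i \<Rightarrow> ('v, 'k) mvec"
    using that by (induction A rule: infinite_finite_induct) (auto simp: M_0 M_add)
  define Mk where "Mk = (\<lambda>k. M \<inter> free_piece V B \<delta> k)"
  \<comment> \<open>The piece one degree below \<open>k\<close>, which is zero below degree 0. Then
    \<open>W k\<close> is the degree \<open>k\<close> part of the irrelevant ideal times M.\<close>
  define Mp where "Mp = (\<lambda>k. if k = 0 then {0} else Mk (k - 1))"
  define W where "W = (\<lambda>k. {w. \<exists>h. (\<forall>v\<in>V. h v \<in> Mp k) \<and> w = (\<Sum>v\<in>V. mvec_scale (var v) (h v))})"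
  have gF: "graded (free_piece V B \<delta>)" by (rule graded_free_piece[OF V ix])
  have gM: "graded Mk"
    using gF M_0 M_add M_scale[OF poly_ring_const] M_scale[OF poly_ring_var]
    unfolding graded_def subspace_def Mk_def vscale_def by blast
  have sMk: "subspace (Mk k)" for k using gM by (rule graded_subspace)
  have sMp: "subspace (Mp k)" for k using sMk by (simp add: Mp_def subspace_def)
  have MpX: "mvec_scale (var v) h \<in> Mk k" if "v \<in> V" "h \<in> Mp k" for v h k
    using gM that subspace_0[OF sMk] by (cases k) (auto simp: Mp_def graded_def)
  have WM: "W k \<subseteq> Mk k" for k
    using MpX by (auto simp: W_def intro!: subspace_sum[OF sMk])
  have sW: "subspace (W k)" for k
    unfolding subspace_def
  proof (intro conjI ballI allI)
    show "0 \<in> W k" unfolding W_def using subspace_0[OF sMp] by (intro CollectI exI[of _ "\<lambda>_. 0"]) simp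
    show "x + y \<in> W k" if x: "x \<in> W k" and y: "y \<in> W k" for x y
    proof -
      obtain h where h: "\<forall>v\<in>V. h v \<in> Mp k" "x = (\<Sum>v\<in>V. mvec_scale (var v) (h v))" using x by (auto simp: W_def)
      obtain g where g: "\<forall>v\<in>V. g v \<in> Mp k" "y = (\<Sum>v\<in>V. mvec_scale (var v) (g v))" using y by (auto simp: W_def)
      show ?thesis unfolding W_def
        using h g subspace_add[OF sMp]
        by (intro CollectI exI[of _ "\<lambda>v. h v + g v"]) (simp add: mvec_scale_add sum.distrib)
    qed
    show "vscale c x \<in> W k" if x: "x \<in> W k" for c x
    proof -
      obtain h where h: "\<forall>v\<in>V. h v \<in> Mp k" "x = (\<Sum>v\<in>V. mvec_scale (var v) (h v))" using x by (auto simp: W_def)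
      show ?thesis unfolding W_def
        using h subspace_scale[OF sMp]
        by (intro CollectI exI[of _ "\<lambda>v. vscale c (h v)"]) (simp add: scale_sum_right X_scale)
    qed
  qed
  have "\<exists>D. finite D \<and> quot_basis vscale (Mk k) (W k) D id" for k
  proof -
    obtain T where T: "finite T" "(free_piece V B \<delta> k :: ('v,'k) mvec set) \<subseteq> span T"
      using free_piece_finite_span[OF V fin] by blast
    then have "Mk k \<subseteq> span T" by (auto simp: Mk_def)
    from quot_basis_exists[OF vector_space_axioms sMk sW WM T(1) this] show ?thesis .
  qed
  then obtain D where D: "\<And>k. finite (D k)" "\<And>k. quot_basis vscale (Mk k) (W k) (D k) id" by metis
  have "\<exists>b. bij_betw b {..<card (D k)} (D k)" for k
    using ex_bij_betw_nat_finite[OF D(1)] by (simp add: atLeast0LessThan)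
  then obtain b where b: "\<And>k. bij_betw (b k) {..<card (D k)} (D k)" by metis
  \<comment> \<open>Basis elements must be natural numbers: a generator is coded by the pair of its
    degree and its position in that degree, so different degrees cannot collide.\<close>
  define \<delta>' where "\<delta>' = (\<lambda>e. fst (prod_decode e))"
  define B' where "B' = {e. snd (prod_decode e) < card (D (\<delta>' e))}"
  define gen where "gen = (\<lambda>e. b (\<delta>' e) (snd (prod_decode e)))"
  define F where "F = free_piece V B' \<delta>'"
  have slice: "{e \<in> B'. \<delta>' e = k} = (\<lambda>j. prod_encode (k, j)) ` {..<card (D k)}" for k
  proof -
    have "e \<in> (\<lambda>j. prod_encode (k, j)) ` {..<card (D k)}" if "e \<in> B'" "\<delta>' e = k" for e
    proof -
      have "prod_encode (k, snd (prod_decode e)) = e" using that by (auto simp: \<delta>'_def)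
      then show ?thesis using that by (intro image_eqI[of _ _ "snd (prod_decode e)"]) (auto simp: B'_def)
    qed
    then show ?thesis by (auto simp: B'_def \<delta>'_def)
  qed
  have finB': "finite {e \<in> B'. \<delta>' e = k}" for k unfolding slice by simp
  have gen_bij: "bij_betw gen {e \<in> B'. \<delta>' e = k} (D k)" for k
  proof -
    have "bij_betw (\<lambda>j. prod_encode (k, j)) {..<card (D k)} {e \<in> B'. \<delta>' e = k}"
      unfolding slice by (rule bij_betw_imageI) (auto intro!: inj_onI)
    moreover have "bij_betw (gen \<circ> (\<lambda>j. prod_encode (k, j))) {..<card (D k)} (D k)"
      using b[of k] by (simp add: gen_def \<delta>'_def comp_def)
    ultimately show ?thesis using bij_betw_comp_iff by blast
  qed
  have gb: "quot_basis vscale (Mk k) (W k) {e \<in> B'. \<delta>' e = k} gen" for k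
    using quot_basis_reindex[OF D(2) gen_bij, of k] by simp
  have gen_M: "gen e \<in> Mk (\<delta>' e)" if "e \<in> B'" for e
    using quot_basis_in[OF gb, of e "\<delta>' e"] that by simp
  have gen_M': "gen e \<in> M" if "e \<in> B'" for e using gen_M[OF that] by (simp add: Mk_def)
  define \<phi> where "\<phi> = gen_map gen"
  have \<phi>_M: "\<phi> u \<in> M" if "u \<in> free_module V B'" for u
  proof -
    have "Poly_Mapping.lookup u e \<in> poly_ring V" "e \<in> Poly_Mapping.keys u \<Longrightarrow> e \<in> B'" for e
      using that by (auto simp: free_module_def)
    then show ?thesis unfolding \<phi>_def gen_map_def by (intro M_sum M_scale gen_M') auto
  qed
  have lin: "linear_over (poly_ring V) mvec_scale mvec_scale (free_module V B') (free_module V B) \<phi>"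
    using \<phi>_M M_F by (auto simp: linear_over_def \<phi>_def gen_map_add gen_map_scale)
  have gr: "mvec_homogeneous \<delta> d (\<phi> u)" if u: "u \<in> free_module V B'" "mvec_homogeneous \<delta>' d u" for d u
    unfolding \<phi>_def gen_map_def
  proof (rule mvec_homogeneous_sum)
    fix e assume e: "e \<in> Poly_Mapping.keys u"
    then have "e \<in> B'" using u by (auto simp: free_module_def)
    then have "mvec_homogeneous \<delta> (\<delta>' e) (gen e)" using gen_M by (simp add: Mk_def free_piece_def)
    moreover have "homogeneous (d - \<delta>' e) (Poly_Mapping.lookup u e)"
      using mvec_homogeneousD[OF u(2)] by (intro homogeneousI) (metis diff_add_inverse2)
    ultimately have "mvec_homogeneous \<delta> (d - \<delta>' e + \<delta>' e) (mvec_scale (Poly_Mapping.lookup u e) (gen e))"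
      by (intro mvec_scale_homogeneous)
    moreover have "\<delta>' e \<le> d"
    proof -
      have "Poly_Mapping.lookup u e \<noteq> 0" using e by (simp add: in_keys_iff)
      then obtain m where "coeff (Poly_Mapping.lookup u e) m \<noteq> 0" by (metis lookup_zero poly_mapping_eqI)
      from mvec_homogeneousD[OF u(2) this] show ?thesis by simp
    qed
    ultimately show "mvec_homogeneous \<delta> d (mvec_scale (Poly_Mapping.lookup u e) (gen e))" by simp
  qed
  have F'_sum: "(\<Sum>i\<in>A. f i) \<in> free_module V B'" if "\<And>i. i \<in> A \<Longrightarrow> f i \<in> free_module V B'"
    for A and f :: "'i \<Rightarrow> ('v, 'k) mvec"
    using that by (rule free_module_sum)
  have onto_k: "Mk k \<subseteq> \<phi> ` free_module V B'" for k
  proof (induction k rule: less_induct)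
    case (less k)
    show ?case
    proof
      fix y assume y: "y \<in> Mk k"
      \<comment> \<open>Modulo variables times elements of degree \<open>k - 1\<close>, which are
        images by induction, \<open>y\<close> is a combination of the chosen generators of degree
        \<open>k\<close>.\<close>
      obtain E c where E: "finite E" "E \<subseteq> {e \<in> B'. \<delta>' e = k}" "y - (\<Sum>e\<in>E. vscale (c e) (gen e)) \<in> W k"
        using quot_basis_spans[OF gb y] by blast
      then obtain h where h: "\<And>v. v \<in> V \<Longrightarrow> h v \<in> Mp k"
        "y - (\<Sum>e\<in>E. vscale (c e) (gen e)) = (\<Sum>v\<in>V. mvec_scale (var v) (h v))" unfolding W_def by blast
      have "\<exists>g\<in>free_module V B'. h v = \<phi> g" if v: "v \<in> V" for v
      proof (cases "k = 0")
        case True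
        then have "h v = \<phi> 0" using h(1)[OF v] by (simp add: Mp_def \<phi>_def gen_map_def)
        then show ?thesis using free_module_zero by blast
      next
        case False
        then show ?thesis using h(1)[OF v] less.IH[of "k - 1"] by (auto simp: Mp_def)
      qed
      then obtain g where g: "\<And>v. v \<in> V \<Longrightarrow> g v \<in> free_module V B'" "\<And>v. v \<in> V \<Longrightarrow> h v = \<phi> (g v)" by metis
      define x where "x = (\<Sum>v\<in>V. mvec_scale (var v) (g v)) +
        (\<Sum>e\<in>E. vscale (c e) (Poly_Mapping.single e 1))"
      have s1: "mvec_scale (var v) (g v) \<in> free_module V B'" if "v \<in> V" for v
        using that g(1) by (intro free_module_scale poly_ring_var)
      have s2: "vscale (c e) (Poly_Mapping.single e 1) \<in> (free_module V B' :: ('v,'k) mvec set)" if "e \<in> E" for e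
        unfolding vscale_def using that E(2)
        by (intro free_module_scale poly_ring_const free_moduleI)
          (auto simp: lookup_single lookup_one when_def split: if_splits)
      have x: "x \<in> free_module V B'" unfolding x_def by (intro free_module_add F'_sum s1 s2)
      have "\<phi> x = (\<Sum>v\<in>V. mvec_scale (var v) (h v)) + (\<Sum>e\<in>E. vscale (c e) (gen e))"
      proof -
        have "\<phi> x = (\<Sum>v\<in>V. mvec_scale (var v) (\<phi> (g v))) + (\<Sum>e\<in>E. vscale (c e) (gen e))"
          by (simp add: x_def \<phi>_def gen_map_add gen_map_sum gen_map_scale vscale_def)
        also have "(\<Sum>v\<in>V. mvec_scale (var v) (\<phi> (g v))) = (\<Sum>v\<in>V. mvec_scale (var v) (h v))"
          by (intro sum.cong) (simp_all add: g(2))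
        finally show ?thesis .
      qed
      then have "\<phi> x = y" unfolding h(2)[symmetric] by simp
      then show "y \<in> \<phi> ` free_module V B'" using x by blast
    qed
  qed
  have onto: "\<phi> ` free_module V B' = M"
  proof
    show "\<phi> ` free_module V B' \<subseteq> M" using \<phi>_M by blast
    show "M \<subseteq> \<phi> ` free_module V B'"
    proof
      fix y assume y: "y \<in> M"
      obtain K where K: "finite K" "\<And>K'. finite K' \<Longrightarrow> K \<subseteq> K' \<Longrightarrow> (\<Sum>k\<in>K'. vcomp \<delta> k y) = y"
        using vcomp_decompose by blast
      have yk: "vcomp \<delta> k y \<in> Mk k" for k
        using M_comp[OF y] vcomp_piece[OF subsetD[OF M_F y]] by (simp add: Mk_def)
      have "\<exists>u. u \<in> free_module V B' \<and> \<phi> u = vcomp \<delta> k y" for k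
        using subsetD[OF onto_k yk[of k]] by (simp add: image_iff) (metis)
      then obtain u where u: "\<And>k. u k \<in> free_module V B'" "\<And>k. \<phi> (u k) = vcomp \<delta> k y" by metis
      have "\<phi> (\<Sum>k\<in>K. u k) = y" by (simp add: linear_over_sum[OF lin u(1)] u(2) K)
      moreover have "(\<Sum>k\<in>K. u k) \<in> free_module V B'" by (rule F'_sum[OF u(1)])
      ultimately show "y \<in> \<phi> ` free_module V B'" by (intro image_eqI) simp_all
    qed
  qed
  have min: "coeff (Poly_Mapping.lookup u e) 0 = 0" if u: "u \<in> free_module V B'" "\<phi> u = 0" for u e
  proof (cases "e \<in> B'")
    case False
    then show ?thesis using free_moduleD(1)[OF u(1)] by blast
  next
    case e: True
    define k where "k = \<delta>' e"
    define w where "w = vcomp \<delta>' k u"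
    have w: "w \<in> free_piece V B' \<delta>' k" unfolding w_def by (rule vcomp_piece[OF u(1)])
    have \<phi>w: "\<phi> w = 0"
    proof -
      have "\<phi> w = vcomp \<delta> k (\<phi> u)" unfolding w_def by (rule vcomp_linear[OF lin gr u(1)])
      also have "\<dots> = 0" unfolding u(2) by (rule poly_mapping_eqI2) simp
      finally show ?thesis .
    qed
    note qb = free_piece_basis[OF V, of B' \<delta>' k, where 'k = 'k]
    \<comment> \<open>The component of \<open>u\<close> in the degree of \<open>e\<close> is split
      into a constant part and a part \<open>z\<close> without constants. The image of
      \<open>z\<close> lies in \<open>W k\<close>; since the whole component maps to 0, so does the
      combination of generators, and its coefficients vanish.\<close>
    obtain E c where E: "finite E" "E \<subseteq> {e \<in> B'. \<delta>' e = k}"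
      "w - (\<Sum>e\<in>E. vscale (c e) (Poly_Mapping.single e 1)) \<in> {u \<in> free_piece V B' \<delta>' k. \<forall>e. coeff (Poly_Mapping.lookup u e) 0 = 0}"
      using quot_basis_spans[OF qb w] by blast
    define z where "z = w - (\<Sum>e\<in>E. vscale (c e) (Poly_Mapping.single e 1))"
    have z: "z \<in> free_piece V B' \<delta>' k" "\<And>e. coeff (Poly_Mapping.lookup z e) 0 = 0" using E(3) by (auto simp: z_def)
    have s2: "vscale (c e) (Poly_Mapping.single e 1) \<in> (free_module V B' :: ('v,'k) mvec set)" if "e \<in> E" for e
      unfolding vscale_def using that E(2)
      by (intro free_module_scale poly_ring_const free_moduleI)
        (auto simp: lookup_single lookup_one when_def split: if_splits)
    have "\<phi> z + (\<Sum>e\<in>E. vscale (c e) (gen e)) = \<phi> w"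
    proof -
      have "(\<Sum>e\<in>E. vscale (c e) (gen e)) = \<phi> (\<Sum>e\<in>E. vscale (c e) (Poly_Mapping.single e 1))"
        by (simp add: \<phi>_def gen_map_sum gen_map_scale vscale_def)
      then have "\<phi> z + (\<Sum>e\<in>E. vscale (c e) (gen e)) = \<phi> (z + (\<Sum>e\<in>E. vscale (c e) (Poly_Mapping.single e 1)))"
        by (simp add: \<phi>_def gen_map_add)
      then show ?thesis by (simp add: z_def)
    qed
    then have eq: "(\<Sum>e\<in>E. vscale (c e) (gen e)) = - \<phi> z" using \<phi>w by (simp add: eq_neg_iff_add_eq_0 add.commute)
    have "\<phi> z \<in> W k"
    proof (cases k)
      case 0
      have "z = 0"
      proof (rule poly_mapping_eqI2)
        fix e m
        show "coeff (Poly_Mapping.lookup z e) m = coeff (Poly_Mapping.lookup 0 e) m"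
          using free_pieceD(3)[OF z(1), of e m] z(2)[of e] 0 by (auto simp: mdeg_eq_0)
      qed
      then have "\<phi> z = 0" by (simp add: \<phi>_def gen_map_def)
      then show ?thesis using subspace_0[OF sW] by simp
    next
      case (Suc j)
      obtain h where h: "\<And>v. v \<in> V \<Longrightarrow> h v \<in> free_piece V B' \<delta>' j" "z = (\<Sum>v\<in>V. mvec_scale (var v) (h v))"
        using free_piece_irrelevant[OF V ix z(1)[unfolded Suc] z(2)] by blast
      have hF: "h v \<in> free_module V B'" if "v \<in> V" for v using h(1)[OF that] by (rule free_piece_module)
      have sF: "mvec_scale (var v) (h v) \<in> free_module V B'" if "v \<in> V" for v
        using that hF by (intro free_module_scale poly_ring_var)
      have "\<phi> (h v) \<in> Mp k" if "v \<in> V" for v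
      proof -
        have "mvec_homogeneous \<delta> j (\<phi> (h v))"
          using gr[OF hF[OF that]] h(1)[OF that] by (simp add: free_piece_def)
        then show ?thesis
          using \<phi>_M[OF hF[OF that]] M_F by (auto simp: Mp_def Suc Mk_def free_piece_def)
      qed
      moreover have "\<phi> z = (\<Sum>v\<in>V. mvec_scale (var v) (\<phi> (h v)))"
        unfolding h(2) by (subst linear_over_sum[OF lin sF]) (auto simp: \<phi>_def gen_map_scale)
      ultimately show ?thesis unfolding W_def by (intro CollectI exI[of _ "\<lambda>v. \<phi> (h v)"]) simp
    qed
    then have "(\<Sum>e\<in>E. vscale (c e) (gen e)) \<in> W k" unfolding eq by (rule subspace_neg[OF sW])
    then have c0: "c e' = 0" if "e' \<in> E" for e' using quot_basis_indep[OF gb E(1,2) _ that] by blast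
    then have "w = z" by (simp add: z_def)
    then have "coeff (Poly_Mapping.lookup w e) 0 = 0" using z(2) by simp
    then show ?thesis by (simp add: w_def k_def)
  qed
  show ?thesis
    using finB' lin gr onto min by (intro exI[of _ B'] exI[of _ \<delta>'] exI[of _ \<phi>]) blast
qed

text \<open>Iterated covers by minimal generators. A state consists of a free module with its
  degrees and the submodule that the next differential has to hit.\<close>

theorem minimal_graded_free_resolution_exists:
  fixes V :: "'v set" and I :: "('v, 'k::field) mpoly set"
  assumes V: "finite V" and I: "homogeneous_ideal V I" and proper: "\<And>p. p \<in> I \<Longrightarrow> coeff p 0 = 0"
  shows "\<exists>B \<delta> \<phi> \<epsilon>. minimal_graded_free_resolution V I B \<delta> \<phi> \<epsilon>"
proof -
  obtain ix :: "'v \<Rightarrow> nat" where ix: "inj_on ix V" using finite_imp_inj_to_nat_seg[OF V] by blast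
  \<comment> \<open>The clause on constants makes the differential onto \<open>M\<close> minimal; it
    holds at the start because I is proper and later because relations between minimal generators
    have no constants.\<close>
  define P where "P = (\<lambda>(B, \<delta>, M :: ('v, 'k) mvec set). (\<forall>j. finite {e \<in> B. \<delta> e = (j::nat)}) \<and>
    graded_submodule V B \<delta> M \<and> (\<forall>u\<in>M. \<forall>e. coeff (Poly_Mapping.lookup u e) 0 = 0))"
  define Q where "Q = (\<lambda>(B, \<delta>, M :: ('v, 'k) mvec set) (B', \<delta>' :: nat \<Rightarrow> nat, M') \<phi>.
    linear_over (poly_ring V) mvec_scale mvec_scale (free_module V B') (free_module V B) \<phi> \<and>
    (\<forall>d. \<forall>u\<in>free_module V B'. mvec_homogeneous \<delta>' d u \<longrightarrow> mvec_homogeneous \<delta> d (\<phi> u)) \<and>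
    \<phi> ` free_module V B' = M \<and> M' = {u \<in> free_module V B'. \<phi> u = 0})"
  \<comment> \<open>The ideal as a submodule of the free module on the generator 0 of degree 0,
    whose entry at 0 is the augmentation.\<close>
  define M0 where "M0 = {u :: ('v, 'k) mvec. u \<in> free_module V {0} \<and> Poly_Mapping.lookup u 0 \<in> I}"
  have IV: "I \<subseteq> poly_ring V" "0 \<in> I" "\<And>p q. p \<in> I \<Longrightarrow> q \<in> I \<Longrightarrow> p + q \<in> I"
    "\<And>r p. r \<in> poly_ring V \<Longrightarrow> p \<in> I \<Longrightarrow> r * p \<in> I" "\<And>p k. p \<in> I \<Longrightarrow> pcomp k p \<in> I"
    using I unfolding homogeneous_ideal_def by auto
  have vp: "Poly_Mapping.lookup (vcomp (\<lambda>_. 0) k u) 0 = pcomp k (Poly_Mapping.lookup u 0)" for k and u :: "('v,'k) mvec"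
    by (rule poly_mapping_eqI) simp
  have vcomp_module: "vcomp \<delta> k u \<in> free_module V B" if "u \<in> free_module V B" for u :: "('v,'k) mvec" and \<delta> k B
    using vcomp_piece[OF that] by (rule free_piece_module)
  have P0: "P ({0}, \<lambda>_. 0, M0)"
  proof -
    have "graded_submodule V {0} (\<lambda>_. 0) M0"
      unfolding graded_submodule_def M0_def
      by (auto simp: free_module_add free_module_scale lookup_add vp IV vcomp_module)
    moreover have "coeff (Poly_Mapping.lookup u e) 0 = 0" if "u \<in> M0" for u e
      using that proper free_moduleD(1)[of u V "{0}" e 0] by (cases "e = 0") (auto simp: M0_def)
    ultimately show ?thesis by (simp add: P_def)
  qed
  have step: "\<exists>y. P y \<and> (\<exists>\<phi>. Q x y \<phi>)" if Px: "P x" for x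
  proof -
    obtain B \<delta> M where x: "x = (B, \<delta>, M)" by (cases x)
    obtain B' \<delta>' \<phi> where f: "\<And>j. finite {e \<in> B'. \<delta>' e = (j::nat)}"
      and lin: "linear_over (poly_ring V) mvec_scale mvec_scale (free_module V B') (free_module V B) \<phi>"
      and gr: "\<And>d u. u \<in> free_module V B' \<Longrightarrow> mvec_homogeneous \<delta>' d u \<Longrightarrow> mvec_homogeneous \<delta> d (\<phi> u)"
      and im: "\<phi> ` free_module V B' = M"
      and min: "\<And>u e. u \<in> free_module V B' \<Longrightarrow> \<phi> u = 0 \<Longrightarrow> coeff (Poly_Mapping.lookup u e) 0 = 0"
    proof -
      have "\<And>j. finite {e \<in> B. \<delta> e = j}" "graded_submodule V B \<delta> M" using Px by (auto simp: P_def x)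
      from minimal_generators_exist[OF V ix this] show thesis using that by (elim exE conjE) blast
    qed
    define M' where "M' = {u \<in> free_module V B'. \<phi> u = 0}"
    have v0: "vcomp \<delta> k 0 = (0 :: ('v,'k) mvec)" for k by (rule poly_mapping_eqI2) simp
    have "graded_submodule V B' \<delta>' M'"
      unfolding graded_submodule_def M'_def
      by (auto simp: free_module_add free_module_scale linear_over_zero[OF lin] linear_over_add[OF lin]
          linear_over_scale[OF lin] vcomp_module vcomp_linear[OF lin gr] v0)
    then have "P (B', \<delta>', M')" using f min by (simp add: P_def M'_def)
    moreover have "Q x (B', \<delta>', M') \<phi>" using lin gr im by (simp add: Q_def x M'_def)
    ultimately show ?thesis by blast
  qed
  \<comment> \<open>The conditional clause at \<open>n = 0\<close> pins the initial state inside the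
    invariant of dependent choice.\<close>
  have "\<exists>S. \<forall>n. (P (S n) \<and> (n = 0 \<longrightarrow> S n = ({0}, \<lambda>_. 0, M0))) \<and> (\<exists>\<phi>. Q (S n) (S (Suc n)) \<phi>)"
  proof (rule dependent_nat_choice)
    show "\<exists>x. P x \<and> ((0::nat) = 0 \<longrightarrow> x = ({0}, \<lambda>_. 0, M0))" using P0 by blast
    show "\<exists>y. (P y \<and> (Suc n = 0 \<longrightarrow> y = ({0}, \<lambda>_. 0, M0))) \<and> (\<exists>\<phi>. Q x y \<phi>)"
      if "P x \<and> (n = 0 \<longrightarrow> x = ({0}, \<lambda>_. 0, M0))" for x n
      using step[of x] that by auto
  qed
  then obtain S where S: "\<And>n. P (S n)" "S 0 = ({0}, \<lambda>_. 0, M0)" "\<And>n. \<exists>\<phi>. Q (S n) (S (Suc n)) \<phi>" by blast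
  then obtain \<phi> where \<phi>: "\<And>n. Q (S n) (S (Suc n)) (\<phi> n)" by metis
  define B where "B = (\<lambda>n. fst (S n))"
  define \<delta> where "\<delta> = (\<lambda>n. fst (snd (S n)))"
  define M where "M = (\<lambda>n. snd (snd (S n)))"
  have Sn: "S n = (B n, \<delta> n, M n)" for n by (simp add: B_def \<delta>_def M_def)
  have S0: "B 0 = {0}" "\<delta> 0 = (\<lambda>_. 0)" "M 0 = M0" using S(2) by (simp_all add: Sn)
  have q1: "linear_over (poly_ring V) mvec_scale mvec_scale (free_module V (B (Suc n))) (free_module V (B n)) (\<phi> n)"
    and q2: "\<And>d u. u \<in> free_module V (B (Suc n)) \<Longrightarrow> mvec_homogeneous (\<delta> (Suc n)) d u \<Longrightarrow> mvec_homogeneous (\<delta> n) d (\<phi> n u)"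
    and q3: "\<phi> n ` free_module V (B (Suc n)) = M n"
    and q4: "M (Suc n) = {u \<in> free_module V (B (Suc n)). \<phi> n u = 0}" for n
    using \<phi>[of n] unfolding Sn Q_def by auto
  have Mirr: "coeff (Poly_Mapping.lookup u e) 0 = 0" if "u \<in> M n" for u n e
    using S(1)[of n] that by (auto simp: Sn P_def)
  define \<epsilon> where "\<epsilon> = (\<lambda>u :: ('v, 'k) mvec. Poly_Mapping.lookup u 0)"
  have "minimal_graded_free_resolution V I B \<delta> \<phi> \<epsilon>"
    unfolding minimal_graded_free_resolution_def Let_def
  proof (intro conjI allI ballI impI)
    show "linear_over (poly_ring V) mvec_scale (*) (free_module V (B 0)) (poly_ring V) \<epsilon>"
      by (auto simp: linear_over_def \<epsilon>_def lookup_add free_module_def)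
    show "linear_over (poly_ring V) mvec_scale mvec_scale (free_module V (B (Suc i))) (free_module V (B i)) (\<phi> i)" for i
      by (rule q1)
    show "homogeneous d (\<epsilon> u)" if "mvec_homogeneous (\<delta> 0) d u" for d u
      using mvec_homogeneousD[OF that, of 0] by (intro homogeneousI) (simp add: \<epsilon>_def S0)
    show "mvec_homogeneous (\<delta> i) d (\<phi> i u)"
      if "u \<in> free_module V (B (Suc i))" "mvec_homogeneous (\<delta> (Suc i)) d u" for i d u
      using that by (rule q2)
    show "{\<epsilon> u + g |u g. u \<in> free_module V (B 0) \<and> g \<in> I} = poly_ring V"
    proof
      show "{\<epsilon> u + g |u g. u \<in> free_module V (B 0) \<and> g \<in> I} \<subseteq> poly_ring V"
        using IV(1) by (auto simp: \<epsilon>_def free_module_def intro!: poly_ring_add)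
      show "poly_ring V \<subseteq> {\<epsilon> u + g |u g. u \<in> free_module V (B 0) \<and> g \<in> I}"
      proof
        fix p :: "('v, 'k) mpoly" assume p: "p \<in> poly_ring V"
        have "Poly_Mapping.single 0 p \<in> free_module V (B 0)"
          unfolding S0 using poly_ringD[OF p]
          by (intro free_moduleI) (auto simp: lookup_single when_def split: if_splits)
        moreover have "p = \<epsilon> (Poly_Mapping.single 0 p) + 0" by (simp add: \<epsilon>_def)
        ultimately show "p \<in> {\<epsilon> u + g |u g. u \<in> free_module V (B 0) \<and> g \<in> I}" using IV(2) by blast
      qed
    qed
    show "\<phi> 0 ` free_module V (B 1) = {u \<in> free_module V (B 0). \<epsilon> u \<in> I}"
      using q3[of 0] by (simp add: S0 M0_def \<epsilon>_def)
    show "\<phi> (Suc i) ` free_module V (B (Suc (Suc i))) = {u \<in> free_module V (B (Suc i)). \<phi> i u = 0}" for i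
      using q3[of "Suc i"] q4[of i] by simp
    show "Poly_Mapping.lookup (\<phi> i u) e \<in> irrelevant_ideal V" if u: "u \<in> free_module V (B (Suc i))" for i u e
    proof -
      have "\<phi> i u \<in> M i" using q3 u by blast
      moreover have "Poly_Mapping.lookup (\<phi> i u) e \<in> poly_ring V"
        using linear_over_maps[OF q1 u] by (simp add: free_module_def)
      ultimately show ?thesis using Mirr by (simp add: irrelevant_ideal_def)
    qed
  qed
  then show ?thesis by blast
qed

section \<open>Koszul homology of edge ideals\<close>

definition simple_graph :: "'v graph \<Rightarrow> bool" where
  "simple_graph G \<longleftrightarrow> finite (verts G) \<and>
    (\<forall>e\<in>edges G. \<exists>x y. e = {x, y} \<and> x \<noteq> y \<and> x \<in> verts G \<and> y \<in> verts G)"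

text \<open>The exponents of the monomials outside the edge ideal; these monomials represent a basis
  of the quotient ring.\<close>

definition standard :: "'v graph \<Rightarrow> ('v \<Rightarrow>\<^sub>0 nat) \<Rightarrow> bool" where
  "standard G m \<longleftrightarrow> (\<forall>e\<in>edges G. \<not> e \<subseteq> Poly_Mapping.keys m)"

section \<open>Membership in edge ideals\<close>

lemma ideal_gen_add:
  assumes "p \<in> ideal_gen V S" "q \<in> ideal_gen V S"
  shows "p + q \<in> ideal_gen V S"
proof -
  obtain T c where p: "p = (\<Sum>s\<in>T. c s * s)" "finite T" "T \<subseteq> S" "\<forall>s\<in>T. c s \<in> poly_ring V"
    using assms(1) unfolding ideal_gen_def by blast
  obtain T' c' where q: "q = (\<Sum>s\<in>T'. c' s * s)" "finite T'" "T' \<subseteq> S" "\<forall>s\<in>T'. c' s \<in> poly_ring V"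
    using assms(2) unfolding ideal_gen_def by blast
  define d where "d = (\<lambda>s. (if s \<in> T then c s else 0) + (if s \<in> T' then c' s else 0))"
  have "(\<Sum>s\<in>T \<union> T'. d s * s) = (\<Sum>s\<in>T \<union> T'. (if s \<in> T then c s * s else 0)) + (\<Sum>s\<in>T \<union> T'. (if s \<in> T' then c' s * s else 0))"
    by (simp add: d_def distrib_right if_distrib[of "\<lambda>x. x * _"] sum.distrib cong: if_cong)
  also have "(\<Sum>s\<in>T \<union> T'. (if s \<in> T then c s * s else 0)) = p"
    unfolding p(1) by (rule sum.mono_neutral_cong_right) (use p q in auto)
  also have "(\<Sum>s\<in>T \<union> T'. (if s \<in> T' then c' s * s else 0)) = q"
    unfolding q(1) by (rule sum.mono_neutral_cong_right) (use p q in auto)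
  finally have "p + q = (\<Sum>s\<in>T \<union> T'. d s * s)" by simp
  moreover have "\<forall>s\<in>T \<union> T'. d s \<in> poly_ring V"
    using p(4) q(4) by (auto simp: d_def intro: poly_ring_add)
  ultimately show ?thesis using p(2,3) q(2,3) unfolding ideal_gen_def by blast
qed

lemma ideal_gen_zero: "0 \<in> ideal_gen V S"
  unfolding ideal_gen_def by (intro CollectI exI[of _ "{}"] exI[of _ "\<lambda>_. 0"]) simp

lemma ideal_gen_generator:
  assumes "c \<in> poly_ring V" "s \<in> S"
  shows "c * s \<in> ideal_gen V S"
proof -
  have "c * s = (\<Sum>s\<in>{s}. c * s) \<and> finite {s} \<and> {s} \<subseteq> S \<and> (\<forall>s\<in>{s}. c \<in> poly_ring V)"
    using assms by simp
  then show ?thesis unfolding ideal_gen_def by (intro CollectI exI[of _ "{s}"] exI[of _ "\<lambda>_. c"])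
qed

lemma ideal_gen_sum: "(\<And>i. i \<in> A \<Longrightarrow> f i \<in> ideal_gen V S) \<Longrightarrow> (\<Sum>i\<in>A. f i) \<in> ideal_gen V S"
  by (induction A rule: infinite_finite_induct) (auto simp: ideal_gen_zero ideal_gen_add)

lemma poly_ring_sum: "(\<And>i. i \<in> A \<Longrightarrow> f i \<in> poly_ring V) \<Longrightarrow> (\<Sum>i\<in>A. f i) \<in> poly_ring V"
  by (induction A rule: infinite_finite_induct) (auto simp: poly_ring_add)

lemma poly_expand: "p = (\<Sum>m\<in>Poly_Mapping.keys p. Poly_Mapping.single m (coeff p m))"
proof (rule poly_mapping_eqI)
  fix m
  have "coeff (\<Sum>m\<in>Poly_Mapping.keys p. Poly_Mapping.single m (coeff p m)) m =
    (\<Sum>m'\<in>Poly_Mapping.keys p. if m' = m then coeff p m else 0)"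
    by (auto simp: lookup_sum lookup_single when_def intro!: sum.cong)
  then show "coeff p m = coeff (\<Sum>m\<in>Poly_Mapping.keys p. Poly_Mapping.single m (coeff p m)) m"
    by (simp add: in_keys_iff)
qed

text \<open>An edge ideal is a monomial ideal, so membership is decided one coefficient at a time. A
  monomial that is not standard contains an edge and is therefore a multiple of the corresponding
  generator.\<close>

lemma mem_edge_ideal:
  fixes p :: "('v, 'k::field) mpoly"
  assumes G: "simple_graph G"
  shows "p \<in> edge_ideal G \<longleftrightarrow> p \<in> poly_ring (verts G) \<and> (\<forall>m. standard G m \<longrightarrow> coeff p m = 0)"
proof
  assume "p \<in> edge_ideal G"
  then obtain T c where p: "p = (\<Sum>s\<in>T. c s * s)" "finite T" "T \<subseteq> {var x * var y | x y. {x, y} \<in> edges G}"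
    "\<forall>s\<in>T. c s \<in> poly_ring (verts G)" unfolding edge_ideal_def ideal_gen_def by blast
  have "c s * s \<in> poly_ring (verts G) \<and> (\<forall>m. standard G m \<longrightarrow> coeff (c s * s) m = 0)" if "s \<in> T" for s
  proof -
    obtain x y where xy: "s = var x * var y" "{x, y} \<in> edges G" using p(3) \<open>s \<in> T\<close> by blast
    then have V: "x \<in> verts G" "y \<in> verts G" "x \<noteq> y" using G unfolding simple_graph_def by (metis doubleton_eq_iff)+
    have "coeff (c s * s) m = 0" if "standard G m" for m
    proof (rule ccontr)
      assume "coeff (c s * s) m \<noteq> 0"
      then have "coeff (var x * (var y * c s)) m \<noteq> 0" by (simp add: xy(1) mult_ac)
      then have "Poly_Mapping.lookup m x \<noteq> 0" "Poly_Mapping.lookup (m - mono1 x) y \<noteq> 0"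
        unfolding coeff_var_times by (auto split: if_splits)
      then have "{x, y} \<subseteq> Poly_Mapping.keys m" by (auto simp: in_keys_iff lookup_minus)
      then show False using that xy(2) unfolding standard_def by blast
    qed
    moreover have "c s * s \<in> poly_ring (verts G)"
      unfolding xy(1) using p(4) \<open>s \<in> T\<close> V by (intro poly_ring_mult poly_ring_var) (auto simp: xy)
    ultimately show ?thesis by blast
  qed
  then show "p \<in> poly_ring (verts G) \<and> (\<forall>m. standard G m \<longrightarrow> coeff p m = 0)"
    unfolding p(1) lookup_sum
    by (intro conjI allI impI sum.neutral ballI) (auto intro!: poly_ring_sum)
next
  assume p: "p \<in> poly_ring (verts G) \<and> (\<forall>m. standard G m \<longrightarrow> coeff p m = 0)"
  have "Poly_Mapping.single m (coeff p m) \<in> edge_ideal G" if m: "m \<in> Poly_Mapping.keys p" for m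
  proof -
    have "\<not> standard G m" using p m by (auto simp: in_keys_iff)
    then obtain e where e: "e \<in> edges G" "e \<subseteq> Poly_Mapping.keys m" unfolding standard_def by blast
    obtain x y where xy: "e = {x, y}" "x \<noteq> y" using G e unfolding simple_graph_def by blast
    have mx: "Poly_Mapping.lookup m x \<noteq> 0" and my: "Poly_Mapping.lookup (m - mono1 x) y \<noteq> 0"
      using e(2) xy by (auto simp: in_keys_iff lookup_minus lookup_single when_def)
    define m' where "m' = m - mono1 x - mono1 y"
    have m_eq: "m = mono1 x + mono1 y + m'"
      using mono1_split[OF mx] mono1_split[OF my] by (simp add: m'_def ac_simps)
    have "Poly_Mapping.single m (coeff p m) = Poly_Mapping.single m' (coeff p m) * (var x * var y)"
      unfolding m_eq by (simp add: var_def mult_single ac_simps)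
    moreover have "Poly_Mapping.keys m' \<subseteq> verts G"
    proof -
      have "Poly_Mapping.keys m \<subseteq> verts G" using p m unfolding poly_ring_def by blast
      moreover have "Poly_Mapping.keys m' \<subseteq> Poly_Mapping.keys m" by (auto simp: in_keys_iff m'_def lookup_minus)
      ultimately show ?thesis by blast
    qed
    then have "Poly_Mapping.single m' (coeff p m) \<in> poly_ring (verts G)"
      by (intro poly_ringI) (auto simp: lookup_single when_def split: if_splits)
    ultimately show ?thesis
      unfolding edge_ideal_def using e(1) xy by (auto intro!: ideal_gen_generator)
  qed
  then have "(\<Sum>m\<in>Poly_Mapping.keys p. Poly_Mapping.single m (coeff p m)) \<in> edge_ideal G"
    unfolding edge_ideal_def by (intro ideal_gen_sum)
  then show "p \<in> edge_ideal G" using poly_expand[of p] by simp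
qed

lemma standard_mono: "standard G m \<Longrightarrow> Poly_Mapping.keys m' \<subseteq> Poly_Mapping.keys m \<Longrightarrow> standard G m'"
  unfolding standard_def by blast

lemma edge_ideal_homogeneous:
  assumes G: "simple_graph G"
  shows "homogeneous_ideal (verts G) (edge_ideal G :: ('v, 'k::field) mpoly set)"
proof -
  have "r * p \<in> edge_ideal G" if r: "r \<in> poly_ring (verts G)" and p: "p \<in> edge_ideal G" for r p :: "('v, 'k) mpoly"
  proof -
    have "coeff (r * p) m = 0" if m: "standard G m" for m
    proof (rule ccontr)
      assume "coeff (r * p) m \<noteq> 0"
      then obtain a b where ab: "m = a + b" "b \<in> Poly_Mapping.keys p"
        using keys_mult[of r p] by (auto simp: in_keys_iff)
      have "standard G b"
        by (rule standard_mono[OF m]) (auto simp: ab(1) in_keys_iff lookup_add)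
      then show False using p ab(2) unfolding mem_edge_ideal[OF G] by (auto simp: in_keys_iff)
    qed
    then show ?thesis using p poly_ring_mult[OF r] unfolding mem_edge_ideal[OF G] by blast
  qed
  moreover have "pcomp k p \<in> edge_ideal G" if "p \<in> edge_ideal G" for p :: "('v, 'k) mpoly" and k
  proof -
    have p: "p \<in> poly_ring (verts G)" "\<And>m. standard G m \<Longrightarrow> coeff p m = 0"
      using that unfolding mem_edge_ideal[OF G] by auto
    have "pcomp k p \<in> poly_ring (verts G)"
      by (rule poly_ringI) (metis coeff_pcomp poly_ringD[OF p(1)])
    then show ?thesis unfolding mem_edge_ideal[OF G] using p(2) by simp
  qed
  ultimately show ?thesis
    unfolding homogeneous_ideal_def
    by (auto simp: mem_edge_ideal[OF G] lookup_add intro: poly_ring_add)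
qed

lemma edge_ideal_const:
  assumes G: "simple_graph G" and p: "p \<in> edge_ideal G"
  shows "coeff p 0 = 0"
proof -
  have "standard G 0" using G by (auto simp: standard_def simple_graph_def)
  then show ?thesis using p unfolding mem_edge_ideal[OF G] by blast
qed

text \<open>Simplicial 1-cocycles and coboundaries of the flag complex with 1-skeleton \<open>N\<close> on \<open>W\<close>.\<close>

definition cocycles1 :: "('v \<Rightarrow> 'v \<Rightarrow> bool) \<Rightarrow> 'v set \<Rightarrow> ('v \<Rightarrow> 'v \<Rightarrow> 'k::field) set" where
  "cocycles1 N W = {f. (\<forall>u v. f u v \<noteq> 0 \<longrightarrow> u \<in> W \<and> v \<in> W \<and> N u v) \<and> (\<forall>u v. f v u = - f u v) \<and>
    (\<forall>u\<in>W. \<forall>v\<in>W. \<forall>w\<in>W. N u v \<and> N v w \<and> N u w \<longrightarrow> f u v + f v w = f u w)}"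

definition coboundaries1 :: "('v \<Rightarrow> 'v \<Rightarrow> bool) \<Rightarrow> 'v set \<Rightarrow> ('v \<Rightarrow> 'v \<Rightarrow> 'k::field) set" where
  "coboundaries1 N W = {f \<in> cocycles1 N W. \<exists>g. \<forall>u\<in>W. \<forall>v\<in>W. N u v \<longrightarrow> f u v = g v - g u}"

text \<open>A relation between the complex and the number, so that finite-dimensionality is
  established together with the value. The type argument fixes the field.\<close>

definition h1_dim :: "'k::field itself \<Rightarrow> ('v \<Rightarrow> 'v \<Rightarrow> bool) \<Rightarrow> 'v set \<Rightarrow> nat \<Rightarrow> bool" where
  "h1_dim K N W r \<longleftrightarrow> quot_dim (\<lambda>c f u v. c * f u v) (cocycles1 N W :: ('v \<Rightarrow> 'v \<Rightarrow> 'k) set) (coboundaries1 N W) r"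

definition nonadj :: "'v graph \<Rightarrow> 'v \<Rightarrow> 'v \<Rightarrow> bool" where
  "nonadj G u v \<longleftrightarrow> u \<noteq> v \<and> {u, v} \<notin> edges G"

lemma vector_space_fun2: "vector_space (\<lambda>c (f :: 'v \<Rightarrow> 'v \<Rightarrow> 'k::field) u v. c * f u v)"
  by (rule vector_space_fun[OF vector_space_fun_times])

lemma nonadj_sym: "nonadj G u v \<Longrightarrow> nonadj G v u"
  by (auto simp: nonadj_def insert_commute)

lemma cocycles1_supp: "f \<in> cocycles1 N W \<Longrightarrow> f u v \<noteq> 0 \<Longrightarrow> u \<in> W \<and> v \<in> W \<and> N u v"
  unfolding cocycles1_def by blast

lemma cocycles1_anti: "f \<in> cocycles1 N W \<Longrightarrow> f v u = - f u v"
  unfolding cocycles1_def by blast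

lemma cocycles1_triangle:
  "f \<in> cocycles1 N W \<Longrightarrow> u \<in> W \<Longrightarrow> v \<in> W \<Longrightarrow> w \<in> W \<Longrightarrow> N u v \<Longrightarrow> N v w \<Longrightarrow> N u w \<Longrightarrow> f u v + f v w = f u w"
  unfolding cocycles1_def by blast

lemma cocycles1I:
  assumes "\<And>u v. f u v \<noteq> 0 \<Longrightarrow> u \<in> W \<and> v \<in> W \<and> N u v" "\<And>u v. f v u = - f u v"
    "\<And>u v w. u \<in> W \<Longrightarrow> v \<in> W \<Longrightarrow> w \<in> W \<Longrightarrow> N u v \<Longrightarrow> N v w \<Longrightarrow> N u w \<Longrightarrow> f u v + f v w = f u w"
  shows "f \<in> cocycles1 N W"
proof -
  have "\<forall>u v. f u v \<noteq> 0 \<longrightarrow> u \<in> W \<and> v \<in> W \<and> N u v" using assms(1) by blast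
  moreover have "\<forall>u v. f v u = - f u v" by (intro allI) (rule assms(2))
  moreover have "\<forall>u\<in>W. \<forall>v\<in>W. \<forall>w\<in>W. N u v \<and> N v w \<and> N u w \<longrightarrow> f u v + f v w = f u w"
    using assms(3) by blast
  ultimately show ?thesis unfolding cocycles1_def by (intro CollectI conjI)
qed

lemma cocycles1_subspace: "module.subspace (\<lambda>c f u v. c * f u v) (cocycles1 N W :: ('v \<Rightarrow> 'v \<Rightarrow> 'k::field) set)"
proof -
  interpret vector_space "\<lambda>c (f :: 'v \<Rightarrow> 'v \<Rightarrow> 'k::field) u v. c * f u v" by (rule vector_space_fun2)
  show ?thesis
  proof (rule subspaceI)
    show "0 \<in> (cocycles1 N W :: ('v \<Rightarrow> 'v \<Rightarrow> 'k) set)" by (rule cocycles1I) auto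
    show "x + y \<in> cocycles1 N W" if x: "x \<in> cocycles1 N W" and y: "y \<in> cocycles1 N W" for x y :: "'v \<Rightarrow> 'v \<Rightarrow> 'k"
    proof (rule cocycles1I)
      fix u v assume "(x + y) u v \<noteq> 0"
      then have "x u v \<noteq> 0 \<or> y u v \<noteq> 0" by auto
      then show "u \<in> W \<and> v \<in> W \<and> N u v" using cocycles1_supp[OF x] cocycles1_supp[OF y] by blast
    next
      show "(x + y) v u = - (x + y) u v" for u v
        using cocycles1_anti[OF x, of u v] cocycles1_anti[OF y, of u v] by simp
    next
      fix u v w assume "u \<in> W" "v \<in> W" "w \<in> W" "N u v" "N v w" "N u w"
      from cocycles1_triangle[OF x this] cocycles1_triangle[OF y this]
      show "(x + y) u v + (x + y) v w = (x + y) u w" by (simp add: algebra_simps)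
    qed
    show "(\<lambda>u v. c * x u v) \<in> cocycles1 N W" if x: "x \<in> cocycles1 N W" for x :: "'v \<Rightarrow> 'v \<Rightarrow> 'k" and c
    proof (rule cocycles1I)
      show "u \<in> W \<and> v \<in> W \<and> N u v" if "c * x u v \<noteq> 0" for u v
        using cocycles1_supp[OF x, of u v] that by simp
      show "c * x v u = - (c * x u v)" for u v using cocycles1_anti[OF x, of v u] by simp
      fix u v w assume "u \<in> W" "v \<in> W" "w \<in> W" "N u v" "N v w" "N u w"
      from cocycles1_triangle[OF x this] show "c * x u v + c * x v w = c * x u w" by (simp flip: distrib_left)
    qed
  qed
qed

lemma coboundaries1_subspace: "module.subspace (\<lambda>c f u v. c * f u v) (coboundaries1 N W :: ('v \<Rightarrow> 'v \<Rightarrow> 'k::field) set)"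
proof -
  interpret vector_space "\<lambda>c (f :: 'v \<Rightarrow> 'v \<Rightarrow> 'k::field) u v. c * f u v" by (rule vector_space_fun2)
  note sub = cocycles1_subspace[of N W, where 'k = 'k]
  show ?thesis
  proof (rule subspaceI)
    show "0 \<in> (coboundaries1 N W :: ('v \<Rightarrow> 'v \<Rightarrow> 'k) set)"
      using subspace_0[OF sub] by (auto simp: coboundaries1_def)
    show "x + y \<in> coboundaries1 N W" if x: "x \<in> coboundaries1 N W" and y: "y \<in> coboundaries1 N W" for x y :: "'v \<Rightarrow> 'v \<Rightarrow> 'k"
    proof -
      obtain g where g: "\<forall>u\<in>W. \<forall>v\<in>W. N u v \<longrightarrow> x u v = g v - g u" using x by (auto simp: coboundaries1_def)
      obtain h where h: "\<forall>u\<in>W. \<forall>v\<in>W. N u v \<longrightarrow> y u v = h v - h u" using y by (auto simp: coboundaries1_def)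
      have "\<forall>u\<in>W. \<forall>v\<in>W. N u v \<longrightarrow> (x + y) u v = (g v + h v) - (g u + h u)" using g h by simp
      then show ?thesis using subspace_add[OF sub, of x y] x y unfolding coboundaries1_def
        by (intro CollectI conjI exI[of _ "\<lambda>v. g v + h v"]) auto
    qed
    show "(\<lambda>u v. c * x u v) \<in> coboundaries1 N W" if x: "x \<in> coboundaries1 N W" for x :: "'v \<Rightarrow> 'v \<Rightarrow> 'k" and c
    proof -
      obtain g where g: "\<forall>u\<in>W. \<forall>v\<in>W. N u v \<longrightarrow> x u v = g v - g u" using x by (auto simp: coboundaries1_def)
      have "\<forall>u\<in>W. \<forall>v\<in>W. N u v \<longrightarrow> c * x u v = c * g v - c * g u" using g by (simp add: right_diff_distrib)
      then show ?thesis using subspace_scale[OF sub, of x c] x unfolding coboundaries1_def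
        by (intro CollectI conjI exI[of _ "\<lambda>v. c * g v"]) auto
    qed
  qed
qed

lemma mdeg_Suc_split:
  assumes "mdeg m = Suc d"
  obtains u m' where "m = mono1 u + m'" "mdeg m' = d" "Poly_Mapping.keys m' \<subseteq> Poly_Mapping.keys m" "u \<in> Poly_Mapping.keys m"
proof -
  have "m \<noteq> 0" using assms by auto
  then obtain u where u: "Poly_Mapping.lookup m u \<noteq> 0" by (metis lookup_zero poly_mapping_eqI)
  show thesis
  proof (rule that[of u "m - mono1 u"])
    show "m = mono1 u + (m - mono1 u)" by (rule mono1_split[OF u])
    show "mdeg (m - mono1 u) = d" using mono_minus_props(1)[OF u] assms by simp
    show "Poly_Mapping.keys (m - mono1 u) \<subseteq> Poly_Mapping.keys m" by (auto simp: in_keys_iff lookup_minus)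
    show "u \<in> Poly_Mapping.keys m" using u by (simp add: in_keys_iff)
  qed
qed

lemma mdeg_2_split:
  assumes "mdeg m = 2"
  obtains u v where "m = mono1 u + mono1 v"
proof -
  obtain u m' where m: "m = mono1 u + m'" "mdeg m' = 1" using assms by (metis Suc_1 mdeg_Suc_split)
  obtain v m'' where m': "m' = mono1 v + m''" "mdeg m'' = 0" using m(2) by (metis One_nat_def mdeg_Suc_split)
  have "m = mono1 u + mono1 v" using m m' by (simp add: mdeg_eq_0)
  then show thesis by (rule that)
qed

lemma mono2_eq:
  assumes "mono1 u + mono1 v = mono1 a + mono1 b" "u \<noteq> v"
  shows "u = a \<and> v = b \<or> u = b \<and> v = a"
proof -
  have "Poly_Mapping.lookup (mono1 u + mono1 v) x = Poly_Mapping.lookup (mono1 a + mono1 b) x" for x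
    using assms(1) by simp
  from this[of u] this[of v] assms(2) show ?thesis
    by (auto simp: lookup_add lookup_single when_def split: if_splits)
qed

section \<open>Koszul cycles with quadratic coefficients as simplicial cocycles\<close>

locale edge_koszul =
  fixes G :: "'v graph" and ix :: "'v \<Rightarrow> nat" and K :: "'k::field itself"
  assumes G: "simple_graph G" and ix: "inj_on ix (verts G)"
begin

abbreviation V where "V \<equiv> verts G"

lemma V: "finite V"
  using G by (simp add: simple_graph_def)

sublocale koszul "pscale :: 'k \<Rightarrow> ('v, 'k) mpoly \<Rightarrow> _" "\<lambda>v p. var v * p" V ix
  by (rule koszul_pscale[OF V ix])

definition Ik :: "nat \<Rightarrow> ('v, 'k) mpoly set" where
  "Ik k = poly_piece V k \<inter> edge_ideal G"

lemma mem_Ik: "p \<in> Ik k \<longleftrightarrow> p \<in> poly_piece V k \<and> (\<forall>m. standard G m \<longrightarrow> coeff p m = 0)"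
  unfolding Ik_def using mem_edge_ideal[OF G] by (auto simp: poly_piece_def)

lemma graded_poly: "graded (poly_piece V)"
  by (rule graded_poly_piece[OF V ix])

lemma graded_Ik: "graded Ik"
proof -
  have "pscale c x \<in> edge_ideal G" if "x \<in> edge_ideal G" for c and x :: "('v, 'k) mpoly"
    using edge_ideal_homogeneous[OF G] that poly_ring_const unfolding pscale_def homogeneous_ideal_def by blast
  moreover have "var v * x \<in> edge_ideal G" if "v \<in> V" "x \<in> edge_ideal G" for v and x :: "('v, 'k) mpoly"
    using edge_ideal_homogeneous[OF G] that poly_ring_var[of v V] unfolding homogeneous_ideal_def by blast
  ultimately show ?thesis
    using graded_poly edge_ideal_homogeneous[OF G, where 'k = 'k]
    unfolding graded_def subspace_def homogeneous_ideal_def Ik_def by blast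
qed

lemma swap:
  "finite T \<Longrightarrow> u \<notin> T \<Longrightarrow> v \<notin> T \<Longrightarrow> ix u \<noteq> ix v \<Longrightarrow>
    ksgn ix v T * ksgn ix u (insert v T) = - (ksgn ix u T * ksgn ix v (insert u T) :: 'k)"
  by (rule ksgn_swap)

text \<open>The sign of pulling first \<open>v\<close> and then \<open>u\<close> out of the ordered
  set W. It is antisymmetric in the two vertices and so turns the symmetric coefficient of their
  product into a function of an oriented edge.\<close>

definition sg :: "'v set \<Rightarrow> 'v \<Rightarrow> 'v \<Rightarrow> 'k" where
  "sg W u v = ksgn ix u (W - {u, v}) * ksgn ix v (W - {v})"

lemma sg_square [simp]: "sg W u v * (sg W u v * x) = x"
proof -
  have "sg W u v * (sg W u v * x) = (ksgn ix u (W - {u, v}) * ksgn ix u (W - {u, v})) *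
    (ksgn ix v (W - {v}) * ksgn ix v (W - {v})) * x"
    unfolding sg_def by (simp only: mult_ac)
  then show ?thesis by simp
qed

lemma sg_swap:
  assumes "W \<subseteq> V" "u \<in> W" "v \<in> W" "u \<noteq> v"
  shows "sg W v u = - sg W u v"
proof -
  define T where "T = W - {u, v}"
  have finT: "finite T" using finite_subset[OF assms(1) V] by (simp add: T_def)
  have nix: "ix u \<noteq> ix v" using assms inj_onD[OF ix] by blast
  have W: "W - {v} = insert u T" "W - {u} = insert v T" "W - {v, u} = T" using assms by (auto simp: T_def)
  have "ksgn ix v T * ksgn ix u (insert v T) = - (ksgn ix u T * ksgn ix v (insert u T) :: 'k)"
    by (rule swap[OF finT _ _ nix]) (simp_all add: T_def)
  then show ?thesis by (simp only: sg_def W T_def[symmetric])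
qed

definition \<Omega> :: "nat \<Rightarrow> 'v set set" where
  "\<Omega> q = {W. W \<subseteq> V \<and> card W = q + 2}"

text \<open>The part of a chain in the squarefree multidegree W, read as a 1-cochain of the
  independence complex of W: the value at \<open>(u, v)\<close> is the coefficient of the product of
  \<open>u\<close> and \<open>v\<close> on the rest of W, up to sign.\<close>

definition \<Phi> :: "nat \<Rightarrow> ('v set \<Rightarrow> ('v, 'k) mpoly) \<Rightarrow> 'v set \<Rightarrow> 'v \<Rightarrow> 'v \<Rightarrow> 'k" where
  "\<Phi> q z W u v = (if W \<in> \<Omega> q \<and> u \<in> W \<and> v \<in> W \<and> nonadj G u v
    then sg W u v * coeff (z (W - {u, v})) (mono1 u + mono1 v) else 0)"

lemma standard_pair:
  assumes "nonadj G u v"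
  shows "standard G (mono1 u + mono1 v)"
  unfolding standard_def
proof
  fix e assume e: "e \<in> edges G"
  then obtain x y where xy: "e = {x, y}" "x \<noteq> y" using G unfolding simple_graph_def by blast
  show "\<not> e \<subseteq> Poly_Mapping.keys (mono1 u + mono1 v)"
  proof
    assume "e \<subseteq> Poly_Mapping.keys (mono1 u + mono1 v)"
    then have "e \<subseteq> {u, v}" by (auto simp: in_keys_iff lookup_add lookup_single when_def split: if_splits)
    then have "e = {u, v}" using xy by auto
    then show False using e assms by (simp add: nonadj_def)
  qed
qed

lemma standard_triple:
  assumes "nonadj G u v" "nonadj G v w" "nonadj G u w"
  shows "standard G (mono1 u + mono1 v + mono1 w)"
  unfolding standard_def
proof
  fix e assume e: "e \<in> edges G"
  then obtain x y where xy: "e = {x, y}" "x \<noteq> y" using G unfolding simple_graph_def by blast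
  show "\<not> e \<subseteq> Poly_Mapping.keys (mono1 u + mono1 v + mono1 w)"
  proof
    assume "e \<subseteq> Poly_Mapping.keys (mono1 u + mono1 v + mono1 w)"
    then have "e \<subseteq> {u, v, w}" by (auto simp: in_keys_iff lookup_add lookup_single when_def split: if_splits)
    then have "e = {u, v} \<or> e = {v, w} \<or> e = {u, w}" using xy by auto
    then show False using e assms by (auto simp: nonadj_def)
  qed
qed

lemma nonadj_of_standard:
  assumes "standard G m" "u \<in> Poly_Mapping.keys m" "v \<in> Poly_Mapping.keys m" "u \<noteq> v"
  shows "nonadj G u v"
  using assms unfolding standard_def nonadj_def by (metis empty_subsetI insert_subset)

lemma coeff_d_pair:
  assumes T: "T \<subseteq> V" and uv: "u \<in> V - T" "v \<in> V - T" "u \<noteq> v"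
  shows "coeff (d z T) (mono1 u + mono1 v) =
    ksgn ix u T * coeff (z (insert u T)) (mono1 v) + ksgn ix v T * coeff (z (insert v T)) (mono1 u)"
proof -
  have "coeff (d z T) (mono1 u + mono1 v) = (\<Sum>x\<in>{u, v}. ksgn ix x T * coeff (z (insert x T)) (mono1 u + mono1 v - mono1 x))"
    unfolding coeff_kdiff if_P[OF T]
    by (rule sum.mono_neutral_cong_right) (use V uv in \<open>auto simp: lookup_add lookup_single when_def split: if_splits\<close>)
  then show ?thesis using uv(3) by (simp add: add.commute[of "mono1 u"])
qed

lemma coeff_d_triple:
  assumes T: "T \<subseteq> V" and uv: "u \<in> V - T" "v \<in> V - T" "w \<in> V - T" "u \<noteq> v" "v \<noteq> w" "u \<noteq> w"
  shows "coeff (d z T) (mono1 u + mono1 v + mono1 w) =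
    ksgn ix u T * coeff (z (insert u T)) (mono1 v + mono1 w) + ksgn ix v T * coeff (z (insert v T)) (mono1 u + mono1 w) +
    ksgn ix w T * coeff (z (insert w T)) (mono1 u + mono1 v)"
proof -
  have "coeff (d z T) (mono1 u + mono1 v + mono1 w) =
    (\<Sum>x\<in>{u, v, w}. ksgn ix x T * coeff (z (insert x T)) (mono1 u + mono1 v + mono1 w - mono1 x))"
    unfolding coeff_kdiff if_P[OF T]
    by (rule sum.mono_neutral_cong_right) (use V uv in \<open>auto simp: lookup_add lookup_single when_def split: if_splits\<close>)
  moreover have "mono1 u + mono1 v + mono1 w - mono1 u = mono1 v + mono1 w"
    "mono1 u + mono1 v + mono1 w - mono1 v = mono1 u + mono1 w"
    "mono1 u + mono1 v + mono1 w - mono1 w = mono1 u + mono1 v"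
    by (rule poly_mapping_eqI, simp add: lookup_add lookup_minus)+
  ultimately show ?thesis using uv(4-) by (simp only: sum.insert_remove sum.empty finite.intros) (simp add: add.assoc)
qed

text \<open>With the signs of \<open>sg\<close> the Koszul differential becomes the simplicial
  coboundary on the triangle \<open>u\<close>, \<open>v\<close>, \<open>w\<close>. The common factor
  is the sign of pulling all three out of W.\<close>

lemma coeff_d_triple_\<Phi>:
  assumes T: "T \<subseteq> V" "Suc (card T) = q" and uv: "u \<in> V - T" "v \<in> V - T" "w \<in> V - T"
    and N: "nonadj G u v" "nonadj G v w" "nonadj G u w" and W: "W = insert u (insert v (insert w T))"
  shows "\<exists>s. s * s = 1 \<and> coeff (d z T) (mono1 u + mono1 v + mono1 w) = s * (\<Phi> q z W v w - \<Phi> q z W u w + \<Phi> q z W u v)"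
proof -
  have dist: "u \<noteq> v" "v \<noteq> w" "u \<noteq> w" using N by (auto simp: nonadj_def)
  have finT: "finite T" using T V finite_subset by blast
  have nix: "ix u \<noteq> ix v" "ix v \<noteq> ix w" "ix u \<noteq> ix w" using uv dist inj_onD[OF ix] by blast+
  have W\<Omega>: "W \<in> \<Omega> q" using T uv dist finT by (auto simp: \<Omega>_def W)
  have W': "W - {v, w} = insert u T" "W - {u, w} = insert v T" "W - {u, v} = insert w T"
    "W - {w} = insert u (insert v T)" "W - {v} = insert u (insert w T)"
    using uv dist by (auto simp: W)
  define E where "E = ksgn ix u T * ksgn ix v (insert u T) * (ksgn ix w (insert u (insert v T)) :: 'k)"
  have c1: "coeff (z (insert u T)) (mono1 v + mono1 w) = sg W v w * \<Phi> q z W v w"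
    and c2: "coeff (z (insert v T)) (mono1 u + mono1 w) = sg W u w * \<Phi> q z W u w"
    and c3: "coeff (z (insert w T)) (mono1 u + mono1 v) = sg W u v * \<Phi> q z W u v"
    using W\<Omega> N by (simp_all add: \<Phi>_def W') (simp_all add: W)
  have e1: "ksgn ix u T * sg W v w = E" by (simp add: sg_def W' E_def)
  have e2: "ksgn ix v T * sg W u w = - E"
  proof -
    have sw: "ksgn ix v T * ksgn ix u (insert v T) = - (ksgn ix u T * ksgn ix v (insert u T) :: 'k)"
      by (rule swap[OF finT _ _ nix(1)]) (use uv in auto)
    show ?thesis by (simp only: sg_def W' E_def mult.assoc[symmetric] sw minus_mult_left)
  qed
  have e3: "ksgn ix w T * sg W u v = E"
  proof -
    have sw: "ksgn ix w T * ksgn ix u (insert w T) = - (ksgn ix u T * ksgn ix w (insert u T) :: 'k)"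
      by (rule swap[OF finT _ _ nix(3)]) (use uv in auto)
    have sw': "ksgn ix w (insert u T) * ksgn ix v (insert u (insert w T)) =
        - (ksgn ix v (insert u T) * ksgn ix w (insert u (insert v T)) :: 'k)"
    proof -
      have "ksgn ix w (insert u T) * ksgn ix v (insert w (insert u T)) =
        - (ksgn ix v (insert u T) * ksgn ix w (insert v (insert u T)) :: 'k)"
        by (rule swap) (use finT uv dist nix in auto)
      then show ?thesis by (simp only: insert_commute[of u])
    qed
    have "ksgn ix w T * sg W u v = (ksgn ix w T * ksgn ix u (insert w T)) * ksgn ix v (insert u (insert w T))"
      by (simp only: sg_def W' mult.assoc)
    also have "\<dots> = - (ksgn ix u T * (ksgn ix w (insert u T) * ksgn ix v (insert u (insert w T))))"
      by (simp only: sw mult.assoc minus_mult_left)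
    also have "\<dots> = E" by (simp only: sw' E_def mult.assoc mult_minus_right minus_minus)
    finally show ?thesis .
  qed
  have "coeff (d z T) (mono1 u + mono1 v + mono1 w) =
    (ksgn ix u T * sg W v w) * \<Phi> q z W v w + (ksgn ix v T * sg W u w) * \<Phi> q z W u w + (ksgn ix w T * sg W u v) * \<Phi> q z W u v"
    using coeff_d_triple[OF T(1) uv dist, of z] unfolding c1 c2 c3 by (simp only: mult.assoc)
  then have "coeff (d z T) (mono1 u + mono1 v + mono1 w) = E * (\<Phi> q z W v w - \<Phi> q z W u w + \<Phi> q z W u v)"
    unfolding e1 e2 e3 by (simp add: algebra_simps)
  moreover have "E * E = 1"
  proof -
    have "E * E = (ksgn ix u T * ksgn ix u T) * (ksgn ix v (insert u T) * ksgn ix v (insert u T)) *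
      (ksgn ix w (insert u (insert v T)) * ksgn ix w (insert u (insert v T)))"
      unfolding E_def by (simp only: mult_ac)
    then show ?thesis by simp
  qed
  ultimately show ?thesis by blast
qed

lemma \<Phi>_anti: "\<Phi> q z W v u = - \<Phi> q z W u v"
proof (cases "W \<in> \<Omega> q \<and> u \<in> W \<and> v \<in> W \<and> nonadj G u v")
  case True
  then have "sg W v u = - sg W u v" by (intro sg_swap) (auto simp: \<Omega>_def nonadj_def)
  then show ?thesis using True nonadj_sym[of G u v] by (simp add: \<Phi>_def insert_commute add.commute)
next
  case False
  then show ?thesis using nonadj_sym[of G] by (auto simp: \<Phi>_def)
qed

abbreviation "cyc q \<equiv> kcyc pscale (\<lambda>v p. var v * p) V ix (poly_piece V) Ik q 1"
abbreviation "bnd q \<equiv> kbnd pscale (\<lambda>v p. var v * p) V ix (poly_piece V) Ik q 1"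

lemma cyc_chain: "z \<in> cyc q \<Longrightarrow> z \<in> kchain V q (poly_piece V 2)"
  by (simp add: kcyc_def eval_nat_numeral)

lemma cyc_standard: "z \<in> cyc q \<Longrightarrow> standard G m \<Longrightarrow> coeff (d z T) m = 0"
  by (simp add: kcyc_def mem_Ik)

lemma \<Phi>_cocycle:
  assumes z: "z \<in> cyc q" and W: "W \<in> \<Omega> q"
  shows "\<Phi> q z W \<in> cocycles1 (nonadj G) W"
proof (rule cocycles1I)
  show "u \<in> W \<and> v \<in> W \<and> nonadj G u v" if "\<Phi> q z W u v \<noteq> 0" for u v
    using that by (auto simp: \<Phi>_def split: if_splits)
  show "\<Phi> q z W v u = - \<Phi> q z W u v" for u v by (rule \<Phi>_anti)
  fix u v w assume uvw: "u \<in> W" "v \<in> W" "w \<in> W" and N: "nonadj G u v" "nonadj G v w" "nonadj G u w"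
  have dist: "u \<noteq> v" "v \<noteq> w" "u \<noteq> w" using N by (auto simp: nonadj_def)
  define T where "T = W - {u, v, w}"
  have WV: "W \<subseteq> V" "card W = q + 2" using W by (auto simp: \<Omega>_def)
  then have finW: "finite W" using V finite_subset by blast
  have "card T = card W - card {u, v, w}" unfolding T_def using uvw by (intro card_Diff_subset) auto
  moreover have "card {u, v, w} = 3" using dist by simp
  moreover have "card {u, v, w} \<le> card W" using uvw finW by (intro card_mono) auto
  ultimately have "Suc (card T) = q" using WV by simp
  moreover have "W = insert u (insert v (insert w T))" using uvw by (auto simp: T_def)
  moreover have "T \<subseteq> V" "u \<in> V - T" "v \<in> V - T" "w \<in> V - T" using WV uvw by (auto simp: T_def)
  ultimately obtain s where s: "s * s = 1" "coeff (d z T) (mono1 u + mono1 v + mono1 w) = s * (\<Phi> q z W v w - \<Phi> q z W u w + \<Phi> q z W u v)"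
    using coeff_d_triple_\<Phi>[OF _ _ _ _ _ N] by blast
  have "coeff (d z T) (mono1 u + mono1 v + mono1 w) = 0" by (rule cyc_standard[OF z standard_triple[OF N]])
  with s have "\<Phi> q z W v w - \<Phi> q z W u w + \<Phi> q z W u v = 0" by auto
  then show "\<Phi> q z W u v + \<Phi> q z W v w = \<Phi> q z W u w" by (simp add: algebra_simps)
qed

text \<open>The boundary of a chain \<open>a\<close> with linear coefficients is the coboundary of
  the 0-cochain whose value at a vertex is the coefficient of that vertex in \<open>a\<close> on the
  rest of W, up to sign.\<close>

lemma \<Phi>_boundary:
  assumes W: "W \<in> \<Omega> q" and uv: "u \<in> W" "v \<in> W" "nonadj G u v"
  shows "\<Phi> q (d a) W u v = ksgn ix v (W - {v}) * coeff (a (W - {v})) (mono1 v) - ksgn ix u (W - {u}) * coeff (a (W - {u})) (mono1 u)"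
proof -
  have dist: "u \<noteq> v" using uv(3) by (simp add: nonadj_def)
  define T where "T = W - {u, v}"
  have T: "T \<subseteq> V" "u \<in> V - T" "v \<in> V - T" "W - {v} = insert u T" "W - {u} = insert v T"
    using W uv dist by (auto simp: T_def \<Omega>_def)
  have finT: "finite T" using T(1) V finite_subset by blast
  have nix: "ix u \<noteq> ix v" using T dist inj_onD[OF ix] by blast
  have sw: "ksgn ix u T * ksgn ix v (insert u T) = - (ksgn ix v T * ksgn ix u (insert v T) :: 'k)"
    by (rule swap[OF finT]) (use T nix in auto)
  define A where "A = coeff (a (insert u T)) (mono1 v)"
  define B where "B = coeff (a (insert v T)) (mono1 u)"
  have "\<Phi> q (d a) W u v = (ksgn ix u T * ksgn ix v (insert u T)) * (ksgn ix u T * A + ksgn ix v T * B)"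
    using W uv coeff_d_pair[OF T(1-3) dist, of a]
    by (simp add: \<Phi>_def sg_def T(4) T_def[symmetric] A_def B_def)
  also have "\<dots> = (ksgn ix u T * ksgn ix u T) * ksgn ix v (insert u T) * A
     + (ksgn ix u T * ksgn ix v (insert u T)) * ksgn ix v T * B"
    by (simp add: distrib_left mult_ac)
  also have "(ksgn ix u T * ksgn ix v (insert u T)) * ksgn ix v T * B = - (ksgn ix v T * ksgn ix v T * ksgn ix u (insert v T) * B)"
    unfolding sw by (simp add: mult_ac)
  finally show ?thesis by (simp add: T(4,5) A_def B_def)
qed

lemma \<Phi>_ideal:
  assumes f: "f \<in> kchain V q (Ik 2)"
  shows "\<Phi> q f W u v = 0"
proof (cases "nonadj G u v")
  case True
  have "f S \<in> Ik 2" for S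
    using kchain_all[OF f subspace_0[OF graded_subspace[OF graded_Ik]]] .
  then show ?thesis using standard_pair[OF True] by (simp add: \<Phi>_def mem_Ik)
qed (simp add: \<Phi>_def)

lemma \<Phi>_add: "\<Phi> q (y + z) W u v = \<Phi> q y W u v + \<Phi> q z W u v"
  by (simp add: \<Phi>_def lookup_add distrib_left)

lemma \<Phi>_minus: "\<Phi> q (y - z) W u v = \<Phi> q y W u v - \<Phi> q z W u v"
  by (simp add: \<Phi>_def lookup_minus right_diff_distrib)

lemma \<Phi>_scale: "\<Phi> q (\<lambda>S. pscale c (z S)) W u v = c * \<Phi> q z W u v"
  by (simp add: \<Phi>_def)

lemma \<Phi>_bnd:
  assumes "z \<in> bnd q" "W \<in> \<Omega> q"
  shows "\<exists>g. \<forall>u\<in>W. \<forall>v\<in>W. nonadj G u v \<longrightarrow> \<Phi> q z W u v = g v - g u"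
proof -
  obtain f a where z: "z = f + d a" "f \<in> kchain V q (Ik 2)"
    using assms(1) unfolding kbnd_def by (auto simp: eval_nat_numeral)
  have "\<forall>u\<in>W. \<forall>v\<in>W. nonadj G u v \<longrightarrow> \<Phi> q z W u v =
    ksgn ix v (W - {v}) * coeff (a (W - {v})) (mono1 v) - ksgn ix u (W - {u}) * coeff (a (W - {u})) (mono1 u)"
    unfolding z(1) \<Phi>_add \<Phi>_ideal[OF z(2)] using \<Phi>_boundary[OF assms(2)] by simp
  then show ?thesis by (intro exI[of _ "\<lambda>x. ksgn ix x (W - {x}) * coeff (a (W - {x})) (mono1 x)"])
qed

end

lemma mono1_eq_iff: "mono1 x = mono1 y \<longleftrightarrow> x = y"
proof
  assume "mono1 x = mono1 y"
  then have "Poly_Mapping.lookup (mono1 x) x = Poly_Mapping.lookup (mono1 y) x" by simp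
  then show "x = y" by (auto simp: lookup_single when_def split: if_splits)
qed simp

context edge_koszul
begin

text \<open>The cochain values are written back as coefficients. The result is a cycle of the
  quotient because standard cubic monomials in its differential have squarefree multidegree, where
  the cocycle identity applies.\<close>

lemma \<Phi>_onto:
  assumes F: "F \<in> fun_prod (\<Omega> (Suc p)) (cocycles1 (nonadj G))"
  shows "\<exists>z\<in>cyc (Suc p). \<Phi> (Suc p) z = F"
proof -
  \<comment> \<open>Each unordered pair is listed once, smaller number first, so that no quadratic
    monomial receives its coefficient twice.\<close>
  define P where "P = (\<lambda>S. {(u, v). u \<in> V - S \<and> v \<in> V - S \<and> nonadj G u v \<and> ix u < ix v})"
  define val where "val = (\<lambda>S u v. sg (insert u (insert v S)) u v * F (insert u (insert v S)) u v)"
  define z where "z = (\<lambda>S. if S \<subseteq> V \<and> card S = Suc p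
    then \<Sum>(u, v)\<in>P S. Poly_Mapping.single (mono1 u + mono1 v) (val S u v) else 0)"
  have finP: "finite (P S)" for S
    by (rule finite_subset[of _ "V \<times> V"]) (use V in \<open>auto simp: P_def\<close>)
  have FW: "F W \<in> cocycles1 (nonadj G) W" if "W \<in> \<Omega> (Suc p)" for W
    using F that by (simp add: fun_prod_def)
  have F0: "F W = 0" if "W \<notin> \<Omega> (Suc p)" for W
    using F that by (simp add: fun_prod_def)
  have z_coeff: "coeff (z S) m = (\<Sum>(u, v)\<in>P S. if mono1 u + mono1 v = m then val S u v else 0)"
    if "S \<subseteq> V" "card S = Suc p" for S m
    using that by (simp add: z_def lookup_sum lookup_single when_def case_prod_unfold)
  have z_nz: "\<exists>u v. (u, v) \<in> P S \<and> m = mono1 u + mono1 v" if "coeff (z S) m \<noteq> 0" for S m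
  proof (rule ccontr)
    assume no: "\<nexists>u v. (u, v) \<in> P S \<and> m = mono1 u + mono1 v"
    have S: "S \<subseteq> V" "card S = Suc p" using that by (auto simp: z_def split: if_splits)
    have "coeff (z S) m = 0" unfolding z_coeff[OF S]
    proof (intro sum.neutral ballI, clarify)
      fix a b assume "(a, b) \<in> P S"
      then have "mono1 a + mono1 b \<noteq> m" using no by blast
      then show "(if mono1 a + mono1 b = m then val S a b else 0) = 0" by simp
    qed
    then show False using that by simp
  qed
  have z_P: "coeff (z S) (mono1 u + mono1 v) = val S u v" if S: "S \<subseteq> V" "card S = Suc p" and uv: "(u, v) \<in> P S" for S u v
  proof -
    have "coeff (z S) (mono1 u + mono1 v) = (\<Sum>x\<in>P S. if x = (u, v) then val S u v else 0)"
      unfolding z_coeff[OF S]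
    proof (rule sum.cong[OF refl], clarify)
      fix a b assume ab: "(a, b) \<in> P S"
      have "mono1 a + mono1 b = mono1 u + mono1 v \<longleftrightarrow> (a, b) = (u, v)"
        using mono2_eq[of a b u v] ab uv by (auto simp: P_def nonadj_def)
      then show "(if mono1 a + mono1 b = mono1 u + mono1 v then val S a b else 0) =
        (if (a, b) = (u, v) then val S u v else 0)" by auto
    qed
    also have "\<dots> = val S u v" using finP uv by simp
    finally show ?thesis .
  qed
  have z_pair: "coeff (z S) (mono1 u + mono1 v) = val S u v"
    if S: "S \<subseteq> V" "card S = Suc p" and uv: "u \<in> V - S" "v \<in> V - S" "nonadj G u v" for S u v
  proof (cases "ix u < ix v")
    case True
    then show ?thesis using z_P[OF S] uv by (simp add: P_def)
  next
    case False
    have dist: "u \<noteq> v" using uv(3) by (simp add: nonadj_def)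
    then have "ix v < ix u" using False uv inj_onD[OF ix, of u v] by force
    then have "coeff (z S) (mono1 v + mono1 u) = val S v u" using z_P[OF S] uv nonadj_sym[OF uv(3)] by (simp add: P_def)
    \<comment> \<open>Both the sign and the cochain are antisymmetric, so their product does not
      depend on the order of the pair.\<close>
    moreover have "val S v u = val S u v"
    proof -
      define W where "W = insert u (insert v S)"
      have "finite S" using S(1) V finite_subset by blast
      then have W: "W \<in> \<Omega> (Suc p)" using S uv dist by (auto simp: W_def \<Omega>_def)
      have "sg W v u = - sg W u v" using W dist by (intro sg_swap) (auto simp: \<Omega>_def W_def)
      moreover have "F W v u = - F W u v" by (rule cocycles1_anti[OF FW[OF W]])
      ultimately show ?thesis by (simp add: val_def insert_commute[of v u] W_def)
    qed
    ultimately show ?thesis by (simp add: add.commute)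
  qed
  have \<Phi>z: "\<Phi> (Suc p) z W u v = F W u v" for W u v
  proof (cases "W \<in> \<Omega> (Suc p) \<and> u \<in> W \<and> v \<in> W \<and> nonadj G u v")
    case True
    then have dist: "u \<noteq> v" by (simp add: nonadj_def)
    have W: "W \<subseteq> V" "card W = Suc p + 2" using True by (auto simp: \<Omega>_def)
    have "card (W - {u, v}) = card W - card {u, v}" using True by (intro card_Diff_subset) auto
    then have "card (W - {u, v}) = Suc p" using W(2) dist by simp
    moreover have "insert u (insert v (W - {u, v})) = W" using True by auto
    ultimately have "coeff (z (W - {u, v})) (mono1 u + mono1 v) = sg W u v * F W u v"
      using z_pair[of "W - {u, v}" u v] W(1) True by (auto simp: val_def)
    then show ?thesis using True by (simp add: \<Phi>_def)
  next
    case False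
    then have "F W u v = 0" using F0[of W] cocycles1_supp[OF FW] by (cases "W \<in> \<Omega> (Suc p)") auto
    then show ?thesis using False by (auto simp: \<Phi>_def)
  qed
  have zC: "z \<in> kchain V (Suc p) (poly_piece V (Suc 1))"
  proof (rule kchainI)
    show "z S \<in> poly_piece V (Suc 1)" for S
    proof (rule poly_pieceI)
      fix m assume "coeff (z S) m \<noteq> 0"
      then obtain u v where "(u, v) \<in> P S" "m = mono1 u + mono1 v" using z_nz by blast
      then show "Poly_Mapping.keys m \<subseteq> V \<and> mdeg m = Suc 1"
        by (auto simp: P_def mdeg_add in_keys_iff lookup_add lookup_single when_def split: if_splits)
    qed
  qed (auto simp: z_def)
  have dC: "d z \<in> kchain V p (poly_piece V (Suc (Suc 1)))" by (rule d_chain[OF graded_poly zC])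
  have "d z T \<in> Ik (Suc (Suc 1))" for T
    unfolding mem_Ik
  proof (intro conjI allI impI)
    show "d z T \<in> poly_piece V (Suc (Suc 1))"
      using dC by (rule kchain_all) (rule subspace_0[OF graded_subspace[OF graded_poly]])
    fix m assume m: "standard G m"
    show "coeff (d z T) m = 0"
    proof (rule ccontr)
      assume nz: "coeff (d z T) m \<noteq> 0"
      then have "d z T \<noteq> 0" by auto
      then have T: "T \<subseteq> V" "card T = p" using kchain_outside[OF dC] by blast+
      have "(\<Sum>x\<in>V - T. ksgn ix x T * (if Poly_Mapping.lookup m x \<noteq> 0 then coeff (z (insert x T)) (m - mono1 x) else 0)) \<noteq> 0"
        using nz unfolding coeff_kdiff if_P[OF T(1)] .
      then obtain x where x: "x \<in> V - T" "ksgn ix x T * (if Poly_Mapping.lookup m x \<noteq> 0 then coeff (z (insert x T)) (m - mono1 x) else 0) \<noteq> 0"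
        using sum.not_neutral_contains_not_neutral by blast
      then have mx: "Poly_Mapping.lookup m x \<noteq> 0" "coeff (z (insert x T)) (m - mono1 x) \<noteq> 0"
        by (auto split: if_splits)
      \<comment> \<open>A nonzero coefficient forces the monomial to be the product of the
        multiplied variable \<open>x\<close> and a listed pair. That pair avoids \<open>x\<close>
        and T, so the three vertices are distinct and W is squarefree.\<close>
      obtain a b where ab: "(a, b) \<in> P (insert x T)" "m - mono1 x = mono1 a + mono1 b" using z_nz[OF mx(2)] by blast
      have m_eq: "m = mono1 x + mono1 a + mono1 b" using mono1_split[OF mx(1)] ab(2) by (simp add: add.assoc)
      have keys: "x \<in> Poly_Mapping.keys m" "a \<in> Poly_Mapping.keys m" "b \<in> Poly_Mapping.keys m"
        by (auto simp: m_eq in_keys_iff lookup_add)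
      have ab': "a \<in> V - T" "b \<in> V - T" "a \<noteq> x" "b \<noteq> x" "nonadj G a b" using ab(1) by (auto simp: P_def)
      have N: "nonadj G x a" "nonadj G x b" using nonadj_of_standard[OF m] keys ab' by auto
      define W where "W = insert x (insert a (insert b T))"
      have "finite T" using T(1) V finite_subset by blast
      then have W: "W \<in> \<Omega> (Suc p)" using T x(1) ab' by (auto simp: W_def \<Omega>_def nonadj_def)
      obtain s where "coeff (d z T) m = s * (\<Phi> (Suc p) z W a b - \<Phi> (Suc p) z W x b + \<Phi> (Suc p) z W x a)"
        using coeff_d_triple_\<Phi>[OF T(1) _ x(1) ab'(1,2) N(1) ab'(5) N(2) W_def] T(2) unfolding m_eq by blast
      moreover have "F W a b - F W x b + F W x a = 0"
        using cocycles1_triangle[OF FW[OF W], of x a b] N ab'(5) by (simp add: W_def algebra_simps)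
      ultimately show False using nz by (simp only: \<Phi>z mult_zero_right)
    qed
  qed
  then have "z \<in> cyc (Suc p)" using zC by (simp add: kcyc_def)
  moreover have "\<Phi> (Suc p) z = F" using \<Phi>z by (simp add: fun_eq_iff)
  ultimately show ?thesis by blast
qed

lemma coeff_khom_zero:
  assumes "\<And>w. w \<in> T \<Longrightarrow> coeff (f (T - {w})) (m + mono1 w) = 0"
  shows "coeff (khom V ix sel f T) m = 0"
  using assms by (simp add: coeff_khom[OF V] Let_def)

text \<open>In the multidegrees that are not squarefree, multiplication by a variable of multiplicity at
  least two is bijective on standard monomials, so there the homotopy contracts the complex.\<close>

lemma \<Phi>_zero_imp_bnd:
  assumes z: "z \<in> cyc q" and \<Phi>z: "\<And>W u v. \<Phi> q z W u v = 0"
  shows "\<exists>h\<in>kchain V (Suc q) (poly_piece V 1). z - d h \<in> kchain V q (Ik 2)"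
proof -
  have zC: "z \<in> kchain V q (poly_piece V 2)" by (rule cyc_chain[OF z])
  \<comment> \<open>Despite the letters, \<open>sq\<close> singles out the multidegrees with a
    vertex of multiplicity at least two. The chain \<open>y\<close> is the part of \<open>z\<close>
    in them, and \<open>sel\<close> picks such a vertex.\<close>
  define sq where "sq = (\<lambda>\<alpha> :: 'v \<Rightarrow>\<^sub>0 nat. \<exists>v\<in>V. Poly_Mapping.lookup \<alpha> v \<ge> 2)"
  define y where "y = (\<lambda>S. pfilter (\<lambda>m. sq (m + chi S)) (z S))"
  define sel where "sel = (\<lambda>\<alpha> :: 'v \<Rightarrow>\<^sub>0 nat. SOME v. v \<in> V \<and> Poly_Mapping.lookup \<alpha> v \<ge> 2)"
  define h where "h = khom V ix sel y"
  have sel: "sel \<alpha> \<in> V \<and> Poly_Mapping.lookup \<alpha> (sel \<alpha>) \<ge> 2" if ex: "sq \<alpha>" for \<alpha>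
  proof -
    obtain v where "v \<in> V \<and> Poly_Mapping.lookup \<alpha> v \<ge> 2" using ex unfolding sq_def by blast
    then show ?thesis unfolding sel_def by (rule someI)
  qed
  have z_nz: "S \<subseteq> V \<and> card S = q \<and> Poly_Mapping.keys m \<subseteq> V \<and> mdeg m = 2" if nz: "coeff (z S) m \<noteq> 0" for S m
  proof -
    have "z S \<noteq> 0" using nz by auto
    then have S: "S \<subseteq> V" "card S = q" using kchain_outside[OF zC] by blast+
    show ?thesis using S poly_pieceD[OF kchain_in[OF zC S] nz] by simp
  qed
  have hC: "h \<in> kchain V (Suc q) (poly_piece V 1)"
  proof -
    have nz: "T \<subseteq> V \<and> card T = Suc q \<and> Poly_Mapping.keys m \<subseteq> V \<and> mdeg m = 1" if "coeff (h T) m \<noteq> 0" for T m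
    proof -
      obtain w where w: "w \<in> T" "coeff (y (T - {w})) (m + mono1 w) \<noteq> 0"
        using coeff_khom_zero[of T y m sel] \<open>coeff (h T) m \<noteq> 0\<close> unfolding h_def by blast
      have TV: "T \<subseteq> V" using \<open>coeff (h T) m \<noteq> 0\<close> by (auto simp: h_def coeff_khom[OF V] Let_def split: if_splits)
      have "coeff (z (T - {w})) (m + mono1 w) \<noteq> 0" using w(2) by (auto simp: y_def split: if_splits)
      from z_nz[OF this] have n: "card (T - {w}) = q" "Poly_Mapping.keys (m + mono1 w) \<subseteq> V" "mdeg (m + mono1 w) = 2" by auto
      have "finite T" using TV V finite_subset by blast
      then have "card T = Suc q" using n(1) card_Suc_Diff1[of T w] w(1) by simp
      moreover have "Poly_Mapping.keys m \<subseteq> Poly_Mapping.keys (m + mono1 w)" by (auto simp: in_keys_iff lookup_add)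
      ultimately show ?thesis using TV n by (auto simp: mdeg_add)
    qed
    show ?thesis
    proof (rule kchainI)
      show "h T \<in> poly_piece V 1" for T using nz by (intro poly_pieceI) blast
      show "h T = 0" if "\<not> (T \<subseteq> V \<and> card T = Suc q)" for T
        using nz that by (intro poly_mapping_eqI) (metis lookup_zero)
    qed
  qed
  have dhC: "d h \<in> kchain V q (poly_piece V 2)"
    using d_chain[OF graded_poly hC] by (simp add: eval_nat_numeral)
  have multideg: "m - mono1 x + chi (insert x T) = m + chi T"
    if "T \<subseteq> V" "x \<in> V - T" "Poly_Mapping.lookup m x \<noteq> 0" for T x m
  proof -
    have "finite T" using that(1) V finite_subset by blast
    then have "m - mono1 x + chi (insert x T) = (mono1 x + (m - mono1 x)) + chi T"
      using that by (simp add: chi_insert ac_simps)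
    then show ?thesis using mono1_split[OF that(3)] by simp
  qed
  have dy: "coeff (d y T) m = coeff (d z T) m" if "T \<subseteq> V" "sq (m + chi T)" for T m
    unfolding coeff_kdiff if_P[OF that(1)]
    by (rule sum.cong) (use that multideg in \<open>auto simp: y_def\<close>)
  have main: "coeff (d h S) m = coeff (z S) m" if m: "standard G m" and S: "S \<subseteq> V" "card S = q" for S m
  proof (cases "sq (m + chi S)")
    case True
    have finS: "finite S" using S(1) V finite_subset by blast
    define w where "w = sel (m + chi S)"
    have w: "w \<in> V" "Poly_Mapping.lookup (m + chi S) w \<ge> 2" using sel[OF True] by (simp_all add: w_def)
    have "coeff (d (khom V ix sel y) S) m = coeff (y S) m"
    proof (rule khom_homotopy[OF V ix S(1)])
      show "sel (m + chi S) = w" by (simp add: w_def)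
      show "w \<in> V" by (rule w)
      show "Poly_Mapping.lookup (m + chi S) w \<noteq> 0" using w(2) by simp
      assume wS: "w \<in> S"
      have mw: "Poly_Mapping.lookup m w \<noteq> 0" using w(2) wS by (simp add: lookup_add lookup_chi[OF finS])
      \<comment> \<open>Multiplicity at least two and \<open>w\<close> in S mean that
        \<open>w\<close> already divides \<open>m\<close>. Multiplying by \<open>w\<close> leaves
        the support unchanged, so the monomial stays standard and the cycle condition is
        available.\<close>
      have "Poly_Mapping.keys (m + mono1 w) \<subseteq> Poly_Mapping.keys m"
        using mw by (auto simp: in_keys_iff lookup_add lookup_single when_def split: if_splits)
      then have std: "standard G (m + mono1 w)" by (rule standard_mono[OF m])
      have "S = insert w (S - {w})" using wS by auto
      then have "chi S = mono1 w + chi (S - {w})" using chi_insert[of "S - {w}" w] finS by simp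
      then have "sq (m + mono1 w + chi (S - {w}))" using True by (simp add: ac_simps)
      then have "coeff (d y (S - {w})) (m + mono1 w) = coeff (d z (S - {w})) (m + mono1 w)"
        using S by (intro dy) auto
      also have "\<dots> = 0" by (rule cyc_standard[OF z std])
      finally show "coeff (d y (S - {w})) (m + mono1 w) = 0" .
    qed
    then show ?thesis using True by (simp add: h_def y_def)
  next
    case False
    have finS: "finite S" using S(1) V finite_subset by blast
    \<comment> \<open>In a squarefree multidegree the monomial is a product of two distinct vertices
      off S, and its coefficient is, up to sign, a value of \<open>\<Phi>\<close>, which
      vanishes.\<close>
    have "coeff (z S) m = 0"
    proof (rule ccontr)
      assume nz: "coeff (z S) m \<noteq> 0"
      from z_nz[OF this] have n: "Poly_Mapping.keys m \<subseteq> V" "mdeg m = 2" by auto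
      obtain a b where ab: "m = mono1 a + mono1 b" using mdeg_2_split[OF n(2)] by blast
      have keys: "a \<in> Poly_Mapping.keys m" "b \<in> Poly_Mapping.keys m" by (auto simp: ab in_keys_iff lookup_add)
      then have abV: "a \<in> V" "b \<in> V" using n(1) by auto
      have lt: "Poly_Mapping.lookup (m + chi S) v < 2" if "v \<in> V" for v using False that by (auto simp: sq_def)
      have "a \<noteq> b" using lt[OF abV(1)] by (auto simp: ab lookup_add)
      moreover have "a \<notin> S" "b \<notin> S"
        using lt[OF abV(1)] lt[OF abV(2)] by (auto simp: ab lookup_add lookup_chi[OF finS])
      ultimately have W: "insert a (insert b S) \<in> \<Omega> q" "insert a (insert b S) - {a, b} = S"
        using S abV finS by (auto simp: \<Omega>_def)
      have "nonadj G a b" by (rule nonadj_of_standard[OF m keys \<open>a \<noteq> b\<close>])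
      then have e: "sg (insert a (insert b S)) a b * coeff (z S) m = 0"
        using \<Phi>z[of "insert a (insert b S)" a b] W by (simp add: \<Phi>_def ab)
      have "coeff (z S) m = sg (insert a (insert b S)) a b * (sg (insert a (insert b S)) a b * coeff (z S) m)"
        by simp
      also have "\<dots> = 0" unfolding e by simp
      finally show False using nz by simp
    qed
    moreover have "coeff (d h S) m = 0"
      unfolding coeff_kdiff if_P[OF S(1)]
    proof (rule sum.neutral, rule ballI)
      fix x assume x: "x \<in> V - S"
      have "coeff (h (insert x S)) (m - mono1 x) = 0" if mx: "Poly_Mapping.lookup m x \<noteq> 0"
        unfolding h_def
      proof (rule coeff_khom_zero)
        fix w assume w: "w \<in> insert x S"
        have "insert x S = insert w (insert x S - {w})" using w by auto
        then have "chi (insert x S) = mono1 w + chi (insert x S - {w})"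
          using chi_insert[of "insert x S - {w}" w] finS by simp
        then have "m - mono1 x + mono1 w + chi (insert x S - {w}) = m + chi S"
          using multideg[OF S(1) x mx] by (simp add: ac_simps)
        then show "coeff (y (insert x S - {w})) (m - mono1 x + mono1 w) = 0" using False by (simp add: y_def)
      qed
      then show "ksgn ix x S * (if Poly_Mapping.lookup m x \<noteq> 0 then coeff (h (insert x S)) (m - mono1 x) else 0) = 0"
        by simp
    qed
    ultimately show ?thesis by simp
  qed
  have "z - d h \<in> kchain V q (Ik 2)"
  proof (rule kchainI)
    have sub: "z - d h \<in> kchain V q (poly_piece V 2)"
      by (rule kchain_minus[OF graded_subspace[OF graded_poly] zC dhC])
    fix S assume S: "S \<subseteq> V" "card S = q"
    show "(z - d h) S \<in> Ik 2"
      unfolding mem_Ik using kchain_in[OF sub S] main[OF _ S] by (simp add: lookup_minus)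
  next
    fix S assume "\<not> (S \<subseteq> V \<and> card S = q)"
    then show "(z - d h) S = 0" using kchain_outside[OF zC] kchain_outside[OF dhC] by simp
  qed
  then show ?thesis using hC by blast
qed

text \<open>Subtracting the boundary of a chain with linear coefficients kills all the cochains at
  once; what is left is a boundary by \<open>\<Phi>_zero_imp_bnd\<close>.\<close>

lemma bnd_of_coboundaries:
  assumes z: "z \<in> cyc q"
    and g: "\<And>W u v. W \<in> \<Omega> q \<Longrightarrow> u \<in> W \<Longrightarrow> v \<in> W \<Longrightarrow> nonadj G u v \<Longrightarrow> \<Phi> q z W u v = g W v - g W u"
  shows "z \<in> bnd q"
proof -
  \<comment> \<open>Obtained by solving the formula of \<open>\<Phi>_boundary\<close> for the
    coefficients; the missing vertex determines W as S with that vertex added.\<close>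
  define a where "a = (\<lambda>S. if S \<subseteq> V \<and> card S = Suc q
    then \<Sum>u\<in>V - S. Poly_Mapping.single (mono1 u) (ksgn ix u S * g (insert u S) u) else 0)"
  have aC: "a \<in> kchain V (Suc q) (poly_piece V 1)"
  proof (rule kchainI)
    show "a S \<in> poly_piece V 1" for S
    proof (rule poly_pieceI)
      fix m assume nz: "coeff (a S) m \<noteq> 0"
      have "\<exists>u\<in>V. m = mono1 u"
      proof (rule ccontr)
        assume no: "\<not> (\<exists>u\<in>V. m = mono1 u)"
        have "coeff (a S) m = 0"
          unfolding a_def using no by (auto simp: lookup_sum lookup_single when_def intro!: sum.neutral)
        then show False using nz by simp
      qed
      then show "Poly_Mapping.keys m \<subseteq> V \<and> mdeg m = 1" by auto
    qed
  qed (auto simp: a_def)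
  have coeff_a: "coeff (a S) (mono1 v) = ksgn ix v S * g (insert v S) v"
    if "S \<subseteq> V" "card S = Suc q" "v \<in> V - S" for S v
  proof -
    have "coeff (a S) (mono1 v) = (\<Sum>u\<in>V - S. if u = v then ksgn ix v S * g (insert v S) v else 0)"
      using that(1,2) by (auto simp: a_def lookup_sum lookup_single when_def mono1_eq_iff intro!: sum.cong)
    then show ?thesis using that(3) V by simp
  qed
  have daC: "d a \<in> kchain V q (poly_piece V 2)"
    using d_chain[OF graded_poly aC] by (simp add: eval_nat_numeral)
  have \<Phi>a: "\<Phi> q (d a) W u v = g W v - g W u"
    if W: "W \<in> \<Omega> q" and uv: "u \<in> W" "v \<in> W" "nonadj G u v" for W u v
  proof -
    have WV: "W \<subseteq> V" "card W = q + 2" using W by (auto simp: \<Omega>_def)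
    have c: "ksgn ix x (W - {x}) * coeff (a (W - {x})) (mono1 x) = g W x" if "x \<in> W" for x
    proof -
      have "card (W - {x}) = Suc q" using WV that by (simp add: card_Diff_singleton)
      then have "coeff (a (W - {x})) (mono1 x) = ksgn ix x (W - {x}) * g W x"
        using coeff_a[of "W - {x}" x] WV that by (auto simp: insert_absorb)
      then show ?thesis by simp
    qed
    show ?thesis unfolding \<Phi>_boundary[OF W uv] c[OF uv(1)] c[OF uv(2)] ..
  qed
  define z' where "z' = z - d a"
  have "z' \<in> cyc q"
  proof -
    have "z' \<in> kchain V q (poly_piece V 2)" unfolding z'_def
      by (rule kchain_minus[OF graded_subspace[OF graded_poly] cyc_chain[OF z] daC])
    moreover have "d z' = d z" by (simp add: z'_def d_minus d_d)
    ultimately show ?thesis using z by (simp add: kcyc_def eval_nat_numeral)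
  qed
  moreover have "\<Phi> q z' W u v = 0" for W u v
  proof (cases "W \<in> \<Omega> q \<and> u \<in> W \<and> v \<in> W \<and> nonadj G u v")
    case True
    then show ?thesis unfolding z'_def \<Phi>_minus using g \<Phi>a by simp
  qed (auto simp: \<Phi>_def)
  ultimately obtain h where h: "h \<in> kchain V (Suc q) (poly_piece V 1)" "z' - d h \<in> kchain V q (Ik 2)"
    using \<Phi>_zero_imp_bnd by blast
  have "z = (z' - d h) + d (h + a)" by (simp add: z'_def d_add)
  moreover have "h + a \<in> kchain V (Suc q) (poly_piece V 1)"
    by (rule kchain_add[OF graded_subspace[OF graded_poly] h(1) aC])
  ultimately show ?thesis using h(2) unfolding kbnd_def by (auto simp: eval_nat_numeral)
qed

lemma koszul_homology_dim:
  assumes r: "\<And>W. W \<in> \<Omega> (Suc p) \<Longrightarrow> h1_dim K (nonadj G) W (r W)"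
  shows "quot_dim (\<lambda>c f S. pscale c (f S)) (cyc (Suc p)) (bnd (Suc p)) (\<Sum>W\<in>\<Omega> (Suc p). r W)"
proof -
  let ?Z = "fun_prod (\<Omega> (Suc p)) (cocycles1 (nonadj G)) :: ('v set \<Rightarrow> 'v \<Rightarrow> 'v \<Rightarrow> 'k) set"
  let ?B = "fun_prod (\<Omega> (Suc p)) (coboundaries1 (nonadj G)) :: ('v set \<Rightarrow> 'v \<Rightarrow> 'v \<Rightarrow> 'k) set"
  interpret F: vector_space "\<lambda>c (f :: 'v \<Rightarrow> 'v \<Rightarrow> 'k) u v. c * f u v" by (rule vector_space_fun2)
  have fin\<Omega>: "finite (\<Omega> (Suc p))" using V by (auto simp: \<Omega>_def)
  have "quot_dim (\<lambda>c f w u v. c * f w u v) ?Z ?B (\<Sum>W\<in>\<Omega> (Suc p). r W)"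
    using r by (intro quot_dim_fun_prod[OF F.vector_space_axioms fin\<Omega> F.subspace_0[OF cocycles1_subspace]])
      (simp add: h1_dim_def)
  then obtain b :: "nat \<Rightarrow> _" where b: "quot_basis (\<lambda>c f w u v. c * f w u v) ?Z ?B {..<(\<Sum>W\<in>\<Omega> (Suc p). r W)} b"
    unfolding quot_dim_def by blast
  have "\<exists>b'. quot_basis (\<lambda>c f S. pscale c (f S)) (cyc (Suc p)) (bnd (Suc p)) {..<(\<Sum>W\<in>\<Omega> (Suc p). r W)} b'"
  \<comment> \<open>The known basis lives on the cohomology side, whereas \<open>\<Phi>\<close> maps
    Koszul cycles there; the converse of its graph is used as the relation.\<close>
  proof (rule quot_basis_transfer[OF vector_space_fun[OF F.vector_space_axioms] vector_space_fun[OF vector_space_axioms] b,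
        where \<rho> = "(\<lambda>z. (\<Phi> (Suc p) z, z)) ` cyc (Suc p)"])
    have \<Phi>Z: "\<Phi> (Suc p) z \<in> ?Z" if "z \<in> cyc (Suc p)" for z
      using \<Phi>_cocycle[OF that] by (auto simp: fun_prod_def \<Phi>_def fun_eq_iff)
    then show "(\<lambda>z. (\<Phi> (Suc p) z, z)) ` cyc (Suc p) \<subseteq> ?Z \<times> cyc (Suc p)" by auto
    show "(u + v, u' + v') \<in> (\<lambda>z. (\<Phi> (Suc p) z, z)) ` cyc (Suc p)"
      if "(u, u') \<in> (\<lambda>z. (\<Phi> (Suc p) z, z)) ` cyc (Suc p)" "(v, v') \<in> (\<lambda>z. (\<Phi> (Suc p) z, z)) ` cyc (Suc p)" for u u' v v'
    proof (rule image_eqI)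
      show "(u + v, u' + v') = (\<Phi> (Suc p) (u' + v'), u' + v')" using that by (auto simp: fun_eq_iff \<Phi>_add)
      show "u' + v' \<in> cyc (Suc p)" using that kcyc_add[OF graded_poly graded_Ik] by auto
    qed
    show "(\<lambda>w. (\<lambda>x y. c * u w x y), \<lambda>S. pscale c (u' S)) \<in> (\<lambda>z. (\<Phi> (Suc p) z, z)) ` cyc (Suc p)"
      if "(u, u') \<in> (\<lambda>z. (\<Phi> (Suc p) z, z)) ` cyc (Suc p)" for c u u'
    proof (rule image_eqI)
      show "(\<lambda>w. (\<lambda>x y. c * u w x y), \<lambda>S. pscale c (u' S)) = (\<Phi> (Suc p) (\<lambda>S. pscale c (u' S)), \<lambda>S. pscale c (u' S))"
        using that by (auto simp: fun_eq_iff \<Phi>_scale)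
      show "(\<lambda>S. pscale c (u' S)) \<in> cyc (Suc p)" using that kcyc_scale[OF graded_poly graded_Ik] by auto
    qed
    show "\<exists>u'. (u, u') \<in> (\<lambda>z. (\<Phi> (Suc p) z, z)) ` cyc (Suc p)" if "u \<in> ?Z" for u
      using \<Phi>_onto[OF that] by blast
    show "\<exists>u w. (u, w) \<in> (\<lambda>z. (\<Phi> (Suc p) z, z)) ` cyc (Suc p) \<and> z - w \<in> bnd (Suc p)" if "z \<in> cyc (Suc p)" for z
      using that kbnd_zero[OF graded_poly graded_Ik, of "Suc p" 1]
      by (intro exI[of _ "\<Phi> (Suc p) z"] exI[of _ z]) simp
    show "u \<in> ?B \<longleftrightarrow> z \<in> bnd (Suc p)" if uz: "(u, z) \<in> (\<lambda>z. (\<Phi> (Suc p) z, z)) ` cyc (Suc p)" for u z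
    proof -
      have z: "z \<in> cyc (Suc p)" "u = \<Phi> (Suc p) z" using uz by auto
      show ?thesis
      proof
        assume u: "u \<in> ?B"
        have "\<forall>W\<in>\<Omega> (Suc p). \<exists>g. \<forall>x\<in>W. \<forall>y\<in>W. nonadj G x y \<longrightarrow> \<Phi> (Suc p) z W x y = g y - g x"
          using u unfolding z(2) fun_prod_def coboundaries1_def by blast
        then obtain g where "\<And>W. W \<in> \<Omega> (Suc p) \<Longrightarrow> \<forall>x\<in>W. \<forall>y\<in>W. nonadj G x y \<longrightarrow> \<Phi> (Suc p) z W x y = g W y - g W x"
          by metis
        then show "z \<in> bnd (Suc p)" by (intro bnd_of_coboundaries[OF z(1), of g]) blast
      next
        assume "z \<in> bnd (Suc p)"
        then show "u \<in> ?B"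
          using \<Phi>_bnd \<Phi>Z[OF z(1)] unfolding z(2) fun_prod_def coboundaries1_def by blast
      qed
    qed
    have "\<Phi> (Suc p) 0 = 0" by (auto simp: fun_eq_iff \<Phi>_def)
    then show "(0, 0) \<in> (\<lambda>z. (\<Phi> (Suc p) z, z)) ` cyc (Suc p)"
      using kcyc_zero[OF graded_poly graded_Ik, of "Suc p" 1] by (intro image_eqI[of _ _ 0]) auto
    show "x + y \<in> bnd (Suc p)" if "x \<in> bnd (Suc p)" "y \<in> bnd (Suc p)" for x y
      by (rule kbnd_add[OF graded_poly graded_Ik that])
  qed
  then show ?thesis unfolding quot_dim_def .
qed

end

text \<open>The case \<open>d = i + 2\<close> of Hochster's formula.\<close>

theorem graph_betti_Hochster:
  fixes G :: "'v graph"
  assumes G: "simple_graph G" and i: "i \<ge> 1"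
    and r: "\<And>W. W \<subseteq> verts G \<Longrightarrow> card W = i + 2 \<Longrightarrow> h1_dim TYPE('k::field) (nonadj G) W (r W)"
  shows "graph_betti TYPE('k) G i (i + 2) = (\<Sum>W | W \<subseteq> verts G \<and> card W = i + 2. r W)"
proof -
  have V: "finite (verts G)" using G by (simp add: simple_graph_def)
  obtain ix :: "'v \<Rightarrow> nat" where ix: "inj_on ix (verts G)" using finite_imp_inj_to_nat_seg[OF V] by blast
  interpret E: edge_koszul G ix "TYPE('k)" by unfold_locales (rule G ix)+
  obtain p where p: "i = Suc p" using i by (cases i) auto
  let ?I = "edge_ideal G :: ('v, 'k) mpoly set"
  have hom: "homogeneous_ideal (verts G) ?I" by (rule edge_ideal_homogeneous[OF G])
  have "quot_dim (\<lambda>c f S. pscale c (f S)) (E.cyc (Suc p)) (E.bnd (Suc p)) (\<Sum>W\<in>E.\<Omega> (Suc p). r W)"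
    using r by (intro E.koszul_homology_dim) (auto simp: E.\<Omega>_def p)
  then have dim: "quot_dim (\<lambda>c f S. pscale c (f S)) (E.cyc (Suc p)) (E.bnd (Suc p)) (\<Sum>W | W \<subseteq> verts G \<and> card W = i + 2. r W)"
    by (simp add: E.\<Omega>_def p)
  \<comment> \<open>Every minimal resolution indexes a basis of the same homology space by these
    elements, so the described number is unique.\<close>
  have uniq: "card {e \<in> B i. \<delta> i e = i + 2} = (\<Sum>W | W \<subseteq> verts G \<and> card W = i + 2. r W)"
    if res: "minimal_graded_free_resolution (verts G) ?I B \<delta> \<phi> \<epsilon>" for B \<delta> \<phi> \<epsilon>
  proof -
    interpret minimal_resolution "verts G" ?I B \<delta> \<phi> \<epsilon> ix
      by unfold_locales (rule V ix hom res)+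
    have Ik: "E.Ik = (\<lambda>k. poly_piece (verts G) k \<inter> ?I)" by (rule ext) (simp add: E.Ik_def)
    obtain b where "quot_basis (\<lambda>c f S. pscale c (f S)) (E.cyc (Suc p)) (E.bnd (Suc p)) {e \<in> B i. \<delta> i e = i + 2} b"
      using resolution_basis_koszul_homology[of p 1] by (auto simp: p Ik)
    from quot_basis_card_eq[OF vector_space_fun[OF E.vector_space_axioms] E.kbnd_subspace[OF E.graded_poly E.graded_Ik] this dim]
    show ?thesis by simp
  qed
  obtain B \<delta> \<phi> \<epsilon> where res: "minimal_graded_free_resolution (verts G) ?I B \<delta> \<phi> \<epsilon>"
    using minimal_graded_free_resolution_exists[OF V hom edge_ideal_const[OF G]] by blast
  show ?thesis
    unfolding graph_betti_def graded_betti_def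
  proof (rule the_equality)
    show "\<exists>B \<delta> \<phi> \<epsilon>. minimal_graded_free_resolution (verts G) ?I B \<delta> \<phi> \<epsilon> \<and>
      (\<Sum>W | W \<subseteq> verts G \<and> card W = i + 2. r W) = card {e \<in> B i. \<delta> i e = i + 2}"
      using res uniq[OF res] by (intro exI conjI) auto
    show "s = (\<Sum>W | W \<subseteq> verts G \<and> card W = i + 2. r W)"
      if "\<exists>B \<delta> \<phi> \<epsilon>. minimal_graded_free_resolution (verts G) ?I B \<delta> \<phi> \<epsilon> \<and>
        s = card {e \<in> B i. \<delta> i e = i + 2}" for s
      using that by (elim exE conjE) (simp only: uniq)
  qed
qed

section \<open>First cohomology of flag complexes\<close>

text \<open>Connected components as a labelling by \<open>{..<c}\<close> that is constant along
  edges and has connected fibres; the empty set gets no components.\<close>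

definition ncomp :: "('v \<Rightarrow> 'v \<Rightarrow> bool) \<Rightarrow> 'v set \<Rightarrow> nat \<Rightarrow> bool" where
  "ncomp N X c \<longleftrightarrow> (\<exists>\<pi> :: 'v \<Rightarrow> nat. \<pi> ` X = {..<c} \<and> (\<forall>x\<in>X. \<forall>y\<in>X. N x y \<longrightarrow> \<pi> x = \<pi> y) \<and>
    (\<forall>x\<in>X. \<forall>y\<in>X. \<pi> x = \<pi> y \<longrightarrow> (\<lambda>u v. u \<in> X \<and> v \<in> X \<and> N u v)\<^sup>*\<^sup>* x y))"

lemma coboundaries1I:
  assumes "f \<in> cocycles1 N W" "\<And>u v. u \<in> W \<Longrightarrow> v \<in> W \<Longrightarrow> N u v \<Longrightarrow> f u v = g v - g u"
  shows "f \<in> coboundaries1 N W"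
  using assms unfolding coboundaries1_def by blast

lemma coboundaries1D: "f \<in> coboundaries1 N W \<Longrightarrow> f \<in> cocycles1 N W"
  unfolding coboundaries1_def by blast

lemma h1_dim_transfer:
  fixes \<theta> :: "('v \<Rightarrow> 'v \<Rightarrow> 'k::field) \<Rightarrow> ('w \<Rightarrow> 'w \<Rightarrow> 'k)"
  assumes "h1_dim TYPE('k) N W r"
    and "\<And>f. f \<in> cocycles1 N W \<Longrightarrow> \<theta> f \<in> cocycles1 N' W'"
    and "\<And>f g. \<theta> (f + g) = \<theta> f + \<theta> g" "\<And>c f. \<theta> (\<lambda>u v. c * f u v) = (\<lambda>u v. c * \<theta> f u v)"
    and "\<And>f'. f' \<in> cocycles1 N' W' \<Longrightarrow> \<exists>f\<in>cocycles1 N W. f' - \<theta> f \<in> coboundaries1 N' W'"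
    and "\<And>f. f \<in> cocycles1 N W \<Longrightarrow> f \<in> coboundaries1 N W \<longleftrightarrow> \<theta> f \<in> coboundaries1 N' W'"
  shows "h1_dim TYPE('k) N' W' r"
  unfolding h1_dim_def
  by (rule quot_dim_transfer_fun[OF vector_space_fun2 vector_space_fun2 assms(1)[unfolded h1_dim_def]
        cocycles1_subspace coboundaries1_subspace assms(2-6)])

lemma h1_dim_image:
  assumes h: "inj_on h W" and N: "\<And>u v. u \<in> W \<Longrightarrow> v \<in> W \<Longrightarrow> N' (h u) (h v) \<longleftrightarrow> N u v"
    and r: "h1_dim TYPE('k::field) N W r"
  shows "h1_dim TYPE('k) N' (h ` W) r"
proof -
  define i where "i = inv_into W h"
  have ih: "i (h u) = u" if "u \<in> W" for u using that h by (simp add: i_def)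
  define \<theta> where "\<theta> = (\<lambda>(f :: 'a \<Rightarrow> 'a \<Rightarrow> 'k) x y. if x \<in> h ` W \<and> y \<in> h ` W then f (i x) (i y) else 0)"
  have \<theta>h: "\<theta> f (h u) (h v) = f u v" if "u \<in> W" "v \<in> W" for f u v
    using that ih by (simp add: \<theta>_def)
  have \<theta>0: "\<theta> f x y = 0" if "x \<notin> h ` W \<or> y \<notin> h ` W" for f x y using that by (auto simp: \<theta>_def)
  have cyc: "\<theta> f \<in> cocycles1 N' (h ` W)" if f: "f \<in> cocycles1 N W" for f
  proof (rule cocycles1I)
    fix x y assume nz: "\<theta> f x y \<noteq> 0"
    then obtain u v where uv: "x = h u" "y = h v" "u \<in> W" "v \<in> W" using \<theta>0 by blast
    then have "f u v \<noteq> 0" using nz \<theta>h by simp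
    then show "x \<in> h ` W \<and> y \<in> h ` W \<and> N' x y" using cocycles1_supp[OF f] N uv by auto
  next
    fix x y show "\<theta> f y x = - \<theta> f x y"
      using cocycles1_anti[OF f, of "i y" "i x"] by (simp add: \<theta>_def)
  next
    fix x y z assume "x \<in> h ` W" "y \<in> h ` W" "z \<in> h ` W" and n: "N' x y" "N' y z" "N' x z"
    then obtain u v w where uvw: "x = h u" "y = h v" "z = h w" "u \<in> W" "v \<in> W" "w \<in> W" by blast
    then show "\<theta> f x y + \<theta> f y z = \<theta> f x z"
      using cocycles1_triangle[OF f uvw(4-6)] n N \<theta>h by simp
  qed
  show ?thesis
  proof (rule h1_dim_transfer[OF r, where \<theta> = \<theta>])
    show "\<theta> f \<in> cocycles1 N' (h ` W)" if "f \<in> cocycles1 N W" for f using that by (rule cyc)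
    show "\<theta> (f + g) = \<theta> f + \<theta> g" for f g by (auto simp: \<theta>_def fun_eq_iff)
    show "\<theta> (\<lambda>u v. c * f u v) = (\<lambda>u v. c * \<theta> f u v)" for c f by (auto simp: \<theta>_def fun_eq_iff)
  next
    fix f' :: "_ \<Rightarrow> _ \<Rightarrow> 'k" assume f': "f' \<in> cocycles1 N' (h ` W)"
    define f where "f = (\<lambda>u v. if u \<in> W \<and> v \<in> W then f' (h u) (h v) else 0)"
    have f: "f \<in> cocycles1 N W"
    proof (rule cocycles1I)
      show "u \<in> W \<and> v \<in> W \<and> N u v" if "f u v \<noteq> 0" for u v
        using that cocycles1_supp[OF f', of "h u" "h v"] N by (auto simp: f_def split: if_splits)
      show "f v u = - f u v" for u v using cocycles1_anti[OF f', of "h v" "h u"] by (simp add: f_def)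
      show "f u v + f v w = f u w" if "u \<in> W" "v \<in> W" "w \<in> W" "N u v" "N v w" "N u w" for u v w
        using cocycles1_triangle[OF f', of "h u" "h v" "h w"] that N by (simp add: f_def)
    qed
    have "f' x y = \<theta> f x y" for x y
    proof (cases "x \<in> h ` W \<and> y \<in> h ` W")
      case True
      then obtain u v where "x = h u" "y = h v" "u \<in> W" "v \<in> W" by blast
      then show ?thesis using \<theta>h by (simp add: f_def)
    next
      case False
      then show ?thesis using \<theta>0 cocycles1_supp[OF f'] by metis
    qed
    then have "f' - \<theta> f = 0" by (simp add: fun_eq_iff)
    then show "\<exists>f\<in>cocycles1 N W. f' - \<theta> f \<in> coboundaries1 N' (h ` W)"
      using f module.subspace_0[OF _ coboundaries1_subspace] vector_space_fun2
      by (metis (no_types, lifting) module_iff_vector_space)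
  next
    fix f :: "'a \<Rightarrow> 'a \<Rightarrow> 'k" assume f: "f \<in> cocycles1 N W"
    show "f \<in> coboundaries1 N W \<longleftrightarrow> \<theta> f \<in> coboundaries1 N' (h ` W)"
    proof
      assume "f \<in> coboundaries1 N W"
      then obtain g where g: "\<And>u v. u \<in> W \<Longrightarrow> v \<in> W \<Longrightarrow> N u v \<Longrightarrow> f u v = g v - g u" unfolding coboundaries1_def by blast
      show "\<theta> f \<in> coboundaries1 N' (h ` W)"
        by (rule coboundaries1I[where g = "g \<circ> i", OF cyc[OF f]]) (use g N \<theta>h ih in auto)
    next
      assume "\<theta> f \<in> coboundaries1 N' (h ` W)"
      then obtain g where g: "\<And>u v. u \<in> h ` W \<Longrightarrow> v \<in> h ` W \<Longrightarrow> N' u v \<Longrightarrow> \<theta> f u v = g v - g u" unfolding coboundaries1_def by blast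
      show "f \<in> coboundaries1 N W"
      proof (rule coboundaries1I[where g = "g \<circ> h", OF f])
        fix u v assume uv: "u \<in> W" "v \<in> W" "N u v"
        then have "\<theta> f (h u) (h v) = g (h v) - g (h u)" using N by (intro g) auto
        then show "f u v = (g \<circ> h) v - (g \<circ> h) u" using \<theta>h uv by simp
      qed
    qed
  qed
qed

lemma ncomp_image:
  assumes h: "inj_on h X" and N: "\<And>u v. u \<in> X \<Longrightarrow> v \<in> X \<Longrightarrow> N' (h u) (h v) \<longleftrightarrow> N u v"
    and c: "ncomp N X c"
  shows "ncomp N' (h ` X) c"
proof -
  obtain \<pi> :: "_ \<Rightarrow> nat" where \<pi>': "\<pi> ` X = {..<c} \<and> (\<forall>x\<in>X. \<forall>y\<in>X. N x y \<longrightarrow> \<pi> x = \<pi> y) \<and>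
    (\<forall>x\<in>X. \<forall>y\<in>X. \<pi> x = \<pi> y \<longrightarrow> (\<lambda>u v. u \<in> X \<and> v \<in> X \<and> N u v)\<^sup>*\<^sup>* x y)"
    using c unfolding ncomp_def by (elim exE)
  note \<pi> = \<pi>'[THEN conjunct1] \<pi>'[THEN conjunct2, THEN conjunct1, rule_format]
    \<pi>'[THEN conjunct2, THEN conjunct2, rule_format]
  define i where "i = inv_into X h"
  have ih: "i (h u) = u" if "u \<in> X" for u using that h by (simp add: i_def)
  have tr: "(\<lambda>u v. u \<in> h ` X \<and> v \<in> h ` X \<and> N' u v)\<^sup>*\<^sup>* (h x) (h y)"
    if "(\<lambda>u v. u \<in> X \<and> v \<in> X \<and> N u v)\<^sup>*\<^sup>* x y" for x y
    using that
  proof (induction rule: rtranclp_induct)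
    case (step y z)
    then have "h y \<in> h ` X \<and> h z \<in> h ` X \<and> N' (h y) (h z)" using N by auto
    then show ?case using step.IH by (rule rtranclp.rtrancl_into_rtrancl[rotated])
  qed simp
  have "(\<pi> \<circ> i) ` h ` X = \<pi> ` X" unfolding image_image by (intro image_cong) (simp_all add: ih)
  then have "(\<pi> \<circ> i) ` h ` X = {..<c}" using \<pi>(1) by simp
  moreover have "\<forall>x\<in>h ` X. \<forall>y\<in>h ` X. N' x y \<longrightarrow> (\<pi> \<circ> i) x = (\<pi> \<circ> i) y"
    using \<pi>(2) ih N by auto
  moreover have "\<forall>x\<in>h ` X. \<forall>y\<in>h ` X. (\<pi> \<circ> i) x = (\<pi> \<circ> i) y \<longrightarrow> (\<lambda>u v. u \<in> h ` X \<and> v \<in> h ` X \<and> N' u v)\<^sup>*\<^sup>* x y"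
    using \<pi>(3) ih tr by auto
  ultimately show ?thesis unfolding ncomp_def by blast
qed

text \<open>On the simplex W0 a cocycle is the coboundary of its values at a fixed vertex, so
  extension by zero from W1 is onto modulo coboundaries.\<close>

lemma h1_dim_simplex_union:
  assumes disj: "W0 \<inter> W1 = {}" and sep: "\<And>u v. u \<in> W0 \<Longrightarrow> v \<in> W1 \<Longrightarrow> \<not> N u v \<and> \<not> N v u"
    and full: "\<And>u v. u \<in> W0 \<Longrightarrow> v \<in> W0 \<Longrightarrow> N u v \<longleftrightarrow> u \<noteq> v"
    and r: "h1_dim TYPE('k::field) N W1 r"
  shows "h1_dim TYPE('k) N (W0 \<union> W1) r"
proof (rule h1_dim_transfer[OF r, where \<theta> = "\<lambda>f. f"])
  show cyc: "f \<in> cocycles1 N (W0 \<union> W1)" if f: "f \<in> cocycles1 N W1" for f :: "'a \<Rightarrow> 'a \<Rightarrow> 'k"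
  proof (rule cocycles1I)
    show "u \<in> W0 \<union> W1 \<and> v \<in> W0 \<union> W1 \<and> N u v" if "f u v \<noteq> 0" for u v
      using cocycles1_supp[OF f that] by simp
    show "f v u = - f u v" for u v by (rule cocycles1_anti[OF f])
    fix u v w assume uvw: "u \<in> W0 \<union> W1" "v \<in> W0 \<union> W1" "w \<in> W0 \<union> W1" "N u v" "N v w" "N u w"
    then consider "u \<in> W1" "v \<in> W1" "w \<in> W1" | "u \<notin> W1" "v \<notin> W1" "w \<notin> W1" using sep by blast
    then show "f u v + f v w = f u w"
    proof cases
      case 1 then show ?thesis using cocycles1_triangle[OF f] uvw by blast
    next
      case 2
      then have "f u v = 0" "f v w = 0" "f u w = 0" using cocycles1_supp[OF f] by blast+
      then show ?thesis by simp
    qed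
  qed
  show "\<exists>f\<in>cocycles1 N W1. f' - f \<in> coboundaries1 N (W0 \<union> W1)" if f': "f' \<in> cocycles1 N (W0 \<union> W1)" for f' :: "'a \<Rightarrow> 'a \<Rightarrow> 'k"
  proof -
    interpret s: vector_space "\<lambda>c (f :: 'a \<Rightarrow> 'a \<Rightarrow> 'k) u v. c * f u v" by (rule vector_space_fun2)
    define f where "f = (\<lambda>u v. if u \<in> W1 \<and> v \<in> W1 then f' u v else 0)"
    have f: "f \<in> cocycles1 N W1"
    proof (rule cocycles1I)
      show "u \<in> W1 \<and> v \<in> W1 \<and> N u v" if "f u v \<noteq> 0" for u v
        using that cocycles1_supp[OF f', of u v] by (auto simp: f_def split: if_splits)
      show "f v u = - f u v" for u v using cocycles1_anti[OF f', of v u] by (simp add: f_def)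
      show "f u v + f v w = f u w" if "u \<in> W1" "v \<in> W1" "w \<in> W1" "N u v" "N v w" "N u w" for u v w
        using cocycles1_triangle[OF f', of u v w] that by (simp add: f_def)
    qed
    define w0 where "w0 = (SOME w. w \<in> W0)"
    define g where "g = (\<lambda>w. if w \<in> W0 then f' w0 w else 0)"
    \<comment> \<open>Antisymmetry alone does not give this in characteristic two. On W0 it is the
      support condition, and on W1 the triangle identity with all three vertices equal.\<close>
    have diag: "f' u u = 0" for u
    proof (rule ccontr)
      assume nz: "f' u u \<noteq> 0"
      then have "u \<in> W0 \<union> W1" "N u u" using cocycles1_supp[OF f'] by blast+
      then have "u \<in> W1" using full by blast
      then have "f' u u + f' u u = f' u u" using cocycles1_triangle[OF f', of u u u] \<open>N u u\<close> by blast
      then show False using nz by (metis add_cancel_left_right)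
    qed
    have "f' - f \<in> coboundaries1 N (W0 \<union> W1)"
    proof (rule coboundaries1I[where g = g])
      show "f' - f \<in> cocycles1 N (W0 \<union> W1)" by (rule s.subspace_diff[OF cocycles1_subspace f' cyc[OF f]])
      fix u v assume uv: "u \<in> W0 \<union> W1" "v \<in> W0 \<union> W1" "N u v"
      then consider "u \<in> W1" "v \<in> W1" | "u \<in> W0" "v \<in> W0" using sep by blast
      then show "(f' - f) u v = g v - g u"
      proof cases
        case 1
        then have "u \<notin> W0" "v \<notin> W0" using disj by auto
        then show ?thesis using 1 by (simp add: f_def g_def)
      next
        case 2
        then have "w0 \<in> W0" unfolding w0_def by (metis someI)
        have "f' u v = f' w0 v - f' w0 u"
        proof (cases "u = w0 \<or> v = w0")
          case True
          then show ?thesis using cocycles1_anti[OF f', of u w0] by (auto simp: diag)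
        next
          case False
          then have "N w0 u" "N w0 v" using full \<open>w0 \<in> W0\<close> 2 by auto
          then have "f' w0 u + f' u v = f' w0 v"
            using cocycles1_triangle[OF f', of w0 u v] \<open>w0 \<in> W0\<close> 2 uv by blast
          then show ?thesis by (simp add: algebra_simps)
        qed
        moreover have "u \<notin> W1" using 2 disj by auto
        ultimately show ?thesis using 2 by (simp add: f_def g_def)
      qed
    qed
    then show ?thesis using f by blast
  qed
  show "f \<in> coboundaries1 N W1 \<longleftrightarrow> f \<in> coboundaries1 N (W0 \<union> W1)" if f: "f \<in> cocycles1 N W1" for f :: "'a \<Rightarrow> 'a \<Rightarrow> 'k"
  proof
    assume "f \<in> coboundaries1 N W1"
    then obtain g where g: "\<And>u v. u \<in> W1 \<Longrightarrow> v \<in> W1 \<Longrightarrow> N u v \<Longrightarrow> f u v = g v - g u" unfolding coboundaries1_def by blast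
    show "f \<in> coboundaries1 N (W0 \<union> W1)"
    proof (rule coboundaries1I[where g = "\<lambda>w. if w \<in> W1 then g w else 0", OF cyc[OF f]])
      fix u v assume uv: "u \<in> W0 \<union> W1" "v \<in> W0 \<union> W1" "N u v"
      then consider "u \<in> W1" "v \<in> W1" | "u \<notin> W1" "v \<notin> W1" using sep by blast
      then show "f u v = (if v \<in> W1 then g v else 0) - (if u \<in> W1 then g u else 0)"
      proof cases
        case 1 then show ?thesis using g uv by simp
      next
        case 2 then show ?thesis using cocycles1_supp[OF f, of u v] by auto
      qed
    qed
  next
    assume "f \<in> coboundaries1 N (W0 \<union> W1)"
    then obtain g where g: "\<And>u v. u \<in> W0 \<union> W1 \<Longrightarrow> v \<in> W0 \<union> W1 \<Longrightarrow> N u v \<Longrightarrow> f u v = g v - g u" unfolding coboundaries1_def by blast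
    show "f \<in> coboundaries1 N W1" by (rule coboundaries1I[where g = g, OF f]) (use g in auto)
  qed
qed auto

section \<open>Graphs, joins and multipartite complexes\<close>

lemma quot_dim_functions:
  assumes A: "finite A"
  shows "quot_dim (\<lambda>c (f :: 'a \<Rightarrow> 'k::field) x. c * f x) {f. \<forall>x. x \<notin> A \<longrightarrow> f x = 0} {0} (card A)"
proof -
  have ev: "(\<Sum>j\<in>F. (\<lambda>x. c j * (if x = j then 1 else 0))) y = (if y \<in> F then c y else (0::'k))"
    if "finite F" for F y and c :: "'a \<Rightarrow> 'k"
  proof -
    have "(\<Sum>j\<in>F. (\<lambda>x. c j * (if x = j then 1 else 0))) y = (\<Sum>j\<in>F. if j = y then c y else 0)"
      unfolding sum_fun_apply by (intro sum.cong) auto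
    then show ?thesis using that by simp
  qed
  have "quot_basis (\<lambda>c (f :: 'a \<Rightarrow> 'k) x. c * f x) {f. \<forall>x. x \<notin> A \<longrightarrow> f x = 0} {0} A (\<lambda>a x. if x = a then 1 else 0)"
  proof (rule quot_basisI)
    show "(\<lambda>x. if x = a then 1 else 0) \<in> {f :: 'a \<Rightarrow> 'k. \<forall>x. x \<notin> A \<longrightarrow> f x = 0}" if "a \<in> A" for a using that by auto
  next
    fix u :: "'a \<Rightarrow> 'k" assume u: "u \<in> {f. \<forall>x. x \<notin> A \<longrightarrow> f x = 0}"
    have "u = (\<Sum>j\<in>A. (\<lambda>x. u j * (if x = j then 1 else 0)))"
      by (rule ext) (use u ev[OF A, of u] in auto)
    then have "u - (\<Sum>j\<in>A. (\<lambda>x. u j * (if x = j then 1 else 0))) \<in> {0}" by (metis diff_self singletonI)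
    then show "\<exists>F c. finite F \<and> F \<subseteq> A \<and> u - (\<Sum>j\<in>F. (\<lambda>x. c j * (if x = j then 1 else 0))) \<in> {0}"
      using A by blast
  next
    fix F c j assume F: "finite F" "F \<subseteq> A" "(\<Sum>j\<in>F. (\<lambda>x. c j * (if x = j then 1 else 0))) \<in> {0 :: 'a \<Rightarrow> 'k}" "j \<in> F"
    then have "(\<Sum>j\<in>F. (\<lambda>x. c j * (if x = j then 1 else 0))) j = (0 :: 'k)" by simp
    then show "c j = 0" using ev[OF F(1), of c j] F(4) by simp
  qed
  from quot_basis_imp_quot_dim[OF this A] show ?thesis .
qed

lemma quot_dim_finite_span:
  assumes vs: "vector_space s" and d: "quot_dim s U {0} r"
  obtains T where "finite T" "U \<subseteq> module.span s T"
proof -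
  interpret vector_space s by (rule vs)
  obtain b :: "nat \<Rightarrow> 'b" where b: "quot_basis s U {0} {..<r} b" using d unfolding quot_dim_def by blast
  have "u \<in> span (b ` {..<r})" if u: "u \<in> U" for u
  proof -
    obtain F c where F: "finite F" "F \<subseteq> {..<r}" "u - (\<Sum>j\<in>F. s (c j) (b j)) \<in> {0}"
      using quot_basis_spans[OF b u] by blast
    then have "u = (\<Sum>j\<in>F. s (c j) (b j))" by simp
    also have "\<dots> \<in> span (b ` {..<r})" using F(2) by (intro span_sum span_scale span_base) auto
    finally show ?thesis .
  qed
  then show thesis by (intro that[of "b ` {..<r}"]) auto
qed

text \<open>Replaces connecting paths by their effect on functions: a function constant along edges
  takes one value on each fibre of the labelling.\<close>

lemma ncomp_locally_constant:
  assumes "ncomp N X c"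
  shows "\<exists>\<pi> :: 'v \<Rightarrow> nat. \<pi> ` X = {..<c} \<and> (\<forall>x\<in>X. \<forall>y\<in>X. N x y \<longrightarrow> \<pi> x = \<pi> y) \<and>
    (\<forall>x\<in>X. \<forall>y\<in>X. \<pi> x = \<pi> y \<longrightarrow>
      (\<forall>f :: 'v \<Rightarrow> 'a. (\<forall>u\<in>X. \<forall>v\<in>X. N u v \<longrightarrow> f u = f v) \<longrightarrow> f x = f y))"
proof -
  obtain \<pi> :: "'v \<Rightarrow> nat" where \<pi>: "\<pi> ` X = {..<c} \<and> (\<forall>x\<in>X. \<forall>y\<in>X. N x y \<longrightarrow> \<pi> x = \<pi> y) \<and>
    (\<forall>x\<in>X. \<forall>y\<in>X. \<pi> x = \<pi> y \<longrightarrow> (\<lambda>u v. u \<in> X \<and> v \<in> X \<and> N u v)\<^sup>*\<^sup>* x y)"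
    using assms unfolding ncomp_def by (elim exE)
  have const: "f x = f y" if xy: "(\<lambda>u v. u \<in> X \<and> v \<in> X \<and> N u v)\<^sup>*\<^sup>* x y"
    and f: "\<forall>u\<in>X. \<forall>v\<in>X. N u v \<longrightarrow> f u = f v" for x y and f :: "'v \<Rightarrow> 'a"
    using xy by (induction rule: rtranclp_induct) (use f in auto)
  show ?thesis
  proof (intro exI conjI ballI allI impI)
    show "\<pi> ` X = {..<c}" using \<pi> by simp
    show "\<pi> x = \<pi> y" if "x \<in> X" "y \<in> X" "N x y" for x y using \<pi> that by simp
    fix x y and f :: "'v \<Rightarrow> 'a"
    assume "x \<in> X" "y \<in> X" "\<pi> x = \<pi> y" and f: "\<forall>u\<in>X. \<forall>v\<in>X. N u v \<longrightarrow> f u = f v"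
    then show "f x = f y" using \<pi> by (intro const[OF _ f]) simp
  qed
qed

text \<open>Rank-nullity for the coboundary map \<open>K\<^sup>W \<rightarrow> K\<^sup>E\<close> of a graph, whose kernel consists of the
  locally constant functions; \<open>E\<close> is an orientation of the edges.\<close>

lemma h1_dim_triangle_free:
  fixes N :: "'v \<Rightarrow> 'v \<Rightarrow> bool"
  assumes W: "finite W" and c: "ncomp N W c" and E: "E \<subseteq> W \<times> W"
    and NE: "\<And>u v. u \<in> W \<Longrightarrow> v \<in> W \<Longrightarrow> N u v \<longleftrightarrow> (u, v) \<in> E \<or> (v, u) \<in> E"
    and asym: "\<And>u v. (u, v) \<in> E \<Longrightarrow> (v, u) \<notin> E"
    and tf: "\<And>u v w. u \<in> W \<Longrightarrow> v \<in> W \<Longrightarrow> w \<in> W \<Longrightarrow> N u v \<Longrightarrow> N v w \<Longrightarrow> \<not> N u w"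
  shows "\<exists>r. h1_dim TYPE('k::field) N W r \<and> r + card W = card E + c"
proof -
  let ?s1 = "\<lambda>c (f :: 'v \<Rightarrow> 'k) x. c * f x" and ?s2 = "\<lambda>c (f :: 'v \<Rightarrow> 'v \<Rightarrow> 'k) u v. c * f u v"
  interpret s1: vector_space ?s1 by (rule vector_space_fun_times)
  interpret s2: vector_space ?s2 by (rule vector_space_fun2)
  let ?KE = "{t :: 'v \<times> 'v \<Rightarrow> 'k. \<forall>e. e \<notin> E \<longrightarrow> t e = 0}"
  let ?KW = "{f :: 'v \<Rightarrow> 'k. \<forall>x. x \<notin> W \<longrightarrow> f x = 0}"
  let ?L = "{f \<in> ?KW. \<forall>u\<in>W. \<forall>v\<in>W. N u v \<longrightarrow> f u = f v}"
  let ?Z = "cocycles1 N W :: ('v \<Rightarrow> 'v \<Rightarrow> 'k) set" and ?B = "coboundaries1 N W :: ('v \<Rightarrow> 'v \<Rightarrow> 'k) set"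
  have finE: "finite E" using E W finite_subset by blast
  have sKE: "module.subspace (\<lambda>c (f :: 'v \<times> 'v \<Rightarrow> 'k) x. c * f x) ?KE"
  proof -
    interpret v: vector_space "\<lambda>c (f :: 'v \<times> 'v \<Rightarrow> 'k) x. c * f x" by (rule vector_space_fun_times)
    show ?thesis by (auto simp: v.subspace_def)
  qed
  have sKc: "module.subspace (\<lambda>c (f :: nat \<Rightarrow> 'k) x. c * f x) {t. \<forall>x. x \<notin> {..<c} \<longrightarrow> t x = 0}"
  proof -
    interpret v: vector_space "\<lambda>c (f :: nat \<Rightarrow> 'k) x. c * f x" by (rule vector_space_fun_times)
    show ?thesis by (auto simp: v.subspace_def)
  qed
  have sKW: "s1.subspace ?KW" and sL: "s1.subspace ?L"
    by (auto simp: s1.subspace_def)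
  have s10: "s1.subspace {0}" and s20: "s2.subspace {0}"
    by (simp_all add: s1.subspace_def s2.subspace_def fun_eq_iff)
  \<comment> \<open>In a triangle-free graph the triangle condition is vacuous, so every
    antisymmetric function supported on edges is a cocycle.\<close>
  have cyc: "f \<in> ?Z" if "\<And>u v. f u v \<noteq> 0 \<Longrightarrow> u \<in> W \<and> v \<in> W \<and> N u v" "\<And>u v. f v u = - f u v" for f
    by (rule cocycles1I) (use that tf in blast)+
  \<comment> \<open>A cocycle is determined by its values on the oriented edges; the other
    orientation is filled in by antisymmetry.\<close>
  have dimZ: "quot_dim ?s2 ?Z {0} (card E)"
  proof (rule quot_dim_transfer_fun[OF vector_space_fun_times s2.vector_space_axioms quot_dim_functions[OF finE] sKE s20,
        where f = "\<lambda>t u v. t (u, v) - t (v, u)"])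
    fix t assume t: "t \<in> ?KE"
    have t0: "t e = 0" if "e \<notin> E" for e using t that by blast
    show "(\<lambda>u v. t (u, v) - t (v, u)) \<in> ?Z"
    proof (rule cyc)
      fix u v assume "t (u, v) - t (v, u) \<noteq> 0"
      then have "(u, v) \<in> E \<or> (v, u) \<in> E" using t0[of "(u, v)"] t0[of "(v, u)"] by force
      then show "u \<in> W \<and> v \<in> W \<and> N u v" using E NE by blast
    qed simp
    show "t \<in> {0} \<longleftrightarrow> (\<lambda>u v. t (u, v) - t (v, u)) \<in> {0}"
    proof
      assume z: "(\<lambda>u v. t (u, v) - t (v, u)) \<in> {0}"
      have "t (u, v) = 0" for u v
      proof (cases "(u, v) \<in> E")
        case True
        then have "t (v, u) = 0" using t asym by auto
        moreover have "t (u, v) - t (v, u) = 0" using z by (simp add: fun_eq_iff)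
        ultimately show ?thesis by simp
      qed (use t in auto)
      then show "t \<in> {0}" by (auto simp: fun_eq_iff)
    qed (auto simp: zero_fun_def)
  next
    fix f assume f: "f \<in> ?Z"
    define t where "t = (\<lambda>e. if e \<in> E then case_prod f e else 0)"
    have "f u v = t (u, v) - t (v, u)" for u v
    proof -
      have "f u v = 0" if "(u, v) \<notin> E" "(v, u) \<notin> E"
        using cocycles1_supp[OF f, of u v] NE that by blast
      then show ?thesis using asym[of u v] asym[of v u] cocycles1_anti[OF f, of u v] by (auto simp: t_def)
    qed
    then have "f - (\<lambda>u v. t (u, v) - t (v, u)) \<in> {0}" by (simp add: fun_eq_iff)
    moreover have "t \<in> ?KE" by (simp add: t_def)
    ultimately show "\<exists>t\<in>?KE. f - (\<lambda>u v. t (u, v) - t (v, u)) \<in> {0}" by blast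
  qed (auto simp: fun_eq_iff algebra_simps)
  obtain \<pi> :: "'v \<Rightarrow> nat" where \<pi>': "\<pi> ` W = {..<c} \<and> (\<forall>x\<in>W. \<forall>y\<in>W. N x y \<longrightarrow> \<pi> x = \<pi> y) \<and>
    (\<forall>x\<in>W. \<forall>y\<in>W. \<pi> x = \<pi> y \<longrightarrow>
      (\<forall>f :: 'v \<Rightarrow> 'k. (\<forall>u\<in>W. \<forall>v\<in>W. N u v \<longrightarrow> f u = f v) \<longrightarrow> f x = f y))"
    using ncomp_locally_constant[OF c] by (elim exE)
  note \<pi> = \<pi>'[THEN conjunct1] \<pi>'[THEN conjunct2, THEN conjunct1, rule_format]
    \<pi>'[THEN conjunct2, THEN conjunct2, rule_format]
  \<comment> \<open>Locally constant functions are functions of the component label.\<close>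
  have "quot_dim ?s1 ?L {0} (card {..<c})"
  proof (rule quot_dim_transfer_fun[OF vector_space_fun_times s1.vector_space_axioms quot_dim_functions[OF finite_lessThan] sKc s10,
        where f = "\<lambda>t x. if x \<in> W then t (\<pi> x) else 0"])
    fix t :: "nat \<Rightarrow> 'k" assume t: "t \<in> {t. \<forall>x. x \<notin> {..<c} \<longrightarrow> t x = 0}"
    show "(\<lambda>x. if x \<in> W then t (\<pi> x) else 0) \<in> ?L" using \<pi>(2) by (auto dest: \<pi>(2))
    show "t \<in> {0} \<longleftrightarrow> (\<lambda>x. if x \<in> W then t (\<pi> x) else 0) \<in> {0}"
    proof
      assume z: "(\<lambda>x. if x \<in> W then t (\<pi> x) else 0) \<in> {0}"
      have "t j = 0" for j
      proof (cases "j < c")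
        case True
        then obtain x where x: "x \<in> W" "\<pi> x = j" using \<pi>(1) by (metis imageE lessThan_iff)
        have "\<forall>x. (if x \<in> W then t (\<pi> x) else 0) = 0" using z by (simp add: fun_eq_iff)
        then show ?thesis using x by metis
      qed (use t in auto)
      then show "t \<in> {0}" by (auto simp: fun_eq_iff)
    qed (auto simp: zero_fun_def)
  next
    fix f assume f: "f \<in> ?L"
    define t where "t = (\<lambda>j. if j < c then f (SOME x. x \<in> W \<and> \<pi> x = j) else 0)"
    have "f x = t (\<pi> x)" if x: "x \<in> W" for x
    proof -
      have "\<pi> x < c" using \<pi>(1) x by auto
      define y where "y = (SOME y. y \<in> W \<and> \<pi> y = \<pi> x)"
      have y: "y \<in> W" "\<pi> y = \<pi> x" using someI[of "\<lambda>y. y \<in> W \<and> \<pi> y = \<pi> x" x] x by (auto simp: y_def)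
      have "f x = f y" using \<pi>(3)[of x y f] x y f by auto
      then show ?thesis using \<open>\<pi> x < c\<close> by (simp add: t_def y_def)
    qed
    moreover have "f x = 0" if "x \<notin> W" for x using f that by simp
    ultimately have "f - (\<lambda>x. if x \<in> W then t (\<pi> x) else 0) \<in> {0}" by (simp add: fun_eq_iff)
    moreover have "t \<in> {t. \<forall>x. x \<notin> {..<c} \<longrightarrow> t x = 0}" by (simp add: t_def)
    ultimately show "\<exists>t\<in>{t. \<forall>x. x \<notin> {..<c} \<longrightarrow> t x = 0}. f - (\<lambda>x. if x \<in> W then t (\<pi> x) else 0) \<in> {0}" by blast
  qed (auto simp: fun_eq_iff)
  then have dimL: "quot_dim ?s1 ?L {0} c" by simp
  have dimKW: "quot_dim ?s1 ?KW {0} (card W)" by (rule quot_dim_functions[OF W])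
  obtain T where T: "finite T" "?KW \<subseteq> s1.span T"
    using quot_dim_finite_span[OF s1.vector_space_axioms dimKW] by blast
  have LK: "?L \<subseteq> ?KW" by blast
  obtain r1 where r1: "quot_dim ?s1 ?KW ?L r1"
    using quot_dim_exists[OF s1.vector_space_axioms sKW sL LK T] by blast
  have "{0} \<subseteq> ?L" by auto
  from quot_dim_add[OF s1.vector_space_axioms LK s10 this sL r1 dimL]
  have e1: "r1 + c = card W" by (rule quot_dim_unique[OF s1.vector_space_axioms s10 _ dimKW])
  define \<delta> where "\<delta> = (\<lambda>(g :: 'v \<Rightarrow> 'k) u v. if u \<in> W \<and> v \<in> W \<and> N u v then g v - g u else 0)"
  have \<delta>Z: "\<delta> g \<in> ?Z" for g
    by (rule cyc) (auto simp: \<delta>_def NE split: if_splits)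
  \<comment> \<open>The coboundary map induces an isomorphism from the functions on W modulo the
    locally constant ones onto the coboundaries, whose dimension is therefore \<open>card W\<close>
    minus \<open>c\<close>.\<close>
  have "quot_dim ?s2 ?B {0} r1"
  proof (rule quot_dim_transfer_fun[OF s1.vector_space_axioms s2.vector_space_axioms r1 sKW s20, where f = \<delta>])
    show "\<delta> g \<in> ?B" for g by (rule coboundaries1I[where g = g, OF \<delta>Z]) (simp add: \<delta>_def)
    show "\<delta> (f + g) = \<delta> f + \<delta> g" for f g by (auto simp: \<delta>_def fun_eq_iff)
    show "\<delta> (\<lambda>x. c * f x) = (\<lambda>u v. c * \<delta> f u v)" for c f by (auto simp: \<delta>_def fun_eq_iff right_diff_distrib)
    show "g \<in> ?L \<longleftrightarrow> \<delta> g \<in> {0}" if g: "g \<in> ?KW" for g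
    proof
      assume "g \<in> ?L"
      then show "\<delta> g \<in> {0}" by (auto simp: \<delta>_def fun_eq_iff)
    next
      assume "\<delta> g \<in> {0}"
      then have "\<delta> g u v = 0" for u v by simp
      then have "g u = g v" if "u \<in> W" "v \<in> W" "N u v" for u v
        using that by (metis (no_types, lifting) \<delta>_def eq_iff_diff_eq_0)
      then show "g \<in> ?L" using g by blast
    qed
    fix f assume f: "f \<in> ?B"
    then obtain g where g: "\<And>u v. u \<in> W \<Longrightarrow> v \<in> W \<Longrightarrow> N u v \<Longrightarrow> f u v = g v - g u" unfolding coboundaries1_def by blast
    define g' where "g' = (\<lambda>x. if x \<in> W then g x else 0)"
    have "f u v = \<delta> g' u v" for u v
      using cocycles1_supp[OF coboundaries1D[OF f], of u v] g by (auto simp: \<delta>_def g'_def)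
    then have "f - \<delta> g' \<in> {0}" by (simp add: fun_eq_iff)
    moreover have "g' \<in> ?KW" by (simp add: g'_def)
    ultimately show "\<exists>g\<in>?KW. f - \<delta> g \<in> {0}" by blast
  qed
  then have dimB: "quot_dim ?s2 ?B {0} r1" .
  have BZ: "?B \<subseteq> ?Z" by (auto simp: coboundaries1_def)
  obtain T2 where T2: "finite T2" "?Z \<subseteq> s2.span T2"
    using quot_dim_finite_span[OF s2.vector_space_axioms dimZ] by blast
  obtain r where r: "quot_dim ?s2 ?Z ?B r"
    using quot_dim_exists[OF s2.vector_space_axioms cocycles1_subspace coboundaries1_subspace BZ T2] by blast
  have "{0} \<subseteq> ?B" using s2.subspace_0[OF coboundaries1_subspace] by blast
  from quot_dim_add[OF s2.vector_space_axioms BZ s20 this coboundaries1_subspace r dimB]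
  have "r + r1 = card E" by (rule quot_dim_unique[OF s2.vector_space_axioms s20 _ dimZ])
  then show ?thesis using r e1 unfolding h1_dim_def by (intro exI[of _ r]) auto
qed

text \<open>The first cohomology of a join is the tensor product of the reduced cohomologies in
  degree 0 of its two sides. A cocycle is normalised by a coboundary to vanish at base points on
  each side; then it vanishes inside both sides and depends only on the components across
  them.\<close>

lemma h1_dim_join:
  assumes disj: "X \<inter> Y = {}" and X: "X \<noteq> {}" and Y: "Y \<noteq> {}"
    and N: "\<And>x y. x \<in> X \<Longrightarrow> y \<in> Y \<Longrightarrow> N x y \<and> N y x"
    and cX: "ncomp N X cX" and cY: "ncomp N Y cY"
  shows "h1_dim TYPE('k::field) N (X \<union> Y) ((cX - 1) * (cY - 1))"
proof -
  let ?s2 = "\<lambda>c (f :: 'a \<Rightarrow> 'a \<Rightarrow> 'k) u v. c * f u v"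
  interpret s2: vector_space ?s2 by (rule vector_space_fun2)
  obtain \<pi> :: "'a \<Rightarrow> nat" where \<pi>': "\<pi> ` X = {..<cX} \<and> (\<forall>x\<in>X. \<forall>y\<in>X. N x y \<longrightarrow> \<pi> x = \<pi> y) \<and>
    (\<forall>x\<in>X. \<forall>y\<in>X. \<pi> x = \<pi> y \<longrightarrow>
      (\<forall>f :: 'a \<Rightarrow> 'k. (\<forall>u\<in>X. \<forall>v\<in>X. N u v \<longrightarrow> f u = f v) \<longrightarrow> f x = f y))"
    using ncomp_locally_constant[OF cX] by (elim exE)
  note \<pi> = \<pi>'[THEN conjunct1] \<pi>'[THEN conjunct2, THEN conjunct1, rule_format]
    \<pi>'[THEN conjunct2, THEN conjunct2, rule_format]
  obtain \<rho> :: "'a \<Rightarrow> nat" where \<rho>': "\<rho> ` Y = {..<cY} \<and> (\<forall>x\<in>Y. \<forall>y\<in>Y. N x y \<longrightarrow> \<rho> x = \<rho> y) \<and>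
    (\<forall>x\<in>Y. \<forall>y\<in>Y. \<rho> x = \<rho> y \<longrightarrow>
      (\<forall>f :: 'a \<Rightarrow> 'k. (\<forall>u\<in>Y. \<forall>v\<in>Y. N u v \<longrightarrow> f u = f v) \<longrightarrow> f x = f y))"
    using ncomp_locally_constant[OF cY] by (elim exE)
  note \<rho> = \<rho>'[THEN conjunct1] \<rho>'[THEN conjunct2, THEN conjunct1, rule_format]
    \<rho>'[THEN conjunct2, THEN conjunct2, rule_format]
  have XY: "x \<notin> Y" if "x \<in> X" for x using disj that by blast
  have "\<exists>x\<in>X. \<pi> x = 0"
  proof -
    obtain x where "x \<in> X" using X by blast
    then have "\<pi> x \<in> {..<cX}" using \<pi>(1) by blast
    then have "0 \<in> \<pi> ` X" unfolding \<pi>(1) by simp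
    then show ?thesis by force
  qed
  then obtain x0 where x0: "x0 \<in> X" "\<pi> x0 = 0" by blast
  have "\<exists>y\<in>Y. \<rho> y = 0"
  proof -
    obtain y where "y \<in> Y" using Y by blast
    then have "\<rho> y \<in> {..<cY}" using \<rho>(1) by blast
    then have "0 \<in> \<rho> ` Y" unfolding \<rho>(1) by simp
    then show ?thesis by force
  qed
  then obtain y0 where y0: "y0 \<in> Y" "\<rho> y0 = 0" by blast
  \<comment> \<open>Component 0 of each side contains the base point and is left out, which accounts
    for the factors reduced by one.\<close>
  define A where "A = {1..<cX} \<times> {1..<cY}"
  let ?KA = "{t :: nat \<times> nat \<Rightarrow> 'k. \<forall>e. e \<notin> A \<longrightarrow> t e = 0}"
  define \<theta> where "\<theta> = (\<lambda>(t :: nat \<times> nat \<Rightarrow> 'k) u v. if u \<in> X \<and> v \<in> Y then t (\<pi> u, \<rho> v)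
    else if u \<in> Y \<and> v \<in> X then - t (\<pi> v, \<rho> u) else 0)"
  have \<theta>Z: "\<theta> t \<in> cocycles1 N (X \<union> Y)" for t
  proof (rule cocycles1I)
    show "u \<in> X \<union> Y \<and> v \<in> X \<union> Y \<and> N u v" if "\<theta> t u v \<noteq> 0" for u v
      using that N by (auto simp: \<theta>_def split: if_splits)
    show "\<theta> t v u = - \<theta> t u v" for u v using disj by (auto simp: \<theta>_def)
    fix u v w assume uvw: "u \<in> X \<union> Y" "v \<in> X \<union> Y" "w \<in> X \<union> Y" and n: "N u v" "N v w" "N u w"
    have "\<And>a b. a \<in> X \<Longrightarrow> b \<in> X \<Longrightarrow> N a b \<Longrightarrow> \<pi> a = \<pi> b" "\<And>a b. a \<in> Y \<Longrightarrow> b \<in> Y \<Longrightarrow> N a b \<Longrightarrow> \<rho> a = \<rho> b"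
      by (rule \<pi>(2), assumption+) (rule \<rho>(2), assumption+)
    then have eq: "u \<in> X \<Longrightarrow> v \<in> X \<Longrightarrow> \<pi> u = \<pi> v" "v \<in> X \<Longrightarrow> w \<in> X \<Longrightarrow> \<pi> v = \<pi> w" "u \<in> X \<Longrightarrow> w \<in> X \<Longrightarrow> \<pi> u = \<pi> w"
      "u \<in> Y \<Longrightarrow> v \<in> Y \<Longrightarrow> \<rho> u = \<rho> v" "v \<in> Y \<Longrightarrow> w \<in> Y \<Longrightarrow> \<rho> v = \<rho> w" "u \<in> Y \<Longrightarrow> w \<in> Y \<Longrightarrow> \<rho> u = \<rho> w"
      using n by blast+
    consider "u \<in> X" "v \<in> X" "w \<in> X" | "u \<in> X" "v \<in> X" "w \<in> Y" | "u \<in> X" "v \<in> Y" "w \<in> X" | "u \<in> X" "v \<in> Y" "w \<in> Y"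
      | "u \<in> Y" "v \<in> X" "w \<in> X" | "u \<in> Y" "v \<in> X" "w \<in> Y" | "u \<in> Y" "v \<in> Y" "w \<in> X" | "u \<in> Y" "v \<in> Y" "w \<in> Y"
      using uvw by blast
    then show "\<theta> t u v + \<theta> t v w = \<theta> t u w"
      by cases (use eq XY in \<open>auto simp: \<theta>_def\<close>)
  qed
  have sKA: "module.subspace (\<lambda>c (f :: nat \<times> nat \<Rightarrow> 'k) x. c * f x) ?KA"
  proof -
    interpret v: vector_space "\<lambda>c (f :: nat \<times> nat \<Rightarrow> 'k) x. c * f x" by (rule vector_space_fun_times)
    show ?thesis by (auto simp: v.subspace_def)
  qed
  have finA: "finite A" by (simp add: A_def)
  have "quot_dim ?s2 (cocycles1 N (X \<union> Y)) (coboundaries1 N (X \<union> Y)) (card A)"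
  proof (rule quot_dim_transfer_fun[OF vector_space_fun_times s2.vector_space_axioms quot_dim_functions[OF finA] sKA
        coboundaries1_subspace, where f = \<theta>])
    show "\<theta> t \<in> cocycles1 N (X \<union> Y)" for t by (rule \<theta>Z)
    show "\<theta> (t + t') = \<theta> t + \<theta> t'" for t t' by (auto simp: \<theta>_def fun_eq_iff)
    show "\<theta> (\<lambda>x. c * t x) = (\<lambda>u v. c * \<theta> t u v)" for c t by (auto simp: \<theta>_def fun_eq_iff)
    show "t \<in> {0} \<longleftrightarrow> \<theta> t \<in> coboundaries1 N (X \<union> Y)" if t: "t \<in> ?KA" for t
    proof
      assume "t \<in> {0}"
      then have "\<theta> t = 0" by (auto simp: \<theta>_def fun_eq_iff)
      then show "\<theta> t \<in> coboundaries1 N (X \<union> Y)" using s2.subspace_0[OF coboundaries1_subspace] by simp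
    next
      assume "\<theta> t \<in> coboundaries1 N (X \<union> Y)"
      then obtain g where g: "\<And>u v. u \<in> X \<union> Y \<Longrightarrow> v \<in> X \<union> Y \<Longrightarrow> N u v \<Longrightarrow> \<theta> t u v = g v - g u"
        unfolding coboundaries1_def by blast
      have t_g: "t (\<pi> x, \<rho> y) = g y - g x" if xy: "x \<in> X" "y \<in> Y" for x y
        using g[of x y] N[OF xy] xy by (simp add: \<theta>_def)
      \<comment> \<open>Vanishing at label 0 makes \<open>g\<close> constant on Y through
        \<open>x0\<close> and then on X through \<open>y0\<close>, so a coboundary of this form is
        zero.\<close>
      have t0: "t (0, j) = 0" "t (j, 0) = 0" for j using t by (auto simp: A_def)
      have gy: "g y = g x0" if "y \<in> Y" for y using t_g[OF x0(1) that] x0(2) t0 by simp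
      have gx: "g x = g x0" if "x \<in> X" for x using t_g[OF that y0(1)] y0 t0 gy[OF y0(1)] by simp
      have "t (p, r) = 0" for p r
      proof (cases "(p, r) \<in> A")
        case True
        then have "p \<in> \<pi> ` X" "r \<in> \<rho> ` Y" unfolding \<pi>(1) \<rho>(1) by (auto simp: A_def)
        then obtain x y where "x \<in> X" "\<pi> x = p" "y \<in> Y" "\<rho> y = r" by blast
        then show ?thesis using t_g[of x y] gx gy by simp
      qed (use t in blast)
      then show "t \<in> {0}" by (simp add: fun_eq_iff)
    qed
    fix f :: "'a \<Rightarrow> 'a \<Rightarrow> 'k" assume f: "f \<in> cocycles1 N (X \<union> Y)"
    \<comment> \<open>Chosen so that the modified cocycle \<open>f'\<close> vanishes from
      \<open>x0\<close> to all of Y and from all of X to \<open>y0\<close>.\<close>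
    define g where "g = (\<lambda>v. if v \<in> Y then f x0 v else f x0 y0 + f y0 v)"
    define f' where "f' = (\<lambda>u v. f u v - g v + g u)"
    have anti: "f v u = - f u v" for u v by (rule cocycles1_anti[OF f])
    have gx0: "g x0 = 0" using XY[OF x0(1)] anti[of y0 x0] by (simp add: g_def)
    have f'x0: "f' x0 y = 0" if "y \<in> Y" for y using that gx0 by (simp add: f'_def g_def)
    have f'y0: "f' x y0 = 0" if "x \<in> X" for x
      using XY[OF that] y0(1) anti[of y0 x] by (simp add: f'_def g_def)
    have tri: "f' u v + f' v w = f' u w" if "u \<in> X \<union> Y" "v \<in> X \<union> Y" "w \<in> X \<union> Y" "N u v" "N v w" "N u w" for u v w
      using cocycles1_triangle[OF f that] by (simp add: f'_def algebra_simps)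
    have f'X: "f' u v = 0" if uv: "u \<in> X" "v \<in> X" "N u v" for u v
      using tri[of u v y0] N y0(1) uv f'y0 by simp
    have f'Y: "f' u v = 0" if uv: "u \<in> Y" "v \<in> Y" "N u v" for u v
      using tri[of x0 u v] N x0(1) uv f'x0 by simp
    have const_x: "f' x y = f' x' y" if "x \<in> X" "x' \<in> X" "\<pi> x = \<pi> x'" "y \<in> Y" for x x' y
    proof (rule \<pi>(3)[OF that(1-3), where f = "\<lambda>x. f' x y"])
      fix u v assume uv: "u \<in> X" "v \<in> X" "N u v"
      show "f' u y = f' v y" using tri[of u v y] N[OF uv(1) that(4)] N[OF uv(2) that(4)] uv that(4) f'X[OF uv] by simp
    qed
    have const_y: "f' x y = f' x y'" if "y \<in> Y" "y' \<in> Y" "\<rho> y = \<rho> y'" "x \<in> X" for x y y'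
    proof (rule \<rho>(3)[OF that(1-3), where f = "\<lambda>y. f' x y"])
      fix u v assume uv: "u \<in> Y" "v \<in> Y" "N u v"
      show "f' x u = f' x v" using tri[of x u v] N[OF that(4) uv(1)] N[OF that(4) uv(2)] uv that(4) f'Y[OF uv] by simp
    qed
    define rx where "rx = (\<lambda>p. SOME x. x \<in> X \<and> \<pi> x = p)"
    define ry where "ry = (\<lambda>r. SOME y. y \<in> Y \<and> \<rho> y = r)"
    have rx: "rx (\<pi> x) \<in> X \<and> \<pi> (rx (\<pi> x)) = \<pi> x" if "x \<in> X" for x
      unfolding rx_def by (rule someI[of _ x]) (use that in simp)
    have ry: "ry (\<rho> y) \<in> Y \<and> \<rho> (ry (\<rho> y)) = \<rho> y" if "y \<in> Y" for y
      unfolding ry_def by (rule someI[of _ y]) (use that in simp)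
    define t where "t = (\<lambda>(p, r). if (p, r) \<in> A then f' (rx p) (ry r) else 0)"
    have f't: "f' x y = t (\<pi> x, \<rho> y)" if x: "x \<in> X" and y: "y \<in> Y" for x y
    proof -
      have "\<pi> x \<in> {..<cX}" "\<rho> y \<in> {..<cY}" using \<pi>(1) \<rho>(1) x y by blast+
      then have "(\<pi> x, \<rho> y) \<in> A \<or> \<pi> x = 0 \<or> \<rho> y = 0" by (auto simp: A_def)
      moreover have "f' x y = 0" if "\<pi> x = 0" using const_x[OF x x0(1) _ y] that x0(2) f'x0[OF y] by simp
      moreover have "f' x y = 0" if "\<rho> y = 0" using const_y[OF y y0(1) _ x] that y0(2) f'y0[OF x] by simp
      moreover have "f' x y = f' (rx (\<pi> x)) (ry (\<rho> y))"
        using const_x[OF x _ _ y, of "rx (\<pi> x)"] const_y[OF y, of "ry (\<rho> y)" "rx (\<pi> x)"] rx[OF x] ry[OF y] by simp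
      ultimately show ?thesis by (cases "(\<pi> x, \<rho> y) \<in> A") (auto simp: t_def)
    qed
    have "f - \<theta> t \<in> coboundaries1 N (X \<union> Y)"
    proof (rule coboundaries1I[where g = g])
      show "f - \<theta> t \<in> cocycles1 N (X \<union> Y)" by (rule s2.subspace_diff[OF cocycles1_subspace f \<theta>Z])
      fix u v assume uv: "u \<in> X \<union> Y" "v \<in> X \<union> Y" "N u v"
      have f'_anti: "f' v u = - f' u v" by (simp add: f'_def anti[of v u])
      have "f' u v = \<theta> t u v"
      proof -
        consider "u \<in> X" "v \<in> X" | "u \<in> X" "v \<in> Y" | "u \<in> Y" "v \<in> X" | "u \<in> Y" "v \<in> Y" using uv by blast
        then show ?thesis
        proof cases
          case 1 then show ?thesis using f'X uv XY by (simp add: \<theta>_def)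
        next
          case 2 then show ?thesis using f't by (simp add: \<theta>_def)
        next
          case 3
          then have "\<theta> t u v = - f' v u" using f't[of v u] XY by (auto simp: \<theta>_def)
          then show ?thesis by (simp add: f'_anti)
        next
          case 4
          then have "u \<notin> X" "v \<notin> X" using XY by blast+
          then show ?thesis using f'Y uv 4 by (simp add: \<theta>_def)
        qed
      qed
      then show "(f - \<theta> t) u v = g v - g u" by (simp add: f'_def algebra_simps)
    qed
    moreover have "t \<in> ?KA" by (auto simp: t_def)
    ultimately show "\<exists>t\<in>?KA. f - \<theta> t \<in> coboundaries1 N (X \<union> Y)" by blast
  qed
  moreover have "card A = (cX - 1) * (cY - 1)" by (simp add: A_def)
  ultimately show ?thesis unfolding h1_dim_def by simp
qed

lemma h1_dim_zeroI:
  fixes N :: "'a \<Rightarrow> 'a \<Rightarrow> bool"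
  assumes "\<And>f :: 'a \<Rightarrow> 'a \<Rightarrow> 'k. f \<in> cocycles1 N W \<Longrightarrow> \<exists>g. \<forall>u\<in>W. \<forall>v\<in>W. N u v \<longrightarrow> f u v = g v - g u"
  shows "h1_dim TYPE('k::field) N W 0"
proof -
  have "quot_basis (\<lambda>c (f :: 'a \<Rightarrow> 'a \<Rightarrow> 'k) u v. c * f u v) (cocycles1 N W) (coboundaries1 N W) {..<0::nat} (\<lambda>_. 0)"
  proof (rule quot_basisI)
    fix f :: "'a \<Rightarrow> 'a \<Rightarrow> 'k" assume f: "f \<in> cocycles1 N W"
    then have "f \<in> coboundaries1 N W" using assms[OF f] by (simp add: coboundaries1_def)
    then show "\<exists>F c. finite F \<and> F \<subseteq> {..<0::nat} \<and> f - (\<Sum>j\<in>F. (\<lambda>u v. c j * (0 :: 'a \<Rightarrow> 'a \<Rightarrow> 'k) u v)) \<in> coboundaries1 N W"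
      by (intro exI[of _ "{}"]) simp
  qed auto
  then show ?thesis unfolding h1_dim_def quot_dim_def by blast
qed

text \<open>A join of at least three nonempty complexes is simply connected. Concretely, after
  normalisation at \<open>x\<close> and \<open>y\<close> every edge lies in a triangle whose other
  two values are already known to vanish.\<close>

lemma h1_dim_multipartite:
  fixes \<kappa> :: "'v \<Rightarrow> 'i"
  assumes N: "\<And>u v. u \<in> W \<Longrightarrow> v \<in> W \<Longrightarrow> \<kappa> u \<noteq> \<kappa> v \<Longrightarrow> N u v"
    and xyz: "x \<in> W" "y \<in> W" "z \<in> W" "\<kappa> x \<noteq> \<kappa> y" "\<kappa> x \<noteq> \<kappa> z" "\<kappa> y \<noteq> \<kappa> z"
  shows "h1_dim TYPE('k::field) N W 0"
proof (rule h1_dim_zeroI)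
  fix f :: "'v \<Rightarrow> 'v \<Rightarrow> 'k" assume f: "f \<in> cocycles1 N W"
  have anti: "f v u = - f u v" for u v by (rule cocycles1_anti[OF f])
  \<comment> \<open>Chosen so that \<open>f'\<close> vanishes from \<open>x\<close> to every vertex
    outside its part, and from the part of \<open>x\<close> to \<open>y\<close>.\<close>
  define g where "g = (\<lambda>v. if \<kappa> v = \<kappa> x then f x y + f y v else f x v)"
  define f' where "f' = (\<lambda>u v. f u v - g v + g u)"
  have tri: "f' u v + f' v w = f' u w" if "u \<in> W" "v \<in> W" "w \<in> W" "N u v" "N v w" "N u w" for u v w
    using cocycles1_triangle[OF f that] by (simp add: f'_def algebra_simps)
  have anti': "f' v u = - f' u v" for u v by (simp add: f'_def anti[of v u])
  have gx: "g x = 0" using anti[of y x] by (simp add: g_def)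
  have x0: "f' x v = 0" if "\<kappa> v \<noteq> \<kappa> x" for v using that gx by (simp add: f'_def g_def)
  have y0: "f' u y = 0" if "\<kappa> u = \<kappa> x" for u
    using that xyz(4) anti[of y u] by (simp add: f'_def g_def)
  have a: "f' u v = 0" if "u \<in> W" "v \<in> W" "N u v" "\<kappa> u \<noteq> \<kappa> x" "\<kappa> v \<noteq> \<kappa> x" for u v
  proof -
    have "N x u" "N x v" using N[OF xyz(1)] that by metis+
    then have "f' x u + f' u v = f' x v" using tri that xyz(1) by blast
    then show ?thesis using x0[OF that(4)] x0[OF that(5)] by simp
  qed
  have b': "f' u v = 0" if "u \<in> W" "v \<in> W" "\<kappa> u = \<kappa> x" "\<kappa> v \<noteq> \<kappa> x" "\<kappa> v \<noteq> \<kappa> y" for u v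
  proof -
    have n: "N u y" "N y v" "N u v" using N that xyz by metis+
    then have "f' u y + f' y v = f' u v" using tri that xyz(2) by blast
    moreover have "f' y v = 0" using a[OF xyz(2) that(2) n(2)] xyz(4) that(4) by simp
    ultimately show ?thesis using y0[OF that(3)] by simp
  qed
  have b: "f' u v = 0" if "u \<in> W" "v \<in> W" "\<kappa> u = \<kappa> x" "\<kappa> v \<noteq> \<kappa> x" for u v
  proof (cases "\<kappa> v = \<kappa> y")
    case True
    have n: "N u z" "N z v" "N u v" using N that xyz True by metis+
    then have "f' u z + f' z v = f' u v" using tri that xyz(3) by blast
    moreover have "f' z v = 0" using a[OF xyz(3) that(2) n(2)] xyz(5) that(4) by simp
    moreover have "f' u z = 0" using b'[OF that(1) xyz(3) that(3)] xyz(5,6) by simp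
    ultimately show ?thesis by simp
  qed (use b' that in blast)
  have "f' u v = 0" if uv: "u \<in> W" "v \<in> W" "N u v" for u v
  proof -
    consider "\<kappa> u \<noteq> \<kappa> x" "\<kappa> v \<noteq> \<kappa> x" | "\<kappa> u = \<kappa> x" "\<kappa> v \<noteq> \<kappa> x" | "\<kappa> u \<noteq> \<kappa> x" "\<kappa> v = \<kappa> x" | "\<kappa> u = \<kappa> x" "\<kappa> v = \<kappa> x"
      by blast
    then show ?thesis
    proof cases
      case 1 then show ?thesis using a uv by blast
    next
      case 2 then show ?thesis using b uv by blast
    next
      case 3 then show ?thesis using b[of v u] anti'[of u v] uv by simp
    next
      case 4
      then have "N v y" "N u y" using N uv xyz by metis+
      then have "f' u v + f' v y = f' u y" using tri uv xyz(2) by blast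
      then show ?thesis using y0 4 by simp
    qed
  qed
  then have "\<forall>u\<in>W. \<forall>v\<in>W. N u v \<longrightarrow> f u v = g v - g u" by (simp add: f'_def algebra_simps)
  then show "\<exists>g. \<forall>u\<in>W. \<forall>v\<in>W. N u v \<longrightarrow> f u v = g v - g u" by blast
qed

section \<open>The crown graph\<close>

text \<open>The complement of \<open>B_graph b\<close> is a complete bipartite graph minus a perfect matching.\<close>

fun crown :: "nat + nat \<Rightarrow> nat + nat \<Rightarrow> bool" where
  "crown (Inl i) (Inr j) \<longleftrightarrow> i \<noteq> j"
| "crown (Inr i) (Inl j) \<longleftrightarrow> i \<noteq> j"
| "crown _ _ \<longleftrightarrow> False"

lemma crown_sym: "crown u v \<Longrightarrow> crown v u"
  by (cases u; cases v) auto

text \<open>A and C are the index sets of the chosen x_i and y_i. With one side empty all vertices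
  are isolated. Otherwise there are two components if a side is a single vertex whose partner is
  chosen, the partner being isolated, or if A = C has two elements, giving two disjoint
  edges.\<close>

definition crown_comps :: "nat set \<Rightarrow> nat set \<Rightarrow> nat" where
  "crown_comps A C = (if A = {} then card C else if C = {} then card A
    else if card A = 1 \<and> A \<subseteq> C \<or> card C = 1 \<and> C \<subseteq> A \<or> card A = 2 \<and> A = C then 2 else 1)"

lemma ncomp_discrete:
  assumes "finite X" "\<And>u v. u \<in> X \<Longrightarrow> v \<in> X \<Longrightarrow> \<not> N u v"
  shows "ncomp N X (card X)"
proof -
  obtain \<pi> where "bij_betw \<pi> X {..<card X}" using ex_bij_betw_finite_nat[OF assms(1)] by (auto simp: atLeast0LessThan)
  then have "\<pi> ` X = {..<card X}" "inj_on \<pi> X" by (auto simp: bij_betw_def)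
  then show ?thesis unfolding ncomp_def using assms(2) by (intro exI[of _ \<pi>]) (auto dest: inj_onD)
qed

lemma ncomp_connected:
  assumes sym: "\<And>u v. N u v \<Longrightarrow> N v u" and r: "r \<in> X"
    and conn: "\<And>x. x \<in> X \<Longrightarrow> (\<lambda>u v. u \<in> X \<and> v \<in> X \<and> N u v)\<^sup>*\<^sup>* r x"
  shows "ncomp N X 1"
proof -
  have "symp (\<lambda>u v. u \<in> X \<and> v \<in> X \<and> N u v)" using sym by (auto intro: sympI)
  then have s: "symp ((\<lambda>u v. u \<in> X \<and> v \<in> X \<and> N u v)\<^sup>*\<^sup>*)" by (rule symp_rtranclp)
  have "(\<lambda>u v. u \<in> X \<and> v \<in> X \<and> N u v)\<^sup>*\<^sup>* x y" if "x \<in> X" "y \<in> X" for x y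
    by (rule rtranclp_trans[OF sympD[OF s conn[OF that(1)]] conn[OF that(2)]])
  then show ?thesis unfolding ncomp_def using r by (intro exI[of _ "\<lambda>_. 0"]) auto
qed

lemma ncomp_two:
  assumes sym: "\<And>u v. N u v \<Longrightarrow> N v u" and X: "X = X1 \<union> X2" "X1 \<inter> X2 = {}"
    and sep: "\<And>u v. u \<in> X1 \<Longrightarrow> v \<in> X2 \<Longrightarrow> \<not> N u v" and r: "r1 \<in> X1" "r2 \<in> X2"
    and c1: "\<And>x. x \<in> X1 \<Longrightarrow> x = r1 \<or> N r1 x" and c2: "\<And>x. x \<in> X2 \<Longrightarrow> x = r2 \<or> N r2 x"
  shows "ncomp N X 2"
proof -
  let ?R = "\<lambda>u v. u \<in> X \<and> v \<in> X \<and> N u v"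
  have "symp ?R" using sym by (auto intro: sympI)
  then have s: "symp ?R\<^sup>*\<^sup>*" by (rule symp_rtranclp)
  have a1: "?R\<^sup>*\<^sup>* r1 x" if "x \<in> X1" for x using c1[OF that] that r X by auto
  have a2: "?R\<^sup>*\<^sup>* r2 x" if "x \<in> X2" for x using c2[OF that] that r X by auto
  have b1: "?R\<^sup>*\<^sup>* x y" if "x \<in> X1" "y \<in> X1" for x y
    by (rule rtranclp_trans[OF sympD[OF s a1[OF that(1)]] a1[OF that(2)]])
  have b2: "?R\<^sup>*\<^sup>* x y" if "x \<in> X2" "y \<in> X2" for x y
    by (rule rtranclp_trans[OF sympD[OF s a2[OF that(1)]] a2[OF that(2)]])
  define \<pi> where "\<pi> = (\<lambda>x. if x \<in> X1 then 0 else 1 :: nat)"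
  have "\<pi> ` X = {..<2}"
  proof
    show "\<pi> ` X \<subseteq> {..<2}" by (auto simp: \<pi>_def)
    have "\<pi> r1 = 0" "\<pi> r2 = 1" using r X by (auto simp: \<pi>_def)
    moreover have "j = 0 \<or> j = 1" if "j < 2" for j :: nat using that by auto
    ultimately show "{..<2} \<subseteq> \<pi> ` X" using r X(1) by (metis UnI1 UnI2 image_eqI lessThan_iff subsetI)
  qed
  moreover have "\<forall>x\<in>X. \<forall>y\<in>X. N x y \<longrightarrow> \<pi> x = \<pi> y" using sep sym X by (auto simp: \<pi>_def)
  moreover have "\<forall>x\<in>X. \<forall>y\<in>X. \<pi> x = \<pi> y \<longrightarrow> ?R\<^sup>*\<^sup>* x y"
    using b1 b2 X(1) by (auto simp: \<pi>_def split: if_splits)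
  ultimately show ?thesis unfolding ncomp_def by blast
qed

lemma ncomp_crown_two:
  assumes A: "A = {i}" "i \<in> C"
  shows "ncomp crown (Inl ` A \<union> Inr ` C) 2"
  by (rule ncomp_two[where ?X1.0 = "insert (Inl i) (Inr ` (C - {i}))" and ?X2.0 = "{Inr i}" and ?r1.0 = "Inl i" and ?r2.0 = "Inr i"])
    (use A in \<open>auto simp: crown_sym\<close>)

lemma ncomp_crown_swap:
  assumes "ncomp crown (Inl ` C \<union> Inr ` A) c"
  shows "ncomp crown (Inl ` A \<union> Inr ` C) c"
proof -
  define h :: "nat + nat \<Rightarrow> nat + nat" where "h = case_sum Inr Inl"
  have "crown (h u) (h v) \<longleftrightarrow> crown u v" for u v by (cases u; cases v) (auto simp: h_def)
  moreover have "inj_on h (Inl ` C \<union> Inr ` A)" by (auto simp: h_def inj_on_def)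
  ultimately have "ncomp crown (h ` (Inl ` C \<union> Inr ` A)) c" using assms by (intro ncomp_image)
  moreover have "h ` (Inl ` C \<union> Inr ` A) = Inl ` A \<union> Inr ` C" unfolding image_Un image_image by (simp add: h_def Un_commute)
  ultimately show ?thesis by simp
qed

text \<open>Two vertices on one side have a common neighbour unless the other side consists of
  exactly their two partners; then a third vertex on their own side gives a longer path.\<close>

lemma ncomp_crown_connected:
  assumes fin: "finite A" "finite C" and A: "card A \<ge> 2" and C: "card C \<ge> 2" and ne: "\<not> (card A = 2 \<and> A = C)"
  shows "ncomp crown (Inl ` A \<union> Inr ` C) 1"
proof -
  let ?X = "Inl ` A \<union> Inr ` C"
  let ?R = "\<lambda>u v. u \<in> ?X \<and> v \<in> ?X \<and> crown u v"
  have step: "?R\<^sup>*\<^sup>* u v" if "u \<in> ?X" "v \<in> ?X" "crown u v" for u v using that by blast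
  have other: "\<exists>x\<in>S. x \<noteq> j" if "card S \<ge> 2" for S :: "nat set" and j
  proof (rule ccontr)
    assume "\<not> (\<exists>x\<in>S. x \<noteq> j)"
    then have "S \<subseteq> {j}" by blast
    then have "card S \<le> 1" using card_mono[of "{j}" S] by simp
    then show False using that by simp
  qed
  have third: "S = {i, k} \<or> (\<exists>x\<in>S. x \<noteq> i \<and> x \<noteq> k)" if "card S \<ge> 2" for S :: "nat set" and i k
  proof (rule ccontr)
    assume no: "\<not> ?thesis"
    then have "S \<subseteq> {i, k}" "S \<noteq> {i, k}" by blast+
    then have "S \<subseteq> {i} \<or> S \<subseteq> {k}" by blast
    then have "card S \<le> 1" using card_mono[of "{i}" S] card_mono[of "{k}" S] by auto
    then show False using that by simp
  qed
  obtain i where i: "i \<in> A" using A by fastforce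
  have xx: "?R\<^sup>*\<^sup>* (Inl i) (Inl k)" if k: "k \<in> A" for k
  proof (cases "k = i")
    case False
    show ?thesis
    proof (cases "\<exists>j\<in>C. j \<noteq> i \<and> j \<noteq> k")
      case True
      then obtain j where j: "j \<in> C" "j \<noteq> i" "j \<noteq> k" by blast
      have "?R\<^sup>*\<^sup>* (Inl i) (Inr j)" by (rule step) (use i j in auto)
      also have "?R\<^sup>*\<^sup>* (Inr j) (Inl k)" by (rule step) (use k j in auto)
      finally show ?thesis .
    next
      case none: False
      then have Ceq: "C = {i, k}" using third[OF C, of i k] by blast
      have "A \<noteq> {i, k}" using ne Ceq False by auto
      \<comment> \<open>The path is x_i, y_k, x_l, y_i, x_k.\<close>
      then obtain l where l: "l \<in> A" "l \<noteq> i" "l \<noteq> k" using third[OF A, of i k] by blast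
      have "?R\<^sup>*\<^sup>* (Inl i) (Inr k)" by (rule step) (use i Ceq False in auto)
      also have "?R\<^sup>*\<^sup>* (Inr k) (Inl l)" by (rule step) (use l Ceq in auto)
      also have "?R\<^sup>*\<^sup>* (Inl l) (Inr i)" by (rule step) (use l Ceq in auto)
      also have "?R\<^sup>*\<^sup>* (Inr i) (Inl k)" by (rule step) (use k Ceq False in auto)
      finally show ?thesis .
    qed
  qed simp
  show ?thesis
  proof (rule ncomp_connected[where r = "Inl i"])
    show "crown v u" if "crown u v" for u v using that by (rule crown_sym)
    show "Inl i \<in> ?X" using i by simp
    fix x assume "x \<in> ?X"
    then consider k where "x = Inl k" "k \<in> A" | j where "x = Inr j" "j \<in> C" by blast
    then show "?R\<^sup>*\<^sup>* (Inl i) x"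
    proof cases
      case 1 then show ?thesis using xx by simp
    next
      case 2
      obtain k where k: "k \<in> A" "k \<noteq> j" using other[OF A] by blast
      have "?R\<^sup>*\<^sup>* (Inl k) (Inr j)" by (rule step) (use k 2 in auto)
      with xx[OF k(1)] show ?thesis unfolding 2(1) by (rule rtranclp_trans)
    qed
  qed
qed

lemma ncomp_crown:
  assumes fin: "finite A" "finite C"
  shows "ncomp crown (Inl ` A \<union> Inr ` C) (crown_comps A C)"
proof -
  have star: "ncomp crown (Inl ` {i} \<union> Inr ` C) 1" if "i \<notin> C" for i and C :: "nat set"
    by (rule ncomp_connected[where r = "Inl i"]) (use that in \<open>auto simp: crown_sym\<close>)
  have disc1: "ncomp crown (Inl ` {} \<union> Inr ` C) (card C)"
  proof -
    have "ncomp crown (Inr ` C) (card (Inr ` C :: (nat + nat) set))" by (rule ncomp_discrete) (use fin in auto)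
    then show ?thesis by (simp add: card_image)
  qed
  have disc2: "ncomp crown (Inl ` A \<union> Inr ` {}) (card A)"
  proof -
    have "ncomp crown (Inl ` A) (card (Inl ` A :: (nat + nat) set))" by (rule ncomp_discrete) (use fin in auto)
    then show ?thesis by (simp add: card_image)
  qed
  consider "A = {}" | "C = {}" "A \<noteq> {}" | i where "A = {i}" "C \<noteq> {}" | i where "C = {i}" "A \<noteq> {}" "card A \<noteq> 1"
    | "card A = 2" "A = C" | "card A \<ge> 2" "card C \<ge> 2" "\<not> (card A = 2 \<and> A = C)"
  proof -
    have "card S = 0 \<longleftrightarrow> S = {}" "card S = 1 \<longleftrightarrow> (\<exists>i. S = {i})" if "finite S" for S :: "nat set"
      using that by (auto simp: card_1_singleton_iff)
    note c = this[OF fin(1)] this[OF fin(2)]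
    have "n = 0 \<or> n = 1 \<or> n \<ge> 2" for n :: nat by linarith
    from this[of "card A"] this[of "card C"] c that show thesis by metis
  qed
  then show ?thesis
  proof cases
    case 1 then show ?thesis using disc1 by (simp add: crown_comps_def)
  next
    case 2 then show ?thesis using disc2 by (simp add: crown_comps_def)
  next
    case (3 i)
    show ?thesis
    proof (cases "i \<in> C")
      case True then show ?thesis using ncomp_crown_two[OF 3(1) True] 3 by (simp add: crown_comps_def)
    next
      case False
      then have "crown_comps A C = 1" using 3 by (auto simp: crown_comps_def)
      then show ?thesis using star[OF False] 3(1) by simp
    qed
  next
    case (4 i)
    show ?thesis
    proof (cases "i \<in> A")
      case True
      then show ?thesis using ncomp_crown_swap[OF ncomp_crown_two[OF 4(1) True]] 4 by (simp add: crown_comps_def)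
    next
      case False
      then show ?thesis using ncomp_crown_swap[OF star[OF False]] 4 by (auto simp: crown_comps_def)
    qed
  next
    case 5
    then obtain i j where ij: "A = {i, j}" "i \<noteq> j" by (auto simp: card_2_iff)
    have "ncomp crown (Inl ` A \<union> Inr ` C) 2"
      by (rule ncomp_two[where ?X1.0 = "{Inl i, Inr j}" and ?X2.0 = "{Inl j, Inr i}" and ?r1.0 = "Inl i" and ?r2.0 = "Inl j"])
        (use ij 5 in \<open>auto simp: crown_sym\<close>)
    moreover have "crown_comps A C = 2" using 5 by (auto simp: crown_comps_def)
    ultimately show ?thesis by simp
  next
    case 6
    then have "crown_comps A C = 1" by (auto simp: crown_comps_def)
    then show ?thesis using ncomp_crown_connected[OF fin 6] by simp
  qed
qed

section \<open>Counting in the crown graph\<close>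

definition pair_sets :: "nat \<Rightarrow> nat \<Rightarrow> (nat set \<times> nat set) set" where
  "pair_sets b m = {(A, C). A \<subseteq> {1..b} \<and> C \<subseteq> {1..b} \<and> card A + card C = m}"

definition comps :: "(nat + nat) set \<Rightarrow> nat" where
  "comps X = crown_comps (Inl -` X) (Inr -` X)"

definition crown_edges :: "(nat + nat) set \<Rightarrow> ((nat + nat) \<times> (nat + nat)) set" where
  "crown_edges X = {(Inl i, Inr j) | i j. Inl i \<in> X \<and> Inr j \<in> X \<and> i \<noteq> j}"

lemma verts_B_graph: "verts (B_graph b) = Inl ` {1..b} \<union> Inr ` {1..b}"
  by (simp add: B_graph_def)

lemma finite_verts_B: "finite (verts (B_graph b))"
  by (simp add: verts_B_graph)

lemma card_verts_B: "card (verts (B_graph b)) = 2 * b"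
proof -
  have "card (Inl ` {1..b} \<union> Inr ` {1..b} :: (nat + nat) set) = card (Inl ` {1..b} :: (nat + nat) set) + card (Inr ` {1..b} :: (nat + nat) set)"
    by (intro card_Un_disjoint) auto
  then show ?thesis by (simp add: verts_B_graph card_image)
qed

lemma card_sum_set:
  assumes "finite A" "finite C"
  shows "card (Inl ` A \<union> Inr ` C) = card A + card C"
proof -
  have "card (Inl ` A \<union> Inr ` C) = card (Inl ` A :: ('a + 'b) set) + card (Inr ` C :: ('a + 'b) set)"
    using assms by (intro card_Un_disjoint) auto
  then show ?thesis by (simp add: card_image)
qed

lemma sum_set_split: "X = Inl ` (Inl -` X) \<union> Inr ` (Inr -` X)"
proof (rule set_eqI)
  fix x show "x \<in> X \<longleftrightarrow> x \<in> Inl ` (Inl -` X) \<union> Inr ` (Inr -` X)" by (cases x) auto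
qed

lemma vimage_sum_set [simp]:
  "Inl -` (Inl ` A \<union> Inr ` C) = A" "Inr -` (Inl ` A \<union> Inr ` C) = C"
  by auto

lemma finite_pair_sets: "finite (pair_sets b m)"
  by (rule finite_subset[of _ "Pow {1..b} \<times> Pow {1..b}"]) (auto simp: pair_sets_def)

lemma sum_pair_sets:
  "(\<Sum>X | X \<subseteq> verts (B_graph b) \<and> card X = m. f (Inl -` X) (Inr -` X)) = (\<Sum>(A, C)\<in>pair_sets b m. f A C)"
proof (rule sum.reindex_bij_witness[of _ "\<lambda>(A, C). Inl ` A \<union> Inr ` C" "\<lambda>X. (Inl -` X, Inr -` X)"])
  fix X assume X: "X \<in> {X. X \<subseteq> verts (B_graph b) \<and> card X = m}"
  show "(case (Inl -` X, Inr -` X) of (A, C) \<Rightarrow> Inl ` A \<union> Inr ` C) = X"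
    using sum_set_split[of X] by simp
  have sub: "Inl -` X \<subseteq> {1..b}" "Inr -` X \<subseteq> {1..b}" using X by (auto simp: verts_B_graph)
  then have "finite (Inl -` X)" "finite (Inr -` X)" using finite_subset by blast+
  from card_sum_set[OF this] have "card X = card (Inl -` X) + card (Inr -` X)"
    using sum_set_split[of X] by simp
  then show "(Inl -` X, Inr -` X) \<in> pair_sets b m" using sub X by (simp add: pair_sets_def)
next
  fix p assume p: "p \<in> pair_sets b m"
  obtain A C where AC: "p = (A, C)" "A \<subseteq> {1..b}" "C \<subseteq> {1..b}" "card A + card C = m"
    using p by (auto simp: pair_sets_def)
  then have "finite A" "finite C" using finite_subset by blast+
  from card_sum_set[OF this] show "(case p of (A, C) \<Rightarrow> Inl ` A \<union> Inr ` C) \<in> {X. X \<subseteq> verts (B_graph b) \<and> card X = m}"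
    using AC by (auto simp: verts_B_graph)
qed auto

lemma card_pairs_empty: "card {p \<in> pair_sets b m. fst p = {}} = b choose m"
proof -
  have "{p \<in> pair_sets b m. fst p = {}} = Pair {} ` {C. C \<subseteq> {1..b} \<and> card C = m}"
    by (auto simp: pair_sets_def)
  moreover have "card {C. C \<subseteq> {1..b} \<and> card C = m} = b choose m" using n_subsets[of "{1..b}" m] by simp
  ultimately show ?thesis by (simp add: card_image inj_on_def)
qed

lemma card_pairs_singleton:
  "card {p \<in> pair_sets b m. card (fst p) = 1 \<and> fst p \<subseteq> snd p} = (if m \<ge> 2 then b * ((b - 1) choose (m - 2)) else 0)"
proof (cases "m \<ge> 2")
  case False
  have "{p \<in> pair_sets b m. card (fst p) = 1 \<and> fst p \<subseteq> snd p} = {}"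
  proof (rule ccontr)
    assume "\<not> ?thesis"
    then obtain A C where AC: "(A, C) \<in> pair_sets b m" "card A = 1" "A \<subseteq> C" by auto
    then have "finite C" using finite_subset by (auto simp: pair_sets_def)
    then have "card A \<le> card C" using AC by (intro card_mono)
    then show False using AC False by (auto simp: pair_sets_def)
  qed
  then show ?thesis using False by (simp only: card.empty if_False)
next
  case True
  define S where "S = (SIGMA i : {1..b}. {D. D \<subseteq> {1..b} - {i} \<and> card D = m - 2})"
  have "{p \<in> pair_sets b m. card (fst p) = 1 \<and> fst p \<subseteq> snd p} = (\<lambda>(i, D). ({i}, insert i D)) ` S"
  proof (intro equalityI subsetI)
    fix p assume "p \<in> {p \<in> pair_sets b m. card (fst p) = 1 \<and> fst p \<subseteq> snd p}"
    then obtain i C where p: "p = ({i}, C)" "i \<in> C" "i \<in> {1..b}" "C \<subseteq> {1..b}" "1 + card C = m"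
      by (auto simp: pair_sets_def card_1_singleton_iff)
    then have "finite C" using finite_subset by blast
    then have "card (C - {i}) = m - 2" using p by simp
    then have "(i, C - {i}) \<in> S" using p by (auto simp: S_def)
    moreover have "p = (\<lambda>(i, D). ({i}, insert i D)) (i, C - {i})" using p by auto
    ultimately show "p \<in> (\<lambda>(i, D). ({i}, insert i D)) ` S" by blast
  next
    fix p assume "p \<in> (\<lambda>(i, D). ({i}, insert i D)) ` S"
    then obtain i D where p: "p = ({i}, insert i D)" "i \<in> {1..b}" "D \<subseteq> {1..b} - {i}" "card D = m - 2"
      by (auto simp: S_def)
    then have "finite D" "i \<notin> D" using finite_subset by blast+
    then show "p \<in> {p \<in> pair_sets b m. card (fst p) = 1 \<and> fst p \<subseteq> snd p}"
      using p True by (auto simp: pair_sets_def)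
  qed
  moreover have "inj_on (\<lambda>(i, D). ({i}, insert i D)) S" by (auto simp: inj_on_def S_def)
  moreover have "card S = (\<Sum>i\<in>{1..b}. card {D. D \<subseteq> {1..b} - {i} \<and> card D = m - 2})"
    unfolding S_def by (intro card_SigmaI) auto
  moreover have "card {D. D \<subseteq> {1..b} - {i} \<and> card D = m - 2} = (b - 1) choose (m - 2)" if "i \<in> {1..b}" for i
    using n_subsets[of "{1..b} - {i}" "m - 2"] that by simp
  ultimately show ?thesis using True by (simp add: card_image)
qed

lemma card_pairs_diagonal:
  "card {p \<in> pair_sets b m. card (fst p) = k \<and> fst p = snd p} = (if m = 2 * k then b choose k else 0)"
proof (cases "m = 2 * k")
  case True
  have "{p \<in> pair_sets b m. card (fst p) = k \<and> fst p = snd p} = (\<lambda>S. (S, S)) ` {S. S \<subseteq> {1..b} \<and> card S = k}"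
    using True by (auto simp: pair_sets_def)
  moreover have "card {S. S \<subseteq> {1..b} \<and> card S = k} = b choose k" using n_subsets[of "{1..b}" k] by simp
  ultimately show ?thesis using True by (simp add: card_image inj_on_def)
next
  case False
  then have "{p \<in> pair_sets b m. card (fst p) = k \<and> fst p = snd p} = {}" by (auto simp: pair_sets_def)
  then show ?thesis using False by (simp only: card.empty if_False)
qed

lemma card_pairs_swap: "card {p \<in> pair_sets b m. P (snd p) (fst p)} = card {p \<in> pair_sets b m. P (fst p) (snd p)}"
proof -
  have "{p \<in> pair_sets b m. P (snd p) (fst p)} = prod.swap ` {p \<in> pair_sets b m. P (fst p) (snd p)}"
    by (auto simp: pair_sets_def image_iff)
  then show ?thesis by (simp add: card_image)
qed

text \<open>Indicators turn the later summation into counting. The two singleton cases overlap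
  exactly when A = C is a singleton, which is why this case is subtracted once.\<close>

lemma crown_comps_expand:
  assumes "finite A" "finite C" "A \<noteq> {} \<or> C \<noteq> {}"
  shows "int (crown_comps A C) - 1 = of_bool (A = {}) * (int (card C) - 1) + of_bool (C = {}) * (int (card A) - 1)
    + of_bool (card A = 1 \<and> A \<subseteq> C) + of_bool (card C = 1 \<and> C \<subseteq> A) - of_bool (card A = 1 \<and> A = C) + of_bool (card A = 2 \<and> A = C)"
proof -
  have "A = C" if "card A = 1" "A \<subseteq> C" "card C = 1 \<or> card C = card A"
    using that assms by (intro card_subset_eq) auto
  moreover have "A = C" if "card A = 1" "card C = 1" "C \<subseteq> A"
    using that assms card_subset_eq[of A C] by auto
  ultimately show ?thesis using assms by (auto simp: crown_comps_def)
qed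

lemma sum_of_bool_card: "finite S \<Longrightarrow> (\<Sum>p\<in>S. of_bool (P p) :: int) = int (card {p \<in> S. P p})"
  by (simp add: of_bool_def sum.If_cases Int_def)

text \<open>The empty sides contribute (m - 1) times \<open>b choose m\<close> each, the singletons
  b times \<open>(b - 1) choose (m - 2)\<close> each. The overlap correction lives in size 2 and the
  two disjoint edges in size 4, which is where \<open>lam\<close> has its exceptional
  values.\<close>

lemma sum_comps:
  assumes b: "b \<ge> 3" and m: "m \<ge> 1"
  shows "(\<Sum>X | X \<subseteq> verts (B_graph b) \<and> card X = m. int (comps X) - 1) = lam b (m - 1)"
proof -
  let ?P = "pair_sets b m"
  note fin = finite_pair_sets[of b m]
  have "(\<Sum>X | X \<subseteq> verts (B_graph b) \<and> card X = m. int (comps X) - 1) = (\<Sum>(A, C)\<in>?P. int (crown_comps A C) - 1)"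
    unfolding comps_def by (rule sum_pair_sets)
  also have "\<dots> = (\<Sum>p\<in>?P. of_bool (fst p = {}) * (int m - 1) + of_bool (snd p = {}) * (int m - 1)
    + of_bool (card (fst p) = 1 \<and> fst p \<subseteq> snd p) + of_bool (card (snd p) = 1 \<and> snd p \<subseteq> fst p)
    - of_bool (card (fst p) = 1 \<and> fst p = snd p) + of_bool (card (fst p) = 2 \<and> fst p = snd p))"
  proof (rule sum.cong[OF refl], clarify)
    fix A C assume AC: "(A, C) \<in> ?P"
    then have f: "finite A" "finite C" using finite_subset by (auto simp: pair_sets_def)
    have "A \<noteq> {} \<or> C \<noteq> {}" using AC m by (auto simp: pair_sets_def)
    from crown_comps_expand[OF f this] AC
    show "int (crown_comps A C) - 1 = of_bool (fst (A, C) = {}) * (int m - 1) + of_bool (snd (A, C) = {}) * (int m - 1)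
      + of_bool (card (fst (A, C)) = 1 \<and> fst (A, C) \<subseteq> snd (A, C)) + of_bool (card (snd (A, C)) = 1 \<and> snd (A, C) \<subseteq> fst (A, C))
      - of_bool (card (fst (A, C)) = 1 \<and> fst (A, C) = snd (A, C)) + of_bool (card (fst (A, C)) = 2 \<and> fst (A, C) = snd (A, C))"
      by (auto simp: pair_sets_def)
  qed
  also have "\<dots> = int (card {p \<in> ?P. fst p = {}}) * (int m - 1) + int (card {p \<in> ?P. snd p = {}}) * (int m - 1)
    + int (card {p \<in> ?P. card (fst p) = 1 \<and> fst p \<subseteq> snd p}) + int (card {p \<in> ?P. card (snd p) = 1 \<and> snd p \<subseteq> fst p})
    - int (card {p \<in> ?P. card (fst p) = 1 \<and> fst p = snd p}) + int (card {p \<in> ?P. card (fst p) = 2 \<and> fst p = snd p})"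
    by (simp only: sum.distrib sum_subtractf sum_distrib_right[symmetric] sum_of_bool_card[OF fin])
  also have "\<dots> = 2 * int (b choose m) * (int m - 1) + 2 * int (if m \<ge> 2 then b * ((b - 1) choose (m - 2)) else 0)
    - int (if m = 2 then b else 0) + int (if m = 4 then b choose 2 else 0)"
    using card_pairs_swap[of b m "\<lambda>A C. A = {}"] card_pairs_swap[of b m "\<lambda>A C. card A = 1 \<and> A \<subseteq> C"]
      card_pairs_diagonal[of b m 1] card_pairs_diagonal[of b m 2]
    by (simp add: card_pairs_empty card_pairs_singleton[unfolded One_nat_def])
  also have "\<dots> = lam b (m - 1)"
  proof -
    \<comment> \<open>Beyond the range of \<open>lam\<close> the generic binomials vanish of
      themselves, matching its value 0.\<close>
    have z: "b choose m = 0" "(b - 1) choose (m - 2) = 0" if "m - 1 > 2 * b - 2"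
      using that b by (auto intro!: binomial_eq_0)
    consider "m = 1" | "m = 2" | "m = 4" | "m \<noteq> 1" "m \<noteq> 2" "m \<noteq> 4" "m - 1 > 2 * b - 2" | "m \<noteq> 1" "m \<noteq> 2" "m \<noteq> 4" "m - 1 \<le> 2 * b - 2"
      by linarith
    then show ?thesis
    proof cases
      case 1 then show ?thesis by (simp add: lam_def)
    next
      case 2 then show ?thesis using b by (simp add: lam_def)
    next
      case 3
      moreover have "\<not> 2 * b - 2 < 3" using b by simp
      ultimately show ?thesis by (simp add: lam_def)
    next
      case 4 then show ?thesis using m by (auto simp: lam_def z)
    next
      case 5
      then obtain i where "m = Suc i" "i \<noteq> 0" "i \<noteq> 1" "i \<noteq> 3" using m by (cases m) auto
      then show ?thesis using 5 by (auto simp: lam_def)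
    qed
  qed
  finally show ?thesis .
qed

lemma card_subsets_containing_pair:
  assumes S: "finite S" and uv: "u \<in> S" "v \<in> S" "u \<noteq> v" and m: "m \<ge> 2"
  shows "card {X. X \<subseteq> S \<and> card X = m \<and> u \<in> X \<and> v \<in> X} = (card S - 2) choose (m - 2)"
proof -
  have "{X. X \<subseteq> S \<and> card X = m \<and> u \<in> X \<and> v \<in> X} = (\<lambda>Y. insert u (insert v Y)) ` {Y. Y \<subseteq> S - {u, v} \<and> card Y = m - 2}"
  proof (intro equalityI subsetI)
    fix X assume X: "X \<in> {X. X \<subseteq> S \<and> card X = m \<and> u \<in> X \<and> v \<in> X}"
    have "card (X - {u, v}) = card X - card {u, v}" using X by (intro card_Diff_subset) auto
    then have "X - {u, v} \<in> {Y. Y \<subseteq> S - {u, v} \<and> card Y = m - 2}" using X uv by auto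
    moreover have "X = insert u (insert v (X - {u, v}))" using X by auto
    ultimately show "X \<in> (\<lambda>Y. insert u (insert v Y)) ` {Y. Y \<subseteq> S - {u, v} \<and> card Y = m - 2}" by blast
  next
    fix X assume "X \<in> (\<lambda>Y. insert u (insert v Y)) ` {Y. Y \<subseteq> S - {u, v} \<and> card Y = m - 2}"
    then obtain Y where Y: "X = insert u (insert v Y)" "Y \<subseteq> S - {u, v}" "card Y = m - 2" by blast
    then have "finite Y" using S finite_subset by blast
    moreover have "u \<notin> insert v Y" "v \<notin> Y" using Y uv by auto
    ultimately show "X \<in> {X. X \<subseteq> S \<and> card X = m \<and> u \<in> X \<and> v \<in> X}" using Y uv m by auto
  qed
  moreover have "inj_on (\<lambda>Y. insert u (insert v Y)) {Y. Y \<subseteq> S - {u, v} \<and> card Y = m - 2}"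
    by (auto simp: inj_on_def)
  moreover have "card {Y. Y \<subseteq> S - {u, v} \<and> card Y = m - 2} = (card S - 2) choose (m - 2)"
  proof -
    have "card (S - {u, v}) = card S - 2" using S uv by (subst card_Diff_subset) auto
    then show ?thesis using n_subsets[of "S - {u, v}" "m - 2"] S by simp
  qed
  ultimately show ?thesis by (simp add: card_image)
qed

text \<open>Double counting: the crown graph on all 2b vertices has b * b - b edges, and an edge
  lies in those vertex sets that extend its two ends by m - 2 others.\<close>

lemma sum_crown_edges:
  assumes m: "m \<ge> 2"
  shows "(\<Sum>X | X \<subseteq> verts (B_graph b) \<and> card X = m. int (card (crown_edges X))) =
    (int b ^ 2 - int b) * int ((2 * b - 2) choose (m - 2))"
proof -
  let ?V = "verts (B_graph b)"
  define E where "E = crown_edges ?V"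
  have E: "E = (\<lambda>(i, j). (Inl i, Inr j)) ` ({1..b} \<times> {1..b} - (\<lambda>i. (i, i)) ` {1..b})"
    by (auto simp: E_def crown_edges_def verts_B_graph image_iff)
  have finE: "finite E" unfolding E by simp
  have "card ({1..b} \<times> {1..b} - (\<lambda>i. (i, i)) ` {1..b}) = b * b - b"
    by (subst card_Diff_subset) (auto simp: card_image inj_on_def)
  then have "card E = b * b - b"
    unfolding E by (subst card_image) (auto simp: inj_on_def)
  then have cE: "int (card E) = int b ^ 2 - int b"
    by (simp add: power2_eq_square of_nat_diff)
  have sub: "int (card (crown_edges X)) = (\<Sum>e\<in>E. if fst e \<in> X \<and> snd e \<in> X then 1 else 0)" if "X \<subseteq> ?V" for X
  proof -
    have "crown_edges X = {e \<in> E. fst e \<in> X \<and> snd e \<in> X}"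
      using that by (auto simp: E_def crown_edges_def)
    then show ?thesis using finE by (simp add: sum.If_cases Int_def)
  qed
  have "(\<Sum>X | X \<subseteq> ?V \<and> card X = m. int (card (crown_edges X))) =
    (\<Sum>X | X \<subseteq> ?V \<and> card X = m. \<Sum>e\<in>E. if fst e \<in> X \<and> snd e \<in> X then 1 else 0)"
    by (intro sum.cong) (auto simp: sub)
  also have "\<dots> = (\<Sum>e\<in>E. \<Sum>X | X \<subseteq> ?V \<and> card X = m. if fst e \<in> X \<and> snd e \<in> X then 1 else 0)"
    by (rule sum.swap)
  also have "\<dots> = (\<Sum>e\<in>E. int ((2 * b - 2) choose (m - 2)))"
  proof (rule sum.cong[OF refl])
    fix e assume e: "e \<in> E"
    then have e': "fst e \<in> ?V" "snd e \<in> ?V" "fst e \<noteq> snd e" by (auto simp: E_def crown_edges_def)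
    have fin: "finite {X. X \<subseteq> ?V \<and> card X = m}" using finite_verts_B by simp
    have "(\<Sum>X | X \<subseteq> ?V \<and> card X = m. if fst e \<in> X \<and> snd e \<in> X then 1 else 0 :: int) =
      int (card {X. X \<subseteq> ?V \<and> card X = m \<and> fst e \<in> X \<and> snd e \<in> X})"
      using fin by (simp add: sum.If_cases Int_def conj_assoc)
    also have "\<dots> = int ((2 * b - 2) choose (m - 2))"
      using card_subsets_containing_pair[OF finite_verts_B e' m] by (simp add: card_verts_B)
    finally show "(\<Sum>X | X \<subseteq> ?V \<and> card X = m. if fst e \<in> X \<and> snd e \<in> X then 1 else 0 :: int) = int ((2 * b - 2) choose (m - 2))" .
  qed
  finally show ?thesis by (simp add: cE)
qed

text \<open>The integer difference makes the absorption identity hold for all k: beyond n both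
  binomials are zero.\<close>

lemma binomial_absorb_int: "int (Suc k) * int (n choose Suc k) = (int n - int k) * int (n choose k)"
proof (cases "k \<le> n")
  case True
  have "Suc k * (n choose Suc k) = (n - k) * (n choose k)"
    using binomial_absorption[of k n] binomial_absorb_comp[of n k] by simp
  then have "int (Suc k * (n choose Suc k)) = int ((n - k) * (n choose k))" by simp
  then show ?thesis using True by (simp only: of_nat_mult of_nat_diff)
qed (simp add: binomial_eq_0)

text \<open>Split e - v + c as e + (c - 1) - (m - 1). The first two sums are known and the third
  counts all sets of size \<open>m\<close>; the remaining identity rewrites that count in binomials
  of 2b - 2.\<close>

lemma sum_crown_h1:
  assumes b: "b \<ge> 3" and m: "m \<ge> 2"
  shows "(\<Sum>X | X \<subseteq> verts (B_graph b) \<and> card X = m. int (card (crown_edges X)) + int (comps X) - int (card X)) = mu b (m - 2)"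
proof -
  let ?V = "verts (B_graph b)"
  obtain i where i: "m = i + 2" using m by (metis add.commute le_Suc_ex)
  have cV: "card {X. X \<subseteq> ?V \<and> card X = m} = (2 * b) choose m"
    using n_subsets[OF finite_verts_B, of b m] by (simp add: card_verts_B)
  have "(\<Sum>X | X \<subseteq> ?V \<and> card X = m. int (card (crown_edges X)) + int (comps X) - int (card X)) =
    (\<Sum>X | X \<subseteq> ?V \<and> card X = m. int (card (crown_edges X))) + (\<Sum>X | X \<subseteq> ?V \<and> card X = m. int (comps X) - 1)
     + (\<Sum>X | X \<subseteq> ?V \<and> card X = m. 1 - int m)"
    unfolding sum.distrib[symmetric] by (intro sum.cong) auto
  also have "\<dots> = (int b ^ 2 - int b) * int ((2 * b - 2) choose i) + lam b (i + 1) - (int i + 1) * int ((2 * b) choose (i + 2))"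
    using sum_crown_edges[OF m, of b] sum_comps[OF b, of m] m cV by (simp add: i algebra_simps)
  also have "\<dots> = mu b i"
  proof -
    obtain c where c: "b = c + 3" using b by (metis add.commute le_Suc_ex)
    define n where "n = 2 * b - 2"
    have n: "2 * b = Suc (Suc n)" using b by (simp add: n_def)
    define x where "x = int (n choose i)"
    define y where "y = int (n choose Suc i)"
    define z where "z = int (n choose Suc (Suc i))"
    have e0: "int ((2 * b) choose (i + 2)) = x + 2 * y + z" by (simp add: n x_def y_def z_def)
    have e1: "(int i + 1) * y = (int n - int i) * x" using binomial_absorb_int[of i n] by (simp add: x_def y_def algebra_simps)
    have e2: "(int i + 2) * z = (int n - int i - 1) * y" using binomial_absorb_int[of "Suc i" n] by (simp add: z_def y_def algebra_simps)
    have nb: "int n = 2 * int b - 2" using b by (simp add: n_def)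
    \<comment> \<open>Pascal's rule applied twice expands the binomial of 2b. The two absorption
      identities then remove the factors depending on \<open>i\<close>.\<close>
    have main: "(int b ^ 2 - int b) * x - (int i + 1) * (x + 2 * y + z) = z - int n * y + (int b ^ 2 - 3 * int b + 1) * x"
    proof -
      have "(int i + 1) * (x + 2 * y + z) = (int i + 1) * x + 2 * ((int i + 1) * y) + ((int i + 2) * z - z)" by (simp add: algebra_simps)
      also have "\<dots> = (int i + 1) * x + 2 * ((int i + 1) * y) + (int n - int i - 1) * y - z" by (simp add: e2)
      also have "\<dots> = (int i + 1) * x + (int i + 1) * y + int n * y - z" by (simp add: algebra_simps)
      also have "\<dots> = (int n + 1) * x + int n * y - z" using e1 by (simp add: algebra_simps)
      finally show ?thesis by (simp add: nb algebra_simps)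
    qed
    consider "i = 0" | "i > 2 * b - 2" | "1 \<le> i" "i \<le> 2 * b - 2" by linarith
    then show ?thesis
    proof cases
      case 1
      have t: "int (2 * (k choose 2)) = int k * (int k - 1)" for k :: nat
      proof -
        have "even (k * (k - 1))" by (cases k) auto
        then have "2 * (k choose 2) = k * (k - 1)" unfolding choose_two by (rule dvd_mult_div_cancel)
        then have "int (2 * (k choose 2)) = int (k * (k - 1))" by simp
          then show ?thesis by (cases k) (auto simp: algebra_simps)
      qed
      \<comment> \<open>At \<open>i = 0\<close> the convention \<open>mu b 0 = 0\<close> applies, so
        the counts on vertex sets of size two must cancel exactly. The factor 2 clears the halves in
        the binomials.\<close>
      have "2 * ((int b ^ 2 - int b) + lam b 1 - int ((2 * b) choose 2)) = 0"
      proof -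
        have "lam b 1 = int b * (int b - 1) + int b" using t[of b] b by (simp add: lam_def)
        moreover have "2 * int ((2 * b) choose 2) = int (2 * b) * (int (2 * b) - 1)" using t[of "2 * b"] by simp
        ultimately show ?thesis by (simp add: algebra_simps power2_eq_square)
      qed
      then show ?thesis using 1 by (simp add: mu_def numeral_2_eq_2)
    next
      case 2
      then have "lam b (i + 1) = 0" "x = 0" "(2 * b) choose (i + 2) = 0"
        using b by (auto simp: lam_def x_def n_def intro!: binomial_eq_0)
      then show ?thesis using 2 by (simp add: mu_def x_def n_def binomial_eq_0)
    next
      case 3
      then have "mu b i = lam b (i + 1) + z - int n * y + (int b ^ 2 - 3 * int b + 1) * x"
        by (simp add: mu_def z_def y_def x_def n_def[symmetric] nb)
      then show ?thesis using main unfolding e0 by (simp add: x_def[symmetric] n_def[symmetric])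
    qed
  qed
  finally show ?thesis by (simp add: i)
qed

section \<open>The graph \<open>G_graph a b n\<close>\<close>

lemma B_graph_edge:
  assumes "x \<in> verts (B_graph b)" "y \<in> verts (B_graph b)"
  shows "nonadj (B_graph b) x y \<longleftrightarrow> crown x y"
proof (cases x; cases y)
  fix i j assume "x = Inl i" "y = Inl j"
  then show ?thesis using assms
    by (auto simp: nonadj_def B_graph_def doubleton_eq_iff) (metis nat_neq_iff)
next
  fix i j assume "x = Inl i" "y = Inr j"
  then show ?thesis using assms by (auto simp: nonadj_def B_graph_def doubleton_eq_iff)
next
  fix i j assume "x = Inr i" "y = Inl j"
  then show ?thesis using assms by (auto simp: nonadj_def B_graph_def doubleton_eq_iff)
next
  fix i j assume "x = Inr i" "y = Inr j"
  then show ?thesis using assms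
    by (auto simp: nonadj_def B_graph_def doubleton_eq_iff) (metis nat_neq_iff)
qed

lemma simple_B_graph: "simple_graph (B_graph b)"
  unfolding simple_graph_def by (auto simp: B_graph_def) force+

lemma verts_G_graph: "verts (G_graph a b n) = Inl ` {1..a} \<union> Inr ` ({1..n} \<times> verts (B_graph b))"
  by (simp add: G_graph_def graph_join_def edgeless_def graph_copies_def)

lemma edges_G_graph: "edges (G_graph a b n) =
    {Inr ` Pair k ` e | k e. k \<in> {1..n} \<and> e \<in> edges (B_graph b)} \<union>
    {{Inl x, Inr y} | x y. x \<in> {1..a} \<and> y \<in> {1..n} \<times> verts (B_graph b)}"
proof -
  have "(`) (Inr :: _ \<Rightarrow> nat + nat \<times> (nat + nat)) ` {Pair k ` e | k e. k \<in> {1..n} \<and> e \<in> edges (B_graph b)} =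
    {Inr ` Pair k ` e | k e. k \<in> {1..n} \<and> e \<in> edges (B_graph b)}" by blast
  then show ?thesis
    by (simp only: G_graph_def graph_join_def edgeless_def graph_copies_def fst_conv snd_conv image_empty Un_empty_left)
qed

lemma simple_G_graph: "simple_graph (G_graph a b n)"
  unfolding simple_graph_def
proof (intro conjI ballI)
  show "finite (verts (G_graph a b n))" by (simp add: verts_G_graph finite_verts_B)
  fix e assume "e \<in> edges (G_graph a b n)"
  then consider k e' where "e = Inr ` Pair k ` e'" "k \<in> {1..n}" "e' \<in> edges (B_graph b)"
    | x y where "e = {Inl x, Inr y}" "x \<in> {1..a}" "y \<in> {1..n} \<times> verts (B_graph b)"
    unfolding edges_G_graph by blast
  then show "\<exists>x y. e = {x, y} \<and> x \<noteq> y \<and> x \<in> verts (G_graph a b n) \<and> y \<in> verts (G_graph a b n)"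
  proof cases
    case 1
    then obtain x y where "e' = {x, y}" "x \<noteq> y" "x \<in> verts (B_graph b)" "y \<in> verts (B_graph b)"
      using simple_B_graph[of b] unfolding simple_graph_def by blast
    then show ?thesis using 1
      by (intro exI[of _ "Inr (k, x)"] exI[of _ "Inr (k, y)"]) (auto simp: verts_G_graph)
  next
    case 2
    then show ?thesis by (intro exI[of _ "Inl x"] exI[of _ "Inr y"]) (auto simp: verts_G_graph)
  qed
qed

lemma nonadj_G_left: "nonadj (G_graph a b n) (Inl p) (Inl q) \<longleftrightarrow> p \<noteq> q"
proof -
  have "{Inl p, Inl q} \<notin> edges (G_graph a b n)"
    unfolding edges_G_graph using simple_B_graph[of b] unfolding simple_graph_def
    by (auto simp: doubleton_eq_iff)
  then show ?thesis by (simp add: nonadj_def)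
qed

lemma nonadj_G_cross:
  assumes "p \<in> {1..a}" "y \<in> {1..n} \<times> verts (B_graph b)"
  shows "\<not> nonadj (G_graph a b n) (Inl p) (Inr y)" "\<not> nonadj (G_graph a b n) (Inr y) (Inl p)"
proof -
  have "{Inl p, Inr y} \<in> edges (G_graph a b n)" unfolding edges_G_graph using assms by blast
  then show "\<not> nonadj (G_graph a b n) (Inl p) (Inr y)" "\<not> nonadj (G_graph a b n) (Inr y) (Inl p)"
    by (simp_all add: nonadj_def insert_commute)
qed

text \<open>Vertices of different copies are never adjacent, so the independence complexes of the
  copies are joined; inside one copy the crown graph appears.\<close>

lemma nonadj_G_right:
  assumes "k \<in> {1..n}" "x \<in> verts (B_graph b)" "y \<in> verts (B_graph b)"
  shows "nonadj (G_graph a b n) (Inr (k, x)) (Inr (l, y)) \<longleftrightarrow> k \<noteq> l \<or> crown x y"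
proof -
  have "{Inr (k, x), Inr (l, y)} \<in> edges (G_graph a b n) \<longleftrightarrow> k = l \<and> {x, y} \<in> edges (B_graph b)"
  proof
    assume "{Inr (k, x), Inr (l, y)} \<in> edges (G_graph a b n)"
    then obtain k' e where e: "{Inr (k, x), Inr (l, y)} = (Inr ` Pair k' ` e :: (nat + nat \<times> (nat + nat)) set)"
      "e \<in> edges (B_graph b)" unfolding edges_G_graph by (auto simp: doubleton_eq_iff)
    then have "Inr ` {(k, x), (l, y)} = (Inr ` Pair k' ` e :: (nat + nat \<times> (nat + nat)) set)" by simp
    then have eq: "{(k, x), (l, y)} = Pair k' ` e" by (simp only: inj_image_eq_iff[OF inj_Inr])
    then have "k = k'" "l = k'" by auto
    then have "Pair k' ` {x, y} = Pair k' ` e" using eq by simp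
    moreover have "inj (Pair k')" by (simp add: inj_def)
    ultimately have "{x, y} = e" by (metis inj_image_eq_iff)
    then show "k = l \<and> {x, y} \<in> edges (B_graph b)" using e(2) \<open>k = k'\<close> \<open>l = k'\<close> by simp
  next
    assume "k = l \<and> {x, y} \<in> edges (B_graph b)"
    then have "{Inr (k, x), Inr (l, y)} = Inr ` Pair k ` {x, y} \<and> k \<in> {1..n} \<and> {x, y} \<in> edges (B_graph b)"
      using assms by simp
    then show "{Inr (k, x), Inr (l, y)} \<in> edges (G_graph a b n)" unfolding edges_G_graph by blast
  qed
  then show ?thesis using B_graph_edge[OF assms(2,3)] by (auto simp: nonadj_def)
qed

text \<open>The truncated subtraction is exact, since the second part of \<open>h1_dim_crown\<close>
  shows that the subtrahend is not larger.\<close>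

definition crown_h1 :: "(nat + nat) set \<Rightarrow> nat" where
  "crown_h1 X = card (crown_edges X) + comps X - card X"

text \<open>\<open>Domain Q\<close> is the set of copies met by Q and the image of a copy is the
  slice of Q in it. The default 0 covers the empty set as well as three or more copies.\<close>

definition copies_h1 :: "(nat \<times> (nat + nat)) set \<Rightarrow> nat" where
  "copies_h1 Q = (if card (Domain Q) = 1 then \<Sum>k\<in>Domain Q. crown_h1 (Q `` {k})
    else if card (Domain Q) = 2 then \<Prod>k\<in>Domain Q. (comps (Q `` {k}) - 1) else 0)"

lemma ncomp_comps: "finite X \<Longrightarrow> ncomp crown X (comps X)"
  using ncomp_crown[of "Inl -` X" "Inr -` X"] sum_set_split[of X]
  by (simp add: comps_def finite_vimageI)

text \<open>The crown graph is bipartite, hence triangle-free; its edges are oriented from the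
  x-side to the y-side.\<close>

lemma h1_dim_crown:
  assumes X: "finite X"
  shows "h1_dim TYPE('k::field) crown X (crown_h1 X)" "card X \<le> card (crown_edges X) + comps X"
proof -
  have "\<exists>r. h1_dim TYPE('k) crown X r \<and> r + card X = card (crown_edges X) + comps X"
  proof (rule h1_dim_triangle_free[OF X ncomp_comps[OF X]])
    show "crown_edges X \<subseteq> X \<times> X" by (auto simp: crown_edges_def)
    show "crown u v \<longleftrightarrow> (u, v) \<in> crown_edges X \<or> (v, u) \<in> crown_edges X" if "u \<in> X" "v \<in> X" for u v
      using that by (cases u; cases v) (auto simp: crown_edges_def)
    show "(v, u) \<notin> crown_edges X" if "(u, v) \<in> crown_edges X" for u v
      using that by (auto simp: crown_edges_def)
    show "\<not> crown u w" if "crown u v" "crown v w" for u v w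
      using that by (cases u; cases v; cases w) auto
  qed
  then obtain r where r: "h1_dim TYPE('k) crown X r" "r + card X = card (crown_edges X) + comps X" by blast
  then have "r = crown_h1 X" by (simp add: crown_h1_def)
  then show "h1_dim TYPE('k) crown X (crown_h1 X)" "card X \<le> card (crown_edges X) + comps X" using r by simp_all
qed

lemma Domain_slices: "Q = (\<Union>k\<in>Domain Q. {k} \<times> (Q `` {k}))"
  by auto

lemma image_Pair_eq: "Pair k ` X = {k} \<times> X"
  by auto

lemma h1_dim_copies:
  assumes Q: "Q \<subseteq> {1..n} \<times> verts (B_graph b)"
  shows "h1_dim TYPE('k::field) (nonadj (G_graph a b n)) (Inr ` Q) (copies_h1 Q)"
proof -
  let ?N = "nonadj (G_graph a b n)"
  have finQ: "finite Q" by (rule finite_subset[OF Q]) (simp add: finite_verts_B)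
  have fin: "finite (Domain Q)" using finQ by (rule finite_Domain)
  have finX: "finite (Q `` {k})" for k using finQ by (rule finite_Image)
  have N: "?N (Inr (k, x)) (Inr (l, y)) \<longleftrightarrow> k \<noteq> l \<or> crown x y" if "(k, x) \<in> Q" "(l, y) \<in> Q" for k x l y
    using that Q by (intro nonadj_G_right) auto
  have slice: "h1_dim TYPE('k) ?N ((\<lambda>x. Inr (k, x)) ` (Q `` {k})) (crown_h1 (Q `` {k}))" for k
    by (rule h1_dim_image[OF _ _ h1_dim_crown(1)[OF finX]]) (auto simp: inj_on_def N)
  have slice_comp: "ncomp ?N ((\<lambda>x. Inr (k, x)) ` (Q `` {k})) (comps (Q `` {k}))" for k
    by (rule ncomp_image[OF _ _ ncomp_comps[OF finX]]) (auto simp: inj_on_def N)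
  consider "card (Domain Q) = 0" | "card (Domain Q) = 1" | "card (Domain Q) = 2" | "card (Domain Q) \<ge> 3" by linarith
  then show ?thesis
  proof cases
    case 1
    then have "Q = {}" using fin by auto
    then show ?thesis by (auto simp: copies_h1_def intro!: h1_dim_zeroI)
  next
    case 2
    then obtain k where k: "Domain Q = {k}" by (auto simp: card_1_singleton_iff)
    then have "Q = Pair k ` (Q `` {k})" using Domain_slices[of Q] by (simp add: image_Pair_eq)
    then have "(Inr ` Q :: (nat + nat \<times> (nat + nat)) set) = Inr ` Pair k ` (Q `` {k})" by simp
    then have "(Inr ` Q :: (nat + nat \<times> (nat + nat)) set) = (\<lambda>x. Inr (k, x)) ` (Q `` {k})" by (simp only: image_image)
    then show ?thesis using slice[of k] k by (simp add: copies_h1_def)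
  next
    case 3
    then obtain k l where kl: "Domain Q = {k, l}" "k \<noteq> l" by (auto simp: card_2_iff)
    then have "Q = Pair k ` (Q `` {k}) \<union> Pair l ` (Q `` {l})"
      using Domain_slices[of Q] by (simp add: image_Pair_eq)
    then have "(Inr ` Q :: (nat + nat \<times> (nat + nat)) set) = Inr ` (Pair k ` (Q `` {k}) \<union> Pair l ` (Q `` {l}))" by simp
    then have eq: "(Inr ` Q :: (nat + nat \<times> (nat + nat)) set) = (\<lambda>x. Inr (k, x)) ` (Q `` {k}) \<union> (\<lambda>x. Inr (l, x)) ` (Q `` {l})"
      by (simp only: image_image image_Un)
    have "h1_dim TYPE('k) ?N ((\<lambda>x. Inr (k, x)) ` (Q `` {k}) \<union> (\<lambda>x. Inr (l, x)) ` (Q `` {l}))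
      ((comps (Q `` {k}) - 1) * (comps (Q `` {l}) - 1))"
    proof (rule h1_dim_join[OF _ _ _ _ slice_comp slice_comp])
      show "(\<lambda>x. Inr (k, x)) ` (Q `` {k}) \<inter> (\<lambda>x. Inr (l, x)) ` (Q `` {l}) = {}" using kl by auto
      show "(\<lambda>x. Inr (k, x)) ` (Q `` {k}) \<noteq> {}" "(\<lambda>x. Inr (l, x)) ` (Q `` {l}) \<noteq> {}" using kl by blast+
      show "?N x y \<and> ?N y x" if "x \<in> (\<lambda>x. Inr (k, x)) ` (Q `` {k})" "y \<in> (\<lambda>x. Inr (l, x)) ` (Q `` {l})" for x y
        using that kl(2) by (auto simp: N)
    qed
    then show ?thesis using 3 kl eq by (simp add: copies_h1_def)
  next
    case 4
    \<comment> \<open>One vertex from each of three copies serves as the triple of representatives;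
      the parts are told apart by the number of the copy.\<close>
    obtain D where D: "D \<subseteq> Domain Q" "card D = 3" using obtain_subset_with_card_n[OF 4] by blast
    then obtain k l m where klm: "k \<noteq> l" "k \<noteq> m" "l \<noteq> m" "k \<in> Domain Q" "l \<in> Domain Q" "m \<in> Domain Q"
      by (auto simp: card_3_iff)
    then obtain x y z where xyz: "(k, x) \<in> Q" "(l, y) \<in> Q" "(m, z) \<in> Q" by blast
    define \<kappa> :: "nat + nat \<times> (nat + nat) \<Rightarrow> nat" where "\<kappa> = case_sum id fst"
    have "h1_dim TYPE('k) ?N (Inr ` Q) 0"
      by (rule h1_dim_multipartite[where \<kappa> = \<kappa> and x = "Inr (k, x)" and y = "Inr (l, y)" and z = "Inr (m, z)"])
        (use klm xyz in \<open>auto simp: \<kappa>_def N\<close>)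
    then show ?thesis using 4 by (simp add: copies_h1_def)
  qed
qed

lemma h1_dim_G_graph:
  assumes W: "W \<subseteq> verts (G_graph a b n)"
  shows "h1_dim TYPE('k::field) (nonadj (G_graph a b n)) W (copies_h1 (Inr -` W))"
proof -
  have S: "Inl -` W \<subseteq> {1..a}" and Q: "Inr -` W \<subseteq> {1..n} \<times> verts (B_graph b)"
    using W by (auto simp: verts_G_graph)
  have "h1_dim TYPE('k) (nonadj (G_graph a b n)) (Inl ` (Inl -` W) \<union> Inr ` (Inr -` W)) (copies_h1 (Inr -` W))"
  proof (rule h1_dim_simplex_union[OF _ _ _ h1_dim_copies[OF Q]])
    show "Inl ` (Inl -` W) \<inter> Inr ` (Inr -` W) = {}" by auto
    fix u :: "nat + nat \<times> (nat + nat)" assume "u \<in> Inl ` (Inl -` W)"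
    then obtain p where p: "u = Inl p" "p \<in> {1..a}" using S by blast
    show "\<not> nonadj (G_graph a b n) u v \<and> \<not> nonadj (G_graph a b n) v u" if "v \<in> Inr ` (Inr -` W)" for v
    proof -
      obtain y where "v = Inr y" "y \<in> {1..n} \<times> verts (B_graph b)" using \<open>v \<in> Inr ` (Inr -` W)\<close> Q by blast
      then show ?thesis using p nonadj_G_cross[OF p(2)] by simp
    qed
    show "nonadj (G_graph a b n) u v \<longleftrightarrow> u \<noteq> v" if "v \<in> Inl ` (Inl -` W)" for v
      using that p(1) nonadj_G_left by auto
  qed
  then show ?thesis using sum_set_split[of W] by simp
qed

section \<open>Summation\<close>

text \<open>The summand ignores the left part of W, so for each size j of that part a right part is
  counted \<open>card A choose j\<close> times.\<close>

lemma sum_subsets_sum_set: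
  fixes f :: "'b set \<Rightarrow> int"
  assumes A: "finite A" and P: "finite P"
  shows "(\<Sum>W | W \<subseteq> Inl ` A \<union> Inr ` P \<and> card W = m. f (Inr -` W)) =
    (\<Sum>j = 0..m. int (card A choose j) * (\<Sum>Q | Q \<subseteq> P \<and> card Q = m - j. f Q))"
proof -
  define T where "T = (\<lambda>j. {S. S \<subseteq> A \<and> card S = j} \<times> {Q. Q \<subseteq> P \<and> card Q = m - j})"
  have "(\<Sum>W | W \<subseteq> Inl ` A \<union> Inr ` P \<and> card W = m. f (Inr -` W)) = (\<Sum>(j, S, Q)\<in>Sigma {0..m} T. f Q)"
  proof (rule sum.reindex_bij_witness[of _ "\<lambda>(j, S, Q). Inl ` S \<union> Inr ` Q" "\<lambda>W. (card (Inl -` W), Inl -` W, Inr -` W)"])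
    fix W assume W: "W \<in> {W. W \<subseteq> Inl ` A \<union> Inr ` P \<and> card W = m}"
    then have sub: "Inl -` W \<subseteq> A" "Inr -` W \<subseteq> P" by auto
    then have "finite (Inl -` W)" "finite (Inr -` W)" using A P finite_subset by blast+
    then have "card W = card (Inl -` W) + card (Inr -` W)"
      using card_sum_set sum_set_split[of W] by metis
    then show "(card (Inl -` W), Inl -` W, Inr -` W) \<in> Sigma {0..m} T"
      using W sub by (auto simp: T_def)
    show "(case (card (Inl -` W), Inl -` W, Inr -` W) of (j, S, Q) \<Rightarrow> Inl ` S \<union> Inr ` Q) = W"
      using sum_set_split[of W] by simp
  next
    fix p assume "p \<in> Sigma {0..m} T"
    then obtain j S Q where p: "p = (j, S, Q)" "j \<le> m" "S \<subseteq> A" "card S = j" "Q \<subseteq> P" "card Q = m - j"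
      by (auto simp: T_def)
    then have "finite S" "finite Q" using A P finite_subset by blast+
    then have "card (Inl ` S \<union> Inr ` Q) = m" using card_sum_set[of S Q] p by simp
    then show "(case p of (j, S, Q) \<Rightarrow> Inl ` S \<union> Inr ` Q) \<in> {W. W \<subseteq> Inl ` A \<union> Inr ` P \<and> card W = m}"
      using p by auto
    show "(card (Inl -` (case p of (j, S, Q) \<Rightarrow> Inl ` S \<union> Inr ` Q)), Inl -` (case p of (j, S, Q) \<Rightarrow> Inl ` S \<union> Inr ` Q),
      Inr -` (case p of (j, S, Q) \<Rightarrow> Inl ` S \<union> Inr ` Q)) = p" by (simp only: p(1,4) prod.case vimage_sum_set)
  qed auto
  also have "\<dots> = (\<Sum>j = 0..m. \<Sum>(S, Q)\<in>T j. f Q)"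
    using A P by (subst sum.Sigma) (auto simp: T_def)
  also have "\<dots> = (\<Sum>j = 0..m. int (card A choose j) * (\<Sum>Q | Q \<subseteq> P \<and> card Q = m - j. f Q))"
    using n_subsets[OF A] by (intro sum.cong refl) (simp add: T_def sum.cartesian_product[symmetric])
  finally show ?thesis .
qed

lemma sum_single_copy:
  assumes b: "b \<ge> 3" and m: "m \<ge> 2"
  shows "(\<Sum>Q | Q \<subseteq> {1..n} \<times> verts (B_graph b) \<and> card Q = m \<and> card (Domain Q) = 1. int (copies_h1 Q)) = int n * mu b (m - 2)"
proof -
  let ?B = "verts (B_graph b)"
  have "(\<Sum>Q | Q \<subseteq> {1..n} \<times> ?B \<and> card Q = m \<and> card (Domain Q) = 1. int (copies_h1 Q)) =
    (\<Sum>(k, X)\<in>{1..n} \<times> {X. X \<subseteq> ?B \<and> card X = m}. int (crown_h1 X))"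
  proof (rule sum.reindex_bij_witness[of _ "\<lambda>(k, X). {k} \<times> X" "\<lambda>Q. (the_elem (Domain Q), Q `` Domain Q)"])
    fix Q assume Q: "Q \<in> {Q. Q \<subseteq> {1..n} \<times> ?B \<and> card Q = m \<and> card (Domain Q) = 1}"
    then obtain k where k: "Domain Q = {k}" by (auto simp: card_1_singleton_iff)
    then have eq: "Q = {k} \<times> (Q `` {k})" using Domain_slices[of Q] by simp
    have kn: "k \<in> {1..n}"
    proof -
      have "k \<in> Domain Q" using k by simp
      then show ?thesis using Q by auto
    qed
    from eq have "card Q = card (Q `` {k})" by (metis card_cartesian_product_singleton)
    then show "(the_elem (Domain Q), Q `` Domain Q) \<in> {1..n} \<times> {X. X \<subseteq> ?B \<and> card X = m}"
      using Q k kn by auto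
    show "(case (the_elem (Domain Q), Q `` Domain Q) of (k, X) \<Rightarrow> {k} \<times> X) = Q" using eq k by simp
    show "(case (the_elem (Domain Q), Q `` Domain Q) of (k, X) \<Rightarrow> int (crown_h1 X)) = int (copies_h1 Q)"
      using k by (simp add: copies_h1_def)
  next
    fix p assume "p \<in> {1..n} \<times> {X. X \<subseteq> ?B \<and> card X = m}"
    then obtain k X where p: "p = (k, X)" "k \<in> {1..n}" "X \<subseteq> ?B" "card X = m" by auto
    \<comment> \<open>An empty X would leave no trace of \<open>k\<close> in the product, and the
      copy could not be recovered.\<close>
    then have "X \<noteq> {}" using m by auto
    then have D: "Domain ({k} \<times> X) = {k}" by auto
    show "(case p of (k, X) \<Rightarrow> {k} \<times> X) \<in> {Q. Q \<subseteq> {1..n} \<times> ?B \<and> card Q = m \<and> card (Domain Q) = 1}"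
      using p D by (auto simp: card_cartesian_product_singleton)
    show "(the_elem (Domain (case p of (k, X) \<Rightarrow> {k} \<times> X)), (case p of (k, X) \<Rightarrow> {k} \<times> X) `` Domain (case p of (k, X) \<Rightarrow> {k} \<times> X)) = p"
      using p D by auto
  qed
  also have "\<dots> = int n * (\<Sum>X | X \<subseteq> ?B \<and> card X = m. int (crown_h1 X))"
    by (simp add: sum.cartesian_product[symmetric])
  also have "(\<Sum>X | X \<subseteq> ?B \<and> card X = m. int (crown_h1 X)) =
    (\<Sum>X | X \<subseteq> ?B \<and> card X = m. int (card (crown_edges X)) + int (comps X) - int (card X))"
  proof (rule sum.cong[OF refl])
    fix X assume "X \<in> {X. X \<subseteq> ?B \<and> card X = m}"
    then have "finite X" using finite_verts_B finite_subset by blast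
    from h1_dim_crown(2)[OF this]
    show "int (crown_h1 X) = int (card (crown_edges X)) + int (comps X) - int (card X)" by (simp add: crown_h1_def of_nat_diff)
  qed
  also have "\<dots> = mu b (m - 2)" by (rule sum_crown_h1[OF b m])
  finally show ?thesis .
qed

lemma comps_pos:
  assumes "finite X" "X \<noteq> {}"
  shows "comps X \<ge> 1"
proof (rule ccontr)
  assume "\<not> comps X \<ge> 1"
  then have "comps X = 0" by simp
  moreover obtain \<pi> :: "nat + nat \<Rightarrow> nat" where "\<pi> ` X = {..<comps X}"
    using ncomp_comps[OF assms(1)] unfolding ncomp_def by blast
  ultimately show False using assms(2) by simp
qed

text \<open>The substitution p = |X| - 1 and q = |Y| - 1 turns sizes adding to \<open>m\<close> into
  p + q = m - 2, in accordance with the shift by one between sizes and indices of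
  \<open>lam\<close>.\<close>

lemma sum_nonempty_pairs:
  assumes b: "b \<ge> 3" and m: "m \<ge> 2"
  shows "(\<Sum>(X, Y) | X \<subseteq> verts (B_graph b) \<and> Y \<subseteq> verts (B_graph b) \<and> X \<noteq> {} \<and> Y \<noteq> {} \<and> card X + card Y = m.
      int (comps X - 1) * int (comps Y - 1)) = (\<Sum>(p, q) | p + q = m - 2 \<and> p \<ge> 1 \<and> q \<ge> 1. lam b p * lam b q)"
proof -
  let ?B = "verts (B_graph b)"
  define L where "L = (\<lambda>s. {X. X \<subseteq> ?B \<and> card X = s})"
  have finL: "finite (L s)" for s using finite_verts_B by (simp add: L_def)
  have "(\<Sum>(X, Y) | X \<subseteq> ?B \<and> Y \<subseteq> ?B \<and> X \<noteq> {} \<and> Y \<noteq> {} \<and> card X + card Y = m. int (comps X - 1) * int (comps Y - 1)) =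
    (\<Sum>(s, X, Y)\<in>Sigma {1..m - 1} (\<lambda>s. L s \<times> L (m - s)). int (comps X - 1) * int (comps Y - 1))"
  proof (rule sum.reindex_bij_witness[of _ "\<lambda>(s, X, Y). (X, Y)" "\<lambda>(X, Y). (card X, X, Y)"])
    fix p assume "p \<in> {(X, Y). X \<subseteq> ?B \<and> Y \<subseteq> ?B \<and> X \<noteq> {} \<and> Y \<noteq> {} \<and> card X + card Y = m}"
    then obtain X Y where p: "p = (X, Y)" "X \<subseteq> ?B" "Y \<subseteq> ?B" "X \<noteq> {}" "Y \<noteq> {}" "card X + card Y = m" by blast
    then have "finite X" "finite Y" using finite_verts_B finite_subset by blast+
    then have "card X > 0" "card Y > 0" using p by (simp_all add: card_gt_0_iff)
    then show "(case p of (X, Y) \<Rightarrow> (card X, X, Y)) \<in> Sigma {1..m - 1} (\<lambda>s. L s \<times> L (m - s))"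
      using p by (auto simp: L_def)
  next
    fix t assume "t \<in> Sigma {1..m - 1} (\<lambda>s. L s \<times> L (m - s))"
    then show "(case t of (s, X, Y) \<Rightarrow> (X, Y)) \<in> {(X, Y). X \<subseteq> ?B \<and> Y \<subseteq> ?B \<and> X \<noteq> {} \<and> Y \<noteq> {} \<and> card X + card Y = m}"
      by (auto simp: L_def)
  qed (auto simp: L_def)
  also have "\<dots> = (\<Sum>s\<in>{1..m - 1}. \<Sum>(X, Y)\<in>L s \<times> L (m - s). int (comps X - 1) * int (comps Y - 1))"
    using finL by (subst sum.Sigma) auto
  also have "\<dots> = (\<Sum>s\<in>{1..m - 1}. (\<Sum>X\<in>L s. int (comps X - 1)) * (\<Sum>Y\<in>L (m - s). int (comps Y - 1)))"
    by (simp add: sum_product sum.cartesian_product)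
  also have "\<dots> = (\<Sum>s\<in>{1..m - 1}. lam b (s - 1) * lam b (m - s - 1))"
  proof (rule sum.cong[OF refl])
    fix s assume s: "s \<in> {1..m - 1}"
    have "(\<Sum>X\<in>L t. int (comps X - 1)) = lam b (t - 1)" if t: "t \<ge> 1" for t
    proof -
      have "(\<Sum>X\<in>L t. int (comps X - 1)) = (\<Sum>X\<in>L t. int (comps X) - 1)"
      proof (rule sum.cong[OF refl])
        fix X assume X: "X \<in> L t"
        then have "finite X" "X \<noteq> {}" using finite_verts_B finite_subset t by (auto simp: L_def)
        from comps_pos[OF this] show "int (comps X - 1) = int (comps X) - 1" by simp
      qed
      then show ?thesis using sum_comps[OF b t] by (simp add: L_def)
    qed
    moreover have "s \<ge> 1" "m - s \<ge> 1" using s m by auto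
    ultimately show "(\<Sum>X\<in>L s. int (comps X - 1)) * (\<Sum>Y\<in>L (m - s). int (comps Y - 1)) = lam b (s - 1) * lam b (m - s - 1)" by simp
  qed
  also have "\<dots> = (\<Sum>(p, q)\<in>(\<lambda>s. (s - 1, m - s - 1)) ` {1..m - 1}. lam b p * lam b q)"
    by (subst sum.reindex) (auto simp: inj_on_def)
  \<comment> \<open>Singletons give p = 0 or q = 0, and \<open>lam b 0\<close> is 0.\<close>
  also have "\<dots> = (\<Sum>(p, q) | p + q = m - 2 \<and> p \<ge> 1 \<and> q \<ge> 1. lam b p * lam b q)"
  proof (rule sum.mono_neutral_right)
    show "{(p, q). p + q = m - 2 \<and> p \<ge> 1 \<and> q \<ge> 1} \<subseteq> (\<lambda>s. (s - 1, m - s - 1)) ` {1..m - 1}"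
    proof (rule subsetI)
      fix x assume "x \<in> {(p, q). p + q = m - 2 \<and> p \<ge> 1 \<and> q \<ge> 1}"
      then obtain p q where pq: "p + q = m - 2" "p \<ge> 1" "q \<ge> 1" "x = (p, q)" by auto
      show "x \<in> (\<lambda>s. (s - 1, m - s - 1)) ` {1..m - 1}"
        by (rule image_eqI[of _ _ "p + 1"]) (use pq in auto)
    qed
    show "\<forall>x\<in>(\<lambda>s. (s - 1, m - s - 1)) ` {1..m - 1} - {(p, q). p + q = m - 2 \<and> p \<ge> 1 \<and> q \<ge> 1}. (case x of (p, q) \<Rightarrow> lam b p * lam b q) = 0"
    proof (rule ballI)
      fix x assume x: "x \<in> (\<lambda>s. (s - 1, m - s - 1)) ` {1..m - 1} - {(p, q). p + q = m - 2 \<and> p \<ge> 1 \<and> q \<ge> 1}"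
      then obtain s where s: "x = (s - 1, m - s - 1)" "s \<in> {1..m - 1}" by blast
      then have "s - 1 = 0 \<or> m - s - 1 = 0" using x by auto
      then show "(case x of (p, q) \<Rightarrow> lam b p * lam b q) = 0" using s(1) by (auto simp: lam_def)
    qed
  qed simp
  finally show ?thesis .
qed

lemma sum_two_copies:
  assumes b: "b \<ge> 3" and m: "m \<ge> 2"
  shows "(\<Sum>Q | Q \<subseteq> {1..n} \<times> verts (B_graph b) \<and> card Q = m \<and> card (Domain Q) = 2. int (copies_h1 Q)) =
    int (n choose 2) * (\<Sum>(p, q) | p + q = m - 2 \<and> p \<ge> 1 \<and> q \<ge> 1. lam b p * lam b q)"
proof -
  let ?B = "verts (B_graph b)"
  define P where "P = {(X, Y). X \<subseteq> ?B \<and> Y \<subseteq> ?B \<and> X \<noteq> {} \<and> Y \<noteq> {} \<and> card X + card Y = m}"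
  define D2 where "D2 = {D. D \<subseteq> {1..n} \<and> card D = 2}"
  \<comment> \<open>The unordered pair of copies is ordered by size of the copy number, so that each
    Q corresponds to exactly one ordered pair of slices; this is the origin of
    \<open>n choose 2\<close> next to a sum over ordered pairs.\<close>
  define join where "join = (\<lambda>(D :: nat set, X :: (nat + nat) set, Y :: (nat + nat) set). {Min D} \<times> X \<union> {Max D} \<times> Y)"
  define split where "split = (\<lambda>Q :: (nat \<times> (nat + nat)) set. (Domain Q, Q `` {Min (Domain Q)}, Q `` {Max (Domain Q)}))"
  have pair: "\<exists>k l. D = {k, l} \<and> k < l \<and> Min D = k \<and> Max D = l" if "card D = 2" for D :: "nat set"
  proof -
    obtain k l where "D = {k, l}" "k < l" using \<open>card D = 2\<close> by (metis card_2_iff insert_commute nat_neq_iff)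
    then show ?thesis by auto
  qed
  have "(\<Sum>Q | Q \<subseteq> {1..n} \<times> ?B \<and> card Q = m \<and> card (Domain Q) = 2. int (copies_h1 Q)) =
    (\<Sum>(D, X, Y)\<in>D2 \<times> P. int (comps X - 1) * int (comps Y - 1))"
  proof (rule sum.reindex_bij_witness[of _ join split])
    fix Q assume Q: "Q \<in> {Q. Q \<subseteq> {1..n} \<times> ?B \<and> card Q = m \<and> card (Domain Q) = 2}"
    then obtain k l where kl: "Domain Q = {k, l}" "k < l" "Min (Domain Q) = k" "Max (Domain Q) = l"
      using pair[of "Domain Q"] by auto
    then have eq: "Q = {k} \<times> (Q `` {k}) \<union> {l} \<times> (Q `` {l})" using Domain_slices[of Q] by simp
    have "finite Q" using Q finite_subset[of Q "{1..n} \<times> ?B"] finite_verts_B by auto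
    then have fin: "finite (Q `` {k})" "finite (Q `` {l})" by (simp_all add: finite_Image)
    have "card Q = card ({k} \<times> (Q `` {k})) + card ({l} \<times> (Q `` {l}))"
      by (subst eq, rule card_Un_disjoint) (use fin kl in auto)
    then have "card (Q `` {k}) + card (Q `` {l}) = m" using Q by (simp add: card_cartesian_product_singleton)
    moreover have "k \<in> {1..n}" "l \<in> {1..n}"
    proof -
      have "k \<in> Domain Q" "l \<in> Domain Q" using kl(1) by simp_all
      then show "k \<in> {1..n}" "l \<in> {1..n}" using Q by auto
    qed
    ultimately show "split Q \<in> D2 \<times> P" using Q kl by (auto simp: split_def D2_def P_def)
    show "join (split Q) = Q" using eq kl by (simp add: join_def split_def)
    show "(case split Q of (D, X, Y) \<Rightarrow> int (comps X - 1) * int (comps Y - 1)) = int (copies_h1 Q)"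
      using kl Q by (simp add: split_def copies_h1_def)
  next
    fix t assume "t \<in> D2 \<times> P"
    then obtain D X Y where t: "t = (D, X, Y)" "D \<subseteq> {1..n}" "card D = 2" "X \<subseteq> ?B" "Y \<subseteq> ?B" "X \<noteq> {}" "Y \<noteq> {}" "card X + card Y = m"
      by (auto simp: D2_def P_def)
    obtain k l where kl: "D = {k, l}" "k < l" "Min D = k" "Max D = l" using pair[OF t(3)] by blast
    have fin: "finite X" "finite Y" using t finite_verts_B finite_subset by blast+
    have j: "join t = {k} \<times> X \<union> {l} \<times> Y" using t(1) kl by (simp add: join_def)
    have dom: "Domain (join t) = {k, l}" using t j by auto
    have im: "join t `` {k} = X" "join t `` {l} = Y" using kl(2) j by auto
    show "split (join t) = t" using t(1) kl dom im by (simp add: split_def)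
    have "card (join t) = card ({k} \<times> X) + card ({l} \<times> Y)"
      unfolding j by (rule card_Un_disjoint) (use fin kl in auto)
    then have "card (join t) = m" using t by (simp add: card_cartesian_product_singleton)
    moreover have "join t \<subseteq> {1..n} \<times> ?B" using t kl j by auto
    ultimately show "join t \<in> {Q. Q \<subseteq> {1..n} \<times> ?B \<and> card Q = m \<and> card (Domain Q) = 2}"
      using dom kl(2) by simp
  qed
  also have "\<dots> = int (card D2) * (\<Sum>(X, Y)\<in>P. int (comps X - 1) * int (comps Y - 1))"
  proof -
    have "(\<Sum>(D, X, Y)\<in>D2 \<times> P. int (comps X - 1) * int (comps Y - 1)) = (\<Sum>D\<in>D2. \<Sum>(X, Y)\<in>P. int (comps X - 1) * int (comps Y - 1))"
      by (simp only: sum.cartesian_product)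
    then show ?thesis by (simp only: sum_constant of_nat_mult)
  qed
  also have "card D2 = n choose 2" unfolding D2_def using n_subsets[of "{1..n}" 2] by simp
  also have "(\<Sum>(X, Y)\<in>P. int (comps X - 1) * int (comps Y - 1)) = (\<Sum>(p, q) | p + q = m - 2 \<and> p \<ge> 1 \<and> q \<ge> 1. lam b p * lam b q)"
    unfolding P_def by (rule sum_nonempty_pairs[OF b m])
  finally show ?thesis .
qed

lemma sum_copies_h1:
  assumes b: "b \<ge> 3" and m: "m \<ge> 2"
  shows "(\<Sum>Q | Q \<subseteq> {1..n} \<times> verts (B_graph b) \<and> card Q = m. int (copies_h1 Q)) =
    int n * mu b (m - 2) + int (n choose 2) * (\<Sum>(p, q) | p + q = m - 2 \<and> p \<ge> 1 \<and> q \<ge> 1. lam b p * lam b q)"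
proof -
  let ?P = "{1..n} \<times> verts (B_graph b)"
  have fin: "finite {Q. Q \<subseteq> ?P \<and> card Q = m}" by (simp add: finite_verts_B)
  have "(\<Sum>Q | Q \<subseteq> ?P \<and> card Q = m. int (copies_h1 Q)) =
    (\<Sum>Q\<in>{Q. Q \<subseteq> ?P \<and> card Q = m \<and> card (Domain Q) = 1} \<union> {Q. Q \<subseteq> ?P \<and> card Q = m \<and> card (Domain Q) = 2}. int (copies_h1 Q))"
    by (rule sum.mono_neutral_right[OF fin]) (auto simp: copies_h1_def)
  also have "\<dots> = (\<Sum>Q | Q \<subseteq> ?P \<and> card Q = m \<and> card (Domain Q) = 1. int (copies_h1 Q)) +
    (\<Sum>Q | Q \<subseteq> ?P \<and> card Q = m \<and> card (Domain Q) = 2. int (copies_h1 Q))"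
  proof (rule sum.union_disjoint)
    show "finite {Q. Q \<subseteq> ?P \<and> card Q = m \<and> card (Domain Q) = 1}" by (rule finite_subset[OF _ fin]) blast
    show "finite {Q. Q \<subseteq> ?P \<and> card Q = m \<and> card (Domain Q) = 2}" by (rule finite_subset[OF _ fin]) blast
  qed auto
  finally show ?thesis by (simp only: sum_single_copy[OF b m] sum_two_copies[OF b m])
qed

text \<open>Fewer than two vertices carry no edge of the complex. This cuts the sum over the
  edgeless part at \<open>j = i\<close>.\<close>

lemma copies_h1_small:
  assumes "finite Q" "card Q < 2"
  shows "copies_h1 Q = 0"
proof -
  consider "Q = {}" | k x where "Q = {(k, x)}"
  proof -
    have "card Q = 0 \<or> card Q = 1" using assms(2) by linarith
    then show thesis using assms(1) that by (auto simp: card_1_singleton_iff)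
  qed
  then show ?thesis
  proof cases
    case 1 then show ?thesis by (simp add: copies_h1_def)
  next
    case (2 k x)
    have "comps {x} = 1" by (cases x) (simp_all add: comps_def crown_comps_def vimage_def)
    moreover have "crown_edges {x} = {}" by (auto simp: crown_edges_def)
    ultimately have "crown_h1 {x} = 0" by (simp add: crown_h1_def)
    then show ?thesis by (simp add: 2 copies_h1_def Image_def)
  qed
qed

theorem theorem5p2:
  fixes a b n i :: nat
  assumes "a \<ge> 1" and "n \<ge> 1" and "b \<ge> 3" and "i \<ge> 1"
  shows "int (graph_betti TYPE('k::field) (G_graph a b n) i (i + 2)) =
    (\<Sum>j = 0..i. int (a choose j) *
       (int n * mu b (i - j) +
        int (n choose 2) *
          (\<Sum>(p, q) \<in> {(p, q). p + q = i - j \<and> p \<ge> 1 \<and> q \<ge> 1}. lam b p * lam b q)))"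
proof -
  let ?P = "{1..n} \<times> verts (B_graph b)"
  define f where "f = (\<lambda>Q. int (copies_h1 Q))"
  define s where "s = (\<lambda>m. \<Sum>Q | Q \<subseteq> ?P \<and> card Q = m. f Q)"
  have finP: "finite ?P" by (simp add: finite_verts_B)
  have "graph_betti TYPE('k) (G_graph a b n) i (i + 2) =
    (\<Sum>W | W \<subseteq> verts (G_graph a b n) \<and> card W = i + 2. copies_h1 (Inr -` W))"
    by (rule graph_betti_Hochster[OF simple_G_graph assms(4) h1_dim_G_graph])
  then have "int (graph_betti TYPE('k) (G_graph a b n) i (i + 2)) =
    (\<Sum>W | W \<subseteq> Inl ` {1..a} \<union> Inr ` ?P \<and> card W = i + 2. f (Inr -` W))"
    by (simp add: f_def verts_G_graph)
  also have "\<dots> = (\<Sum>j = 0..i + 2. int (a choose j) * s (i + 2 - j))"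
    unfolding s_def using sum_subsets_sum_set[of "{1..a}" ?P f "i + 2"] finP by simp
  \<comment> \<open>For \<open>j = i + 1\<close> and \<open>j = i + 2\<close> at most one vertex
    remains in the copies.\<close>
  also have "\<dots> = (\<Sum>j = 0..i. int (a choose j) * s (i + 2 - j))"
  proof (rule sum.mono_neutral_right)
    have small: "s m = 0" if "m < 2" for m
      unfolding s_def f_def using that finP finite_subset
      by (intro sum.neutral ballI) (auto intro!: copies_h1_small)
    show "\<forall>j\<in>{0..i + 2} - {0..i}. int (a choose j) * s (i + 2 - j) = 0"
      by (auto intro!: small)
  qed auto
  also have "\<dots> = (\<Sum>j = 0..i. int (a choose j) *
       (int n * mu b (i - j) +
        int (n choose 2) *
          (\<Sum>(p, q) \<in> {(p, q). p + q = i - j \<and> p \<ge> 1 \<and> q \<ge> 1}. lam b p * lam b q)))"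
  proof (rule sum.cong[OF refl])
    fix j assume "j \<in> {0..i}"
    then have m: "i + 2 - j \<ge> 2" "i + 2 - j - 2 = i - j" by auto
    show "int (a choose j) * s (i + 2 - j) = int (a choose j) * (int n * mu b (i - j) + int (n choose 2) *
          (\<Sum>(p, q) \<in> {(p, q). p + q = i - j \<and> p \<ge> 1 \<and> q \<ge> 1}. lam b p * lam b q))"
      unfolding s_def f_def sum_copies_h1[OF assms(3) m(1)] m(2) ..
  qed
  finally show ?thesis .
qed

end
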